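(* Let $\Sigma$ be a PA surface with $(\mathcal V,\theta)$ in a $3$-dimensional Riemannian manifold $M^3$, where $\mathcal V$ is an anti-torqued vector field along $\Sigma$ with nowhere vanishing potential function $f$. If $\theta=\frac{\pi}{2}$ identically, then $\Sigma$ is an extrinsically flat ruled surface. Moreover, for $K_0\in\mathbb R$, the intrinsic curvature $K_{\mathrm{int}}$ of $\Sigma$ is the constant $K_0$ if and only if there is a (local) adapted coordinate system $(u,v)$ on $\Sigma$ such that $$ f(u,v)= \begin{cases} \sqrt{K_0}\,\tan\big(q(v)-\sqrt{K_0}\,u\big), & K_0>0,\\[6pt] \dfrac{1}{u+q(v)}, & K_0=0,\\[10pt] \sqrt{-K_0}\,\tanh\big(q(v)+\sqrt{-K_0}\,u\big)\ \text{ or }\ \pm\sqrt{-K_0}, & K_0<0, \end{cases} $$ where $q(v)$ is a smooth function.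
   Context: Let $\nabla$ be the Levi-Civita connection of $M^3$, and let $\mathfrak X(\Sigma)$ be the smooth vector fields tangent to $\Sigma$. A vector field along $\Sigma$ is a smooth section of $TM|_\Sigma$. An orientable surface $\Sigma\subset M^3$ with unit normal field $\mathcal N$ is a prescribed angle (PA) surface with $(\mathcal V,\theta)$ if $\mathcal V$ is a unit vector field along $\Sigma$, $\theta:\Sigma\to[0,\frac{\pi}{2}]$ is a smooth function, and $\langle\mathcal V,\mathcal N\rangle=\cos\theta$. The unit field $\mathcal V$ is anti-torqued along $\Sigma$ with potential function $f\in C^\infty(\Sigma)$ if $\nabla_X\mathcal V=f\big(X-\langle X,\mathcal V\rangle\mathcal V\big)$ for all $X\in\mathfrak X(\Sigma)$. If $\theta=\frac{\pi}{2}$ then $\mathcal V$ is tangent to $\Sigma$. The shape operator is $A(X)=-\nabla_X\mathcal N$, the extrinsic curvature is $K_{\mathrm{ext}}=\det A$, and $\Sigma$ is extrinsically flat if $K_{\mathrm{ext}}$ vanishes identically. $K_{\mathrm{int}}$ is the Gaussian (sectional) curvature of the induced metric. A surface $\Sigma\subset M^3$ is ruled if it admits a foliation by curves which are geodesics of $M^3$. Adapted coordinates: local coordinates $(u,v)$ on $\Sigma$ in which $\mathcal V=\partial_u$ and the induced metric is $du^2+\big(p\,e^{\int f\,du}\big)^2dv^2$ for some positive function $p=p(v)$, where $\int f\,du$ is an antiderivative of $f$ with respect to $u$. The classification statement is local on $\Sigma$.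
   Formalization: For K_0<0 the printed form is false (f=coth r on a punctured totally geodesic H^2 in H^3); here q may be complex valued, which adds coth, and the choice between tanh and the constant ±sqrt(-K_0) may depend on the line v=const, with q smooth on the open set of v where tanh holds. *)

theory Defs
  imports "HOL-Analysis.Analysis"
begin

section \<open>Smooth maps between Euclidean spaces\<close>

text \<open>Used for open sets \<open>S\<close> only.\<close>

primrec Ck_on :: "nat \<Rightarrow> 'a::real_normed_vector set \<Rightarrow> ('a \<Rightarrow> 'b::real_normed_vector) \<Rightarrow> bool" where
  "Ck_on 0 S f \<longleftrightarrow> continuous_on S f"
| "Ck_on (Suc k) S f \<longleftrightarrow>
     (\<forall>x\<in>S. f differentiable (at x)) \<and>
     (\<forall>h. Ck_on k S (\<lambda>x. frechet_derivative f (at x) h))"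

definition smooth_on :: "'a::real_normed_vector set \<Rightarrow> ('a \<Rightarrow> 'b::real_normed_vector) \<Rightarrow> bool" where
  "smooth_on S f \<longleftrightarrow> (\<forall>k. Ck_on k S f)"


section \<open>Smooth manifolds\<close>

text \<open>
  A manifold is a type with a Hausdorff, second countable topology (imposed by type classes)
  together with an atlas.  A chart is a domain paired with a coordinate map; the values of the
  coordinate map outside the domain are irrelevant.
\<close>

type_synonym ('a, 'n) chart = "'a set \<times> ('a \<Rightarrow> (real, 'n) vec)"

abbreviation chart_dom :: "('a, 'n::finite) chart \<Rightarrow> 'a set" where
  "chart_dom c \<equiv> fst c"

abbreviation chart_map :: "('a, 'n::finite) chart \<Rightarrow> 'a \<Rightarrow> real ^ 'n" where
  "chart_map c \<equiv> snd c"

definition chart_img :: "('a, 'n::finite) chart \<Rightarrow> (real ^ 'n) set" where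
  "chart_img c = chart_map c ` chart_dom c"

definition chart_inv :: "('a, 'n::finite) chart \<Rightarrow> real ^ 'n \<Rightarrow> 'a" where
  "chart_inv c = inv_into (chart_dom c) (chart_map c)"

definition is_chart :: "('a::topological_space, 'n::finite) chart \<Rightarrow> bool" where
  "is_chart c \<longleftrightarrow> open (chart_dom c) \<and> open (chart_img c) \<and>
     homeomorphism (chart_dom c) (chart_img c) (chart_map c) (chart_inv c)"

definition transition :: "('a, 'n::finite) chart \<Rightarrow> ('a, 'n) chart \<Rightarrow> real ^ 'n \<Rightarrow> real ^ 'n" where
  "transition c d = chart_map d \<circ> chart_inv c"

definition smooth_compatible :: "('a, 'n::finite) chart \<Rightarrow> ('a, 'n) chart \<Rightarrow> bool" where
  "smooth_compatible c d \<longleftrightarrow>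
     smooth_on (chart_map c ` (chart_dom c \<inter> chart_dom d)) (transition c d) \<and>
     smooth_on (chart_map d ` (chart_dom c \<inter> chart_dom d)) (transition d c)"

definition smooth_atlas :: "('a::topological_space, 'n::finite) chart set \<Rightarrow> bool" where
  "smooth_atlas A \<longleftrightarrow> (\<forall>c\<in>A. is_chart c) \<and> (\<Union>c\<in>A. chart_dom c) = UNIV \<and>
     (\<forall>c\<in>A. \<forall>d\<in>A. smooth_compatible c d)"

text \<open>Local coordinate systems: members of the maximal atlas generated by \<open>A\<close>.\<close>

definition coordinate_system ::
  "('a::topological_space, 'n::finite) chart set \<Rightarrow> ('a, 'n) chart \<Rightarrow> bool" where
  "coordinate_system A c \<longleftrightarrow> is_chart c \<and> (\<forall>d\<in>A. smooth_compatible c d)"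

definition orientable :: "('a::topological_space, 'n::finite) chart set \<Rightarrow> bool" where
  "orientable A \<longleftrightarrow> (\<exists>B. (\<forall>c\<in>B. coordinate_system A c) \<and> (\<Union>c\<in>B. chart_dom c) = UNIV \<and>
     (\<forall>c\<in>B. \<forall>d\<in>B. \<forall>p\<in>chart_dom c \<inter> chart_dom d.
        det (matrix (frechet_derivative (transition c d) (at (chart_map c p)))) > 0))"

text \<open>An arbitrary chart of the atlas around a point; everything defined from it is
  independent of the choice.\<close>

definition chart_at :: "('a, 'n::finite) chart set \<Rightarrow> 'a \<Rightarrow> ('a, 'n) chart" where
  "chart_at A p = (SOME c. c \<in> A \<and> p \<in> chart_dom c)"

definition smooth_function ::
  "('a, 'n::finite) chart set \<Rightarrow> ('a \<Rightarrow> real) \<Rightarrow> bool" where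
  "smooth_function A f \<longleftrightarrow> (\<forall>c\<in>A. smooth_on (chart_img c) (f \<circ> chart_inv c))"

definition smooth_map :: "('a::topological_space, 'm::finite) chart set \<Rightarrow>
    ('b::topological_space, 'n::finite) chart set \<Rightarrow> ('a \<Rightarrow> 'b) \<Rightarrow> bool" where
  "smooth_map A B F \<longleftrightarrow> continuous_on UNIV F \<and>
     (\<forall>c\<in>A. \<forall>d\<in>B. smooth_on (chart_map c ` (chart_dom c \<inter> F -` chart_dom d))
                              (chart_map d \<circ> F \<circ> chart_inv c))"


section \<open>Tangent vectors\<close>

text \<open>
  A tangent vector at \<open>p\<close> is the family of its component vectors with respect to the charts of the
  atlas around \<open>p\<close>, related by the Jacobians of the transition maps.  It is \<open>0\<close> at all other charts,
  so that equality of tangent vectors is equality of functions, and the linear structure is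
  the pointwise one.
\<close>

type_synonym ('a, 'n) tvec = "('a, 'n) chart \<Rightarrow> (real, 'n) vec"

definition tangent_space :: "('a, 'n::finite) chart set \<Rightarrow> 'a \<Rightarrow> ('a, 'n) tvec set" where
  "tangent_space A p = {X.
     (\<forall>c. \<not> (c \<in> A \<and> p \<in> chart_dom c) \<longrightarrow> X c = 0) \<and>
     (\<forall>c\<in>A. \<forall>d\<in>A. p \<in> chart_dom c \<longrightarrow> p \<in> chart_dom d \<longrightarrow>
        X d = frechet_derivative (transition c d) (at (chart_map c p)) (X c))}"

text \<open>The coordinate vector field of index \<open>i\<close> of a coordinate system \<open>c\<close> (not necessarily in
  \<open>A\<close>), at \<open>p\<close>.\<close>

definition coord_vec ::
  "('a, 'n::finite) chart set \<Rightarrow> ('a, 'n) chart \<Rightarrow> 'n \<Rightarrow> 'a \<Rightarrow> ('a, 'n) tvec" where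
  "coord_vec A c i p = (\<lambda>d. if d \<in> A \<and> p \<in> chart_dom d
     then frechet_derivative (transition c d) (at (chart_map c p)) (axis i 1) else 0)"

definition differential :: "('a, 'm::finite) chart set \<Rightarrow> ('b, 'n::finite) chart set \<Rightarrow>
    ('a \<Rightarrow> 'b) \<Rightarrow> 'a \<Rightarrow> ('a, 'm) tvec \<Rightarrow> ('b, 'n) tvec" where
  "differential A B F p X = (let c = chart_at A p in
     (\<lambda>d. if d \<in> B \<and> F p \<in> chart_dom d
       then frechet_derivative (chart_map d \<circ> F \<circ> chart_inv c) (at (chart_map c p)) (X c) else 0))"

definition immersion :: "('a::topological_space, 'm::finite) chart set \<Rightarrow>
    ('b::topological_space, 'n::finite) chart set \<Rightarrow> ('a \<Rightarrow> 'b) \<Rightarrow> bool" where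
  "immersion A B F \<longleftrightarrow> smooth_map A B F \<and>
     (\<forall>p. inj_on (differential A B F p) (tangent_space A p))"

text \<open>Smooth sections of \<open>TM|\<Sigma>\<close>, for \<open>F : \<Sigma> \<rightarrow> M\<close>; with \<open>F = id\<close> these are the smooth vector fields
  of a manifold.\<close>

definition vector_field_along :: "('a, 'm::finite) chart set \<Rightarrow> ('b, 'n::finite) chart set \<Rightarrow>
    ('a \<Rightarrow> 'b) \<Rightarrow> ('a \<Rightarrow> ('b, 'n) tvec) \<Rightarrow> bool" where
  "vector_field_along A B F Y \<longleftrightarrow> (\<forall>p. Y p \<in> tangent_space B (F p)) \<and>
     (\<forall>c\<in>A. \<forall>d\<in>B. smooth_on (chart_map c ` (chart_dom c \<inter> F -` chart_dom d))
                              (\<lambda>x. Y (chart_inv c x) d))"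

definition vector_field :: "('a, 'n::finite) chart set \<Rightarrow> ('a \<Rightarrow> ('a, 'n) tvec) \<Rightarrow> bool" where
  "vector_field A X \<longleftrightarrow> vector_field_along A A id X"


section \<open>Riemannian metrics\<close>

type_synonym ('a, 'n) metric = "'a \<Rightarrow> ('a, 'n) tvec \<Rightarrow> ('a, 'n) tvec \<Rightarrow> real"

text \<open>The matrix of the metric in a coordinate system, as a function of the coordinates.\<close>

definition metric_matrix :: "('a, 'n::finite) chart set \<Rightarrow> ('a, 'n) metric \<Rightarrow>
    ('a, 'n) chart \<Rightarrow> real ^ 'n \<Rightarrow> real ^ 'n ^ 'n" where
  "metric_matrix A g c x = (let p = chart_inv c x in
     \<chi> i j. g p (coord_vec A c i p) (coord_vec A c j p))"

definition riemannian_metric :: "('a, 'n::finite) chart set \<Rightarrow> ('a, 'n) metric \<Rightarrow> bool" where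
  "riemannian_metric A g \<longleftrightarrow>
     (\<forall>p. \<forall>X\<in>tangent_space A p. \<forall>Y\<in>tangent_space A p. g p X Y = g p Y X) \<and>
     (\<forall>p. \<forall>X\<in>tangent_space A p. \<forall>Y\<in>tangent_space A p. \<forall>Z\<in>tangent_space A p. \<forall>a b.
        g p (\<lambda>c. a *\<^sub>R X c + b *\<^sub>R Y c) Z = a * g p X Z + b * g p Y Z) \<and>
     (\<forall>p. \<forall>X\<in>tangent_space A p. X \<noteq> (\<lambda>c. 0) \<longrightarrow> g p X X > 0) \<and>
     (\<forall>c\<in>A. \<forall>i j. smooth_on (chart_img c) (\<lambda>x. metric_matrix A g c x $ i $ j))"

definition riemannian_manifold ::
  "('a::topological_space, 'n::finite) chart set \<Rightarrow> ('a, 'n) metric \<Rightarrow> bool" where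
  "riemannian_manifold A g \<longleftrightarrow> smooth_atlas A \<and> riemannian_metric A g"

definition partial :: "'n::finite \<Rightarrow> (real ^ 'n \<Rightarrow> real) \<Rightarrow> real ^ 'n \<Rightarrow> real" where
  "partial i h x = frechet_derivative h (at x) (axis i 1)"

text \<open>\<open>christoffel G k i j\<close> is the Christoffel symbol of the Levi-Civita connection with upper index
  \<open>k\<close> and lower indices \<open>i, j\<close>, for a metric with coefficient matrix \<open>G\<close>.\<close>

definition christoffel ::
  "(real ^ 'n \<Rightarrow> real ^ 'n ^ 'n) \<Rightarrow> 'n::finite \<Rightarrow> 'n \<Rightarrow> 'n \<Rightarrow> real ^ 'n \<Rightarrow> real" where
  "christoffel G k i j x = (1/2) * (\<Sum>l\<in>UNIV. matrix_inv (G x) $ k $ l *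
     (partial i (\<lambda>y. G y $ j $ l) x + partial j (\<lambda>y. G y $ i $ l) x
       - partial l (\<lambda>y. G y $ i $ j) x))"

text \<open>The component of index \<open>l\<close> of \<open>R(\<partial>\<^sub>i, \<partial>\<^sub>j) \<partial>\<^sub>k\<close>, where
  \<open>R(X, Y) Z = \<nabla>\<^sub>X \<nabla>\<^sub>Y Z - \<nabla>\<^sub>Y \<nabla>\<^sub>X Z - \<nabla>\<^bsub>[X, Y]\<^esub> Z\<close>.\<close>

definition curvature_tensor ::
  "(real ^ 'n \<Rightarrow> real ^ 'n ^ 'n) \<Rightarrow> 'n::finite \<Rightarrow> 'n \<Rightarrow> 'n \<Rightarrow> 'n \<Rightarrow> real ^ 'n \<Rightarrow> real" where
  "curvature_tensor G l i j k x =
     partial i (christoffel G l j k) x - partial j (christoffel G l i k) x +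
     (\<Sum>m\<in>UNIV. christoffel G m j k x * christoffel G l i m x
             - christoffel G m i k x * christoffel G l j m x)"

text \<open>Sectional curvature \<open>\<langle>R(\<partial>\<^sub>1, \<partial>\<^sub>2) \<partial>\<^sub>2, \<partial>\<^sub>1\<rangle> / (|\<partial>\<^sub>1|\<^sup>2 |\<partial>\<^sub>2|\<^sup>2 - \<langle>\<partial>\<^sub>1, \<partial>\<^sub>2\<rangle>\<^sup>2)\<close> of the tangent
  plane.\<close>

definition gaussian_curvature :: "('a, 2) chart set \<Rightarrow> ('a, 2) metric \<Rightarrow> 'a \<Rightarrow> real" where
  "gaussian_curvature A g p = (let c = chart_at A p; x = chart_map c p; G = metric_matrix A g c in
     (\<Sum>l\<in>UNIV. curvature_tensor G l 1 2 2 x * G x $ l $ 1) /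
     (G x $ 1 $ 1 * G x $ 2 $ 2 - (G x $ 1 $ 2)\<^sup>2))"


section \<open>Geometry of a mapped manifold\<close>

text \<open>
  In this section \<open>A\<close> is the atlas of the source \<open>\<Sigma>\<close>, \<open>(B, g)\<close> the atlas and metric of the
  Riemannian manifold \<open>M\<close>, and \<open>F : \<Sigma> \<rightarrow> M\<close>.
\<close>

definition induced_metric :: "('a, 'm::finite) chart set \<Rightarrow> ('b, 'n::finite) chart set \<Rightarrow>
    ('b, 'n) metric \<Rightarrow> ('a \<Rightarrow> 'b) \<Rightarrow> ('a, 'm) metric" where
  "induced_metric A B g F p X Y = g (F p) (differential A B F p X) (differential A B F p Y)"

text \<open>\<open>\<nabla>\<^sub>X Y\<close> for \<open>X\<close> tangent to \<open>\<Sigma>\<close> at \<open>p\<close>, \<open>Y\<close> a vector field along \<open>F\<close>, and \<open>\<nabla>\<close> the Levi-Civita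
  connection of \<open>M\<close>.\<close>

definition cov_deriv :: "('a, 'm::finite) chart set \<Rightarrow> ('b, 'n::finite) chart set \<Rightarrow>
    ('b, 'n) metric \<Rightarrow> ('a \<Rightarrow> 'b) \<Rightarrow> 'a \<Rightarrow> ('a, 'm) tvec \<Rightarrow> ('a \<Rightarrow> ('b, 'n) tvec) \<Rightarrow> ('b, 'n) tvec" where
  "cov_deriv A B g F p X Y = (let c = chart_at A p in
     (\<lambda>d. if d \<in> B \<and> F p \<in> chart_dom d
       then frechet_derivative (\<lambda>x. Y (chart_inv c x) d) (at (chart_map c p)) (X c) +
         (\<chi> k. \<Sum>i\<in>UNIV. \<Sum>j\<in>UNIV.
            christoffel (metric_matrix B g d) k i j (chart_map d (F p)) *
            differential A B F p X d $ i * Y p d $ j)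
       else 0))"

definition geodesic_on :: "('b::topological_space, 'n::finite) chart set \<Rightarrow> ('b, 'n) metric \<Rightarrow>
    real set \<Rightarrow> (real \<Rightarrow> 'b) \<Rightarrow> bool" where
  "geodesic_on B g I \<gamma> \<longleftrightarrow> open I \<and> is_interval I \<and> continuous_on I \<gamma> \<and>
     (\<forall>d\<in>B. smooth_on (I \<inter> \<gamma> -` chart_dom d) (chart_map d \<circ> \<gamma>) \<and>
        (\<forall>t\<in>I \<inter> \<gamma> -` chart_dom d.
           let \<gamma>' = (\<lambda>s. vector_derivative (chart_map d \<circ> \<gamma>) (at s)) in
           \<gamma>' t \<noteq> 0 \<and>
           vector_derivative \<gamma>' (at t) +
             (\<chi> k. \<Sum>i\<in>UNIV. \<Sum>j\<in>UNIV.
                christoffel (metric_matrix B g d) k i j (chart_map d (\<gamma> t)) *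
                \<gamma>' t $ i * \<gamma>' t $ j) = 0))"

text \<open>A foliation by curves of a surface, given by a foliated atlas: charts onto open rectangles
  whose horizontal segments (the plaques) are locally mapped into horizontal segments by the
  transition maps.\<close>

definition foliation_by_curves ::
  "('a::topological_space, 2) chart set \<Rightarrow> ('a, 2) chart set \<Rightarrow> bool" where
  "foliation_by_curves A \<F> \<longleftrightarrow>
     (\<forall>c\<in>\<F>. coordinate_system A c \<and> (\<exists>a b. chart_img c = box a b)) \<and>
     (\<Union>c\<in>\<F>. chart_dom c) = UNIV \<and>
     (\<forall>c\<in>\<F>. \<forall>d\<in>\<F>. \<forall>p\<in>chart_dom c \<inter> chart_dom d.
        \<exists>W h. open W \<and> p \<in> W \<and> W \<subseteq> chart_dom c \<inter> chart_dom d \<and>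
          (\<forall>x\<in>W. chart_map d x $ 2 = h (chart_map c x $ 2)))"

definition plaque :: "('a, 2) chart \<Rightarrow> 'a \<Rightarrow> 'a set" where
  "plaque c p = {x \<in> chart_dom c. chart_map c x $ 2 = chart_map c p $ 2}"

text \<open>Being a geodesic is local, so the leaves are geodesics of \<open>M\<close> iff the plaques are.\<close>

definition ruled :: "('a::topological_space, 2) chart set \<Rightarrow>
    ('b::topological_space, 'n::finite) chart set \<Rightarrow> ('b, 'n) metric \<Rightarrow> ('a \<Rightarrow> 'b) \<Rightarrow> bool" where
  "ruled A B g F \<longleftrightarrow> (\<exists>\<F>. foliation_by_curves A \<F> \<and>
     (\<forall>c\<in>\<F>. \<forall>p\<in>chart_dom c. \<exists>I \<gamma>.
        continuous_on I \<gamma> \<and> \<gamma> ` I = plaque c p \<and> geodesic_on B g I (F \<circ> \<gamma>)))"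


section \<open>Surfaces in a three-dimensional Riemannian manifold\<close>

definition unit_field_along :: "('a, 'm::finite) chart set \<Rightarrow> ('b, 'n::finite) chart set \<Rightarrow>
    ('b, 'n) metric \<Rightarrow> ('a \<Rightarrow> 'b) \<Rightarrow> ('a \<Rightarrow> ('b, 'n) tvec) \<Rightarrow> bool" where
  "unit_field_along A B g F Y \<longleftrightarrow> vector_field_along A B F Y \<and> (\<forall>p. g (F p) (Y p) (Y p) = 1)"

definition unit_normal_field :: "('a, 'm::finite) chart set \<Rightarrow> ('b, 'n::finite) chart set \<Rightarrow>
    ('b, 'n) metric \<Rightarrow> ('a \<Rightarrow> 'b) \<Rightarrow> ('a \<Rightarrow> ('b, 'n) tvec) \<Rightarrow> bool" where
  "unit_normal_field A B g F N \<longleftrightarrow> unit_field_along A B g F N \<and>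
     (\<forall>p. \<forall>X\<in>tangent_space A p. g (F p) (differential A B F p X) (N p) = 0)"

text \<open>\<open>- \<nabla>\<^sub>X N\<close>, pulled back along \<open>dF\<close> to the tangent space of \<open>\<Sigma>\<close>.\<close>

definition shape_operator :: "('a, 'm::finite) chart set \<Rightarrow> ('b, 'n::finite) chart set \<Rightarrow>
    ('b, 'n) metric \<Rightarrow> ('a \<Rightarrow> 'b) \<Rightarrow> ('a \<Rightarrow> ('b, 'n) tvec) \<Rightarrow> 'a \<Rightarrow> ('a, 'm) tvec \<Rightarrow> ('a, 'm) tvec" where
  "shape_operator A B g F N p X = (THE Y. Y \<in> tangent_space A p \<and>
     differential A B F p Y = (\<lambda>d. - cov_deriv A B g F p X N d))"

text \<open>The determinant of the shape operator is computed in a coordinate basis of the tangent space.\<close>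

definition K_ext :: "('a, 'm::finite) chart set \<Rightarrow> ('b, 'n::finite) chart set \<Rightarrow>
    ('b, 'n) metric \<Rightarrow> ('a \<Rightarrow> 'b) \<Rightarrow> ('a \<Rightarrow> ('b, 'n) tvec) \<Rightarrow> 'a \<Rightarrow> real" where
  "K_ext A B g F N p = (let c = chart_at A p in
     det (\<chi> i j. shape_operator A B g F N p (coord_vec A c j p) c $ i))"

definition extrinsically_flat :: "('a, 'm::finite) chart set \<Rightarrow> ('b, 'n::finite) chart set \<Rightarrow>
    ('b, 'n) metric \<Rightarrow> ('a \<Rightarrow> 'b) \<Rightarrow> ('a \<Rightarrow> ('b, 'n) tvec) \<Rightarrow> bool" where
  "extrinsically_flat A B g F N \<longleftrightarrow> (\<forall>p. K_ext A B g F N p = 0)"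

definition K_int :: "('a, 2) chart set \<Rightarrow> ('b, 'n::finite) chart set \<Rightarrow>
    ('b, 'n) metric \<Rightarrow> ('a \<Rightarrow> 'b) \<Rightarrow> 'a \<Rightarrow> real" where
  "K_int A B g F = gaussian_curvature A (induced_metric A B g F)"

definition PA_surface :: "('a::topological_space, 2) chart set \<Rightarrow>
    ('b::topological_space, 3) chart set \<Rightarrow> ('b, 3) metric \<Rightarrow> ('a \<Rightarrow> 'b) \<Rightarrow>
    ('a \<Rightarrow> ('b, 3) tvec) \<Rightarrow> ('a \<Rightarrow> ('b, 3) tvec) \<Rightarrow> ('a \<Rightarrow> real) \<Rightarrow> bool" where
  "PA_surface A B g F N V \<theta> \<longleftrightarrow>
     smooth_atlas A \<and> orientable A \<and> immersion A B F \<and> unit_normal_field A B g F N \<and>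
     unit_field_along A B g F V \<and>
     smooth_function A \<theta> \<and> (\<forall>p. 0 \<le> \<theta> p \<and> \<theta> p \<le> pi / 2) \<and>
     (\<forall>p. g (F p) (V p) (N p) = cos (\<theta> p))"

definition anti_torqued :: "('a, 'm::finite) chart set \<Rightarrow> ('b, 'n::finite) chart set \<Rightarrow>
    ('b, 'n) metric \<Rightarrow> ('a \<Rightarrow> 'b) \<Rightarrow> ('a \<Rightarrow> ('b, 'n) tvec) \<Rightarrow> ('a \<Rightarrow> real) \<Rightarrow> bool" where
  "anti_torqued A B g F V f \<longleftrightarrow> unit_field_along A B g F V \<and> smooth_function A f \<and>
     (\<forall>X. vector_field A X \<longrightarrow> (\<forall>p. let dX = differential A B F p (X p) in
        cov_deriv A B g F p (X p) V =
          (\<lambda>d. f p *\<^sub>R (dX d - g (F p) dX (V p) *\<^sub>R V p d))))"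


section \<open>Adapted coordinates\<close>

text \<open>The coordinates are \<open>u = x $ 1\<close> and \<open>v = x $ 2\<close>; \<open>\<Phi>\<close> is the antiderivative of \<open>f\<close> with respect
  to \<open>u\<close>.\<close>

definition v_range :: "('a, 2) chart \<Rightarrow> real set" where
  "v_range c = (\<lambda>x. x $ 2) ` chart_img c"

definition adapted_coordinates :: "('a::topological_space, 2) chart set \<Rightarrow>
    ('b, 'n::finite) chart set \<Rightarrow> ('b, 'n) metric \<Rightarrow> ('a \<Rightarrow> 'b) \<Rightarrow>
    ('a \<Rightarrow> ('b, 'n) tvec) \<Rightarrow> ('a \<Rightarrow> real) \<Rightarrow> ('a, 2) chart \<Rightarrow> bool" where
  "adapted_coordinates A B g F V f c \<longleftrightarrow> coordinate_system A c \<and>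
     (\<forall>p\<in>chart_dom c. V p = differential A B F p (coord_vec A c 1 p)) \<and>
     (\<exists>p \<Phi>. smooth_on (v_range c) p \<and> (\<forall>v\<in>v_range c. p v > 0) \<and>
        (\<forall>x\<in>chart_img c.
           ((\<lambda>u. \<Phi> (vector [u, x $ 2])) has_real_derivative f (chart_inv c x)) (at (x $ 1))) \<and>
        (\<forall>x\<in>chart_img c. let G = metric_matrix A (induced_metric A B g F) c x in
           G $ 1 $ 1 = 1 \<and> G $ 1 $ 2 = 0 \<and> G $ 2 $ 1 = 0 \<and>
           G $ 2 $ 2 = (p (x $ 2) * exp (\<Phi> x))\<^sup>2))"

text \<open>
  The form of the potential in the coordinates \<open>c\<close>.  Two points concern \<open>K\<^sub>0 < 0\<close>.
  First, \<open>q\<close> has to be allowed complex values, as \<open>tanh (q + \<i> \<pi> / 2) = coth q\<close>: the potential may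
  satisfy \<open>|f| > sqrt (- K\<^sub>0)\<close>, e.g. \<open>f = coth r\<close> for the radial field \<open>\<partial>\<^sub>r\<close> on a totally geodesic
  hyperbolic plane in hyperbolic space, and no real \<open>q\<close> gives this value.
  Secondly, which of the two alternatives holds may depend on the coordinate line \<open>v = const\<close>:
  the potential \<open>k (1 - C(v) exp (- 2 k u)) / (1 + C(v) exp (- 2 k u))\<close>, \<open>k = sqrt (- K\<^sub>0)\<close>, is
  constant on the lines with \<open>C(v) = 0\<close> only.  The set \<open>J\<close> collects the lines on which the
  \<open>tanh\<close> alternative holds.
\<close>

definition potential_form ::
  "('a, 2) chart \<Rightarrow> ('a \<Rightarrow> real) \<Rightarrow> real \<Rightarrow> bool" where
  "potential_form c f K0 \<longleftrightarrow>
     (K0 > 0 \<longrightarrow> (\<exists>q::real \<Rightarrow> real. smooth_on (v_range c) q \<and>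
        (\<forall>x\<in>chart_img c. f (chart_inv c x) = sqrt K0 * tan (q (x $ 2) - sqrt K0 * x $ 1)))) \<and>
     (K0 = 0 \<longrightarrow> (\<exists>q::real \<Rightarrow> real. smooth_on (v_range c) q \<and>
        (\<forall>x\<in>chart_img c. f (chart_inv c x) = 1 / (x $ 1 + q (x $ 2))))) \<and>
     (K0 < 0 \<longrightarrow> (\<exists>J (q::real \<Rightarrow> complex) \<epsilon>.
        J \<subseteq> v_range c \<and> open J \<and> smooth_on J q \<and> \<epsilon> \<in> {1, -1} \<and>
        (\<forall>x\<in>chart_img c. if x $ 2 \<in> J
           then complex_of_real (f (chart_inv c x)) =
             of_real (sqrt (- K0)) * tanh (q (x $ 2) + of_real (sqrt (- K0) * x $ 1))
           else f (chart_inv c x) = \<epsilon> * sqrt (- K0))))"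

end

theory Submission
  imports Defs
begin

text \<open>
  Since \<open>V\<close> is orthogonal to \<open>N\<close>, it is tangent to the surface, and \<open>\<langle>A(X), V\<rangle> = \<langle>N, \<nabla>\<^sub>X V\<rangle> = 0\<close> for
  every tangent \<open>X\<close>; so the image of the shape operator is orthogonal to \<open>V\<close> and its determinant
  vanishes. Moreover \<open>\<nabla>\<^sub>V V = 0\<close>, so the flow lines of \<open>V\<close> are geodesics of the ambient manifold and
  the flow boxes of \<open>V\<close> form the ruling.

  By the Gauss formula \<open>\<nabla>\<^sub>X V = f (X - \<langle>X, V\<rangle> V)\<close> also holds for the intrinsic connection. Then the
  Ricci identity gives \<open>K\<^sub>i\<^sub>n\<^sub>t = - (V f + f\<^sup>2)\<close>, and in a flow box \<open>\<partial>\<^sub>u\<langle>\<partial>\<^sub>u, \<partial>\<^sub>v\<rangle> = 0\<close> and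
  \<open>\<partial>\<^sub>u\<langle>\<partial>\<^sub>v, \<partial>\<^sub>v\<rangle> = 2 f \<langle>\<partial>\<^sub>v, \<partial>\<^sub>v\<rangle>\<close> once \<open>\<langle>\<partial>\<^sub>u, \<partial>\<^sub>v\<rangle> = 0\<close>. So adapted coordinates exist, and constant curvature
  is the Riccati equation \<open>f\<^sub>u + f\<^sup>2 = - K\<^sub>0\<close> on each coordinate line.
\<close>

section \<open>Calculus of smooth maps\<close>

text \<open>Tangent vectors and covariant derivatives are given by components in charts, some of
  them through an arbitrarily chosen chart, so each geometric statement must first be moved to a
  convenient coordinate system. The transformation law of the Christoffel symbols that permits this
  comes from the same Koszul computation as the Gauss formula. Flow boxes require flows that are
  smooth in the initial value; in the plane a scalar equation is enough, because where one component
  of the field is nonzero the integral curves are graphs whose slope is the quotient of the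
  components. That \<open>f\<close> vanishes nowhere matters for the Riccati equation: it makes
  \<open>1 / f\<close> available for \<open>K0 = 0\<close> and fixes the sign of \<open>f\<close> on
  a box for \<open>K0 < 0\<close>. In the latter case, with \<open>k = sqrt (- K0)\<close>, the
  quotient \<open>(k + f) / (k - f)\<close> is proportional to \<open>exp (2 * k * u)\<close> on
  each line. Its logarithm is complex where the quotient is negative, and the lines with
  \<open>f = k\<close> or \<open>f = - k\<close> are kept apart because the quotient degenerates
  there.\<close>

abbreviation fD :: "('a::real_normed_vector \<Rightarrow> 'b::real_normed_vector) \<Rightarrow> 'a \<Rightarrow> 'a \<Rightarrow> 'b" where
  "fD f x \<equiv> frechet_derivative f (at x)"

lemma fD_eqI: "(f has_derivative f') (at x) \<Longrightarrow> fD f x = f'"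
  by (metis frechet_derivative_at)

lemma has_derivative_fD: "f differentiable (at x) \<Longrightarrow> (f has_derivative fD f x) (at x)"
  by (simp add: frechet_derivative_works)

lemma linear_fD: "f differentiable (at x) \<Longrightarrow> linear (fD f x)"
  by (rule linear_frechet_derivative)

text \<open>\<open>frechet_derivative\<close> is a choice among all derivatives and depends only on
  the predicate \<open>has_derivative\<close> at \<open>x\<close>; hence functions that agree near
  \<open>x\<close> have equal \<open>fD\<close> even where neither is differentiable.\<close>

lemma fD_cong_open:
  assumes "open S" "x \<in> S" "\<And>y. y \<in> S \<Longrightarrow> f y = g y"
  shows "fD f x = fD g x"
proof -
  have "(f has_derivative d) (at x) \<longleftrightarrow> (g has_derivative d) (at x)" for d
    using has_derivative_transform_within_open[of f d x UNIV S g]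
      has_derivative_transform_within_open[of g d x UNIV S f] assms by auto
  then show ?thesis by (simp add: frechet_derivative_def)
qed

lemma differentiable_cong_open:
  assumes "open S" "x \<in> S" "\<And>y. y \<in> S \<Longrightarrow> f y = g y"
  shows "f differentiable (at x) \<longleftrightarrow> g differentiable (at x)"
proof -
  have "(f has_derivative d) (at x) \<longleftrightarrow> (g has_derivative d) (at x)" for d
    using has_derivative_transform_within_open[of f d x UNIV S g]
      has_derivative_transform_within_open[of g d x UNIV S f] assms by auto
  then show ?thesis by (simp add: differentiable_def)
qed

lemma fD_compose:
  assumes "f differentiable (at x)" "g differentiable (at (f x))"
  shows "fD (\<lambda>x. g (f x)) x h = fD g (f x) (fD f x h)"
    and "(\<lambda>x. g (f x)) differentiable (at x)"
proof -
  have *: "((\<lambda>x. g (f x)) has_derivative (\<lambda>h. fD g (f x) (fD f x h))) (at x)"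
    using has_derivative_compose[OF has_derivative_fD[OF assms(1)] has_derivative_fD[OF assms(2)]]
    by simp
  then show "fD (\<lambda>x. g (f x)) x h = fD g (f x) (fD f x h)" by (simp add: fD_eqI)
  show "(\<lambda>x. g (f x)) differentiable (at x)" using * differentiable_def by blast
qed

lemma fD_bilinear:
  assumes "bounded_bilinear pr" "f differentiable (at x)" "g differentiable (at x)"
  shows "fD (\<lambda>x. pr (f x) (g x)) x h = pr (f x) (fD g x h) + pr (fD f x h) (g x)"
    and "(\<lambda>x. pr (f x) (g x)) differentiable (at x)"
proof -
  have *: "((\<lambda>x. pr (f x) (g x)) has_derivative (\<lambda>h. pr (f x) (fD g x h) + pr (fD f x h) (g x))) (at x)"
    using bounded_bilinear.FDERIV[OF assms(1) has_derivative_fD[OF assms(2)] has_derivative_fD[OF assms(3)]] .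
  then show "fD (\<lambda>x. pr (f x) (g x)) x h = pr (f x) (fD g x h) + pr (fD f x h) (g x)"
    by (simp add: fD_eqI)
  show "(\<lambda>x. pr (f x) (g x)) differentiable (at x)" using * differentiable_def by blast
qed

lemma fD_add:
  assumes "f differentiable (at x)" "g differentiable (at x)"
  shows "fD (\<lambda>x. f x + g x) x h = fD f x h + fD g x h"
  by (subst fD_eqI[OF has_derivative_add[OF has_derivative_fD[OF assms(1)] has_derivative_fD[OF assms(2)]]]) simp

lemma fD_diff:
  assumes "f differentiable (at x)" "g differentiable (at x)"
  shows "fD (\<lambda>x. f x - g x) x h = fD f x h - fD g x h"
  by (subst fD_eqI[OF has_derivative_diff[OF has_derivative_fD[OF assms(1)] has_derivative_fD[OF assms(2)]]]) simp

lemma fD_bounded_linear: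
  assumes "bounded_linear L" "f differentiable (at x)"
  shows "fD (\<lambda>x. L (f x)) x h = L (fD f x h)"
  by (subst fD_eqI[OF bounded_linear.has_derivative[OF assms(1) has_derivative_fD[OF assms(2)]]]) simp

lemma fD_linear: "bounded_linear L \<Longrightarrow> fD L x = L"
  by (rule fD_eqI) (rule bounded_linear_imp_has_derivative)

lemma fD_vec_nth:
  fixes f :: "'a::real_normed_vector \<Rightarrow> real ^ 'n::finite"
  assumes "f differentiable (at x)"
  shows "fD (\<lambda>x. f x $ i) x h = fD f x h $ i"
  by (rule fD_bounded_linear[OF bounded_linear_vec_nth assms])

section \<open>Closure properties of the classes \<open>Ck_on\<close>\<close>

lemma Ck_on_subset: "Ck_on k S f \<Longrightarrow> T \<subseteq> S \<Longrightarrow> Ck_on k T f"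
  by (induction k arbitrary: f) (auto intro: continuous_on_subset)

lemma Ck_on_Suc_imp: "Ck_on (Suc k) S f \<Longrightarrow> Ck_on k S f"
proof (induction k arbitrary: f)
  case 0
  then show ?case
    by (auto intro!: continuous_at_imp_continuous_on differentiable_imp_continuous_within)
next
  case (Suc k)
  have "Ck_on k S (\<lambda>x. fD f x h)" for h
    using Suc.IH[of "\<lambda>x. fD f x h"] Suc.prems Ck_on.simps(2)[of "Suc k" S f] by blast
  moreover have "\<forall>x\<in>S. f differentiable (at x)" using Suc.prems Ck_on.simps(2)[of "Suc k" S f] by blast
  ultimately show ?case using Ck_on.simps(2)[of k S f] by blast
qed

lemma Ck_on_cong:
  assumes "open S" "\<And>x. x \<in> S \<Longrightarrow> f x = g x"
  shows "Ck_on k S f \<longleftrightarrow> Ck_on k S g"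
  using assms(2)
proof (induction k arbitrary: f g)
  case 0
  then show ?case by (auto intro: continuous_on_cong)
next
  case (Suc k)
  have "fD f x = fD g x" "f differentiable (at x) \<longleftrightarrow> g differentiable (at x)" if "x \<in> S" for x
    using fD_cong_open[of S x f g, OF assms(1) that Suc.prems]
      differentiable_cong_open[of S x f g, OF assms(1) that Suc.prems]
    by blast+
  then have "\<And>h. Ck_on k S (\<lambda>x. fD f x h) \<longleftrightarrow> Ck_on k S (\<lambda>x. fD g x h)"
    by (intro Suc.IH) simp
  then show ?case using \<open>\<And>x. x \<in> S \<Longrightarrow> f differentiable (at x) \<longleftrightarrow> g differentiable (at x)\<close>
    by simp
qed

text \<open>The definition mentions the chosen \<open>frechet_derivative\<close>; this rule accepts
  any explicit formula for the derivative, which is how most regularity inductions below are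
  run.\<close>

lemma Ck_on_SucI:
  assumes "open S" "\<And>x. x \<in> S \<Longrightarrow> (f has_derivative f' x) (at x)"
    "\<And>h. Ck_on k S (\<lambda>x. f' x h)"
  shows "Ck_on (Suc k) S f"
proof -
  have "fD f x = f' x" if "x \<in> S" for x using assms(2)[OF that] by (rule fD_eqI)
  then have "Ck_on k S (\<lambda>x. fD f x h)" for h
    using Ck_on_cong[OF assms(1), of "\<lambda>x. fD f x h" "\<lambda>x. f' x h" k] assms(3) by simp
  then show ?thesis using assms(2) by (auto simp: differentiable_def)
qed

text \<open>Differentiability and continuity at a point are local. This lets smoothness be checked
  near each point, typically inside one auxiliary chart.\<close>

lemma Ck_on_open_cover:
  assumes "\<And>x. x \<in> S \<Longrightarrow> \<exists>U. open U \<and> x \<in> U \<and> Ck_on k U f"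
  shows "Ck_on k S f"
  using assms
proof (induction k arbitrary: f)
  case 0
  then show ?case
    by (metis Ck_on.simps(1) continuous_at_imp_continuous_on continuous_on_eq_continuous_at)
next
  case (Suc k)
  have "f differentiable (at x)" if "x \<in> S" for x
    using Suc.prems[OF that] Ck_on.simps(2) by blast
  moreover have "Ck_on k S (\<lambda>x. fD f x h)" for h
  proof (rule Suc.IH)
    show "\<exists>U. open U \<and> x \<in> U \<and> Ck_on k U (\<lambda>x. fD f x h)" if "x \<in> S" for x
      using Suc.prems[OF that] Ck_on.simps(2)[of k _ f] by blast
  qed
  ultimately show ?case by simp
qed

lemma Ck_on_const [simp]: "Ck_on k S (\<lambda>x. c)"
proof (induction k arbitrary: c)
  case (Suc k)
  then show ?case by (simp add: Ck_on.simps)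
qed simp

lemma Ck_on_bounded_linear:
  assumes "bounded_linear L" shows "Ck_on k S L"
proof (cases k)
  case 0
  then show ?thesis using linear_continuous_on[OF assms] by simp
next
  case (Suc k')
  then show ?thesis
    using assms by (auto simp: fD_linear bounded_linear_imp_differentiable)
qed

lemma Ck_on_add:
  assumes "open S" "Ck_on k S f" "Ck_on k S g"
  shows "Ck_on k S (\<lambda>x. f x + g x)"
  using assms(2,3)
proof (induction k arbitrary: f g)
  case 0
  then show ?case by (auto intro: continuous_on_add)
next
  case (Suc k)
  show ?case
  proof (rule Ck_on_SucI[OF assms(1)])
    show "((\<lambda>x. f x + g x) has_derivative (\<lambda>h. fD f x h + fD g x h)) (at x)" if "x \<in> S" for x
      using Suc.prems that by (auto intro!: has_derivative_add has_derivative_fD)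
    show "Ck_on k S (\<lambda>x. fD f x h + fD g x h)" for h using Suc by simp
  qed
qed

text \<open>One product rule for multiplication, scaling and inner products. The derivative again
  contains the undifferentiated factors, so the induction also uses that class k + 1 is contained in
  class k.\<close>

lemma Ck_on_bilinear:
  assumes "open S" "bounded_bilinear pr" "Ck_on k S f" "Ck_on k S g"
  shows "Ck_on k S (\<lambda>x. pr (f x) (g x))"
  using assms(3,4)
proof (induction k arbitrary: f g)
  case 0
  then show ?case using bounded_bilinear.continuous_on[OF assms(2)] by simp
next
  case (Suc k)
  show ?case
  proof (rule Ck_on_SucI[OF assms(1)])
    show "((\<lambda>x. pr (f x) (g x)) has_derivative (\<lambda>h. pr (f x) (fD g x h) + pr (fD f x h) (g x))) (at x)"
      if "x \<in> S" for x
      using Suc.prems that by (auto intro!: bounded_bilinear.FDERIV[OF assms(2)] has_derivative_fD)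
    show "Ck_on k S (\<lambda>x. pr (f x) (fD g x h) + pr (fD f x h) (g x))" for h
      using Suc Ck_on_Suc_imp[OF Suc.prems(1)] Ck_on_Suc_imp[OF Suc.prems(2)]
      by (intro Ck_on_add[OF assms(1)]) simp_all
  qed
qed

lemma Ck_on_sum:
  assumes "open S" "\<And>i. i \<in> I \<Longrightarrow> Ck_on k S (f i)"
  shows "Ck_on k S (\<lambda>x. \<Sum>i\<in>I. f i x)"
  using assms(2) by (induction I rule: infinite_finite_induct) (auto intro: Ck_on_add[OF assms(1)])

lemma linear_eq_sum_Basis:
  fixes L :: "'a::euclidean_space \<Rightarrow> 'b::real_vector"
  assumes "linear L"
  shows "L h = (\<Sum>i\<in>Basis. (h \<bullet> i) *\<^sub>R L i)"
proof -
  have "L h = L (\<Sum>i\<in>Basis. (h \<bullet> i) *\<^sub>R i)" by (simp add: euclidean_representation)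
  also have "\<dots> = (\<Sum>i\<in>Basis. (h \<bullet> i) *\<^sub>R L i)"
    by (simp add: linear_sum[OF assms] linear_scale[OF assms])
  finally show ?thesis .
qed

text \<open>In \<open>fD g (f x) (fD f x h)\<close> point and direction both vary with
  \<open>x\<close>. Expanding the direction in \<open>Basis\<close> leaves a finite sum of scalar
  coefficients times maps \<open>fD g (f x) i\<close> with fixed \<open>i\<close>, to which the
  induction hypothesis applies; hence the Euclidean middle space.\<close>

lemma Ck_on_compose:
  fixes f :: "'a::real_normed_vector \<Rightarrow> 'b::euclidean_space" and g :: "'b \<Rightarrow> 'c::real_normed_vector"
  assumes "open S" "open T" "f ` S \<subseteq> T" "Ck_on k S f" "Ck_on k T g"
  shows "Ck_on k S (\<lambda>x. g (f x))"
  using assms(4,5)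
proof (induction k arbitrary: g)
  case 0
  then show ?case using continuous_on_compose2[of T g S f] assms(3) by simp
next
  case (Suc k)
  show ?case
  proof (rule Ck_on_SucI[OF assms(1)])
    show "((\<lambda>x. g (f x)) has_derivative (\<lambda>h. \<Sum>i\<in>Basis. (fD f x h \<bullet> i) *\<^sub>R fD g (f x) i)) (at x)"
      if "x \<in> S" for x
    proof -
      have d: "f differentiable (at x)" "g differentiable (at (f x))"
        using that Suc.prems assms(3) by auto
      have "((\<lambda>x. g (f x)) has_derivative (\<lambda>h. fD g (f x) (fD f x h))) (at x)"
        using has_derivative_compose[OF has_derivative_fD[OF d(1)] has_derivative_fD[OF d(2)]] by simp
      then show ?thesis by (subst (asm) linear_eq_sum_Basis[OF linear_fD[OF d(2)]])
    qed
    show "Ck_on k S (\<lambda>x. \<Sum>i\<in>Basis. (fD f x h \<bullet> i) *\<^sub>R fD g (f x) i)" for h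
    proof (intro Ck_on_sum[OF assms(1)] Ck_on_bilinear[OF assms(1) bounded_bilinear_scaleR]
        Ck_on_bilinear[OF assms(1) bounded_bilinear_inner])
      show "Ck_on k S (\<lambda>x. fD g (f x) i)" for i
        using Suc.IH[of "\<lambda>y. fD g y i"] Suc.prems(2) Ck_on_Suc_imp[OF Suc.prems(1)] by simp
    qed (use Suc.prems in auto)
  qed
qed

section \<open>Rules for smooth maps\<close>

lemma smooth_on_imp_Ck: "smooth_on S f \<Longrightarrow> Ck_on k S f" by (simp add: smooth_on_def)

lemma smooth_on_differentiable: "smooth_on S f \<Longrightarrow> x \<in> S \<Longrightarrow> f differentiable (at x)"
  using smooth_on_imp_Ck[of S f "Suc 0"] by simp

lemma smooth_on_continuous: "smooth_on S f \<Longrightarrow> continuous_on S f"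
  using smooth_on_imp_Ck[of S f 0] by simp

lemma smooth_on_fD: "smooth_on S f \<Longrightarrow> smooth_on S (\<lambda>x. fD f x h)"
  unfolding smooth_on_def by (metis Ck_on.simps(2))

lemma smooth_on_subset: "smooth_on S f \<Longrightarrow> T \<subseteq> S \<Longrightarrow> smooth_on T f"
  by (meson Ck_on_subset smooth_on_def)

lemma smooth_on_cong:
  "open S \<Longrightarrow> (\<And>x. x \<in> S \<Longrightarrow> f x = g x) \<Longrightarrow> smooth_on S f \<longleftrightarrow> smooth_on S g"
  by (metis Ck_on_cong smooth_on_def)

lemma smooth_on_eq: "smooth_on S f \<Longrightarrow> open S \<Longrightarrow> (\<And>x. x \<in> S \<Longrightarrow> f x = g x) \<Longrightarrow> smooth_on S g"
  using smooth_on_cong by blast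

lemma smooth_on_open_cover:
  assumes "\<And>x. x \<in> S \<Longrightarrow> \<exists>U. open U \<and> x \<in> U \<and> smooth_on U f"
  shows "smooth_on S f"
  unfolding smooth_on_def using Ck_on_open_cover assms by (metis smooth_on_def)

lemma smooth_on_const [simp]: "smooth_on S (\<lambda>x. c)" by (simp add: smooth_on_def)

lemma smooth_on_bounded_linear: "bounded_linear L \<Longrightarrow> smooth_on S L"
  by (simp add: smooth_on_def Ck_on_bounded_linear)

lemma smooth_on_id [simp]: "smooth_on S (\<lambda>x. x)" by (rule smooth_on_bounded_linear) simp

lemma smooth_on_add: "open S \<Longrightarrow> smooth_on S f \<Longrightarrow> smooth_on S g \<Longrightarrow> smooth_on S (\<lambda>x. f x + g x)"
  by (simp add: smooth_on_def Ck_on_add)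

lemma smooth_on_bilinear:
  "open S \<Longrightarrow> bounded_bilinear pr \<Longrightarrow> smooth_on S f \<Longrightarrow> smooth_on S g \<Longrightarrow> smooth_on S (\<lambda>x. pr (f x) (g x))"
  by (simp add: smooth_on_def Ck_on_bilinear)

lemmas smooth_on_scaleR = smooth_on_bilinear[OF _ bounded_bilinear_scaleR]
lemmas smooth_on_inner = smooth_on_bilinear[OF _ bounded_bilinear_inner]

lemma smooth_on_mult:
  fixes f :: "'a::real_normed_vector \<Rightarrow> 'b::real_normed_algebra"
  shows "open S \<Longrightarrow> smooth_on S f \<Longrightarrow> smooth_on S g \<Longrightarrow> smooth_on S (\<lambda>x. f x * g x)"
  by (rule smooth_on_bilinear[OF _ bounded_bilinear_mult])

lemma smooth_on_minus: "open S \<Longrightarrow> smooth_on S f \<Longrightarrow> smooth_on S (\<lambda>x. - f x)"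
  using smooth_on_scaleR[of S "\<lambda>x. -1" f] by simp

lemma smooth_on_diff: "open S \<Longrightarrow> smooth_on S f \<Longrightarrow> smooth_on S g \<Longrightarrow> smooth_on S (\<lambda>x. f x - g x)"
  using smooth_on_add[of S f "\<lambda>x. - g x"] smooth_on_minus[of S g] by simp

lemma smooth_on_sum:
  "open S \<Longrightarrow> (\<And>i. i \<in> I \<Longrightarrow> smooth_on S (f i)) \<Longrightarrow> smooth_on S (\<lambda>x. \<Sum>i\<in>I. f i x)"
  by (simp add: smooth_on_def Ck_on_sum)

lemma smooth_on_compose:
  fixes f :: "'a::real_normed_vector \<Rightarrow> 'b::euclidean_space"
  shows "smooth_on T g \<Longrightarrow> smooth_on S f \<Longrightarrow> open S \<Longrightarrow> open T \<Longrightarrow> f ` S \<subseteq> T \<Longrightarrow> smooth_on S (\<lambda>x. g (f x))"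
  by (simp add: smooth_on_def Ck_on_compose)

text \<open>Reading \<open>L (f x)\<close> as the bilinear expression
  \<open>1 *\<^sub>R L (f x)\<close> brings it under the product rule and avoids the Euclidean
  middle space of \<open>smooth_on_compose\<close>.\<close>

lemma smooth_on_linear_compose:
  assumes "bounded_linear L" "open S" "smooth_on S f"
  shows "smooth_on S (\<lambda>x. L (f x))"
proof -
  have "bounded_bilinear (\<lambda>(a::real) y. a *\<^sub>R L y)"
    using bounded_bilinear.comp[OF bounded_bilinear_scaleR bounded_linear_ident assms(1)] .
  from smooth_on_bilinear[OF assms(2) this smooth_on_const assms(3), of 1] show ?thesis
    by (simp only: scaleR_one)
qed

lemma smooth_on_vec_nth:
  fixes f :: "'a::real_normed_vector \<Rightarrow> real ^ 'n::finite"
  shows "open S \<Longrightarrow> smooth_on S f \<Longrightarrow> smooth_on S (\<lambda>x. f x $ i)"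
  by (rule smooth_on_linear_compose[OF bounded_linear_vec_nth])

lemma smooth_on_vecI:
  fixes f :: "'a::real_normed_vector \<Rightarrow> real ^ 'n::finite"
  assumes "open S" "\<And>i. smooth_on S (\<lambda>x. f x $ i)"
  shows "smooth_on S f"
proof -
  have "smooth_on S (\<lambda>x. \<Sum>i\<in>UNIV. f x $ i *\<^sub>R axis i 1)"
    by (rule smooth_on_sum[OF assms(1)], rule smooth_on_scaleR[OF assms(1) assms(2) smooth_on_const])
  moreover have "(\<Sum>i\<in>UNIV. f x $ i *\<^sub>R axis i 1) = f x" for x
    by (rule basis_expansion[of "f x", unfolded scalar_mult_eq_scaleR])
  ultimately show ?thesis by (subst (asm) smooth_on_cong[OF assms(1)])
qed

section \<open>Smoothness of elementary real functions\<close>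

lemma Ck_on_real_SucI:
  fixes f :: "real \<Rightarrow> real"
  assumes "open S" "\<And>x. x \<in> S \<Longrightarrow> (f has_real_derivative f' x) (at x)" "Ck_on k S f'"
  shows "Ck_on (Suc k) S f"
proof (rule Ck_on_SucI[OF assms(1)])
  show "(f has_derivative (\<lambda>h. f' x * h)) (at x)" if "x \<in> S" for x
    using assms(2)[OF that] by (simp add: has_field_derivative_def)
  show "Ck_on k S (\<lambda>x. f' x * h)" for h
    using Ck_on_bilinear[OF assms(1) bounded_bilinear_mult assms(3), of "\<lambda>x. h"] by simp
qed

lemma smooth_on_realI:
  fixes f :: "real \<Rightarrow> real"
  assumes "open S" "\<And>x. x \<in> S \<Longrightarrow> (f has_real_derivative f' x) (at x)" "smooth_on S f'"
  shows "smooth_on S f"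
  unfolding smooth_on_def
proof
  show "Ck_on k S f" for k
    using Ck_on_real_SucI[OF assms(1,2), of k] assms(3) Ck_on_Suc_imp smooth_on_def by blast
qed

lemma smooth_on_exp_real: "smooth_on UNIV (exp :: real \<Rightarrow> real)"
proof -
  have "Ck_on k UNIV (exp :: real \<Rightarrow> real)" for k
  proof (induction k)
    case 0
    show ?case using continuous_on_exp[OF continuous_on_id, of UNIV] by simp
  next
    case (Suc k)
    then show ?case by (intro Ck_on_real_SucI[where f'=exp]) (auto intro: DERIV_exp)
  qed
  then show ?thesis by (simp add: smooth_on_def)
qed

lemma smooth_on_inverse_real: "smooth_on (- {0}) (inverse :: real \<Rightarrow> real)"
proof -
  have op: "open (- {0::real})" by auto
  have "Ck_on k (- {0}) (inverse :: real \<Rightarrow> real)" for k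
  proof (induction k)
    case 0
    have "continuous_on (- {0}) (\<lambda>x::real. inverse x)" by (rule continuous_on_inverse) auto
    then show ?case by simp
  next
    case (Suc k)
    have "Ck_on k (- {0}) (\<lambda>x::real. -1 * (inverse x * inverse x))"
      using Suc by (intro Ck_on_bilinear[OF op bounded_bilinear_mult]) auto
    then show ?case
      by (intro Ck_on_real_SucI[OF op]) (auto intro!: derivative_eq_intros simp: power2_eq_square)
  qed
  then show ?thesis by (simp add: smooth_on_def)
qed

lemma smooth_on_inverse:
  fixes f :: "'a::real_normed_vector \<Rightarrow> real"
  assumes "open S" "smooth_on S f" "\<And>x. x \<in> S \<Longrightarrow> f x \<noteq> 0"
  shows "smooth_on S (\<lambda>x. inverse (f x))"
  by (rule smooth_on_compose[OF smooth_on_inverse_real]) (use assms in auto)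

lemma smooth_on_divide:
  fixes f g :: "'a::real_normed_vector \<Rightarrow> real"
  assumes "open S" "smooth_on S f" "smooth_on S g" "\<And>x. x \<in> S \<Longrightarrow> g x \<noteq> 0"
  shows "smooth_on S (\<lambda>x. f x / g x)"
  using smooth_on_mult[OF assms(1,2) smooth_on_inverse[OF assms(1,3,4)]] by (simp add: divide_inverse)

lemma smooth_on_exp:
  fixes f :: "'a::real_normed_vector \<Rightarrow> real"
  assumes "open S" "smooth_on S f"
  shows "smooth_on S (\<lambda>x. exp (f x))"
  by (rule smooth_on_compose[OF smooth_on_exp_real]) (use assms in auto)

lemma smooth_on_ln_real: "smooth_on {0<..} (ln :: real \<Rightarrow> real)"
  by (rule smooth_on_realI[where f'=inverse])
    (auto intro!: derivative_eq_intros smooth_on_subset[OF smooth_on_inverse_real] simp: divide_inverse)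

lemma smooth_on_ln:
  fixes f :: "'a::real_normed_vector \<Rightarrow> real"
  assumes "open S" "smooth_on S f" "\<And>x. x \<in> S \<Longrightarrow> f x > 0"
  shows "smooth_on S (\<lambda>x. ln (f x))"
  by (rule smooth_on_compose[OF smooth_on_ln_real]) (use assms in auto)

lemma smooth_on_sqrt:
  fixes f :: "'a::real_normed_vector \<Rightarrow> real"
  assumes "open S" "smooth_on S f" "\<And>x. x \<in> S \<Longrightarrow> f x > 0"
  shows "smooth_on S (\<lambda>x. sqrt (f x))"
proof -
  have "smooth_on S (\<lambda>x. exp ((1/2) * ln (f x)))"
    by (rule smooth_on_exp[OF assms(1)], rule smooth_on_mult[OF assms(1) smooth_on_const],
        rule smooth_on_ln[OF assms])
  moreover have "exp ((1/2) * ln (f x)) = sqrt (f x)" if "x \<in> S" for x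
    using assms(3)[OF that] by (simp add: powr_def powr_half_sqrt[symmetric] less_imp_le)
  ultimately show ?thesis by (subst (asm) smooth_on_cong[OF assms(1)])
qed

lemma smooth_on_arctan:
  fixes f :: "'a::real_normed_vector \<Rightarrow> real"
  assumes "open S" "smooth_on S f"
  shows "smooth_on S (\<lambda>x. arctan (f x))"
proof -
  have ne: "1 + x * x \<noteq> 0" for x :: real using zero_le_square[of x] by linarith
  have sm: "smooth_on UNIV (\<lambda>x::real. inverse (1 + x * x))"
    by (rule smooth_on_inverse[OF open_UNIV smooth_on_add[OF open_UNIV smooth_on_const
          smooth_on_mult[OF open_UNIV smooth_on_id smooth_on_id]]]) (rule ne)
  have "(arctan has_real_derivative inverse (1 + x * x)) (at x)" for x
    using DERIV_arctan[of x] by (simp add: power2_eq_square)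
  then have "smooth_on UNIV arctan" by (rule smooth_on_realI[OF open_UNIV _ sm])
  from smooth_on_compose[OF this assms(2,1)] show ?thesis by simp
qed

lemma has_vector_derivative_line:
  assumes "g differentiable (at (a + t *\<^sub>R h))"
  shows "((\<lambda>t. g (a + t *\<^sub>R h)) has_vector_derivative fD g (a + t *\<^sub>R h) h) (at t)"
proof -
  have "((\<lambda>t. a + t *\<^sub>R h) has_derivative (\<lambda>s. s *\<^sub>R h)) (at t)"
    by (auto intro!: derivative_eq_intros)
  from has_derivative_compose[OF this has_derivative_fD[OF assms]]
  show ?thesis
    by (simp add: has_vector_derivative_def linear_scale[OF linear_fD[OF assms]])
qed

lemma has_real_derivative_line:
  fixes g :: "'a::real_normed_vector \<Rightarrow> real"
  assumes "g differentiable (at (a + t *\<^sub>R h))"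
  shows "((\<lambda>t. g (a + t *\<^sub>R h)) has_real_derivative fD g (a + t *\<^sub>R h) h) (at t)"
  using has_vector_derivative_line[OF assms]
  by (simp add: has_real_derivative_iff_has_vector_derivative)

lemma Ck_on_imp_continuous: "Ck_on k S f \<Longrightarrow> continuous_on S f"
proof (induction k)
  case (Suc k)
  show ?case by (rule Suc.IH[OF Ck_on_Suc_imp[OF Suc.prems]])
qed simp

section \<open>Symmetry of second derivatives\<close>

text \<open>Two applications of the mean value theorem: first to the increment of \<open>f\<close>
  in direction \<open>k\<close>, moved along \<open>h\<close>, then to the derivative in direction
  \<open>h\<close>, moved along \<open>k\<close>.\<close>

lemma second_difference_eq:
  fixes f :: "'a::real_normed_vector \<Rightarrow> real"
  assumes S: "ball x d \<subseteq> S" and f: "Ck_on 2 S f" and s: "s > 0" "s * (norm h + norm k) < d"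
  obtains y where "dist x y < d"
    "f (x + s *\<^sub>R h + s *\<^sub>R k) - f (x + s *\<^sub>R h) - f (x + s *\<^sub>R k) + f x = s * s * fD (\<lambda>y. fD f y h) y k"
proof -
  have f1: "f differentiable (at y)" and f2: "(\<lambda>y. fD f y h) differentiable (at y)" if "y \<in> ball x d" for y
    using f that S by (auto simp: numeral_2_eq_2)
  have inb: "x + a *\<^sub>R h + b *\<^sub>R k \<in> ball x d" if "0 \<le> a" "a \<le> s" "0 \<le> b" "b \<le> s" for a b
  proof -
    have "norm (a *\<^sub>R h + b *\<^sub>R k) \<le> a * norm h + b * norm k"
      using norm_triangle_ineq[of "a *\<^sub>R h" "b *\<^sub>R k"] that by simp
    also have "\<dots> \<le> s * norm h + s * norm k" using that by (intro add_mono mult_right_mono) auto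
    also have "\<dots> < d" using s by (simp add: algebra_simps)
    finally show ?thesis by (simp add: dist_norm norm_minus_commute add.assoc)
      (metis add_diff_cancel_left' diff_add_cancel norm_minus_commute)
  qed
  have inb1: "x + b *\<^sub>R k + a *\<^sub>R h \<in> ball x d" if "0 \<le> a" "a \<le> s" "0 \<le> b" "b \<le> s" for a b
    using inb[OF that] by (simp add: add_ac)
  have inb2: "x + a *\<^sub>R h \<in> ball x d" if "0 \<le> a" "a \<le> s" for a
    using inb[of a 0] that s(1) by simp
  have "\<exists>z>0. z < s \<and> (f (x + s *\<^sub>R k + s *\<^sub>R h) - f (x + s *\<^sub>R h)) - (f (x + s *\<^sub>R k + 0 *\<^sub>R h) - f (x + 0 *\<^sub>R h)) =
      (s - 0) * (fD f (x + s *\<^sub>R k + z *\<^sub>R h) h - fD f (x + z *\<^sub>R h) h)"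
  proof (rule MVT2[OF s(1)])
    fix z assume z: "0 \<le> z" "z \<le> s"
    show "((\<lambda>z. f (x + s *\<^sub>R k + z *\<^sub>R h) - f (x + z *\<^sub>R h)) has_real_derivative
        fD f (x + s *\<^sub>R k + z *\<^sub>R h) h - fD f (x + z *\<^sub>R h) h) (at z)"
      using z s(1) by (intro DERIV_diff has_real_derivative_line f1 inb1 inb2) auto
  qed
  then obtain z where z: "0 < z" "z < s" and e1: "(f (x + s *\<^sub>R k + s *\<^sub>R h) - f (x + s *\<^sub>R h)) - (f (x + s *\<^sub>R k) - f x) =
      s * (fD f (x + s *\<^sub>R k + z *\<^sub>R h) h - fD f (x + z *\<^sub>R h) h)" by auto
  have "\<exists>u>0. u < s \<and> fD f (x + z *\<^sub>R h + s *\<^sub>R k) h - fD f (x + z *\<^sub>R h + 0 *\<^sub>R k) h =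
      (s - 0) * fD (\<lambda>y. fD f y h) (x + z *\<^sub>R h + u *\<^sub>R k) k"
  proof (rule MVT2[OF s(1)])
    fix u assume u: "0 \<le> u" "u \<le> s"
    show "((\<lambda>u. fD f (x + z *\<^sub>R h + u *\<^sub>R k) h) has_real_derivative
        fD (\<lambda>y. fD f y h) (x + z *\<^sub>R h + u *\<^sub>R k) k) (at u)"
      using u z by (intro has_real_derivative_line f2 inb) auto
  qed
  then obtain u where u: "0 < u" "u < s" and e2: "fD f (x + z *\<^sub>R h + s *\<^sub>R k) h - fD f (x + z *\<^sub>R h) h =
      s * fD (\<lambda>y. fD f y h) (x + z *\<^sub>R h + u *\<^sub>R k) k" by auto
  have "f (x + s *\<^sub>R h + s *\<^sub>R k) - f (x + s *\<^sub>R h) - f (x + s *\<^sub>R k) + f x =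
      s * s * fD (\<lambda>y. fD f y h) (x + z *\<^sub>R h + u *\<^sub>R k) k"
    using e1 e2 by (simp add: add_ac)
  moreover have "dist x (x + z *\<^sub>R h + u *\<^sub>R k) < d"
    using inb[of z u] z u by simp
  ultimately show ?thesis using that by blast
qed

text \<open>The second difference is symmetric in \<open>h\<close> and \<open>k\<close> and equals
  \<open>s * s\<close> times either mixed derivative at a point close to \<open>x\<close>;
  continuity of the two mixed derivatives then excludes different values at
  \<open>x\<close>.\<close>

lemma fD_fD_commute_real:
  fixes f :: "'a::real_normed_vector \<Rightarrow> real"
  assumes S: "open S" "x \<in> S" and f: "Ck_on 2 S f"
  shows "fD (\<lambda>y. fD f y h) x k = fD (\<lambda>y. fD f y k) x h"
proof (rule ccontr)
  define A where "A = (\<lambda>y. fD (\<lambda>y. fD f y h) y k)"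
  define B where "B = (\<lambda>y. fD (\<lambda>y. fD f y k) y h)"
  assume "fD (\<lambda>y. fD f y h) x k \<noteq> fD (\<lambda>y. fD f y k) x h"
  then have ne: "A x \<noteq> B x" by (simp add: A_def B_def)
  define e where "e = dist (A x) (B x) / 2"
  have e: "e > 0" using ne by (simp add: e_def)
  have "continuous_on S A" "continuous_on S B" using f by (auto simp: numeral_2_eq_2 A_def B_def)
  then have "isCont A x" "isCont B x" using S by (auto simp: continuous_on_eq_continuous_at)
  then obtain d1 d2 where d1: "d1 > 0" "\<And>y. dist y x < d1 \<Longrightarrow> dist (A y) (A x) < e"
    and d2: "d2 > 0" "\<And>y. dist y x < d2 \<Longrightarrow> dist (B y) (B x) < e"
    using e unfolding continuous_at_eps_delta by metis
  obtain d3 where d3: "d3 > 0" "ball x d3 \<subseteq> S" using S by (meson openE)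
  define d where "d = min d1 (min d2 d3)"
  have d: "d > 0" "ball x d \<subseteq> S" using d1 d2 d3 by (auto simp: d_def)
  \<comment> \<open>The summand 1 keeps the denominator positive if \<open>h\<close> and
    \<open>k\<close> are both zero; the factor 2 makes the bound by \<open>d\<close> strict.\<close>
  define s where "s = d / (2 * (norm h + norm k + 1))"
  have pos: "norm h + norm k + 1 > 0" using norm_ge_zero[of h] norm_ge_zero[of k] by linarith
  have s: "s > 0" using d pos by (simp add: s_def)
  have "s * (norm h + norm k) \<le> s * (norm h + norm k + 1)" using s by (intro mult_left_mono) auto
  also have "\<dots> = d / 2" using pos by (simp add: s_def field_simps)
  finally have sd: "s * (norm h + norm k) < d" using d by simp
  obtain y1 where y1: "dist x y1 < d"
    "f (x + s *\<^sub>R h + s *\<^sub>R k) - f (x + s *\<^sub>R h) - f (x + s *\<^sub>R k) + f x = s * s * A y1"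
    using second_difference_eq[OF d(2) f s sd] unfolding A_def by blast
  have sd': "s * (norm k + norm h) < d" using sd by (simp add: add.commute)
  obtain y2 where y2: "dist x y2 < d"
    "f (x + s *\<^sub>R k + s *\<^sub>R h) - f (x + s *\<^sub>R k) - f (x + s *\<^sub>R h) + f x = s * s * B y2"
    using second_difference_eq[OF d(2) f s sd'] unfolding B_def by blast
  have "x + s *\<^sub>R h + s *\<^sub>R k = x + s *\<^sub>R k + s *\<^sub>R h" by (simp add: add_ac)
  then have "f (x + s *\<^sub>R h + s *\<^sub>R k) - f (x + s *\<^sub>R k) - f (x + s *\<^sub>R h) + f x = s * s * B y2"
    using y2(2) by (simp only:)
  then have "s * s * A y1 = s * s * B y2" using y1(2) by linarith
  then have "A y1 = B y2" using s by simp
  moreover have "dist (A y1) (A x) < e" "dist (B y2) (B x) < e"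
    using d1(2)[of y1] d2(2)[of y2] y1(1) y2(1) by (auto simp: d_def dist_commute)
  ultimately have "dist (A x) (B x) < 2 * e"
    using dist_triangle[of "A x" "B x" "A y1"] by (simp add: dist_commute)
  then show False by (simp add: e_def)
qed

lemma fD_fD_commute:
  fixes f :: "'a::real_normed_vector \<Rightarrow> real ^ 'n::finite"
  assumes S: "open S" "x \<in> S" and f: "smooth_on S f"
  shows "fD (\<lambda>y. fD f y h) x k = fD (\<lambda>y. fD f y k) x h"
proof (rule vec_eq_iff[THEN iffD2], rule allI)
  fix i
  have e: "fD (\<lambda>y. fD f y h) x k $ i = fD (\<lambda>y. fD (\<lambda>z. f z $ i) y h) x k" for h k
  proof -
    have "fD (\<lambda>y. fD f y h) x k $ i = fD (\<lambda>y. fD f y h $ i) x k"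
      by (rule fD_vec_nth[symmetric]) (rule smooth_on_differentiable[OF smooth_on_fD[OF f] S(2)])
    also have "fD (\<lambda>y. fD f y h $ i) x = fD (\<lambda>y. fD (\<lambda>z. f z $ i) y h) x"
      by (rule fD_cong_open[OF S]) (simp add: fD_vec_nth smooth_on_differentiable[OF f])
    finally show ?thesis .
  qed
  have "Ck_on 2 S (\<lambda>z. f z $ i)" by (rule smooth_on_imp_Ck[OF smooth_on_vec_nth[OF S(1) f]])
  from fD_fD_commute_real[OF S this] show "fD (\<lambda>y. fD f y h) x k $ i = fD (\<lambda>y. fD f y k) x h $ i"
    by (simp add: e)
qed

section \<open>Integrals depending on a parameter\<close>

text \<open>Differentiation under the integral sign, iterated: the derivative in direction
  \<open>a\<close> is an integral of the same kind with integrand \<open>fD h _ (a, 0)\<close>. The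
  open set \<open>W\<close> around \<open>U \<times> {0..1}\<close> supplies two-sided derivatives
  at the end points 0 and 1.\<close>

lemma Ck_on_integral_param:
  fixes h :: "'a::euclidean_space \<times> real \<Rightarrow> 'b::euclidean_space"
  assumes U: "open U" and W: "open W" "U \<times> {0..1} \<subseteq> W" and h: "Ck_on k W h"
  shows "Ck_on k U (\<lambda>z. integral {0..1} (\<lambda>t. h (z, t)))"
  using h
proof (induction k arbitrary: h)
  case 0
  then have "continuous_on (U \<times> cbox 0 1) (\<lambda>(z, t). h (z, t))"
    using W(2) continuous_on_subset by (auto simp: case_prod_eta)
  from integral_continuous_on_param[OF this] show ?case by simp
next
  case (Suc k)
  have dh: "h differentiable (at (z, t))" if "z \<in> U" "t \<in> {0..1}" for z t
  proof -
    have "(z, t) \<in> W" using W(2) that by auto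
    then show ?thesis using Suc.prems by simp
  qed
  \<comment> \<open>The Leibniz rule takes the partial derivative as a continuous map into the space
    of bounded linear maps.\<close>
  define F where "F = (\<lambda>z t. Blinfun (\<lambda>a. fD h (z, t) (a, 0)))"
  have F: "blinfun_apply (F z t) = (\<lambda>a. fD h (z, t) (a, 0))" if "z \<in> U" "t \<in> {0..1}" for z t
  proof -
    have "bounded_linear (fD h (z, t))" using has_derivative_bounded_linear[OF has_derivative_fD[OF dh[OF that]]] .
    from bounded_linear_compose[OF this, of "\<lambda>a. (a, 0)"]
    have "bounded_linear (\<lambda>a. fD h (z, t) (a, 0))"
      using bounded_linear_Pair[OF bounded_linear_ident bounded_linear_zero] by blast
    then show ?thesis by (simp add: F_def bounded_linear_Blinfun_apply)
  qed
  have dCk: "Ck_on k W (\<lambda>q. fD h q b)" for b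
    by (rule spec[OF conjunct2[OF Suc.prems[unfolded Ck_on.simps]]])
  have cont: "continuous_on (U \<times> {0..1}) (\<lambda>q. fD h q b)" for b
  proof -
    from continuous_on_subset[OF Ck_on_imp_continuous[OF dCk] W(2)] show ?thesis .
  qed
  have contF: "continuous_on (U \<times> {0..1}) (\<lambda>q. F (fst q) (snd q))"
  proof (rule continuous_on_blinfun_componentwise)
    fix i :: 'a
    show "continuous_on (U \<times> {0..1}) (\<lambda>q. blinfun_apply (F (fst q) (snd q)) i)"
      using cont[of "(i, 0)"] by (rule continuous_on_eq) (auto simp: F)
  qed
  have conth: "continuous_on W h"
    by (rule Ck_on_imp_continuous[OF Suc.prems])
  have hI: "(\<lambda>t. h (z, t)) integrable_on {0..1}" if "z \<in> U" for z
    by (rule integrable_continuous_real, rule continuous_on_compose2[OF conth])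
      (use that W(2) in \<open>auto intro!: continuous_intros\<close>)
  show ?case
  proof (rule Ck_on_SucI[OF U])
    fix z assume z: "z \<in> U"
    obtain e where e: "e > 0" "ball z e \<subseteq> U" using U z by (meson openE)
    have at_eq: "at z within ball z e = at z" by (rule at_within_open) (use e in auto)
    have "((\<lambda>z. integral (cbox 0 1) (\<lambda>t. h (z, t))) has_derivative integral (cbox 0 1) (F z)) (at z within ball z e)"
    proof (rule leibniz_rule)
      show "((\<lambda>z. h (z, t)) has_derivative blinfun_apply (F y t)) (at y within ball z e)"
        if "y \<in> ball z e" "t \<in> cbox 0 1" for y t
      proof -
        have y: "y \<in> U" "t \<in> {0..1}" using that e by auto
        have "((\<lambda>z. (z, t)) has_derivative (\<lambda>a. (a, 0))) (at y)" by (auto intro!: derivative_eq_intros)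
        from has_derivative_compose[OF this has_derivative_fD[OF dh[OF y]]]
        show ?thesis by (simp add: F[OF y] has_derivative_at_withinI)
      qed
      show "(\<lambda>t. h (y, t)) integrable_on cbox 0 1" if "y \<in> ball z e" for y using hI that e by auto
      show "continuous_on (ball z e \<times> cbox 0 1) (\<lambda>(y, t). F y t)"
        using continuous_on_subset[OF contF, of "ball z e \<times> {0..1}"] e by (auto simp: case_prod_beta)
    qed (use e in auto)
    then have "((\<lambda>z. integral {0..1} (\<lambda>t. h (z, t))) has_derivative integral {0..1} (F z)) (at z)"
      by (simp only: at_eq box_real)
    moreover have Fz: "F z integrable_on {0..1}"
    proof (rule integrable_continuous_real)
      have "continuous_on {0..1} (\<lambda>t. F (fst (z, t)) (snd (z, t)))"
        by (rule continuous_on_compose2[OF contF, of "{0..1}" "\<lambda>t. (z, t)"])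
          (use z in \<open>auto intro!: continuous_on_Pair continuous_on_const continuous_on_id\<close>)
      then show "continuous_on {0..1} (F z)" by (simp only: fst_conv snd_conv)
    qed
    have "blinfun_apply (integral {0..1} (F z)) a = integral {0..1} (\<lambda>t. fD h (z, t) (a, 0))" for a
    proof -
      have "blinfun_apply (integral {0..1} (F z)) a = integral {0..1} (\<lambda>t. blinfun_apply (F z t) a)"
        by (rule blinfun_apply_integral[OF Fz])
      also have "\<dots> = integral {0..1} (\<lambda>t. fD h (z, t) (a, 0))"
        by (rule integral_cong) (simp add: F[OF z])
      finally show ?thesis .
    qed
    then have "blinfun_apply (integral {0..1} (F z)) = (\<lambda>a. integral {0..1} (\<lambda>t. fD h (z, t) (a, 0)))"
      by (rule ext)
    ultimately show "((\<lambda>z. integral {0..1} (\<lambda>t. h (z, t))) has_derivative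
        (\<lambda>a. integral {0..1} (\<lambda>t. fD h (z, t) (a, 0)))) (at z)" by (simp only:)
  next
    show "Ck_on k U (\<lambda>z. integral {0..1} (\<lambda>t. fD h (z, t) (a, 0)))" for a
      by (rule Suc.IH[OF dCk])
  qed
qed

text \<open>The integral of \<open>g\<close> from \<open>t0\<close> to \<open>t\<close>, pulled back to \<open>[0, 1]\<close> so that its smoothness in
  \<open>t\<close> and in parameters of \<open>g\<close> is differentiation under the integral sign.\<close>

definition line_integral :: "(real \<Rightarrow> real) \<Rightarrow> real \<Rightarrow> real \<Rightarrow> real" where
  "line_integral g t0 t = (t - t0) * integral {0..1} (\<lambda>r. g (t0 + r * (t - t0)))"

lemma line_integral_refl [simp]: "line_integral g t t = 0"
  by (simp add: line_integral_def)

lemma in_interval_convex: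
  fixes t0 t :: real
  assumes "t0 \<in> {a..b}" "t \<in> {a..b}" "0 \<le> r" "r \<le> 1"
  shows "t0 + r * (t - t0) \<in> {a..b}"
proof -
  have "closed_segment t0 t \<subseteq> {a..b}" using assms by (simp add: closed_segment_subset)
  moreover have "t0 + r * (t - t0) \<in> closed_segment t0 t"
    using assms by (auto simp: closed_segment_def algebra_simps intro!: exI[of _ r])
  ultimately show ?thesis by blast
qed

lemma in_open_interval_convex:
  fixes t0 t :: real
  assumes "t0 \<in> {a<..<b}" "t \<in> {a<..<b}" "0 \<le> r" "r \<le> 1"
  shows "t0 + r * (t - t0) \<in> {a<..<b}"
  using in_interval_convex[of t0 "min t0 t" "max t0 t" t r] assms by auto

text \<open>Fundamental theorem under the substitution \<open>s = t0 + r * (t - t0)\<close>, which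
  treats \<open>t\<close> on either side of \<open>t0\<close> alike.\<close>

lemma line_integral_antiderivative:
  assumes "\<And>s. s \<in> {a..b} \<Longrightarrow> (G has_vector_derivative g s) (at s within {a..b})"
    "t0 \<in> {a..b}" "t \<in> {a..b}"
  shows "line_integral g t0 t = G t - G t0"
proof -
  have "((\<lambda>r. (t - t0) *\<^sub>R g (t0 + r * (t - t0))) has_integral G (t0 + 1 * (t - t0)) - G (t0 + 0 * (t - t0))) {0..1}"
  proof (rule fundamental_theorem_of_calculus)
    fix r :: real assume r: "r \<in> {0..1}"
    have sub: "(\<lambda>r. t0 + r * (t - t0)) ` {0..1} \<subseteq> {a..b}"
      using in_interval_convex[OF assms(2,3)] by auto
    have "((\<lambda>r. t0 + r * (t - t0)) has_vector_derivative (t - t0)) (at r within {0..1})"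
      by (auto intro!: derivative_eq_intros)
    moreover have "(G has_vector_derivative g (t0 + r * (t - t0)))
        (at (t0 + r * (t - t0)) within (\<lambda>r. t0 + r * (t - t0)) ` {0..1})"
      using has_vector_derivative_within_subset[OF assms(1) sub] sub r by blast
    ultimately have "((G \<circ> (\<lambda>r. t0 + r * (t - t0))) has_vector_derivative
        (t - t0) *\<^sub>R g (t0 + r * (t - t0))) (at r within {0..1})"
      by (rule vector_diff_chain_within)
    then show "((\<lambda>r. G (t0 + r * (t - t0))) has_vector_derivative
        (t - t0) *\<^sub>R g (t0 + r * (t - t0))) (at r within {0..1})"
      by (simp add: o_def)
  qed simp
  from integral_unique[OF this] show ?thesis
    by (simp add: line_integral_def)
qed

lemma line_integral_deriv:
  assumes "continuous_on {a..b} g" "t0 \<in> {a..b}" "t \<in> {a<..<b}"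
  shows "(line_integral g t0 has_real_derivative g t) (at t)"
proof -
  obtain G where G: "\<And>s. s \<in> {a..b} \<Longrightarrow> (G has_vector_derivative g s) (at s within {a..b})"
    using antiderivative_continuous[OF assms(1)] by blast
  have "{a<..<b} \<subseteq> {a..b}" by auto
  then have "(G has_vector_derivative g t) (at t within {a<..<b})"
    by (rule has_vector_derivative_within_subset[OF G, rotated]) (use assms(3) in auto)
  then have "(G has_real_derivative g t) (at t)"
    using at_within_open[of t "{a<..<b}"] assms(3)
    by (simp add: has_real_derivative_iff_has_vector_derivative)
  then have "((\<lambda>s. G s - G t0) has_real_derivative g t) (at t)"
    by (auto intro!: derivative_eq_intros)
  then show ?thesis
    by (rule has_field_derivative_transform_within_open[where S="{a<..<b}"])
      (use assms(2,3) line_integral_antiderivative[OF G] in auto)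
qed

lemma line_integral_deriv_open:
  assumes "continuous_on {a<..<b} g" "t0 \<in> {a<..<b}" "t \<in> {a<..<b}"
  shows "(line_integral g t0 has_real_derivative g t) (at t)"
proof -
  \<comment> \<open>A compact interval inside the open one, with end points halfway to
    \<open>a\<close> and \<open>b\<close>, that contains \<open>t0\<close> and has \<open>t\<close>
    in its interior.\<close>
  define a' b' where "a' = (a + min t0 t) / 2" and "b' = (b + max t0 t) / 2"
  have "a < a'" "b' < b" "t0 \<in> {a'..b'}" "t \<in> {a'<..<b'}"
    using assms(2,3) by (auto simp: a'_def b'_def min_def max_def field_simps)
  then show ?thesis
    by (intro line_integral_deriv[of a' b'] continuous_on_subset[OF assms(1)]) auto
qed

lemma Ck_on_line_integral:
  fixes g :: "real \<times> real \<Rightarrow> real"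
  assumes g: "Ck_on k ({a<..<b} \<times> J) g" and "open J" "t0 \<in> {a<..<b}"
  shows "Ck_on k ({a<..<b} \<times> J) (\<lambda>z. line_integral (\<lambda>s. g (s, snd z)) t0 (fst z))"
proof -
  let ?U = "{a<..<b} \<times> J"
  have oU: "open ?U" using assms by (intro open_Times) auto
  \<comment> \<open>\<open>m\<close> puts the pulled-back integration variable into the first
    argument of \<open>g\<close>. Its preimage \<open>W\<close> of the domain is the open set needed
    for differentiation under the integral; it contains \<open>?U \<times> {0..1}\<close> by
    convexity of the interval.\<close>
  define m :: "(real \<times> real) \<times> real \<Rightarrow> real \<times> real" where
    "m = (\<lambda>q. (t0 + snd q * (fst (fst q) - t0), snd (fst q)))"
  define W where "W = m -` ?U"
  have contm: "continuous_on UNIV m" unfolding m_def by (intro continuous_intros)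
  have oW: "open W" unfolding W_def using open_vimage[OF oU contm] .
  have WU: "?U \<times> {0..1} \<subseteq> W"
  proof
    fix q assume q: "q \<in> ?U \<times> {0..1::real}"
    then have "t0 + snd q * (fst (fst q) - t0) \<in> {a<..<b}"
      using in_open_interval_convex[OF assms(3), of "fst (fst q)" "snd q"] by auto
    then show "q \<in> W" using q by (auto simp: W_def m_def)
  qed
  have Cl: "Ck_on k W L" if "bounded_linear L" for L :: "(real \<times> real) \<times> real \<Rightarrow> real"
    by (rule Ck_on_bounded_linear[OF that])
  have b1: "bounded_linear (\<lambda>q :: (real \<times> real) \<times> real. fst (fst q))"
    by (rule bounded_linear_compose[OF bounded_linear_fst bounded_linear_fst])
  have b2: "bounded_linear (\<lambda>q :: (real \<times> real) \<times> real. snd (fst q))"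
    by (rule bounded_linear_compose[OF bounded_linear_snd bounded_linear_fst])
  have c1: "Ck_on k W (\<lambda>q. t0 + snd q * (fst (fst q) + (- t0)))"
    by (rule Ck_on_add[OF oW Ck_on_const], rule Ck_on_bilinear[OF oW bounded_bilinear_mult Cl[OF bounded_linear_snd]],
        rule Ck_on_add[OF oW Cl[OF b1] Ck_on_const])
  have bp: "bounded_linear (\<lambda>x::real. (x, 0::real))" "bounded_linear (\<lambda>x::real. (0::real, x))"
    by (auto intro!: bounded_linear_Pair bounded_linear_zero bounded_linear_ident)
  have "Ck_on k W (\<lambda>q. (t0 + snd q * (fst (fst q) + (- t0)), 0) + (0, snd (fst q)))"
    by (rule Ck_on_add[OF oW],
        rule Ck_on_compose[OF oW open_UNIV _ c1 Ck_on_bounded_linear[OF bp(1)]], simp,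
        rule Ck_on_compose[OF oW open_UNIV _ Cl[OF b2] Ck_on_bounded_linear[OF bp(2)]], simp)
  then have Cm: "Ck_on k W m" by (simp add: m_def)
  have "Ck_on k W (\<lambda>q. g (m q))"
    by (rule Ck_on_compose[OF oW oU _ Cm g]) (auto simp: W_def)
  from Ck_on_integral_param[OF oU oW WU this]
  have "Ck_on k ?U (\<lambda>z. integral {0..1} (\<lambda>r. g (t0 + r * (fst z - t0), snd z)))"
    by (simp add: m_def)
  moreover have "Ck_on k ?U (\<lambda>z :: real \<times> real. fst z + (- t0))"
    by (rule Ck_on_add[OF oU Ck_on_bounded_linear[OF bounded_linear_fst] Ck_on_const])
  ultimately have "Ck_on k ?U (\<lambda>z. (fst z + (- t0)) * integral {0..1} (\<lambda>r. g (t0 + r * (fst z - t0), snd z)))"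
    using Ck_on_bilinear[OF oU bounded_bilinear_mult] by blast
  then show ?thesis by (simp add: line_integral_def)
qed

section \<open>Scalar ordinary differential equations with smooth right-hand side\<close>

lemma Ck_on_Pair:
  assumes "open S" "Ck_on k S f" "Ck_on k S g"
  shows "Ck_on k S (\<lambda>x. (f x :: real, g x :: real))"
proof -
  have bp: "bounded_linear (\<lambda>x::real. (x, 0::real))" "bounded_linear (\<lambda>x::real. (0::real, x))"
    by (auto intro!: bounded_linear_Pair bounded_linear_zero bounded_linear_ident)
  have "Ck_on k S (\<lambda>x. (f x, 0) + (0, g x))"
    by (rule Ck_on_add[OF assms(1)],
        rule Ck_on_compose[OF assms(1) open_UNIV _ assms(2) Ck_on_bounded_linear[OF bp(1)]], simp,
        rule Ck_on_compose[OF assms(1) open_UNIV _ assms(3) Ck_on_bounded_linear[OF bp(2)]], simp)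
  then show ?thesis by simp
qed

text \<open>The function \<open>c\<close> will be a cutoff of the time variable, so that the Picard
  operator can act on functions on the whole plane.\<close>

lemma continuous_on_line_integral:
  fixes g :: "real \<times> real \<Rightarrow> real" and c :: "real \<Rightarrow> real"
  assumes g: "continuous_on UNIV g" and c: "continuous_on UNIV c"
  shows "continuous_on UNIV (\<lambda>z. line_integral (\<lambda>s. g (s, snd z)) t0 (c (fst z)))"
proof -
  have c': "continuous_on S (\<lambda>z. c (fst (fst z)))" for S :: "((real \<times> 'b::topological_space) \<times> 'c::topological_space) set"
    by (rule continuous_on_compose2[OF c]) (auto intro!: continuous_intros)
  have "continuous_on (UNIV \<times> cbox 0 1) (\<lambda>(z, r). g (t0 + r * (c (fst z) - t0), snd z))"
    unfolding case_prod_beta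
    by (rule continuous_on_compose2[OF g]) (auto intro!: continuous_intros c')
  from integral_continuous_on_param[OF this]
  have "continuous_on UNIV (\<lambda>z. integral {0..1} (\<lambda>r. g (t0 + r * (c (fst z) - t0), snd z)))" by simp
  moreover have "continuous_on UNIV (\<lambda>z::real \<times> real. c (fst z))"
    by (rule continuous_on_compose2[OF c]) (auto intro!: continuous_intros)
  ultimately show ?thesis unfolding line_integral_def by (intro continuous_intros)
qed

lemma line_integral_bound:
  assumes "\<And>s. s \<in> {a..b} \<Longrightarrow> \<bar>g s\<bar> \<le> M" "t0 \<in> {a..b}" "t \<in> {a..b}" "continuous_on {a..b} g"
  shows "\<bar>line_integral g t0 t\<bar> \<le> \<bar>t - t0\<bar> * M"
proof -
  have c: "continuous_on {0..1} (\<lambda>r. g (t0 + r * (t - t0)))"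
    by (rule continuous_on_compose2[OF assms(4)])
      (use in_interval_convex[OF assms(2,3)] in \<open>auto intro!: continuous_intros\<close>)
  have "norm (integral {0..1} (\<lambda>r. g (t0 + r * (t - t0)))) \<le> M * (1 - 0)"
    by (rule integral_bound[OF _ c])
      (use in_interval_convex[OF assms(2,3)] assms(1) in auto)
  then show ?thesis unfolding line_integral_def abs_mult
    by (intro mult_left_mono) auto
qed

text \<open>The contraction acts on bounded continuous functions of time and initial value together,
  so a single fixed point yields all solutions at once along with their joint continuity. The
  product \<open>h * L\<close> bounds the contraction constant.\<close>

lemma picard_fixed_point:
  fixes b :: "real \<times> real \<Rightarrow> real"
  assumes cb: "continuous_on UNIV b" and M: "\<And>q. \<bar>b q\<bar> \<le> M"
    and L: "\<And>t y z. \<bar>b (t, y) - b (t, z)\<bar> \<le> L * \<bar>y - z\<bar>"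
    and h: "h > 0" "h * L \<le> 1/2" and r: "r > 0"
  obtains \<phi> where "continuous_on UNIV \<phi>"
    "\<And>t \<eta>. t \<in> {t0 - h..t0 + h} \<Longrightarrow> \<eta> \<in> {y0 - r..y0 + r} \<Longrightarrow>
      \<phi> (t, \<eta>) = \<eta> + line_integral (\<lambda>s. b (s, \<phi> (s, \<eta>))) t0 t"
proof -
  \<comment> \<open>Clamping time and initial value to the given intervals keeps
    \<open>T \<phi>\<close> bounded on the whole plane; inside the intervals the clamps are the
    identity.\<close>
  define ct where "ct = (\<lambda>t. max (t0 - h) (min (t0 + h) t))"
  define cy where "cy = (\<lambda>y. max (y0 - r) (min (y0 + r) y))"
  have cont: "continuous_on UNIV ct" "continuous_on UNIV cy"
    unfolding ct_def cy_def by (auto intro!: continuous_intros)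
  have ct: "ct t \<in> {t0 - h..t0 + h}" for t using h by (auto simp: ct_def)
  have cy: "cy y \<in> {y0 - r..y0 + r}" for y using r by (auto simp: cy_def)
  define T where "T = (\<lambda>\<phi> q. cy (snd q) + line_integral (\<lambda>s. b (s, \<phi> (s, snd q))) t0 (ct (fst q)))"
  have cbphi: "continuous_on UNIV (\<lambda>q. b (fst q, \<phi> q))" if "continuous_on UNIV \<phi>" for \<phi> :: "real \<times> real \<Rightarrow> real"
    by (rule continuous_on_compose2[OF cb]) (auto intro!: continuous_intros that)
  have cbphi1: "continuous_on A (\<lambda>s. b (s, \<phi> (s, y)))" if "continuous_on UNIV \<phi>" for \<phi> :: "real \<times> real \<Rightarrow> real" and y A
    by (rule continuous_on_compose2[OF cbphi[OF that], of _ "\<lambda>s. (s, y)", simplified]) (auto intro!: continuous_intros)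
  have t0: "t0 \<in> {t0 - h..t0 + h}" using h by simp
  have Tcont: "continuous_on UNIV (T \<phi>)" if "continuous_on UNIV \<phi>" for \<phi>
  proof -
    have "continuous_on UNIV (\<lambda>q :: real \<times> real. cy (snd q))"
      by (rule continuous_on_compose2[OF cont(2)]) (auto intro!: continuous_intros)
    moreover have "continuous_on UNIV (\<lambda>z. line_integral (\<lambda>s. b (s, \<phi> (s, snd z))) t0 (ct (fst z)))"
      using continuous_on_line_integral[OF cbphi[OF that] cont(1), of t0] by simp
    ultimately show ?thesis unfolding T_def by (intro continuous_on_add)
  qed
  have Tb: "T \<phi> \<in> bcontfun" if "continuous_on UNIV \<phi>" for \<phi>
  proof (rule bcontfun_normI[OF Tcont[OF that]])
    fix q :: "real \<times> real"
    have M0: "0 \<le> M" using M[of undefined] abs_ge_zero order_trans by blast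
    have "\<bar>line_integral (\<lambda>s. b (s, \<phi> (s, snd q))) t0 (ct (fst q))\<bar> \<le> \<bar>ct (fst q) - t0\<bar> * M"
      by (rule line_integral_bound[OF _ t0 ct cbphi1[OF that]]) (rule M)
    also have "\<dots> \<le> h * M" using ct[of "fst q"] M0 by (intro mult_right_mono) auto
    finally show "norm (T \<phi> q) \<le> \<bar>y0\<bar> + r + h * M"
      using cy[of "snd q"] unfolding T_def by auto
  qed
  define TT where "TT = (\<lambda>f. Bcontfun (T (apply_bcontfun f)))"
  have TT: "apply_bcontfun (TT f) = T (apply_bcontfun f)" for f
    unfolding TT_def by (rule Bcontfun_inverse[OF Tb]) simp
  have "\<exists>!f. TT f = f"
  proof (rule banach_fix_type)
    show "\<forall>f g. dist (TT f) (TT g) \<le> 1/2 * dist f g"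
    proof (intro allI)
      fix f g :: "(real \<times> real, real) bcontfun"
      show "dist (TT f) (TT g) \<le> 1/2 * dist f g"
      proof (rule dist_bound)
        fix q :: "real \<times> real"
        let ?f = "\<lambda>s. b (s, apply_bcontfun f (s, snd q))" and ?g = "\<lambda>s. b (s, apply_bcontfun g (s, snd q))"
        let ?u = "ct (fst q)"
        have cf: "continuous_on A ?f" and cg: "continuous_on A ?g" for A by (rule cbphi1, simp)+
        have cc: "continuous_on {0..1} (\<lambda>r. F (t0 + r * (?u - t0)))" if "continuous_on UNIV F" for F :: "real \<Rightarrow> real"
          by (rule continuous_on_compose2[OF that]) (auto intro!: continuous_intros)
        have "line_integral ?f t0 ?u - line_integral ?g t0 ?u = line_integral (\<lambda>s. ?f s - ?g s) t0 ?u"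
          unfolding line_integral_def right_diff_distrib[symmetric]
          by (subst integral_diff[symmetric]) (auto intro!: integrable_continuous_real cc cf cg)
        then have "dist (apply_bcontfun (TT f) q) (apply_bcontfun (TT g) q) = \<bar>line_integral (\<lambda>s. ?f s - ?g s) t0 ?u\<bar>"
          unfolding TT T_def dist_real_def by simp
        also have "\<dots> \<le> \<bar>?u - t0\<bar> * (L * dist f g)"
        proof (rule line_integral_bound[OF _ t0 ct])
          fix s
          have L0: "0 \<le> L" using L[of 0 1 0] by simp
          have "\<bar>?f s - ?g s\<bar> \<le> L * \<bar>apply_bcontfun f (s, snd q) - apply_bcontfun g (s, snd q)\<bar>" by (rule L)
          also have "\<dots> \<le> L * dist f g"
            using dist_bounded[of f "(s, snd q)" g] L0 by (intro mult_left_mono) (auto simp: dist_real_def)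
          finally show "\<bar>?f s - ?g s\<bar> \<le> L * dist f g" .
        qed (intro continuous_on_diff cf cg)
        also have "\<dots> \<le> h * (L * dist f g)"
          using ct[of "fst q"] L[of 0 1 0] by (intro mult_right_mono) auto
        also have "\<dots> \<le> 1/2 * dist f g"
          using h(2) mult_right_mono[of "h * L" "1/2" "dist f g"] by (simp add: mult.assoc)
        finally show "dist (apply_bcontfun (TT f) q) (apply_bcontfun (TT g) q) \<le> 1/2 * dist f g" .
      qed
    qed
  qed auto
  then obtain f where f: "TT f = f" by blast
  have fp: "apply_bcontfun f (t, \<eta>) = \<eta> + line_integral (\<lambda>s. b (s, apply_bcontfun f (s, \<eta>))) t0 t"
    if "t \<in> {t0 - h..t0 + h}" "\<eta> \<in> {y0 - r..y0 + r}" for t \<eta>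
  proof -
    have c: "ct t = t" "cy \<eta> = \<eta>" using that by (auto simp: ct_def cy_def)
    have "apply_bcontfun f = T (apply_bcontfun f)" using TT[of f] by (simp only: f)
    then have "apply_bcontfun f (t, \<eta>) = T (apply_bcontfun f) (t, \<eta>)" by (rule fun_cong)
    then show ?thesis by (simp only: T_def fst_conv snd_conv c)
  qed
  show ?thesis by (rule that[OF continuous_on_apply_bcontfun fp])
qed

text \<open>Integrating factor. Besides solving equations this serves as a uniqueness statement: a
  solution that vanishes at \<open>t0\<close> vanishes on the whole interval.\<close>

lemma scalar_linear_ode:
  fixes d :: "real \<Rightarrow> real"
  assumes I: "t0 \<in> {a<..<b}" "t \<in> {a<..<b}"
    and d: "\<And>s. s \<in> {a<..<b} \<Longrightarrow> (d has_real_derivative B s * d s) (at s)"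
    and B: "continuous_on {a<..<b} B"
  shows "d t = d t0 * exp (line_integral B t0 t)"
proof -
  define E where "E = line_integral B t0"
  have E: "(E has_real_derivative B s) (at s)" if "s \<in> {a<..<b}" for s
    unfolding E_def by (rule line_integral_deriv_open[OF B I(1) that])
  have "((\<lambda>s. d s * exp (- E s)) has_field_derivative 0) (at s within {a<..<b})" if "s \<in> {a<..<b}" for s
  proof -
    have "((\<lambda>s. d s * exp (- E s)) has_field_derivative B s * d s * exp (- E s) + (exp (- E s) * - B s) * d s) (at s)"
      by (rule DERIV_mult[OF d[OF that] DERIV_fun_exp[OF DERIV_minus[OF E[OF that]]]])
    then show ?thesis by (simp add: has_field_derivative_at_within algebra_simps)
  qed
  from has_field_derivative_zero_constant[OF convex_real_interval(8) this]
  obtain c where c: "\<And>s. s \<in> {a<..<b} \<Longrightarrow> d s * exp (- E s) = c" by blast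
  have "d t * exp (- E t) = d t0 * exp (- E t0)" using c I by simp
  also have "E t0 = 0" by (simp add: E_def)
  finally have "d t * exp (- E t) * exp (E t) = d t0 * exp (E t)" by simp
  then show ?thesis by (simp add: E_def mult.assoc flip: exp_add)
qed

text \<open>By the mean value theorem in integral form, the difference of two solutions solves a
  linear equation whose coefficient \<open>B\<close> averages the derivative of \<open>b\<close>
  over the segment between them. So the difference quotient in \<eta> is exactly an exponential, and
  its limit follows from the continuity of \<open>B\<close>.\<close>

lemma flow_partial_derivative:
  fixes b \<phi> :: "real \<times> real \<Rightarrow> real"
  assumes \<Omega>: "open \<Omega>" "Ck_on 1 \<Omega> b"
    and I: "t0 \<in> {a<..<c}" "t \<in> {a<..<c}" and J: "open J" "\<eta> \<in> J"
    and Y: "convex Y" "{a<..<c} \<times> Y \<subseteq> \<Omega>" "\<And>s \<eta>. s \<in> {a<..<c} \<Longrightarrow> \<eta> \<in> J \<Longrightarrow> \<phi> (s, \<eta>) \<in> Y"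
    and cont: "continuous_on ({a<..<c} \<times> J) \<phi>"
    and init: "\<And>\<eta>. \<eta> \<in> J \<Longrightarrow> \<phi> (t0, \<eta>) = \<eta>"
    and ode: "\<And>s \<eta>. s \<in> {a<..<c} \<Longrightarrow> \<eta> \<in> J \<Longrightarrow> ((\<lambda>s. \<phi> (s, \<eta>)) has_real_derivative b (s, \<phi> (s, \<eta>))) (at s)"
  shows "((\<lambda>\<eta>. \<phi> (t, \<eta>)) has_real_derivative
    exp (line_integral (\<lambda>s. fD b (s, \<phi> (s, \<eta>)) (0, 1)) t0 t)) (at \<eta>)"
proof -
  let ?I = "{a<..<c}"
  define by' where "by' = (\<lambda>q. fD b q (0, 1))"
  have bd: "b differentiable (at q)" if "q \<in> \<Omega>" for q using \<Omega>(2) that by simp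
  have cby: "continuous_on \<Omega> by'" using \<Omega>(2) by (simp add: by'_def)
  have seg: "y + r * (z - y) \<in> Y" if "y \<in> Y" "z \<in> Y" "0 \<le> r" "r \<le> 1" for y z r
  proof -
    have "(1 - r) *\<^sub>R y + r *\<^sub>R z \<in> Y" using convexD_alt[OF Y(1) that(1,2)] that by simp
    then show ?thesis by (simp add: algebra_simps)
  qed
  \<comment> \<open>The point at fraction \<open>snd q\<close> of the segment from the solution
    started at \<eta> to the one started at \<open>snd (fst q)\<close>, both taken at time
    \<open>fst (fst q)\<close>.\<close>
  define m where "m = (\<lambda>q :: (real \<times> real) \<times> real. (fst (fst q), \<phi> (fst (fst q), \<eta>) + snd q * (\<phi> (fst q) - \<phi> (fst (fst q), \<eta>))))"
  define B where "B = (\<lambda>z. integral {0..1} (\<lambda>r. by' (m (z, r))))"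
  have oIJ: "open (?I \<times> J)" by (intro open_Times J) auto
  have "continuous_on ((?I \<times> J) \<times> UNIV) m"
  proof -
    have 1: "continuous_on ((?I \<times> J) \<times> UNIV) (\<lambda>q :: (real \<times> real) \<times> real. \<phi> (fst (fst q), \<eta>))"
      by (rule continuous_on_compose2[OF cont]) (use J in \<open>auto intro!: continuous_intros\<close>)
    have 2: "continuous_on ((?I \<times> J) \<times> UNIV) (\<lambda>q :: (real \<times> real) \<times> real. \<phi> (fst q))"
      by (rule continuous_on_compose2[OF cont]) (auto intro!: continuous_intros)
    show ?thesis unfolding m_def by (intro continuous_intros 1 2)
  qed
  define W where "W = ((?I \<times> J) \<times> UNIV) \<inter> m -` \<Omega>"
  have oW: "open W" unfolding W_def
    by (rule continuous_open_preimage) (use \<open>continuous_on _ m\<close> oIJ \<Omega> in \<open>auto intro!: open_Times\<close>)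
  have WI: "(?I \<times> J) \<times> {0..1} \<subseteq> W"
    using seg[OF Y(3) Y(3)] J Y(2) by (auto simp: W_def m_def subset_iff)
  have "continuous_on W (\<lambda>q. by' (m q))"
    by (rule continuous_on_compose2[OF cby continuous_on_subset[OF \<open>continuous_on _ m\<close>]]) (auto simp: W_def)
  then have "Ck_on 0 W (\<lambda>q. by' (m q))" by simp
  from Ck_on_integral_param[OF oIJ oW WI this]
  have B0: "Ck_on 0 (?I \<times> J) B" by (simp add: B_def)
  have slope: "b (s, \<phi> (s, x)) - b (s, \<phi> (s, \<eta>)) = B (s, x) * (\<phi> (s, x) - \<phi> (s, \<eta>))"
    if "s \<in> ?I" "x \<in> J" for s x
  proof -
    let ?y = "\<phi> (s, \<eta>)" and ?z = "\<phi> (s, x)"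
    have y: "?y \<in> Y" "?z \<in> Y" using Y(3) that J by auto
    have sub: "{min ?y ?z..max ?y ?z} \<subseteq> Y"
      using closed_segment_subset[OF y Y(1)]
      by (cases "?y \<le> ?z") (simp_all add: closed_segment_eq_real_ivl)
    have "line_integral (\<lambda>y. by' (s, y)) ?y ?z = b (s, ?z) - b (s, ?y)"
    proof (rule line_integral_antiderivative[where a="min ?y ?z" and b="max ?y ?z"])
      fix y assume "y \<in> {min ?y ?z..max ?y ?z}"
      then have "y \<in> Y" using sub by blast
      then have "(s, y) \<in> ?I \<times> Y" using that by simp
      then have "(s, y) \<in> \<Omega>" using Y(2) by blast
      from has_real_derivative_line[of b "(s, 0)" y "(0, 1)"] bd[OF this]
      have "((\<lambda>y. b (s, y)) has_real_derivative by' (s, y)) (at y)" by (simp add: by'_def)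
      then show "((\<lambda>y. b (s, y)) has_vector_derivative by' (s, y)) (at y within {min ?y ?z..max ?y ?z})"
        by (simp add: has_real_derivative_iff_has_vector_derivative has_vector_derivative_at_within)
    qed auto
    then show ?thesis by (simp add: line_integral_def B_def m_def mult.commute)
  qed
  have Bc: "continuous_on ?I (\<lambda>s. B (s, x))" if "x \<in> J" for x
  proof -
    have "continuous_on (?I \<times> J) B" using B0 by simp
    then show ?thesis
      by (rule continuous_on_compose2) (use that in \<open>auto intro!: continuous_on_Pair continuous_on_id continuous_on_const\<close>)
  qed
  have diff: "\<phi> (t, x) - \<phi> (t, \<eta>) = (x - \<eta>) * exp (line_integral (\<lambda>s. B (s, x)) t0 t)" if "x \<in> J" for x
  proof -
    have "(\<lambda>s. \<phi> (s, x) - \<phi> (s, \<eta>)) t = (\<lambda>s. \<phi> (s, x) - \<phi> (s, \<eta>)) t0 * exp (line_integral (\<lambda>s. B (s, x)) t0 t)"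
    proof (rule scalar_linear_ode[OF I _ Bc[OF that]])
      fix s assume s: "s \<in> ?I"
      show "((\<lambda>s. \<phi> (s, x) - \<phi> (s, \<eta>)) has_real_derivative B (s, x) * (\<phi> (s, x) - \<phi> (s, \<eta>))) (at s)"
        using DERIV_diff[OF ode[OF s that] ode[OF s J(2)]] slope[OF s that] by simp
    qed
    then show ?thesis using init that J by simp
  qed
  have "continuous_on (?I \<times> J) (\<lambda>z. line_integral (\<lambda>s. B (s, snd z)) t0 (fst z))"
    using Ck_on_line_integral[of 0 a c J B t0] B0 J(1) I(1) by simp
  moreover have "Pair t ` J \<subseteq> ?I \<times> J" using I(2) by blast
  ultimately have "continuous_on J (\<lambda>x. line_integral (\<lambda>s. B (s, x)) t0 t)"
    using continuous_on_compose2[of "?I \<times> J" "\<lambda>z. line_integral (\<lambda>s. B (s, snd z)) t0 (fst z)" J "\<lambda>x. (t, x)",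
        OF _ continuous_on_Pair[OF continuous_on_const continuous_on_id]] by simp
  then have "isCont (\<lambda>x. exp (line_integral (\<lambda>s. B (s, x)) t0 t)) \<eta>"
    using J by (auto simp: continuous_on_eq_continuous_at intro!: continuous_intros)
  then have lim: "((\<lambda>x. exp (line_integral (\<lambda>s. B (s, x)) t0 t)) \<longlongrightarrow> exp (line_integral (\<lambda>s. B (s, \<eta>)) t0 t)) (at \<eta>)"
    by (simp add: isCont_def)
  have "((\<lambda>x. (\<phi> (t, x) - \<phi> (t, \<eta>)) / (x - \<eta>)) \<longlongrightarrow> exp (line_integral (\<lambda>s. B (s, \<eta>)) t0 t)) (at \<eta>)"
    by (rule Lim_transform_within_open[OF lim J]) (simp add: diff)
  moreover have "(\<lambda>s. B (s, \<eta>)) = (\<lambda>s. fD b (s, \<phi> (s, \<eta>)) (0, 1))"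
    by (rule ext) (simp add: B_def m_def by'_def)
  ultimately show ?thesis by (simp add: has_field_derivative_iff)
qed

lemma has_derivative_real_partials:
  fixes \<phi> p q :: "real \<times> real \<Rightarrow> real"
  assumes "open I" "open J" "convex J"
    and 1: "\<And>t y. t \<in> I \<Longrightarrow> y \<in> J \<Longrightarrow> ((\<lambda>t. \<phi> (t, y)) has_real_derivative p (t, y)) (at t)"
    and 2: "\<And>t y. t \<in> I \<Longrightarrow> y \<in> J \<Longrightarrow> ((\<lambda>y. \<phi> (t, y)) has_real_derivative q (t, y)) (at y)"
    and q: "continuous_on (I \<times> J) q" and z: "z \<in> I \<times> J"
  shows "(\<phi> has_derivative (\<lambda>h. fst h * p z + snd h * q z)) (at z)"
proof -
  obtain x y where xy: "z = (x, y)" "x \<in> I" "y \<in> J" using z by auto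
  have "((\<lambda>(x, y). \<phi> (x, y)) has_derivative (\<lambda>(tx, ty). p (x, y) * tx + blinfun_apply (blinfun_mult_left (q (x, y))) ty))
    (at (x, y) within I \<times> J)"
  proof (rule has_derivative_partialsI[where fy="\<lambda>x y. blinfun_mult_left (q (x, y))"])
    show "((\<lambda>x. \<phi> (x, y)) has_derivative (*) (p (x, y))) (at x within I)"
      using 1[OF xy(2,3)] by (simp add: has_field_derivative_def has_derivative_at_withinI)
    show "((\<lambda>y. \<phi> (x, y)) has_derivative blinfun_apply (blinfun_mult_left (q (x, y)))) (at y within J)"
      if "x \<in> I" "y \<in> J" for x y
    proof -
      have "blinfun_apply (blinfun_mult_left (q (x, y))) = (*) (q (x, y))"
        by (auto simp: blinfun_mult_left.rep_eq)
      then show ?thesis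
        using 2[OF that] by (simp add: has_field_derivative_def has_derivative_at_withinI)
    qed
    have "continuous_on (I \<times> J) (\<lambda>z. blinfun_mult_left (q z))"
      by (rule bounded_linear.continuous_on[OF bounded_linear_blinfun_mult_left q])
    then have "continuous (at (x, y) within I \<times> J) (\<lambda>z. blinfun_mult_left (q z))"
      using xy unfolding continuous_on_eq_continuous_within by blast
    moreover have "(\<lambda>(x, y). blinfun_mult_left (q (x, y))) = (\<lambda>z. blinfun_mult_left (q z))" by auto
    ultimately show "continuous (at (x, y) within I \<times> J) (\<lambda>(x, y). blinfun_mult_left (q (x, y)))"
      by (simp only:)
  qed (use xy assms in auto)
  moreover have "at (x, y) within I \<times> J = at (x, y)"
    by (rule at_within_open) (use xy assms in \<open>auto intro: open_Times\<close>)
  moreover have "(\<lambda>(tx, ty). p (x, y) * tx + blinfun_apply (blinfun_mult_left (q (x, y))) ty) =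
      (\<lambda>h. fst h * p z + snd h * q z)"
    by (auto simp: xy blinfun_mult_left.rep_eq)
  moreover have "(\<lambda>(x, y). \<phi> (x, y)) = \<phi>" by auto
  ultimately show ?thesis by (simp only: xy)
qed

text \<open>Both partial derivatives \<open>b(t, \<phi>)\<close> and \<open>exp (\<integral> b\<^sub>y(s, \<phi>) ds)\<close> of the flow are expressed by \<open>\<phi>\<close>
  itself, so its regularity bootstraps.\<close>

lemma flow_smooth:
  fixes b \<phi> :: "real \<times> real \<Rightarrow> real"
  assumes \<Omega>: "open \<Omega>" "smooth_on \<Omega> b"
    and I: "t0 \<in> {a<..<c}" and J: "open J" "convex J"
    and Y: "convex Y" "{a<..<c} \<times> Y \<subseteq> \<Omega>" "\<And>s \<eta>. s \<in> {a<..<c} \<Longrightarrow> \<eta> \<in> J \<Longrightarrow> \<phi> (s, \<eta>) \<in> Y"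
    and cont: "continuous_on ({a<..<c} \<times> J) \<phi>"
    and init: "\<And>\<eta>. \<eta> \<in> J \<Longrightarrow> \<phi> (t0, \<eta>) = \<eta>"
    and ode: "\<And>s \<eta>. s \<in> {a<..<c} \<Longrightarrow> \<eta> \<in> J \<Longrightarrow> ((\<lambda>s. \<phi> (s, \<eta>)) has_real_derivative b (s, \<phi> (s, \<eta>))) (at s)"
  shows "smooth_on ({a<..<c} \<times> J) \<phi>"
proof -
  let ?U = "{a<..<c} \<times> J"
  have oU: "open ?U" using J by (intro open_Times) auto
  define E where "E = (\<lambda>z. exp (line_integral (\<lambda>s. fD b (s, \<phi> (s, snd z)) (0, 1)) t0 (fst z)))"
  have inO: "(\<lambda>z. (fst z, \<phi> z)) ` ?U \<subseteq> \<Omega>" using Y(2,3) by auto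
  have CP: "Ck_on k ?U (\<lambda>z. F (fst z, \<phi> z))" if "Ck_on k ?U \<phi>" "smooth_on \<Omega> F" for k and F :: "real \<times> real \<Rightarrow> real"
    by (rule Ck_on_compose[OF oU \<Omega>(1) inO
          Ck_on_Pair[OF oU Ck_on_bounded_linear[OF bounded_linear_fst] that(1)] smooth_on_imp_Ck[OF that(2)]])
  have CE: "Ck_on k ?U E" if "Ck_on k ?U \<phi>" for k
  proof -
    have "Ck_on k ?U (\<lambda>z. fD b (fst z, \<phi> z) (0, 1))" by (rule CP[OF that smooth_on_fD[OF \<Omega>(2)]])
    from Ck_on_line_integral[OF this J(1) I]
    have "Ck_on k ?U (\<lambda>z. line_integral (\<lambda>s. fD b (s, \<phi> (s, snd z)) (0, 1)) t0 (fst z))" by simp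
    from Ck_on_compose[OF oU open_UNIV _ this smooth_on_imp_Ck[OF smooth_on_exp_real]]
    show ?thesis by (simp add: E_def)
  qed
  have C0: "Ck_on 0 ?U \<phi>" using cont by simp
  have der: "(\<phi> has_derivative (\<lambda>h. fst h * b (fst z, \<phi> z) + snd h * E z)) (at z)" if "z \<in> ?U" for z
  proof (rule has_derivative_real_partials[OF _ J _ _ _ that])
    show "((\<lambda>t. \<phi> (t, y)) has_real_derivative b (fst (t, y), \<phi> (t, y))) (at t)"
      if "t \<in> {a<..<c}" "y \<in> J" for t y using ode[OF that] by simp
    show "((\<lambda>y. \<phi> (t, y)) has_real_derivative E (t, y)) (at y)" if "t \<in> {a<..<c}" "y \<in> J" for t y
      using flow_partial_derivative[OF \<Omega>(1) smooth_on_imp_Ck[OF \<Omega>(2)] I that(1) J(1) that(2) Y cont init ode]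
      by (simp add: E_def)
    show "continuous_on ?U E" using CE[OF C0] by simp
  qed auto
  have "Ck_on k ?U \<phi>" for k
  proof (induction k)
    case 0
    then show ?case by (rule C0)
  next
    case (Suc k)
    show ?case
    proof (rule Ck_on_SucI[OF oU der])
      show "Ck_on k ?U (\<lambda>z. fst h * b (fst z, \<phi> z) + snd h * E z)" for h
        by (rule Ck_on_add[OF oU], rule Ck_on_bilinear[OF oU bounded_bilinear_mult Ck_on_const CP[OF Suc \<Omega>(2)]],
            rule Ck_on_bilinear[OF oU bounded_bilinear_mult Ck_on_const CE[OF Suc]])
    qed
  qed
  then show ?thesis by (simp add: smooth_on_def)
qed

text \<open>The fixed point argument wants a globally bounded and Lipschitz right-hand side, whereas
  \<open>b\<close> is controlled near \<open>(t0, y0)\<close> only. Composing \<open>b\<close> with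
  the projection to a square provides one, and for short times the solutions stay in the square,
  where nothing was changed.\<close>

lemma smooth_ode_flow:
  fixes b :: "real \<times> real \<Rightarrow> real"
  assumes \<Omega>: "open \<Omega>" "smooth_on \<Omega> b" "(t0, y0) \<in> \<Omega>"
  obtains h r \<phi> where "h > 0" "r > 0" "smooth_on ({t0 - h<..<t0 + h} \<times> {y0 - r<..<y0 + r}) \<phi>"
    "\<And>t \<eta>. t \<in> {t0 - h<..<t0 + h} \<Longrightarrow> \<eta> \<in> {y0 - r<..<y0 + r} \<Longrightarrow> (t, \<phi> (t, \<eta>)) \<in> \<Omega>"
    "\<And>t \<eta>. t \<in> {t0 - h<..<t0 + h} \<Longrightarrow> \<eta> \<in> {y0 - r<..<y0 + r} \<Longrightarrow>
      ((\<lambda>t. \<phi> (t, \<eta>)) has_real_derivative b (t, \<phi> (t, \<eta>))) (at t)"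
    "\<And>\<eta>. \<eta> \<in> {y0 - r<..<y0 + r} \<Longrightarrow> \<phi> (t0, \<eta>) = \<eta>"
proof -
  obtain e where e: "e > 0" "cball (t0, y0) e \<subseteq> \<Omega>" using \<Omega> open_contains_cball by blast
  \<comment> \<open>Half the radius, because a distance in the product is at most the sum of the two
    coordinate distances.\<close>
  define R where "R = e / 2"
  have R: "R > 0" using e by (simp add: R_def)
  define K where "K = {t0 - R..t0 + R} \<times> {y0 - R..y0 + R}"
  have K\<Omega>: "K \<subseteq> \<Omega>"
  proof
    fix q assume q: "q \<in> K"
    obtain t y where ty: "q = (t, y)" by (cases q)
    have "dist (t0, y0) (t, y) \<le> \<bar>t0 - t\<bar> + \<bar>y0 - y\<bar>"
      unfolding dist_prod_def using sqrt_sum_squares_le_sum_abs by (simp add: dist_real_def)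
    also have "\<dots> \<le> e" using q by (auto simp: K_def ty R_def)
    finally show "q \<in> \<Omega>" using e ty by auto
  qed
  have cK: "compact K" unfolding K_def by (intro compact_Times compact_Icc)
  have Kne: "(t0, y0) \<in> K" using R by (simp add: K_def)
  have bdd: "\<exists>M>0. \<forall>q\<in>K. \<bar>g q\<bar> \<le> M" if "smooth_on \<Omega> g" for g :: "real \<times> real \<Rightarrow> real"
  proof -
    have "compact (g ` K)"
      by (rule compact_continuous_image[OF continuous_on_subset[OF smooth_on_continuous[OF that] K\<Omega>] cK])
    then obtain M where "\<forall>x\<in>g ` K. norm x \<le> M" using compact_imp_bounded bounded_iff by metis
    \<comment> \<open>The maximum with 1 makes the bound positive, as it will occur as a
      denominator.\<close>
    then show ?thesis by (intro exI[of _ "max M 1"]) auto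
  qed
  obtain M where M: "M > 0" "\<And>q. q \<in> K \<Longrightarrow> \<bar>b q\<bar> \<le> M" using bdd[OF \<Omega>(2)] by blast
  obtain L where L: "L > 0" "\<And>q. q \<in> K \<Longrightarrow> \<bar>fD b q (0, 1)\<bar> \<le> L" using bdd[OF smooth_on_fD[OF \<Omega>(2)]] by blast
  have lip: "\<bar>b (t, y) - b (t, z)\<bar> \<le> L * \<bar>y - z\<bar>" if "t \<in> {t0 - R..t0 + R}" "y \<in> {y0 - R..y0 + R}" "z \<in> {y0 - R..y0 + R}" for t y z
  proof -
    have "norm (b (t, y) - b (t, z)) \<le> L * norm (y - z)"
    proof (rule field_differentiable_bound[where S="{y0 - R..y0 + R}" and f'="\<lambda>y. fD b (t, y) (0, 1)"])
      fix x assume x: "x \<in> {y0 - R..y0 + R}"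
      then have xK: "(t, x) \<in> K" using that by (simp add: K_def)
      have bd: "b differentiable (at (t, x))" by (rule smooth_on_differentiable[OF \<Omega>(2)]) (use K\<Omega> xK in auto)
      show "((\<lambda>y. b (t, y)) has_field_derivative fD b (t, x) (0, 1)) (at x within {y0 - R..y0 + R})"
        using has_real_derivative_line[of b "(t, 0)" x "(0, 1)"] bd by (simp add: has_field_derivative_at_within)
      show "norm (fD b (t, x) (0, 1)) \<le> L" using L(2)[OF xK] by simp
    qed (use that in auto)
    then show ?thesis by simp
  qed
  define cl :: "real \<Rightarrow> real \<Rightarrow> real" where "cl = (\<lambda>c t. max (c - R) (min (c + R) t))"
  have cl: "cl c t \<in> {c - R..c + R}" for c t using R by (auto simp: cl_def)
  have cl_id: "cl c t = t" if "t \<in> {c - R..c + R}" for c t using that by (auto simp: cl_def)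
  have cl_lip: "\<bar>cl c y - cl c z\<bar> \<le> \<bar>y - z\<bar>" for c y z by (auto simp: cl_def)
  define bt where "bt = (\<lambda>q. b (cl t0 (fst q), cl y0 (snd q)))"
  have inK: "(cl t0 (fst q), cl y0 (snd q)) \<in> K" for q :: "real \<times> real" using cl by (simp add: K_def)
  have bt1: "continuous_on UNIV bt"
  proof -
    have "continuous_on UNIV (\<lambda>q :: real \<times> real. (cl t0 (fst q), cl y0 (snd q)))"
      unfolding cl_def by (intro continuous_intros)
    moreover have "range (\<lambda>q :: real \<times> real. (cl t0 (fst q), cl y0 (snd q))) \<subseteq> K"
      using inK by (rule image_subsetI)
    ultimately show ?thesis unfolding bt_def
      by (rule continuous_on_compose2[OF continuous_on_subset[OF smooth_on_continuous[OF \<Omega>(2)] K\<Omega>]])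
  qed
  have bt2: "\<bar>bt q\<bar> \<le> M" for q unfolding bt_def by (rule M(2)[OF inK])
  have bt3: "\<bar>bt (t, y) - bt (t, z)\<bar> \<le> L * \<bar>y - z\<bar>" for t y z
  proof -
    have "\<bar>bt (t, y) - bt (t, z)\<bar> \<le> L * \<bar>cl y0 y - cl y0 z\<bar>" unfolding bt_def using lip cl by simp
    also have "\<dots> \<le> L * \<bar>y - z\<bar>" using L cl_lip by (intro mult_left_mono) auto
    finally show ?thesis .
  qed
  \<comment> \<open>In this order: times stay in the square, solutions move by at most
    \<open>R / 2\<close>, and the Picard operator contracts by 1/2. Starting within
    \<open>r = R / 2\<close> of \<open>y0\<close>, solutions therefore stay in the square.\<close>
  define h where "h = min R (min (R / (2 * M)) (1 / (2 * L)))"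
  define r where "r = R / 2"
  have h: "h > 0" "h \<le> R" "h * M \<le> R / 2" "h * L \<le> 1 / 2"
  proof -
    show "h > 0" "h \<le> R" using R M L by (auto simp: h_def)
    have "h \<le> R / (2 * M)" "h \<le> 1 / (2 * L)" by (auto simp: h_def)
    then show "h * M \<le> R / 2" "h * L \<le> 1 / 2" using M(1) L(1) by (auto simp: field_simps)
  qed
  have r: "r > 0" using R by (simp add: r_def)
  obtain \<phi> where \<phi>: "continuous_on UNIV \<phi>"
    "\<And>t \<eta>. t \<in> {t0 - h..t0 + h} \<Longrightarrow> \<eta> \<in> {y0 - r..y0 + r} \<Longrightarrow>
      \<phi> (t, \<eta>) = \<eta> + line_integral (\<lambda>s. bt (s, \<phi> (s, \<eta>))) t0 t"
    by (rule picard_fixed_point[OF bt1 bt2 bt3 h(1,4) r, of t0 y0]) (rule that)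
  let ?I = "{t0 - h<..<t0 + h}" and ?J = "{y0 - r<..<y0 + r}" and ?Y = "{y0 - R..y0 + R}"
  have cs: "continuous_on A (\<lambda>s. bt (s, \<phi> (s, \<eta>)))" for A \<eta>
  proof -
    have "continuous_on A (\<lambda>s. \<phi> (s, \<eta>))"
      by (rule continuous_on_compose2[OF \<phi>(1)]) (auto intro!: continuous_on_Pair continuous_on_id continuous_on_const)
    then show ?thesis
      by (intro continuous_on_compose2[OF bt1, of A "\<lambda>s. (s, \<phi> (s, \<eta>))"])
        (auto intro!: continuous_on_Pair continuous_on_id)
  qed
  have t0: "t0 \<in> {t0 - h..t0 + h}" "t0 \<in> ?I" using h by auto
  have Y: "\<phi> (t, \<eta>) \<in> ?Y" if "t \<in> ?I" "\<eta> \<in> ?J" for t \<eta>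
  proof -
    have t: "t \<in> {t0 - h..t0 + h}" "\<eta> \<in> {y0 - r..y0 + r}" using that by auto
    have "\<bar>line_integral (\<lambda>s. bt (s, \<phi> (s, \<eta>))) t0 t\<bar> \<le> \<bar>t - t0\<bar> * M"
      by (rule line_integral_bound[OF bt2 t0(1) t(1) cs])
    also have "\<dots> \<le> h * M" using t M by (intro mult_right_mono) auto
    also have "\<dots> \<le> R / 2" by (rule h)
    finally show ?thesis using \<phi>(2)[OF t] t(2) by (auto simp: r_def)
  qed
  have inK': "(t, \<phi> (t, \<eta>)) \<in> K" if "t \<in> ?I" "\<eta> \<in> ?J" for t \<eta>
    using Y[OF that] that h by (auto simp: K_def)
  have init: "\<phi> (t0, \<eta>) = \<eta>" if "\<eta> \<in> ?J" for \<eta> using \<phi>(2)[OF t0(1), of \<eta>] that by simp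
  have ode: "((\<lambda>t. \<phi> (t, \<eta>)) has_real_derivative b (t, \<phi> (t, \<eta>))) (at t)" if "t \<in> ?I" "\<eta> \<in> ?J" for t \<eta>
  proof -
    have "(line_integral (\<lambda>s. bt (s, \<phi> (s, \<eta>))) t0 has_real_derivative bt (t, \<phi> (t, \<eta>))) (at t)"
      by (rule line_integral_deriv_open[OF cs t0(2) that(1)])
    from DERIV_add[OF DERIV_const this]
    have "((\<lambda>t. \<eta> + line_integral (\<lambda>s. bt (s, \<phi> (s, \<eta>))) t0 t) has_real_derivative bt (t, \<phi> (t, \<eta>))) (at t)"
      by simp
    then have "((\<lambda>t. \<phi> (t, \<eta>)) has_real_derivative bt (t, \<phi> (t, \<eta>))) (at t)"
      by (rule has_field_derivative_transform_within_open[where S="?I"])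
        (use that \<phi>(2) in auto)
    moreover have "bt (t, \<phi> (t, \<eta>)) = b (t, \<phi> (t, \<eta>))"
      using inK'[OF that] by (simp add: bt_def cl_id K_def)
    ultimately show ?thesis by simp
  qed
  have IY: "?I \<times> ?Y \<subseteq> \<Omega>" using K\<Omega> h by (auto simp: K_def subset_iff)
  have "smooth_on (?I \<times> ?J) \<phi>"
    by (rule flow_smooth[OF \<Omega>(1,2) t0(2) _ _ _ IY Y continuous_on_subset[OF \<phi>(1)] init ode]) auto
  from that[OF h(1) r this subsetD[OF K\<Omega> inK'] ode init] show ?thesis .
qed

section \<open>Flow boxes in the plane\<close>

lemma vector_2_eta: "vector [x $ 1, x $ 2] = (x :: 'a::zero ^ 2)"
  by (simp add: vec_eq_iff forall_2)

lemma smooth_on_vector2: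
  fixes f g :: "'a::real_normed_vector \<Rightarrow> real"
  assumes "open S" "smooth_on S f" "smooth_on S g"
  shows "smooth_on S (\<lambda>x. vector [f x, g x] :: real ^ 2)"
proof (rule smooth_on_vecI[OF assms(1)])
  fix i :: 2
  show "smooth_on S (\<lambda>x. (vector [f x, g x] :: real ^ 2) $ i)"
    using exhaust_2[of i] assms(2,3) by (elim disjE) simp_all
qed

lemma has_derivative_vector2:
  fixes f g :: "'a::real_normed_vector \<Rightarrow> real"
  assumes "f differentiable (at x)" "g differentiable (at x)"
  shows "((\<lambda>x. vector [f x, g x] :: real ^ 2) has_derivative (\<lambda>h. vector [fD f x h, fD g x h])) (at x)"
proof -
  have 1: "vector [a, b] = a *\<^sub>R axis 1 1 + b *\<^sub>R (axis 2 1 :: real ^ 2)" for a b :: real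
    by (simp add: vec_eq_iff forall_2 axis_def)
  show ?thesis unfolding 1
    by (intro has_derivative_add has_derivative_scaleR_left has_derivative_fD assms)
qed

lemma fD_vector2:
  fixes f g :: "'a::real_normed_vector \<Rightarrow> real"
  assumes "f differentiable (at x)" "g differentiable (at x)"
  shows "fD (\<lambda>x. vector [f x, g x] :: real ^ 2) x h = vector [fD f x h, fD g x h]"
  by (subst fD_eqI[OF has_derivative_vector2[OF assms]]) (rule refl)

lemma smooth_on_Pair:
  fixes f g :: "'a::real_normed_vector \<Rightarrow> real"
  shows "open S \<Longrightarrow> smooth_on S f \<Longrightarrow> smooth_on S g \<Longrightarrow> smooth_on S (\<lambda>x. (f x, g x))"
  unfolding smooth_on_def using Ck_on_Pair by blast

lemma linear_real2:
  fixes L :: "real ^ 2 \<Rightarrow> 'b::real_vector"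
  assumes "linear L"
  shows "L h = (h $ 1) *\<^sub>R L (axis 1 1) + (h $ 2) *\<^sub>R L (axis 2 1)"
proof -
  have "h = (h $ 1) *\<^sub>R axis 1 1 + (h $ 2) *\<^sub>R axis 2 1" by (simp add: vec_eq_iff forall_2 axis_def)
  then have "L h = L ((h $ 1) *\<^sub>R axis 1 1 + (h $ 2) *\<^sub>R axis 2 1)" by simp
  then show ?thesis by (simp add: linear_add[OF assms] linear_scale[OF assms])
qed

section \<open>Smooth inverse functions and straightening of fields in the plane\<close>

definition det2 :: "real ^ 2 \<Rightarrow> real ^ 2 \<Rightarrow> real" where
  "det2 p q = p $ 1 * q $ 2 - p $ 2 * q $ 1"

text \<open>Cramer's rule for the coordinates of \<open>h\<close> in the basis \<open>p\<close>,
  \<open>q\<close>.\<close>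

definition solve2 :: "real ^ 2 \<Rightarrow> real ^ 2 \<Rightarrow> real ^ 2 \<Rightarrow> real ^ 2" where
  "solve2 p q h = vector [det2 h q / det2 p q, det2 p h / det2 p q]"

lemma bounded_linear_solve2: "bounded_linear (solve2 p q)"
proof -
  have "linear (solve2 p q)"
    by (rule linearI)
      (auto simp: solve2_def det2_def vec_eq_iff forall_2 add_divide_distrib[symmetric] algebra_simps)
  then show ?thesis by (simp add: linear_conv_bounded_linear)
qed

lemma solve2_linear:
  fixes L :: "real ^ 2 \<Rightarrow> real ^ 2"
  assumes L: "linear L" and d: "det2 (L (axis 1 1)) (L (axis 2 1)) \<noteq> 0"
  shows "solve2 (L (axis 1 1)) (L (axis 2 1)) (L h) = h"
proof -
  let ?p = "L (axis 1 1)" and ?q = "L (axis 2 1)"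
  have Lh: "L h = (h $ 1) *\<^sub>R ?p + (h $ 2) *\<^sub>R ?q" by (rule linear_real2[OF L])
  have "det2 (L h) ?q = h $ 1 * det2 ?p ?q" "det2 ?p (L h) = h $ 2 * det2 ?p ?q"
    unfolding Lh by (simp_all add: det2_def algebra_simps)
  then show ?thesis using d by (simp add: solve2_def vector_2_eta)
qed

text \<open>If the determinant vanishes, the columns of the adjugate matrix lie in the kernel. By
  injectivity they are zero, which forces \<open>L (axis 1 1) = 0\<close>, a contradiction.\<close>

lemma det2_nonzero:
  fixes L :: "real ^ 2 \<Rightarrow> real ^ 2"
  assumes L: "linear L" and inj: "\<And>v. L v = 0 \<Longrightarrow> v = 0"
  shows "det2 (L (axis 1 1)) (L (axis 2 1)) \<noteq> 0"
proof
  let ?p = "L (axis 1 1)" and ?q = "L (axis 2 1)"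
  assume d: "det2 ?p ?q = 0"
  have Lv: "L (vector [a, b]) = a *\<^sub>R ?p + b *\<^sub>R ?q" for a b :: real using linear_real2[OF L, of "vector [a, b]"] by simp
  have "L (vector [?q $ 1, - (?p $ 1)]) = 0" "L (vector [?q $ 2, - (?p $ 2)]) = 0"
    unfolding Lv using d by (simp_all add: det2_def vec_eq_iff forall_2 algebra_simps)
  then have "vector [?q $ 1, - (?p $ 1)] = (0 :: real ^ 2)" "vector [?q $ 2, - (?p $ 2)] = (0 :: real ^ 2)"
    using inj by blast+
  then have "?p = 0" by (simp add: vec_eq_iff forall_2)
  from inj[OF this] show False by (simp add: axis_eq_0_iff)
qed

text \<open>The derivative of \<open>g\<close> at \<open>y\<close> is \<open>G (g y)\<close> with
  \<open>G\<close> smooth by Cramer's rule, so \<open>g\<close> is always one order more regular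
  than it is already known to be.\<close>

lemma smooth_inverse_2d:
  fixes f g :: "real ^ 2 \<Rightarrow> real ^ 2"
  assumes U: "open U" and V: "open V" and hom: "homeomorphism U V f g" and f: "smooth_on U f"
    and d: "\<And>x. x \<in> U \<Longrightarrow> det2 (fD f x (axis 1 1)) (fD f x (axis 2 1)) \<noteq> 0"
  shows "smooth_on V g"
proof -
  define G where "G = (\<lambda>x. solve2 (fD f x (axis 1 1)) (fD f x (axis 2 1)))"
  have gU: "g y \<in> U" and fg: "f (g y) = y" if "y \<in> V" for y
    using hom that by (auto simp: homeomorphism_def)
  have cg: "continuous_on V g" using hom by (simp add: homeomorphism_def)
  have der: "(g has_derivative G (g y)) (at y)" if y: "y \<in> V" for y
  proof (rule has_derivative_inverse_basic[where T=V and f=f and f'="fD f (g y)"])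
    have fd: "f differentiable (at (g y))" by (rule smooth_on_differentiable[OF f gU[OF y]])
    show "(f has_derivative fD f (g y)) (at (g y))" by (rule has_derivative_fD[OF fd])
    show "bounded_linear (G (g y))" unfolding G_def by (rule bounded_linear_solve2)
    show "G (g y) \<circ> fD f (g y) = id"
      unfolding G_def using solve2_linear[OF linear_fD[OF fd] d[OF gU[OF y]]] by auto
    show "continuous (at y) g" using cg y V continuous_on_eq_continuous_at by blast
  qed (use V y fg in auto)
  have sm: "smooth_on U (\<lambda>x. fD f x h $ i)" for h i
    by (rule smooth_on_vec_nth[OF U smooth_on_fD[OF f]])
  have smd: "smooth_on U (\<lambda>x. det2 (a x) (b x))" if "\<And>i. smooth_on U (\<lambda>x. a x $ i)" "\<And>i. smooth_on U (\<lambda>x. b x $ i)" for a b :: "real ^ 2 \<Rightarrow> real ^ 2"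
    unfolding det2_def by (rule smooth_on_diff[OF U smooth_on_mult[OF U that] smooth_on_mult[OF U that]])
  have GS: "smooth_on U (\<lambda>x. G x h)" for h
    unfolding G_def solve2_def
    by (rule smooth_on_vector2[OF U]; rule smooth_on_divide[OF U]; (rule smd)?)
      (use d sm in auto)
  have "Ck_on k V g" for k
  proof (induction k)
    case 0
    show ?case using cg by simp
  next
    case (Suc k)
    show ?case
    proof (rule Ck_on_SucI[OF V der])
      show "Ck_on k V (\<lambda>y. G (g y) h)" for h
        by (rule Ck_on_compose[OF V U _ Suc smooth_on_imp_Ck[OF GS]]) (use gU in auto)
    qed
  qed
  then show ?thesis by (simp add: smooth_on_def)
qed

text \<open>For smoothness of the inverse the determinant has to stay nonzero on the whole
  neighbourhood; hence the restriction to \<open>W\<close> before the inverse function theorem is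
  applied.\<close>

lemma local_diffeo_2d:
  fixes f :: "real ^ 2 \<Rightarrow> real ^ 2"
  assumes S: "open S" and f: "smooth_on S f" and x0: "x0 \<in> S"
    and d: "det2 (fD f x0 (axis 1 1)) (fD f x0 (axis 2 1)) \<noteq> 0"
  obtains U V g where "open U" "x0 \<in> U" "U \<subseteq> S" "open V" "homeomorphism U V f g" "smooth_on V g"
proof -
  define D where "D = (\<lambda>x. det2 (fD f x (axis 1 1)) (fD f x (axis 2 1)))"
  have sm: "smooth_on S (\<lambda>x. fD f x h $ i)" for h i
    by (rule smooth_on_vec_nth[OF S smooth_on_fD[OF f]])
  have "smooth_on S D" unfolding D_def det2_def
    by (rule smooth_on_diff[OF S smooth_on_mult[OF S sm sm] smooth_on_mult[OF S sm sm]])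
  then have cD: "continuous_on S D" by (rule smooth_on_continuous)
  define W where "W = S \<inter> D -` (- {0})"
  have W: "open W" unfolding W_def by (rule continuous_open_preimage[OF cD S]) auto
  have fW: "smooth_on W f" by (rule smooth_on_subset[OF f]) (auto simp: W_def)
  define f' where "f' = (\<lambda>x. Blinfun (fD f x))"
  have fd: "f differentiable (at x)" if "x \<in> W" for x by (rule smooth_on_differentiable[OF fW that])
  have f': "blinfun_apply (f' x) = fD f x" if "x \<in> W" for x
    unfolding f'_def by (rule bounded_linear_Blinfun_apply[OF has_derivative_bounded_linear[OF has_derivative_fD[OF fd[OF that]]]])
  have der: "(f has_derivative blinfun_apply (f' x)) (at x)" if "x \<in> W" for x
    unfolding f'[OF that] by (rule has_derivative_fD[OF fd[OF that]])
  have cf': "continuous_on W f'"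
  proof (rule continuous_on_blinfun_componentwise)
    fix i :: "real ^ 2"
    have "continuous_on W (\<lambda>x. fD f x i)" by (rule smooth_on_continuous[OF smooth_on_fD[OF fW]])
    then show "continuous_on W (\<lambda>x. blinfun_apply (f' x) i)"
      by (rule continuous_on_eq) (simp add: f')
  qed
  have xW: "x0 \<in> W" using x0 d by (simp add: W_def D_def)
  define G where "G = solve2 (fD f x0 (axis 1 1)) (fD f x0 (axis 2 1))"
  have inv: "Blinfun G o\<^sub>L f' x0 = id_blinfun"
  proof (rule blinfun_eqI)
    fix h
    have "blinfun_apply (Blinfun G) = G"
      unfolding G_def by (rule bounded_linear_Blinfun_apply[OF bounded_linear_solve2])
    then show "blinfun_apply (Blinfun G o\<^sub>L f' x0) h = blinfun_apply id_blinfun h"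
      by (simp add: f'[OF xW] G_def solve2_linear[OF linear_fD[OF fd[OF xW]] d])
  qed
  obtain U V g g' where *: "open U" "U \<subseteq> W" "x0 \<in> U" "open V" "homeomorphism U V f g"
    by (rule inverse_function_theorem[OF W der cf' xW inv]) (assumption, rule that)
  have "smooth_on V g"
    by (rule smooth_inverse_2d[OF *(1,4,5) smooth_on_subset[OF fW *(2)]])
      (use *(2) in \<open>auto simp: W_def D_def\<close>)
  moreover have "U \<subseteq> S" using *(2) by (auto simp: W_def)
  ultimately show ?thesis using that[OF *(1,3) _ *(4,5)] by blast
qed

text \<open>Where the first component is nonzero, integral curves are graphs over the first axis. A
  point is labelled by the height at which its curve crosses the vertical line through
  \<open>x0\<close> and by the time elapsed since that crossing; in these coordinates the field is
  the first basis vector.\<close>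

lemma flow_box_aux:
  fixes w :: "real ^ 2 \<Rightarrow> real ^ 2"
  assumes S: "open S" and w: "smooth_on S w" and x0: "x0 \<in> S" and w1: "w x0 $ 1 \<noteq> 0"
  obtains U V and T g :: "real ^ 2 \<Rightarrow> real ^ 2" where "open U" "x0 \<in> U" "U \<subseteq> S" "open V" "homeomorphism U V T g"
    "smooth_on U T" "smooth_on V g" "\<And>x. x \<in> U \<Longrightarrow> fD T x (w x) = axis 1 1"
proof -
  define vec where "vec = (\<lambda>q::real \<times> real. vector [fst q, snd q] :: real ^ 2)"
  have svec: "smooth_on A vec" for A
    unfolding vec_def
    by (rule smooth_on_subset[OF smooth_on_vector2[OF open_UNIV smooth_on_bounded_linear[OF bounded_linear_fst]
          smooth_on_bounded_linear[OF bounded_linear_snd]]]) simp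
  have cvec: "continuous_on A vec" for A by (rule smooth_on_continuous[OF svec])
  have sw1: "smooth_on S (\<lambda>x. w x $ i)" for i by (rule smooth_on_vec_nth[OF S w])
  define S1 where "S1 = S \<inter> (\<lambda>x. w x $ 1) -` (- {0})"
  have S1: "open S1" unfolding S1_def by (rule continuous_open_preimage[OF smooth_on_continuous[OF sw1] S]) auto
  have S1S: "S1 \<subseteq> S" by (auto simp: S1_def)
  define \<Omega> where "\<Omega> = vec -` S1"
  have \<Omega>: "open \<Omega>" unfolding \<Omega>_def by (rule open_vimage[OF S1 cvec])
  have swv: "smooth_on \<Omega> (\<lambda>q. w (vec q) $ i)" for i
    by (rule smooth_on_compose[OF smooth_on_subset[OF sw1 S1S] svec \<Omega> S1]) (auto simp: \<Omega>_def)
  \<comment> \<open>Slope of the integral curves as graphs over the first axis.\<close>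
  define b where "b = (\<lambda>q. w (vec q) $ 2 / w (vec q) $ 1)"
  have b: "smooth_on \<Omega> b" unfolding b_def
    by (rule smooth_on_divide[OF \<Omega> swv swv]) (auto simp: \<Omega>_def S1_def)
  have in\<Omega>: "(x0 $ 1, x0 $ 2) \<in> \<Omega>" using x0 w1 by (simp add: \<Omega>_def vec_def vector_2_eta S1_def)
  obtain h r \<phi> where hr: "h > 0" "r > 0"
    and \<phi>: "smooth_on ({x0 $ 1 - h<..<x0 $ 1 + h} \<times> {x0 $ 2 - r<..<x0 $ 2 + r}) \<phi>"
    and \<phi>\<Omega>: "\<And>t \<eta>. t \<in> {x0 $ 1 - h<..<x0 $ 1 + h} \<Longrightarrow> \<eta> \<in> {x0 $ 2 - r<..<x0 $ 2 + r} \<Longrightarrow> (t, \<phi> (t, \<eta>)) \<in> \<Omega>"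
    and ode: "\<And>t \<eta>. t \<in> {x0 $ 1 - h<..<x0 $ 1 + h} \<Longrightarrow> \<eta> \<in> {x0 $ 2 - r<..<x0 $ 2 + r} \<Longrightarrow>
      ((\<lambda>t. \<phi> (t, \<eta>)) has_real_derivative b (t, \<phi> (t, \<eta>))) (at t)"
    and init: "\<And>\<eta>. \<eta> \<in> {x0 $ 2 - r<..<x0 $ 2 + r} \<Longrightarrow> \<phi> (x0 $ 1, \<eta>) = \<eta>"
    by (rule smooth_ode_flow[OF \<Omega> b in\<Omega>]) (rule that)
  let ?I = "{x0 $ 1 - h<..<x0 $ 1 + h}" and ?J = "{x0 $ 2 - r<..<x0 $ 2 + r}"
  have t0: "x0 $ 1 \<in> ?I" and y0: "x0 $ 2 \<in> ?J" using hr by auto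
  have oIJ: "open (?I \<times> ?J)" by (intro open_Times) auto
  define pr2 where "pr2 = (\<lambda>z::real ^ 2. (z $ 1, z $ 2))"
  have blpr2: "bounded_linear pr2" unfolding pr2_def
    by (rule bounded_linear_Pair[OF bounded_linear_vec_nth bounded_linear_vec_nth])
  have spr2: "smooth_on A pr2" for A by (rule smooth_on_bounded_linear[OF blpr2])
  define D where "D = pr2 -` (?I \<times> ?J)"
  have D: "open D" unfolding D_def by (rule open_vimage[OF oIJ linear_continuous_on[OF blpr2]])
  have x0D: "x0 \<in> D" using t0 y0 by (simp add: D_def pr2_def)
  have D_iff: "z \<in> D \<longleftrightarrow> z $ 1 \<in> ?I \<and> z $ 2 \<in> ?J" for z by (simp add: D_def pr2_def)
  have DIJ: "pr2 ` D \<subseteq> ?I \<times> ?J" by (auto simp: D_def)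
  have comp: "smooth_on D (\<lambda>z. F (pr2 z))" if "smooth_on (?I \<times> ?J) F" for F :: "real \<times> real \<Rightarrow> real"
    by (rule smooth_on_compose[OF that spr2 D oIJ DIJ])
  \<comment> \<open>\<open>P\<close> maps (abscissa, label of the curve) to the point of the plane;
    its local inverse \<open>R\<close> reads off the label.\<close>
  define P where "P = (\<lambda>z::real ^ 2. vector [z $ 1, \<phi> (pr2 z)] :: real ^ 2)"
  have P: "smooth_on D P" unfolding P_def
    by (rule smooth_on_vector2[OF D smooth_on_bounded_linear[OF bounded_linear_vec_nth] comp[OF \<phi>]])
  have Pvec: "P z = vec (z $ 1, \<phi> (z $ 1, z $ 2))" for z by (simp add: P_def vec_def pr2_def)
  have PS1: "P z \<in> S1" if "z \<in> D" for z
    using \<phi>\<Omega>[of "z $ 1" "z $ 2"] that unfolding D_iff Pvec \<Omega>_def by blast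
  have P1: "fD P z v = vector [v $ 1, fD \<phi> (pr2 z) (v $ 1, v $ 2)]" if "z \<in> D" for z v
  proof -
    have "pr2 z \<in> ?I \<times> ?J" using that by (simp add: D_def)
    then have d: "\<phi> differentiable (at (pr2 z))" by (rule smooth_on_differentiable[OF \<phi>])
    have "fD (\<lambda>z. \<phi> (pr2 z)) z v = fD \<phi> (pr2 z) (pr2 v)"
      using fD_compose(1)[OF bounded_linear_imp_differentiable[OF blpr2] d] by (simp add: fD_linear[OF blpr2])
    then show ?thesis unfolding P_def
      using fD_vector2[OF bounded_linear_imp_differentiable[OF bounded_linear_vec_nth[of 1]]
          smooth_on_differentiable[OF comp[OF \<phi>] that], of v]
      by (simp add: fD_linear[OF bounded_linear_vec_nth] pr2_def)
  qed
  have \<phi>1: "fD \<phi> (t, \<eta>) (1, 0) = b (t, \<phi> (t, \<eta>))" if "t \<in> ?I" "\<eta> \<in> ?J" for t \<eta>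
  proof -
    have d: "\<phi> differentiable (at (t, \<eta>))" by (rule smooth_on_differentiable[OF \<phi>]) (use that in auto)
    have "((\<lambda>t. \<phi> (t, \<eta>)) has_real_derivative fD \<phi> (t, \<eta>) (1, 0)) (at t)"
      using has_real_derivative_line[of \<phi> "(0, \<eta>)" t "(1, 0)"] d by simp
    then show ?thesis using DERIV_unique[OF _ ode[OF that]] by blast
  qed
  have \<phi>2: "fD \<phi> (x0 $ 1, x0 $ 2) (0, 1) = 1"
  proof -
    have d: "\<phi> differentiable (at (x0 $ 1, x0 $ 2))" by (rule smooth_on_differentiable[OF \<phi>]) (use t0 y0 in auto)
    have "((\<lambda>y. \<phi> (x0 $ 1, y)) has_real_derivative fD \<phi> (x0 $ 1, x0 $ 2) (0, 1)) (at (x0 $ 2))"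
      using has_real_derivative_line[of \<phi> "(x0 $ 1, 0)" "x0 $ 2" "(0, 1)"] d by simp
    moreover have "((\<lambda>y. \<phi> (x0 $ 1, y)) has_real_derivative 1) (at (x0 $ 2))"
      by (rule has_field_derivative_transform_within_open[OF DERIV_ident, where S="?J"])
        (use y0 init in auto)
    ultimately show ?thesis by (rule DERIV_unique)
  qed
  have dP: "det2 (fD P x0 (axis 1 1)) (fD P x0 (axis 2 1)) \<noteq> 0"
    unfolding P1[OF x0D] using \<phi>2 by (simp add: det2_def axis_def pr2_def)
  obtain U1 V1 R where 1: "open U1" "x0 \<in> U1" "U1 \<subseteq> D" "open V1" "homeomorphism U1 V1 P R" "smooth_on V1 R"
    by (rule local_diffeo_2d[OF D P x0D dP]) (rule that)
  have RU: "R x \<in> U1" "P (R x) = x" if "x \<in> V1" for x using 1(5) that by (auto simp: homeomorphism_def)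
  have RP: "R (P z) = z" "P z \<in> V1" if "z \<in> U1" for z using 1(5) that by (auto simp: homeomorphism_def)
  have Px0: "P x0 = x0" using init[OF y0] by (simp add: P_def pr2_def vector_2_eta)
  have x0V1: "x0 \<in> V1" using RP(2)[OF 1(2)] Px0 by simp
  have V1S: "V1 \<subseteq> S"
  proof
    fix x assume "x \<in> V1"
    then have "P (R x) \<in> S1" "P (R x) = x" using PS1 RU 1(3) by blast+
    then show "x \<in> S" using S1S by auto
  qed
  \<comment> \<open>Time spent per unit of abscissa along the curve; its integral \<open>q\<close>
    below is the time elapsed since the abscissa \<open>x0 $ 1\<close>.\<close>
  define k where "k = (\<lambda>q. inverse (w (vec (fst q, \<phi> q)) $ 1))"
  have k: "smooth_on (?I \<times> ?J) k" unfolding k_def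
  proof (rule smooth_on_inverse[OF oIJ])
    show "smooth_on (?I \<times> ?J) (\<lambda>q. w (vec (fst q, \<phi> q)) $ 1)"
      by (rule smooth_on_compose[OF swv smooth_on_Pair[OF oIJ smooth_on_bounded_linear[OF bounded_linear_fst] \<phi>] oIJ \<Omega>])
        (use \<phi>\<Omega> in auto)
    show "w (vec (fst q, \<phi> q)) $ 1 \<noteq> 0" if "q \<in> ?I \<times> ?J" for q
      using \<phi>\<Omega>[of "fst q" "snd q"] that by (auto simp: \<Omega>_def S1_def)
  qed
  define q where "q = (\<lambda>q. line_integral (\<lambda>s. k (s, snd q)) (x0 $ 1) (fst q))"
  have q: "smooth_on (?I \<times> ?J) q"
    unfolding q_def smooth_on_def
    by (intro allI Ck_on_line_integral smooth_on_imp_Ck[OF k]) (use t0 in auto)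
  have q1: "fD q (t, \<eta>) (1, 0) = k (t, \<eta>)" if "t \<in> ?I" "\<eta> \<in> ?J" for t \<eta>
  proof -
    have d: "q differentiable (at (t, \<eta>))" by (rule smooth_on_differentiable[OF q]) (use that in auto)
    have "((\<lambda>t. q (t, \<eta>)) has_real_derivative fD q (t, \<eta>) (1, 0)) (at t)"
      using has_real_derivative_line[of q "(0, \<eta>)" t "(1, 0)"] d by simp
    moreover have "((\<lambda>t. q (t, \<eta>)) has_real_derivative k (t, \<eta>)) (at t)"
    proof -
      have "continuous_on ?I (\<lambda>s. k (s, \<eta>))"
        by (rule continuous_on_compose2[OF smooth_on_continuous[OF k]])
          (use that in \<open>auto intro!: continuous_on_Pair continuous_on_id continuous_on_const\<close>)
      from line_integral_deriv_open[OF this t0 that(1)] show ?thesis by (simp add: q_def)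
    qed
    ultimately show ?thesis by (rule DERIV_unique)
  qed
  define Q where "Q = (\<lambda>z::real ^ 2. vector [q (pr2 z), z $ 2] :: real ^ 2)"
  have Q: "smooth_on D Q" unfolding Q_def
    by (rule smooth_on_vector2[OF D comp[OF q] smooth_on_bounded_linear[OF bounded_linear_vec_nth]])
  have Q1: "fD Q z v = vector [fD q (pr2 z) (v $ 1, v $ 2), v $ 2]" if "z \<in> D" for z v
  proof -
    have "pr2 z \<in> ?I \<times> ?J" using that by (simp add: D_def)
    then have d: "q differentiable (at (pr2 z))" by (rule smooth_on_differentiable[OF q])
    have "fD (\<lambda>z. q (pr2 z)) z v = fD q (pr2 z) (pr2 v)"
      using fD_compose(1)[OF bounded_linear_imp_differentiable[OF blpr2] d] by (simp add: fD_linear[OF blpr2])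
    then show ?thesis unfolding Q_def
      using fD_vector2[OF smooth_on_differentiable[OF comp[OF q] that]
          bounded_linear_imp_differentiable[OF bounded_linear_vec_nth[of 2]], of v]
      by (simp add: fD_linear[OF bounded_linear_vec_nth] pr2_def)
  qed
  have dQ: "Q differentiable (at z)" if "z \<in> D" for z by (rule smooth_on_differentiable[OF Q that])
  have dR: "R differentiable (at x)" if "x \<in> V1" for x by (rule smooth_on_differentiable[OF 1(6) that])
  have dPz: "P differentiable (at z)" if "z \<in> D" for z by (rule smooth_on_differentiable[OF P that])
  \<comment> \<open>Coordinates (elapsed time, label): \<open>R\<close> straightens the curves,
    \<open>Q\<close> replaces the abscissa by the time.\<close>
  define T where "T = (\<lambda>x. Q (R x))"
  have T: "smooth_on V1 T" unfolding T_def
    by (rule smooth_on_compose[OF Q 1(6,4) D]) (use RU 1(3) in auto)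
  have T1: "fD T x v = fD Q (R x) (fD R x v)" if "x \<in> V1" for x v
    unfolding T_def by (rule fD_compose(1)[OF dR[OF that] dQ]) (use RU[OF that] 1(3) in auto)
  have RPv: "fD R (P z) (fD P z v) = v" if "z \<in> U1" for z v
  proof -
    have z: "z \<in> D" using that 1(3) by blast
    have "fD (\<lambda>z. R (P z)) z v = fD R (P z) (fD P z v)"
      by (rule fD_compose(1)[OF dPz[OF z] dR[OF RP(2)[OF that]]])
    moreover have "fD (\<lambda>z. R (P z)) z = fD (\<lambda>z. z) z"
      by (rule fD_cong_open[OF 1(1) that]) (rule RP(1))
    moreover have "fD (\<lambda>z. z) z v = v" for z v :: "real ^ 2" by (simp add: fD_linear)
    ultimately show ?thesis by simp
  qed
  have PRv: "fD P (R x) (fD R x v) = v" if "x \<in> V1" for x v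
  proof -
    have z: "R x \<in> D" using RU[OF that] 1(3) by blast
    have "fD (\<lambda>x. P (R x)) x v = fD P (R x) (fD R x v)"
      by (rule fD_compose(1)[OF dR[OF that] dPz[OF z]])
    moreover have "fD (\<lambda>x. P (R x)) x = fD (\<lambda>z. z) x"
      by (rule fD_cong_open[OF 1(4) that]) (rule RU(2))
    moreover have "fD (\<lambda>z. z) z v = v" for z v :: "real ^ 2" by (simp add: fD_linear)
    ultimately show ?thesis by simp
  qed
  have Tw: "fD T x (w x) = axis 1 1" if "x \<in> V1" for x
  proof -
    define z where "z = R x"
    have z: "z \<in> U1" "z \<in> D" "P z = x" using RU[OF that] 1(3) by (auto simp: z_def)
    have zIJ: "z $ 1 \<in> ?I" "z $ 2 \<in> ?J" using z(2) by (auto simp: D_iff)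
    have wx: "vec (z $ 1, \<phi> (z $ 1, z $ 2)) = x" using z(3) by (simp add: Pvec)
    have ne: "w x $ 1 \<noteq> 0" using PS1[OF z(2)] z(3) by (simp add: S1_def)
    \<comment> \<open>The derivative of \<open>P\<close> in its first variable is the direction with
      slope \<open>b\<close>, that is, \<open>w\<close> divided by its first component.\<close>
    have "(w x $ 1) *\<^sub>R fD P z (axis 1 1) = w x"
      unfolding P1[OF z(2)] using \<phi>1[OF zIJ] ne wx
      by (simp add: vec_eq_iff forall_2 axis_def pr2_def b_def)
    then have "fD R x (w x) = (w x $ 1) *\<^sub>R fD R x (fD P z (axis 1 1))"
      using linear_scale[OF linear_fD[OF dR[OF that]]] by metis
    also have "\<dots> = (w x $ 1) *\<^sub>R axis 1 1" using RPv[OF z(1)] z(3) by simp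
    finally have "fD T x (w x) = (w x $ 1) *\<^sub>R fD Q z (axis 1 1)"
      unfolding T1[OF that] z_def[symmetric] by (simp add: linear_scale[OF linear_fD[OF dQ[OF z(2)]]])
    also have "\<dots> = axis 1 1"
      unfolding Q1[OF z(2)] using q1[OF zIJ] ne wx
      by (simp add: vec_eq_iff forall_2 axis_def pr2_def k_def)
    finally show ?thesis .
  qed
  \<comment> \<open>The derivative of \<open>Q\<close> is triangular with nonzero diagonal entries
    \<open>k\<close> and 1, and that of \<open>R\<close> is invertible; so the kernel is
    trivial.\<close>
  have "det2 (fD T x0 (axis 1 1)) (fD T x0 (axis 2 1)) \<noteq> 0"
  proof (rule det2_nonzero)
    show "linear (fD T x0)" by (rule linear_fD[OF smooth_on_differentiable[OF T x0V1]])
    fix v assume v: "fD T x0 v = 0"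
    define z where "z = R x0"
    have z: "z \<in> D" "P z = x0" using RU[OF x0V1] 1(3) by (auto simp: z_def)
    have zIJ: "z $ 1 \<in> ?I" "z $ 2 \<in> ?J" using z(1) by (auto simp: D_iff)
    define u where "u = fD R x0 v"
    have e: "vector [fD q (pr2 z) (u $ 1, u $ 2), u $ 2] = (0 :: real ^ 2)"
      using v Q1[OF z(1), of u] unfolding T1[OF x0V1] z_def[symmetric] u_def[symmetric] by simp
    then have u2: "u $ 2 = 0" by (simp add: vec_eq_iff forall_2)
    have e1: "fD q (pr2 z) (u $ 1, 0) = 0" using e u2 by (simp add: vec_eq_iff forall_2)
    have dq: "q differentiable (at (pr2 z))" by (rule smooth_on_differentiable[OF q]) (use zIJ in \<open>simp add: pr2_def\<close>)
    have "fD q (pr2 z) (u $ 1, 0) = (u $ 1) *\<^sub>R fD q (pr2 z) (1, 0)"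
      using linear_scale[OF linear_fD[OF dq], of "u $ 1" "(1, 0)"] by simp
    then have "u $ 1 * k (z $ 1, z $ 2) = 0" using e1 u2 q1[OF zIJ] by (simp add: pr2_def)
    moreover have "k (z $ 1, z $ 2) \<noteq> 0" using PS1[OF z(1)] by (simp add: k_def S1_def Pvec)
    ultimately have "u = 0" using u2 by (simp add: vec_eq_iff forall_2)
    moreover have "v = fD P z u" using PRv[OF x0V1] by (simp add: u_def z_def)
    ultimately show "v = 0" using linear_0[OF linear_fD[OF dPz[OF z(1)]]] by simp
  qed
  then obtain U V g where 2: "open U" "x0 \<in> U" "U \<subseteq> V1" "open V" "homeomorphism U V T g" "smooth_on V g"
    by (rule local_diffeo_2d[OF 1(4) T x0V1]) (rule that)
  show ?thesis
    by (rule that[OF 2(1,2) subset_trans[OF 2(3) V1S] 2(4,5) smooth_on_subset[OF T 2(3)] 2(6)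
          Tw[OF subsetD[OF 2(3)]]])
qed

lemma homeomorphism_shrink:
  assumes "homeomorphism U V T g" "open U" "B \<subseteq> V" "open B"
  shows "homeomorphism (U \<inter> T -` B) B T g" "open (U \<inter> T -` B)"
proof -
  have h: "\<And>x. x \<in> U \<Longrightarrow> g (T x) = x" "T ` U = V" "continuous_on U T" "\<And>y. y \<in> V \<Longrightarrow> T (g y) = y"
    "g ` V = U" "continuous_on V g"
    using assms(1) by (auto simp: homeomorphism_def)
  show "open (U \<inter> T -` B)" by (rule continuous_open_preimage[OF h(3) assms(2,4)])
  have gB: "g y \<in> U" "T (g y) = y" if "y \<in> B" for y using that assms(3) h(4,5) by auto
  show "homeomorphism (U \<inter> T -` B) B T g"
    unfolding homeomorphism_def
  proof (intro conjI ballI)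
    show "T ` (U \<inter> T -` B) = B"
    proof
      show "B \<subseteq> T ` (U \<inter> T -` B)"
      proof
        fix y assume "y \<in> B"
        then show "y \<in> T ` (U \<inter> T -` B)" using gB[of y] by (intro image_eqI[of _ _ "g y"]) auto
      qed
    qed auto
    show "g ` B = U \<inter> T -` B"
    proof
      show "U \<inter> T -` B \<subseteq> g ` B"
      proof
        fix x assume "x \<in> U \<inter> T -` B"
        then show "x \<in> g ` B" using h(1)[of x] by (intro image_eqI[of _ _ "T x"]) auto
      qed
    qed (use gB in auto)
    show "continuous_on (U \<inter> T -` B) T" by (rule continuous_on_subset[OF h(3)]) auto
    show "continuous_on B g" by (rule continuous_on_subset[OF h(6) assms(3)])
  qed (use h gB in auto)
qed

lemma open_contains_box:
  fixes x :: "'a::euclidean_space"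
  assumes "open V" "x \<in> V"
  obtains a b where "x \<in> box a b" "box a b \<subseteq> V"
proof -
  obtain e where "e > 0" "ball x e \<subseteq> V" using assms by (meson openE)
  then show ?thesis using rational_boxes[of e x] that by (metis subset_trans)
qed

text \<open>If the first component of \<open>w x0\<close> vanishes, the second does not, and
  exchanging the coordinates reduces to the case above. The image is finally shrunk to an open box,
  so that coordinate lines are intervals.\<close>

lemma flow_box:
  fixes w :: "real ^ 2 \<Rightarrow> real ^ 2"
  assumes S: "open S" and w: "smooth_on S w" and x0: "x0 \<in> S" and w0: "w x0 \<noteq> 0"
  obtains U a b and T g :: "real ^ 2 \<Rightarrow> real ^ 2" where "open U" "x0 \<in> U" "U \<subseteq> S" "homeomorphism U (box a b) T g"
    "smooth_on U T" "smooth_on (box a b) g" "\<And>x. x \<in> U \<Longrightarrow> fD T x (w x) = axis 1 1"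
proof -
  have "\<exists>U V. \<exists>T g :: real ^ 2 \<Rightarrow> real ^ 2. open U \<and> x0 \<in> U \<and> U \<subseteq> S \<and> open V \<and> homeomorphism U V T g \<and>
    smooth_on U T \<and> smooth_on V g \<and> (\<forall>x\<in>U. fD T x (w x) = axis 1 1)"
  proof (cases "w x0 $ 1 = 0")
    case False
    show ?thesis by (rule flow_box_aux[OF S w x0 False]) blast
  next
    case True
    then have w2: "w x0 $ 2 \<noteq> 0" using w0 by (auto simp: vec_eq_iff forall_2)
    define \<sigma> where "\<sigma> = (\<lambda>x::real ^ 2. vector [x $ 2, x $ 1] :: real ^ 2)"
    have \<sigma>\<sigma>: "\<sigma> (\<sigma> x) = x" for x by (simp add: \<sigma>_def vec_eq_iff forall_2)
    have "linear \<sigma>" by (rule linearI) (simp_all add: \<sigma>_def vec_eq_iff forall_2)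
    then have bl: "bounded_linear \<sigma>" by (simp add: linear_conv_bounded_linear)
    have c\<sigma>: "continuous_on A \<sigma>" for A by (rule linear_continuous_on[OF bl])
    have s\<sigma>: "smooth_on A \<sigma>" for A by (rule smooth_on_bounded_linear[OF bl])
    define S' where "S' = \<sigma> -` S"
    have S': "open S'" unfolding S'_def by (rule open_vimage[OF S c\<sigma>])
    define w' where "w' = (\<lambda>x. \<sigma> (w (\<sigma> x)))"
    have w': "smooth_on S' w'" unfolding w'_def
      by (rule smooth_on_linear_compose[OF bl S' smooth_on_compose[OF w s\<sigma> S' S]]) (auto simp: S'_def)
    have x0': "\<sigma> x0 \<in> S'" using x0 by (simp add: S'_def \<sigma>\<sigma>)
    have w1': "w' (\<sigma> x0) $ 1 \<noteq> 0" using w2 by (simp add: w'_def \<sigma>\<sigma>) (simp add: \<sigma>_def)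
    obtain U V and T g :: "real ^ 2 \<Rightarrow> real ^ 2" where 1: "open U" "\<sigma> x0 \<in> U" "U \<subseteq> S'" "open V" "homeomorphism U V T g"
      "smooth_on U T" "smooth_on V g" "\<And>x. x \<in> U \<Longrightarrow> fD T x (w' x) = axis 1 1"
      by (rule flow_box_aux[OF S' w' x0' w1']) (rule that)
    let ?U = "\<sigma> -` U"
    have oU: "open ?U" by (rule open_vimage[OF 1(1) c\<sigma>])
    have hom: "homeomorphism ?U U \<sigma> \<sigma>"
      unfolding homeomorphism_def using c\<sigma> \<sigma>\<sigma> by (auto simp: image_iff) (metis \<sigma>\<sigma>)+
    have h: "homeomorphism ?U V (T \<circ> \<sigma>) (\<sigma> \<circ> g)" by (rule homeomorphism_compose[OF hom 1(5)])
    have sT: "smooth_on ?U (T \<circ> \<sigma>)" unfolding o_def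
      by (rule smooth_on_compose[OF 1(6) s\<sigma> oU 1(1)]) auto
    have sg: "smooth_on V (\<sigma> \<circ> g)" unfolding o_def
      by (rule smooth_on_linear_compose[OF bl 1(4,7)])
    have fd: "fD (T \<circ> \<sigma>) x (w x) = axis 1 1" if "x \<in> ?U" for x
    proof -
      have "\<sigma> x \<in> U" using that by simp
      from fD_compose(1)[OF bounded_linear_imp_differentiable[OF bl] smooth_on_differentiable[OF 1(6) this]]
      have "fD (T \<circ> \<sigma>) x (w x) = fD T (\<sigma> x) (\<sigma> (w x))" by (simp add: fD_linear[OF bl] o_def)
      also have "\<sigma> (w x) = w' (\<sigma> x)" by (simp add: w'_def \<sigma>\<sigma>)
      finally show ?thesis by (simp only: 1(8)[OF \<open>\<sigma> x \<in> U\<close>])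
    qed
    have US: "?U \<subseteq> S" using 1(3) \<sigma>\<sigma> by (auto simp: S'_def subset_iff)
    have xU: "x0 \<in> ?U" using 1(2) by simp
    from oU xU US 1(4) h sT sg fd show ?thesis by blast
  qed
  then obtain U V and T g :: "real ^ 2 \<Rightarrow> real ^ 2" where 1: "open U" "x0 \<in> U" "U \<subseteq> S" "open V" "homeomorphism U V T g"
    "smooth_on U T" "smooth_on V g" "\<And>x. x \<in> U \<Longrightarrow> fD T x (w x) = axis 1 1" by blast
  have "T x0 \<in> V" using 1(2,5) by (auto simp: homeomorphism_def)
  then obtain a b where ab: "T x0 \<in> box a b" "box a b \<subseteq> V" by (rule open_contains_box[OF 1(4)])
  show ?thesis
    by (rule that[OF homeomorphism_shrink(2)[OF 1(5,1) ab(2) open_box] _ _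
          homeomorphism_shrink(1)[OF 1(5,1) ab(2) open_box]
          smooth_on_subset[OF 1(6)] smooth_on_subset[OF 1(7) ab(2)] 1(8)])
      (use 1(2,3) ab in auto)
qed

section \<open>Riemannian metrics in coordinates\<close>

definition met :: "real ^ 'n ^ 'n \<Rightarrow> real ^ 'n \<Rightarrow> real ^ 'n \<Rightarrow> real" where
  "met M a b = (\<Sum>i\<in>UNIV. \<Sum>j\<in>UNIV. M $ i $ j * a $ i * b $ j)"

text \<open>The Christoffel symbols as a bilinear map at \<open>x\<close>: the correction term of
  covariant differentiation.\<close>

definition chr :: "(real ^ 'n \<Rightarrow> real ^ 'n ^ 'n) \<Rightarrow> real ^ 'n \<Rightarrow> real ^ 'n \<Rightarrow> real ^ 'n \<Rightarrow> real ^ 'n::finite" where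
  "chr G x a b = (\<chi> k. \<Sum>i\<in>UNIV. \<Sum>j\<in>UNIV. christoffel G k i j x * a $ i * b $ j)"

lemma met_inner: "met M a b = a \<bullet> (M *v b)"
  by (simp add: met_def inner_vec_def matrix_vector_mult_def sum_distrib_left mult_ac)

lemma met_linear_left: "linear (\<lambda>a. met M a b)"
  unfolding met_inner by (rule linearI) (simp_all add: inner_add_left)

lemma met_linear_right: "linear (\<lambda>b. met M a b)"
  unfolding met_inner
  by (rule linearI) (simp_all add: matrix_vector_right_distrib matrix_vector_mult_scaleR inner_add_right)

lemmas met_add_left = linear_add[OF met_linear_left]
  and met_add_right = linear_add[OF met_linear_right]
  and met_diff_left = linear_diff[OF met_linear_left]
  and met_diff_right = linear_diff[OF met_linear_right]
  and met_scale_left = linear_scale[OF met_linear_left]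
  and met_scale_right = linear_scale[OF met_linear_right]
  and met_zero_left = linear_0[OF met_linear_left]
  and met_zero_right = linear_0[OF met_linear_right]

lemmas met_simps = met_add_left met_add_right met_diff_left met_diff_right met_scale_left met_scale_right
  met_zero_left met_zero_right

lemma met_axis: "met M (axis i 1) (axis j 1) = M $ i $ j"
proof -
  have "M *v axis j 1 = column j M" by (rule matrix_vector_mult_basis)
  then show ?thesis by (simp add: met_inner inner_axis' column_def)
qed

definition metric_field :: "(real ^ 'n) set \<Rightarrow> (real ^ 'n \<Rightarrow> real ^ 'n ^ 'n::finite) \<Rightarrow> bool" where
  "metric_field S G \<longleftrightarrow> open S \<and> (\<forall>i j. smooth_on S (\<lambda>x. G x $ i $ j)) \<and>
     (\<forall>x\<in>S. (\<forall>i j. G x $ i $ j = G x $ j $ i) \<and> (\<forall>a. a \<noteq> 0 \<longrightarrow> met (G x) a a > 0))"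

context
  fixes S :: "(real ^ 'n) set" and G :: "real ^ 'n \<Rightarrow> real ^ 'n ^ 'n::finite"
  assumes mf: "metric_field S G"
begin

lemma mf_open: "open S" and mf_smooth: "smooth_on S (\<lambda>x. G x $ i $ j)"
  using mf by (auto simp: metric_field_def)

lemma mf_pos: "x \<in> S \<Longrightarrow> a \<noteq> 0 \<Longrightarrow> met (G x) a a > 0"
  using mf by (auto simp: metric_field_def)

lemma met_sym: "x \<in> S \<Longrightarrow> met (G x) a b = met (G x) b a"
proof -
  assume x: "x \<in> S"
  have s: "G x $ i $ j = G x $ j $ i" for i j using mf x by (auto simp: metric_field_def)
  have "met (G x) a b = (\<Sum>j\<in>UNIV. \<Sum>i\<in>UNIV. G x $ i $ j * a $ i * b $ j)"
    unfolding met_def by (rule sum.swap)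
  also have "\<dots> = met (G x) b a"
    unfolding met_def by (intro sum.cong refl) (simp add: s mult_ac)
  finally show ?thesis .
qed

text \<open>Identities for \<open>chr\<close> below are obtained by pairing with an arbitrary
  vector, which keeps the inverse matrix in the Christoffel symbols out of the computation.\<close>

lemma met_nondegenerate:
  assumes "x \<in> S" "\<And>c. met (G x) a c = met (G x) b c" shows "a = b"
proof (rule ccontr)
  assume "a \<noteq> b"
  then have "met (G x) (a - b) (a - b) > 0" using mf_pos[OF assms(1)] by simp
  then show False using assms(2) by (simp add: met_diff_left)
qed

lemma mf_inverse: "x \<in> S \<Longrightarrow> G x ** matrix_inv (G x) = mat 1"
proof -
  assume x: "x \<in> S"
  have "a = 0" if "G x *v a = 0" for a
    using mf_pos[OF x, of a] that by (auto simp: met_inner)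
  then have "inj ((*v) (G x))"
    by (subst matrix_vector_mul_linear[THEN linear_injective_0]) blast
  then have "invertible (G x)" by (simp add: invertible_left_inverse matrix_left_invertible_injective)
  then have "G x ** matrix_inv (G x) = mat 1 \<and> matrix_inv (G x) ** G x = mat 1"
    unfolding matrix_inv_def invertible_def by (rule someI_ex)
  then show ?thesis ..
qed

lemma smooth_on_met:
  fixes \<phi> :: "'a::real_normed_vector \<Rightarrow> real ^ 'n"
  assumes "open U" "smooth_on U \<phi>" "\<phi> ` U \<subseteq> S" "smooth_on U Y" "smooth_on U Z"
  shows "smooth_on U (\<lambda>x. met (G (\<phi> x)) (Y x) (Z x))"
  unfolding met_def
  by (rule smooth_on_sum[OF assms(1)], rule smooth_on_sum[OF assms(1)],
      rule smooth_on_mult[OF assms(1) smooth_on_mult[OF assms(1) smooth_on_compose[OF mf_smooth assms(2,1) mf_open assms(3)]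
        smooth_on_vec_nth[OF assms(1,4)]] smooth_on_vec_nth[OF assms(1,5)]])

lemma mf_diff: "x \<in> S \<Longrightarrow> (\<lambda>x. G x $ i $ j) differentiable (at x)"
  by (rule smooth_on_differentiable[OF mf_smooth])

lemma fD_met:
  assumes "x \<in> S"
  shows "fD (\<lambda>y. met (G y) a b) x h = (\<Sum>i\<in>UNIV. \<Sum>j\<in>UNIV. fD (\<lambda>y. G y $ i $ j) x h * a $ i * b $ j)"
proof -
  have "((\<lambda>y. met (G y) a b) has_derivative (\<lambda>h. \<Sum>i\<in>UNIV. \<Sum>j\<in>UNIV. fD (\<lambda>y. G y $ i $ j) x h * a $ i * b $ j)) (at x)"
    unfolding met_def
    by (intro has_derivative_sum has_derivative_mult_left has_derivative_fD mf_diff assms)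
  then show ?thesis by (simp add: fD_eqI)
qed

lemma fD_met_compose:
  fixes \<phi> :: "'a::real_normed_vector \<Rightarrow> real ^ 'n"
  assumes x: "\<phi> x \<in> S" and d: "\<phi> differentiable (at x)" "Y differentiable (at x)" "Z differentiable (at x)"
  shows "fD (\<lambda>y. met (G (\<phi> y)) (Y y) (Z y)) x h =
    fD (\<lambda>y. met (G y) (Y x) (Z x)) (\<phi> x) (fD \<phi> x h) +
    met (G (\<phi> x)) (fD Y x h) (Z x) + met (G (\<phi> x)) (Y x) (fD Z x h)"
proof -
  have dg: "((\<lambda>y. G (\<phi> y) $ i $ j) has_derivative (\<lambda>h. fD (\<lambda>y. G y $ i $ j) (\<phi> x) (fD \<phi> x h))) (at x)" for i j
    by (rule has_derivative_compose[OF has_derivative_fD[OF d(1)] has_derivative_fD[OF mf_diff[OF x]]])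
  have dv: "((\<lambda>y. Y y $ i) has_derivative (\<lambda>h. fD Y x h $ i)) (at x)" if "Y differentiable (at x)" for Y :: "'a \<Rightarrow> real ^ 'n" and i
    by (rule bounded_linear.has_derivative[OF bounded_linear_vec_nth has_derivative_fD[OF that]])
  have "((\<lambda>y. met (G (\<phi> y)) (Y y) (Z y)) has_derivative (\<lambda>h. \<Sum>i\<in>UNIV. \<Sum>j\<in>UNIV.
      (G (\<phi> x) $ i $ j * Y x $ i) * fD Z x h $ j +
      (G (\<phi> x) $ i $ j * fD Y x h $ i + fD (\<lambda>y. G y $ i $ j) (\<phi> x) (fD \<phi> x h) * Y x $ i) * Z x $ j)) (at x)"
    unfolding met_def by (intro has_derivative_sum has_derivative_mult dg dv d)
  from fD_eqI[OF this] have e: "fD (\<lambda>y. met (G (\<phi> y)) (Y y) (Z y)) x h = (\<Sum>i\<in>UNIV. \<Sum>j\<in>UNIV.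
      (G (\<phi> x) $ i $ j * Y x $ i) * fD Z x h $ j +
      (G (\<phi> x) $ i $ j * fD Y x h $ i + fD (\<lambda>y. G y $ i $ j) (\<phi> x) (fD \<phi> x h) * Y x $ i) * Z x $ j)"
    by (rule fun_cong)
  show ?thesis unfolding e fD_met[OF x] unfolding met_def
    by (simp add: sum.distrib[symmetric] algebra_simps)
qed

text \<open>Koszul's formula for constant fields, whose brackets vanish. Lowering the index cancels
  the inverse matrix; symmetry and metric compatibility of \<open>chr\<close> are then read off from
  here.\<close>

lemma chr_lower:
  assumes x: "x \<in> S"
  shows "2 * met (G x) (chr G x a b) c = fD (\<lambda>y. met (G y) b c) x a + fD (\<lambda>y. met (G y) a c) x b
    - fD (\<lambda>y. met (G y) a b) x c"
proof -
  define P where "P = (\<lambda>i j l. partial i (\<lambda>y. G y $ j $ l) x)"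
  define L where "L = (\<lambda>i j l. P i j l + P j i l - P l i j)"
  define Gam where "Gam = (\<lambda>i j. \<chi> k. christoffel G k i j x)"
  have sym: "G y $ i $ j = G y $ j $ i" if "y \<in> S" for y i j using mf that by (auto simp: metric_field_def)
  have G1: "(2 *\<^sub>R Gam i j) = matrix_inv (G x) *v (\<chi> l. L i j l)" for i j
    by (simp add: vec_eq_iff Gam_def christoffel_def matrix_vector_mult_def L_def P_def)
  have G2: "G x *v (2 *\<^sub>R Gam i j) = (\<chi> l. L i j l)" for i j
    unfolding G1 by (simp add: matrix_vector_mul_assoc mf_inverse[OF x])
  have "chr G x a b = (\<Sum>i\<in>UNIV. \<Sum>j\<in>UNIV. (a $ i * b $ j) *\<^sub>R Gam i j)"
    by (simp add: vec_eq_iff chr_def Gam_def mult_ac)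
  then have "2 * met (G x) (chr G x a b) c = c \<bullet> (G x *v (2 *\<^sub>R (\<Sum>i\<in>UNIV. \<Sum>j\<in>UNIV. (a $ i * b $ j) *\<^sub>R Gam i j)))"
    by (subst met_sym[OF x]) (simp add: met_inner matrix_vector_mult_scaleR)
  also have "2 *\<^sub>R (\<Sum>i\<in>UNIV. \<Sum>j\<in>UNIV. (a $ i * b $ j) *\<^sub>R Gam i j) =
      (\<Sum>i\<in>UNIV. \<Sum>j\<in>UNIV. (a $ i * b $ j) *\<^sub>R (2 *\<^sub>R Gam i j))"
    unfolding scaleR_sum_right scaleR_scaleR by (simp only: mult.commute)
  also have "c \<bullet> (G x *v (\<Sum>i\<in>UNIV. \<Sum>j\<in>UNIV. (a $ i * b $ j) *\<^sub>R (2 *\<^sub>R Gam i j))) =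
      (\<Sum>i\<in>UNIV. \<Sum>j\<in>UNIV. (a $ i * b $ j) * (c \<bullet> (\<chi> l. L i j l)))"
  proof -
    have lin: "linear (\<lambda>v. c \<bullet> (G x *v v))" using met_linear_right[of "G x" c] by (simp add: met_inner)
    show ?thesis by (simp only: linear_sum[OF lin] linear_scale[OF lin] G2 real_scaleR_def)
  qed
  also have "\<dots> = (\<Sum>i\<in>UNIV. \<Sum>j\<in>UNIV. \<Sum>l\<in>UNIV. a $ i * b $ j * c $ l * L i j l)"
    by (simp add: inner_vec_def sum_distrib_left mult_ac)
  also have "\<dots> = (\<Sum>i\<in>UNIV. \<Sum>j\<in>UNIV. \<Sum>l\<in>UNIV. a $ i * b $ j * c $ l * P i j l) +
      (\<Sum>i\<in>UNIV. \<Sum>j\<in>UNIV. \<Sum>l\<in>UNIV. a $ i * b $ j * c $ l * P j i l) -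
      (\<Sum>i\<in>UNIV. \<Sum>j\<in>UNIV. \<Sum>l\<in>UNIV. a $ i * b $ j * c $ l * P l i j)"
    unfolding L_def by (simp add: algebra_simps sum.distrib sum_subtractf)
  finally have main: "2 * met (G x) (chr G x a b) c = (\<Sum>i\<in>UNIV. \<Sum>j\<in>UNIV. \<Sum>l\<in>UNIV. a $ i * b $ j * c $ l * P i j l) +
      (\<Sum>i\<in>UNIV. \<Sum>j\<in>UNIV. \<Sum>l\<in>UNIV. a $ i * b $ j * c $ l * P j i l) -
      (\<Sum>i\<in>UNIV. \<Sum>j\<in>UNIV. \<Sum>l\<in>UNIV. a $ i * b $ j * c $ l * P l i j)" .
  have ex: "fD (\<lambda>y. G y $ j $ l) x h = (\<Sum>i\<in>UNIV. h $ i * P i j l)" for j l h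
  proof -
    have lin: "linear (fD (\<lambda>y. G y $ j $ l) x)" by (rule linear_fD[OF mf_diff[OF x]])
    have "h = (\<Sum>i\<in>UNIV. h $ i *\<^sub>R axis i 1)"
      using basis_expansion[of h] by (simp add: scalar_mult_eq_scaleR)
    then have "fD (\<lambda>y. G y $ j $ l) x h = fD (\<lambda>y. G y $ j $ l) x (\<Sum>i\<in>UNIV. h $ i *\<^sub>R axis i 1)" by simp
    also have "\<dots> = (\<Sum>i\<in>UNIV. h $ i * P i j l)"
      by (simp add: linear_sum[OF lin] linear_scale[OF lin] P_def partial_def)
    finally show ?thesis .
  qed
  have ab: "fD (\<lambda>y. met (G y) u v) x h = (\<Sum>j\<in>UNIV. \<Sum>l\<in>UNIV. \<Sum>i\<in>UNIV. h $ i * u $ j * v $ l * P i j l)" for u v h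
    unfolding fD_met[OF x] ex sum_distrib_right by (intro sum.cong refl) (simp add: mult_ac)
  \<comment> \<open>In \<open>ab\<close> the index of differentiation is summed innermost; it has to
    move to the front to match \<open>main\<close>.\<close>
  have r1: "(\<Sum>j\<in>UNIV. \<Sum>l\<in>UNIV. \<Sum>i\<in>UNIV. F i j l) = (\<Sum>i\<in>UNIV. \<Sum>j\<in>UNIV. \<Sum>l\<in>UNIV. F i j l)" for F :: "'n \<Rightarrow> 'n \<Rightarrow> 'n \<Rightarrow> real"
  proof -
    have "(\<Sum>j\<in>UNIV. \<Sum>l\<in>UNIV. \<Sum>i\<in>UNIV. F i j l) = (\<Sum>j\<in>UNIV. \<Sum>i\<in>UNIV. \<Sum>l\<in>UNIV. F i j l)"
      by (rule sum.cong[OF refl], rule sum.swap)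
    also have "\<dots> = (\<Sum>i\<in>UNIV. \<Sum>j\<in>UNIV. \<Sum>l\<in>UNIV. F i j l)" by (rule sum.swap)
    finally show ?thesis .
  qed
  have t1: "fD (\<lambda>y. met (G y) b c) x a = (\<Sum>i\<in>UNIV. \<Sum>j\<in>UNIV. \<Sum>l\<in>UNIV. a $ i * b $ j * c $ l * P i j l)"
    unfolding ab by (rule r1)
  have t2: "fD (\<lambda>y. met (G y) a c) x b = (\<Sum>i\<in>UNIV. \<Sum>j\<in>UNIV. \<Sum>l\<in>UNIV. a $ i * b $ j * c $ l * P j i l)"
  proof -
    have "fD (\<lambda>y. met (G y) a c) x b = (\<Sum>i\<in>UNIV. \<Sum>j\<in>UNIV. \<Sum>l\<in>UNIV. b $ i * a $ j * c $ l * P i j l)"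
      unfolding ab by (rule r1)
    also have "\<dots> = (\<Sum>j\<in>UNIV. \<Sum>i\<in>UNIV. \<Sum>l\<in>UNIV. b $ i * a $ j * c $ l * P i j l)" by (rule sum.swap)
    finally show ?thesis by (simp only: mult.commute[of "b $ _"])
  qed
  have t3: "fD (\<lambda>y. met (G y) a b) x c = (\<Sum>i\<in>UNIV. \<Sum>j\<in>UNIV. \<Sum>l\<in>UNIV. a $ i * b $ j * c $ l * P l i j)"
    unfolding ab by (intro sum.cong refl) (simp add: mult_ac)
  show ?thesis unfolding main t1 t2 t3 ..
qed

lemma chr_sym:
  assumes x: "x \<in> S" shows "chr G x a b = chr G x b a"
proof (rule met_nondegenerate[OF x])
  fix c
  have "fD (\<lambda>y. met (G y) a b) x = fD (\<lambda>y. met (G y) b a) x"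
    by (rule fD_cong_open[OF mf_open x]) (rule met_sym)
  then show "met (G x) (chr G x a b) c = met (G x) (chr G x b a) c"
    using chr_lower[OF x, of a b c] chr_lower[OF x, of b a c] by simp
qed

text \<open>Add Koszul's formulas for the pairings with \<open>b\<close> and with \<open>a\<close>:
  the terms that differentiate in direction \<open>a\<close> or \<open>b\<close> cancel.\<close>

lemma chr_compat:
  assumes x: "x \<in> S"
  shows "fD (\<lambda>y. met (G y) a b) x h = met (G x) (chr G x h a) b + met (G x) a (chr G x h b)"
proof -
  have "fD (\<lambda>y. met (G y) a b) x = fD (\<lambda>y. met (G y) b a) x" for a b
    by (rule fD_cong_open[OF mf_open x]) (rule met_sym)
  then show ?thesis
    using chr_lower[OF x, of h a b] chr_lower[OF x, of h b a] met_sym[OF x, of a "chr G x h b"] by simp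
qed

end

section \<open>Covariant differentiation along maps\<close>

lemma linear_chr_right: "linear (\<lambda>b. chr G x a b)"
  by (rule linearI)
    (simp_all add: chr_def vec_eq_iff sum.distrib[symmetric] sum_distrib_left algebra_simps)

text \<open>The connection pulled back along \<phi>. An immersion gives the ambient derivative of a
  field along the surface, a change of coordinates the transformation law, and the identity the
  connection of the chart itself.\<close>

definition cov :: "(real ^ 'n \<Rightarrow> real ^ 'n ^ 'n) \<Rightarrow> ('a::real_normed_vector \<Rightarrow> real ^ 'n) \<Rightarrow>
    ('a \<Rightarrow> real ^ 'n::finite) \<Rightarrow> 'a \<Rightarrow> 'a \<Rightarrow> real ^ 'n" where
  "cov G \<phi> Y x h = fD Y x h + chr G (\<phi> x) (fD \<phi> x h) (Y x)"

lemma cov_compat: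
  assumes mf: "metric_field S G" and x: "\<phi> x \<in> S"
    and d: "\<phi> differentiable (at x)" "Y differentiable (at x)" "Z differentiable (at x)"
  shows "fD (\<lambda>y. met (G (\<phi> y)) (Y y) (Z y)) x h =
    met (G (\<phi> x)) (cov G \<phi> Y x h) (Z x) + met (G (\<phi> x)) (Y x) (cov G \<phi> Z x h)"
  unfolding fD_met_compose[OF mf x d] chr_compat[OF mf x] cov_def by (simp add: met_simps)

text \<open>Symmetry of second derivatives together with vanishing torsion.\<close>

lemma cov_fD_sym:
  fixes \<phi> :: "real ^ 'm::finite \<Rightarrow> real ^ 'n::finite"
  assumes mf: "metric_field S G" and U: "open U" "smooth_on U \<phi>" and y: "y \<in> U" "\<phi> y \<in> S"
  shows "cov G \<phi> (\<lambda>y. fD \<phi> y b) y a = cov G \<phi> (\<lambda>y. fD \<phi> y a) y b"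
  unfolding cov_def using fD_fD_commute[OF U(1) y(1) U(2), of b a] chr_sym[OF mf y(2)] by simp

text \<open>Koszul's formula for the metric \<open>H = \<phi>\<^sup>* G\<close>. For an immersion this is the Gauss formula, for a
  change of coordinates it gives the transformation law of the Christoffel symbols.\<close>

lemma chr_pullback:
  fixes \<phi> :: "real ^ 'm::finite \<Rightarrow> real ^ 'n::finite"
  assumes mf: "metric_field S G" and mfH: "metric_field U H" and \<phi>: "smooth_on U \<phi>" "\<phi> ` U \<subseteq> S"
    and H: "\<And>y a b. y \<in> U \<Longrightarrow> met (H y) a b = met (G (\<phi> y)) (fD \<phi> y a) (fD \<phi> y b)"
    and y: "y \<in> U"
  shows "met (H y) (chr H y a b) c = met (G (\<phi> y)) (cov G \<phi> (\<lambda>y. fD \<phi> y b) y a) (fD \<phi> y c)"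
proof -
  have U: "open U" by (rule mf_open[OF mfH])
  have yS: "\<phi> y \<in> S" using \<phi> y by auto
  define D where "D = (\<lambda>a b. cov G \<phi> (\<lambda>y. fD \<phi> y b) y a)"
  have Dsym: "D a b = D b a" for a b unfolding D_def by (rule cov_fD_sym[OF mf U \<phi>(1) y yS])
  have df: "\<phi> differentiable (at y)" "(\<lambda>y. fD \<phi> y b) differentiable (at y)" for b
    by (rule smooth_on_differentiable[OF \<phi>(1) y], rule smooth_on_differentiable[OF smooth_on_fD[OF \<phi>(1)] y])
  have dH: "fD (\<lambda>y. met (H y) b c) y a = met (G (\<phi> y)) (D a b) (fD \<phi> y c) + met (G (\<phi> y)) (D a c) (fD \<phi> y b)" for a b c
  proof -
    have "fD (\<lambda>y. met (H y) b c) y = fD (\<lambda>y. met (G (\<phi> y)) (fD \<phi> y b) (fD \<phi> y c)) y"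
      by (rule fD_cong_open[OF U y]) (rule H)
    then show ?thesis
      using cov_compat[OF mf yS df(1) df(2)[of b] df(2)[of c], of a] met_sym[OF mf yS]
      by (simp add: D_def)
  qed
  have "2 * met (H y) (chr H y a b) c = 2 * met (G (\<phi> y)) (D a b) (fD \<phi> y c)"
    unfolding chr_lower[OF mfH y] dH using Dsym[of b a] Dsym[of c a] Dsym[of c b] by simp
  then show ?thesis by (simp add: D_def)
qed

text \<open>Chain rule for a differential whose base point and argument both vary; the basis
  expansion separates the two dependences.\<close>

lemma fD_fD_app:
  fixes \<phi> :: "'b::euclidean_space \<Rightarrow> 'c::real_normed_vector" and Y :: "'a::real_normed_vector \<Rightarrow> 'b"
  assumes U: "open U" "smooth_on U \<phi>" "\<psi> x \<in> U" and d: "\<psi> differentiable (at x)" "Y differentiable (at x)"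
    and A: "open A" "x \<in> A" "\<And>y. y \<in> A \<Longrightarrow> \<psi> y \<in> U"
  shows "fD (\<lambda>y. fD \<phi> (\<psi> y) (Y y)) x h =
    fD (\<lambda>z. fD \<phi> z (Y x)) (\<psi> x) (fD \<psi> x h) + fD \<phi> (\<psi> x) (fD Y x h)"
proof -
  have exp: "fD \<phi> z v = (\<Sum>i\<in>Basis. (v \<bullet> i) *\<^sub>R fD \<phi> z i)" if "z \<in> U" for z v
    by (rule linear_eq_sum_Basis[OF linear_fD[OF smooth_on_differentiable[OF U(2) that]]])
  have dd: "(\<lambda>z. fD \<phi> z i) differentiable (at (\<psi> x))" for i
    by (rule smooth_on_differentiable[OF smooth_on_fD[OF U(2)] U(3)])
  have "fD (\<lambda>y. fD \<phi> (\<psi> y) (Y y)) x = fD (\<lambda>y. \<Sum>i\<in>Basis. (Y y \<bullet> i) *\<^sub>R fD \<phi> (\<psi> y) i) x"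
    by (rule fD_cong_open[OF A(1,2)]) (rule exp[OF A(3)])
  also have "\<dots> = (\<lambda>h. \<Sum>i\<in>Basis. (Y x \<bullet> i) *\<^sub>R fD (\<lambda>z. fD \<phi> z i) (\<psi> x) (fD \<psi> x h) + (fD Y x h \<bullet> i) *\<^sub>R fD \<phi> (\<psi> x) i)"
    by (rule fD_eqI, intro has_derivative_sum has_derivative_scaleR has_derivative_inner_left has_derivative_fD[OF d(2)]
        has_derivative_compose[OF has_derivative_fD[OF d(1)] has_derivative_fD[OF dd]])
  finally have "fD (\<lambda>y. fD \<phi> (\<psi> y) (Y y)) x h = (\<Sum>i\<in>Basis. (Y x \<bullet> i) *\<^sub>R fD (\<lambda>z. fD \<phi> z i) (\<psi> x) (fD \<psi> x h) + (fD Y x h \<bullet> i) *\<^sub>R fD \<phi> (\<psi> x) i)"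
    by (rule fun_cong)
  then have 1: "fD (\<lambda>y. fD \<phi> (\<psi> y) (Y y)) x h = (\<Sum>i\<in>Basis. (Y x \<bullet> i) *\<^sub>R fD (\<lambda>z. fD \<phi> z i) (\<psi> x) (fD \<psi> x h)) +
      (\<Sum>i\<in>Basis. (fD Y x h \<bullet> i) *\<^sub>R fD \<phi> (\<psi> x) i)" by (simp only: sum.distrib)
  have "fD (\<lambda>z. fD \<phi> z (Y x)) (\<psi> x) = fD (\<lambda>z. \<Sum>i\<in>Basis. (Y x \<bullet> i) *\<^sub>R fD \<phi> z i) (\<psi> x)"
    by (rule fD_cong_open[OF U(1,3)]) (rule exp)
  also have "\<dots> = (\<lambda>k. \<Sum>i\<in>Basis. (Y x \<bullet> i) *\<^sub>R fD (\<lambda>z. fD \<phi> z i) (\<psi> x) k)"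
    by (rule fD_eqI, intro has_derivative_sum has_derivative_scaleR_right has_derivative_fD[OF dd])
  finally have 2: "fD (\<lambda>z. fD \<phi> z (Y x)) (\<psi> x) k = (\<Sum>i\<in>Basis. (Y x \<bullet> i) *\<^sub>R fD (\<lambda>z. fD \<phi> z i) (\<psi> x) k)" for k
    by (rule fun_cong)
  show ?thesis unfolding 1 2 exp[OF U(3), of "fD Y x h"] ..
qed

lemma cov_fD_app:
  fixes \<phi> :: "real ^ 'm::finite \<Rightarrow> real ^ 'n::finite" and Y :: "'a::real_normed_vector \<Rightarrow> real ^ 'm"
  assumes U: "open U" "smooth_on U \<phi>" and d: "\<psi> differentiable (at x)" "Y differentiable (at x)"
    and A: "open A" "x \<in> A" "\<And>y. y \<in> A \<Longrightarrow> \<psi> y \<in> U"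
  shows "cov G (\<lambda>y. \<phi> (\<psi> y)) (\<lambda>y. fD \<phi> (\<psi> y) (Y y)) x h =
    cov G \<phi> (\<lambda>y. fD \<phi> y (Y x)) (\<psi> x) (fD \<psi> x h) + fD \<phi> (\<psi> x) (fD Y x h)"
proof -
  have z: "\<psi> x \<in> U" using A by blast
  have "fD (\<lambda>y. fD \<phi> (\<psi> y) (Y y)) x h =
      fD (\<lambda>z. fD \<phi> z (Y x)) (\<psi> x) (fD \<psi> x h) + fD \<phi> (\<psi> x) (fD Y x h)"
    by (rule fD_fD_app[OF U z d A])
  then show ?thesis unfolding cov_def
    by (simp add: fD_compose(1)[OF d(1) smooth_on_differentiable[OF U(2) z]])
qed

text \<open>Here \<phi> is a local isometry between domains of equal dimension. Its differential is
  injective because \<open>H\<close> is definite, hence onto, so the Koszul identity of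
  \<open>chr_pullback\<close> is tested against every vector of the target and becomes an equality
  of vectors.\<close>

lemma cov_transition:
  fixes \<phi> :: "real ^ 'n::finite \<Rightarrow> real ^ 'n" and Y :: "'a::real_normed_vector \<Rightarrow> real ^ 'n"
  assumes mf: "metric_field S G" and mfH: "metric_field U H" and \<phi>: "smooth_on U \<phi>" "\<phi> ` U \<subseteq> S"
    and H: "\<And>y a b. y \<in> U \<Longrightarrow> met (H y) a b = met (G (\<phi> y)) (fD \<phi> y a) (fD \<phi> y b)"
    and d: "\<psi> differentiable (at x)" "Y differentiable (at x)"
    and A: "open A" "x \<in> A" "\<And>y. y \<in> A \<Longrightarrow> \<psi> y \<in> U"
  shows "cov G (\<lambda>y. \<phi> (\<psi> y)) (\<lambda>y. fD \<phi> (\<psi> y) (Y y)) x h = fD \<phi> (\<psi> x) (cov H \<psi> Y x h)"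
proof -
  have z: "\<psi> x \<in> U" and zS: "\<phi> (\<psi> x) \<in> S" using A \<phi>(2) by blast+
  have lin: "linear (fD \<phi> (\<psi> x))" by (rule linear_fD[OF smooth_on_differentiable[OF \<phi>(1) z]])
  have "v = 0" if "fD \<phi> (\<psi> x) v = 0" for v
  proof (rule ccontr)
    assume "v \<noteq> 0"
    from mf_pos[OF mfH z this] show False unfolding H[OF z] that by (simp add: met_zero_left)
  qed
  then have "inj (fD \<phi> (\<psi> x))" using linear_injective_0[OF lin] by blast
  then have surj: "surj (fD \<phi> (\<psi> x))" by (rule linear_inj_imp_surj[OF lin])
  have "cov G \<phi> (\<lambda>y. fD \<phi> y b) (\<psi> x) a = fD \<phi> (\<psi> x) (chr H (\<psi> x) a b)" for a b
  proof (rule met_nondegenerate[OF mf zS])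
    fix c
    obtain c' where c: "c = fD \<phi> (\<psi> x) c'" using surj by (metis surjD)
    show "met (G (\<phi> (\<psi> x))) (cov G \<phi> (\<lambda>y. fD \<phi> y b) (\<psi> x) a) c = met (G (\<phi> (\<psi> x))) (fD \<phi> (\<psi> x) (chr H (\<psi> x) a b)) c"
      unfolding c H[OF z, symmetric] by (rule chr_pullback[OF mf mfH \<phi> H z, symmetric])
  qed
  moreover have "cov G (\<lambda>y. \<phi> (\<psi> y)) (\<lambda>y. fD \<phi> (\<psi> y) (Y y)) x h =
      cov G \<phi> (\<lambda>y. fD \<phi> y (Y x)) (\<psi> x) (fD \<psi> x h) + fD \<phi> (\<psi> x) (fD Y x h)"
    by (rule cov_fD_app[OF mf_open[OF mfH] \<phi>(1) d A])
  moreover have "cov H \<psi> Y x h = fD Y x h + chr H (\<psi> x) (fD \<psi> x h) (Y x)" by (rule cov_def)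
  ultimately show ?thesis by (simp only: linear_add[OF lin] add.commute)
qed

text \<open>Gauss formula for tangent fields. The part of the ambient derivative that comes from
  differentiating \<open>w\<close> is tangent, and the rest is the case of constant coefficients in
  \<open>chr_pullback\<close>.\<close>

lemma met_cov_tangent:
  fixes \<phi> :: "real ^ 'm::finite \<Rightarrow> real ^ 'n::finite"
  assumes mf: "metric_field S G" and mfH: "metric_field U H" and \<phi>: "smooth_on U \<phi>" "\<phi> ` U \<subseteq> S"
    and H: "\<And>y a b. y \<in> U \<Longrightarrow> met (H y) a b = met (G (\<phi> y)) (fD \<phi> y a) (fD \<phi> y b)"
    and y: "y \<in> U" and w: "smooth_on U w"
  shows "met (G (\<phi> y)) (cov G \<phi> (\<lambda>y. fD \<phi> y (w y)) y a) (fD \<phi> y c) = met (H y) (cov H (\<lambda>y. y) w y a) c"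
proof -
  have U: "open U" by (rule mf_open[OF mfH])
  have d: "(\<lambda>y. y) differentiable (at y)" "w differentiable (at y)"
    by (simp, rule smooth_on_differentiable[OF w y])
  have "cov G \<phi> (\<lambda>y. fD \<phi> y (w y)) y a = cov G \<phi> (\<lambda>x. fD \<phi> x (w y)) y a + fD \<phi> y (fD w y a)"
    using cov_fD_app[OF U \<phi>(1) d U y, of G a] by (simp add: fD_linear)
  then show ?thesis
    unfolding cov_def[of H] using chr_pullback[OF mf mfH \<phi> H y, of a "w y" c]
    by (simp add: met_simps H[OF y] fD_linear)
qed

section \<open>Gaussian curvature in the presence of an anti-torqued field\<close>

lemma fD_mult:
  fixes f g :: "'a::real_normed_vector \<Rightarrow> real"
  assumes "f differentiable (at x)" "g differentiable (at x)"
  shows "fD (\<lambda>x. f x * g x) x h = f x * fD g x h + fD f x h * g x"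
  by (rule fD_bilinear(1)[OF bounded_bilinear_mult assms])

lemma met_2: "met M a b = M $ 1 $ 1 * a $ 1 * b $ 1 + M $ 1 $ 2 * a $ 1 * b $ 2 +
    M $ 2 $ 1 * a $ 2 * b $ 1 + M $ 2 $ 2 * a $ 2 * b $ 2"
  for M :: "real ^ 2 ^ 2"
  by (simp add: met_def sum_2)

lemma chr_2: "chr G x (axis i 1) b $ l = christoffel G l i 1 x * b $ 1 + christoffel G l i 2 x * b $ 2"
  for G :: "real ^ 2 \<Rightarrow> real ^ 2 ^ 2"
  using exhaust_2[of i] by (elim disjE) (simp_all add: chr_def sum_2 axis_def)

context
  fixes S :: "(real ^ 2) set" and G :: "real ^ 2 \<Rightarrow> real ^ 2 ^ 2"
  assumes mf: "metric_field S G"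
begin

lemma mf2_sym: "x \<in> S \<Longrightarrow> G x $ 2 $ 1 = G x $ 1 $ 2"
  using mf by (auto simp: metric_field_def)

lemma mf2_det: "x \<in> S \<Longrightarrow> G x $ 1 $ 1 * G x $ 2 $ 2 - (G x $ 1 $ 2)\<^sup>2 > 0"
proof -
  assume x: "x \<in> S"
  have "met (G x) (axis 2 1) (axis 2 1) > 0" by (rule mf_pos[OF mf x]) (simp add: axis_eq_0_iff)
  then have g: "G x $ 2 $ 2 > 0" by (simp add: met_axis)
  define v :: "real ^ 2" where "v = vector [G x $ 2 $ 2, - (G x $ 1 $ 2)]"
  have "v \<noteq> 0" using g by (auto simp: v_def vec_eq_iff forall_2)
  from mf_pos[OF mf x this] have "0 < G x $ 2 $ 2 * (G x $ 1 $ 1 * G x $ 2 $ 2 - (G x $ 1 $ 2)\<^sup>2)"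
    unfolding met_2 mf2_sym[OF x] by (simp add: v_def power2_eq_square algebra_simps)
  then show ?thesis using g by (simp add: zero_less_mult_iff)
qed

text \<open>Adjugate of the symmetric matrix of the metric; the explicit inverse makes it visible
  that the Christoffel symbols are smooth.\<close>

definition adj2 :: "2 \<Rightarrow> 2 \<Rightarrow> real ^ 2 \<Rightarrow> real" where
  "adj2 k l x = (if k = 1 then if l = 1 then G x $ 2 $ 2 else - (G x $ 1 $ 2)
     else if l = 1 then - (G x $ 1 $ 2) else G x $ 1 $ 1)"

lemma mf2_inverse:
  assumes x: "x \<in> S"
  shows "matrix_inv (G x) $ k $ l = adj2 k l x / (G x $ 1 $ 1 * G x $ 2 $ 2 - (G x $ 1 $ 2)\<^sup>2)"
proof -
  define d where "d = G x $ 1 $ 1 * G x $ 2 $ 2 - (G x $ 1 $ 2)\<^sup>2"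
  have d: "d \<noteq> 0" using mf2_det[OF x] by (simp add: d_def)
  define A :: "real ^ 2 ^ 2" where "A = (\<chi> k l. adj2 k l x / d)"
  have "A ** G x = mat 1"
    using d by (simp add: vec_eq_iff forall_2 matrix_matrix_mult_def sum_2 A_def adj2_def mat_def mf2_sym[OF x]
        add_divide_distrib[symmetric] diff_divide_distrib[symmetric])
      (simp add: d_def power2_eq_square algebra_simps)
  then have "matrix_inv (G x) = (A ** G x) ** matrix_inv (G x)" by simp
  also have "\<dots> = A" unfolding matrix_mul_assoc[symmetric] mf_inverse[OF mf x] by simp
  finally show ?thesis by (simp add: A_def d_def)
qed

lemma smooth_on_christoffel: "smooth_on S (christoffel G k i j)"
proof -
  note oS = mf_open[OF mf] and sG = mf_smooth[OF mf]
  define d where "d = (\<lambda>x. G x $ 1 $ 1 * G x $ 2 $ 2 - G x $ 1 $ 2 * G x $ 1 $ 2)"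
  have d: "smooth_on S d" unfolding d_def
    by (rule smooth_on_diff[OF oS smooth_on_mult[OF oS sG sG] smooth_on_mult[OF oS sG sG]])
  have d0: "d x \<noteq> 0" if "x \<in> S" for x using mf2_det[OF that] by (simp add: d_def power2_eq_square)
  have adj: "smooth_on S (adj2 k l)" for k l
    by (cases "k = 1"; cases "l = 1"; simp add: adj2_def[abs_def] sG smooth_on_minus[OF oS sG])
  have pa: "smooth_on S (partial m (\<lambda>y. G y $ i $ j))" for m i j
    unfolding partial_def by (rule smooth_on_fD[OF sG])
  have "smooth_on S (\<lambda>x. (1/2) * (\<Sum>l\<in>UNIV. (adj2 k l x / d x) *
     (partial i (\<lambda>y. G y $ j $ l) x + partial j (\<lambda>y. G y $ i $ l) x - partial l (\<lambda>y. G y $ i $ j) x)))"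
    by (rule smooth_on_mult[OF oS smooth_on_const], rule smooth_on_sum[OF oS],
        rule smooth_on_mult[OF oS smooth_on_divide[OF oS adj d d0] smooth_on_diff[OF oS smooth_on_add[OF oS pa pa] pa]])
  then show ?thesis
    by (subst (asm) smooth_on_cong[OF oS, of _ "christoffel G k i j"])
      (simp_all add: christoffel_def mf2_inverse d_def power2_eq_square)
qed

abbreviation (input) nab :: "2 \<Rightarrow> (real ^ 2 \<Rightarrow> real ^ 2) \<Rightarrow> real ^ 2 \<Rightarrow> real ^ 2" where
  "nab i Z x \<equiv> cov G (\<lambda>y. y) Z x (axis i 1)"

lemma nab_nth:
  assumes "x \<in> S" "smooth_on S Z"
  shows "nab i Z x $ l = partial i (\<lambda>y. Z y $ l) x + (christoffel G l i 1 x * Z x $ 1 + christoffel G l i 2 x * Z x $ 2)"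
  unfolding cov_def partial_def
  by (simp add: fD_linear chr_2 fD_vec_nth[OF smooth_on_differentiable[OF assms(2,1)]])

lemma smooth_on_partial: "smooth_on S h \<Longrightarrow> smooth_on S (partial i h)"
  unfolding partial_def by (rule smooth_on_fD)

lemma smooth_on_nab:
  assumes Z: "smooth_on S Z"
  shows "smooth_on S (nab i Z)"
proof (rule smooth_on_vecI)
  note oS = mf_open[OF mf]
  show "open S" by (rule oS)
  have Zl: "smooth_on S (\<lambda>y. Z y $ l)" for l by (rule smooth_on_vec_nth[OF oS Z])
  show "smooth_on S (\<lambda>x. nab i Z x $ l)" for l
    by (subst smooth_on_cong[OF oS nab_nth[OF _ Z]], assumption)
      (rule smooth_on_add[OF oS smooth_on_partial[OF Zl]
        smooth_on_add[OF oS smooth_on_mult[OF oS smooth_on_christoffel Zl] smooth_on_mult[OF oS smooth_on_christoffel Zl]]])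
qed

lemma nab_nab_nth:
  assumes x: "x \<in> S" and Z: "smooth_on S Z"
  shows "nab i (nab j Z) x $ l = partial i (partial j (\<lambda>y. Z y $ l)) x
    + (christoffel G l j 1 x * partial i (\<lambda>y. Z y $ 1) x + partial i (christoffel G l j 1) x * Z x $ 1)
    + (christoffel G l j 2 x * partial i (\<lambda>y. Z y $ 2) x + partial i (christoffel G l j 2) x * Z x $ 2)
    + christoffel G l i 1 x * (partial j (\<lambda>y. Z y $ 1) x + christoffel G 1 j 1 x * Z x $ 1 + christoffel G 1 j 2 x * Z x $ 2)
    + christoffel G l i 2 x * (partial j (\<lambda>y. Z y $ 2) x + christoffel G 2 j 1 x * Z x $ 1 + christoffel G 2 j 2 x * Z x $ 2)"
proof -
  note oS = mf_open[OF mf]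
  have Zl: "smooth_on S (\<lambda>y. Z y $ l)" for l by (rule smooth_on_vec_nth[OF oS Z])
  have dZ: "(\<lambda>y. Z y $ l) differentiable (at x)" "partial j (\<lambda>y. Z y $ l) differentiable (at x)" for l
    by (rule smooth_on_differentiable[OF Zl x], rule smooth_on_differentiable[OF smooth_on_partial[OF Zl] x])
  have dG: "christoffel G l j k differentiable (at x)" for l k
    by (rule smooth_on_differentiable[OF smooth_on_christoffel x])
  have dm: "(\<lambda>y. christoffel G l j k y * Z y $ k) differentiable (at x)" for l k
    by (rule fD_bilinear(2)[OF bounded_bilinear_mult dG dZ(1)])
  have "fD (\<lambda>y. nab j Z y $ l) x = fD (\<lambda>y. partial j (\<lambda>y. Z y $ l) y +
      (christoffel G l j 1 y * Z y $ 1 + christoffel G l j 2 y * Z y $ 2)) x"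
    by (rule fD_cong_open[OF oS x]) (rule nab_nth[OF _ Z])
  then have "partial i (\<lambda>y. nab j Z y $ l) x = partial i (partial j (\<lambda>y. Z y $ l)) x
    + ((christoffel G l j 1 x * partial i (\<lambda>y. Z y $ 1) x + partial i (christoffel G l j 1) x * Z x $ 1)
    + (christoffel G l j 2 x * partial i (\<lambda>y. Z y $ 2) x + partial i (christoffel G l j 2) x * Z x $ 2))"
    unfolding partial_def[of i]
    by (simp only: fD_add[OF dZ(2) differentiable_add[OF dm dm]] fD_add[OF dm dm] fD_mult[OF dG dZ(1)])
  then show ?thesis
    unfolding nab_nth[OF x smooth_on_nab[OF Z]] nab_nth[OF x Z] by (simp add: add.assoc)
qed

definition Rop :: "real ^ 2 \<Rightarrow> real ^ 2 \<Rightarrow> real ^ 2" where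
  "Rop x z = (\<chi> l. \<Sum>k\<in>UNIV. curvature_tensor G l 1 2 k x * z $ k)"

lemma linear_Rop: "linear (Rop x)"
  by (rule linearI) (simp_all add: Rop_def vec_eq_iff sum_2 algebra_simps)

text \<open>Coordinate fields commute, so no bracket term appears. Second partial derivatives cancel
  by symmetry, terms with first derivatives of \<open>Z\<close> cancel in pairs, and what remains is
  the definition of the curvature tensor.\<close>

lemma ricci_identity:
  assumes x: "x \<in> S" and Z: "smooth_on S Z"
  shows "nab 1 (nab 2 Z) x - nab 2 (nab 1 Z) x = Rop x (Z x)"
proof (rule vec_eq_iff[THEN iffD2], rule allI)
  fix l
  note oS = mf_open[OF mf]
  have "partial 1 (partial 2 (\<lambda>y. Z y $ l)) x = partial 2 (partial 1 (\<lambda>y. Z y $ l)) x"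
    unfolding partial_def
    by (rule fD_fD_commute_real[OF oS x smooth_on_imp_Ck[OF smooth_on_vec_nth[OF oS Z]]])
  then show "(nab 1 (nab 2 Z) x - nab 2 (nab 1 Z) x) $ l = Rop x (Z x) $ l"
    unfolding vector_minus_component nab_nab_nth[OF x Z]
    by (simp add: Rop_def curvature_tensor_def sum_2 algebra_simps)
qed

lemma fD_met_nab:
  assumes x: "x \<in> S" and Y: "smooth_on S Y" and Z: "smooth_on S Z"
  shows "fD (\<lambda>y. met (G y) (Y y) (Z y)) x (axis i 1) = met (G x) (nab i Y x) (Z x) + met (G x) (Y x) (nab i Z x)"
  by (rule cov_compat[OF mf, where \<phi>="\<lambda>y. y"])
    (auto simp: x smooth_on_differentiable[OF Y x] smooth_on_differentiable[OF Z x])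

text \<open>Second derivatives of the function \<open>met (G y) a b\<close> commute. When both
  orders are expanded by compatibility, the terms with one derivative on each factor are symmetric
  in the two directions and drop out; the rest is the Ricci identity for the constant fields
  \<open>a\<close> and \<open>b\<close>.\<close>

lemma Rop_skew:
  assumes x: "x \<in> S"
  shows "met (G x) (Rop x a) b = - met (G x) (Rop x b) a"
proof -
  note oS = mf_open[OF mf]
  let ?a = "\<lambda>y::real ^ 2. a" and ?b = "\<lambda>y::real ^ 2. b"
  have c: "smooth_on S ?a" "smooth_on S ?b" by simp_all
  note N = smooth_on_nab[OF c(1)] smooth_on_nab[OF c(2)]
  have sm: "smooth_on S (\<lambda>y. met (G y) (Y y) (Z y))" if "smooth_on S Y" "smooth_on S Z" for Y Z
    by (rule smooth_on_met[OF mf oS smooth_on_id _ that]) simp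
  have dm: "(\<lambda>y. met (G y) (Y y) (Z y)) differentiable (at x)" if "smooth_on S Y" "smooth_on S Z" for Y Z
    by (rule smooth_on_differentiable[OF sm[OF that] x])
  have *: "fD (\<lambda>y. fD (\<lambda>y. met (G y) a b) y (axis j 1)) x (axis i 1) =
    met (G x) (nab i (nab j ?a) x) b + met (G x) (nab j ?a x) (nab i ?b x) +
    (met (G x) (nab i ?a x) (nab j ?b x) + met (G x) a (nab i (nab j ?b) x))" for i j
  proof -
    have "fD (\<lambda>y. fD (\<lambda>y. met (G y) a b) y (axis j 1)) x =
        fD (\<lambda>y. met (G y) (nab j ?a y) b + met (G y) a (nab j ?b y)) x"
      by (rule fD_cong_open[OF oS x]) (rule fD_met_nab[OF _ c])
    then show ?thesis
      by (simp only: fD_add[OF dm[OF N(1) c(2)] dm[OF c(1) N(2)]] fD_met_nab[OF x N(1) c(2)] fD_met_nab[OF x c(1) N(2)])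
  qed
  have "fD (\<lambda>y. fD (\<lambda>y. met (G y) a b) y (axis 2 1)) x (axis 1 1) = fD (\<lambda>y. fD (\<lambda>y. met (G y) a b) y (axis 1 1)) x (axis 2 1)"
    by (rule fD_fD_commute_real[OF oS x smooth_on_imp_Ck[OF sm[OF c]]])
  then have "met (G x) (nab 1 (nab 2 ?a) x - nab 2 (nab 1 ?a) x) b + met (G x) a (nab 1 (nab 2 ?b) x - nab 2 (nab 1 ?b) x) = 0"
    unfolding * by (simp add: met_simps)
  then show ?thesis
    unfolding ricci_identity[OF x c(1)] ricci_identity[OF x c(2)] using met_sym[OF mf x] by simp
qed

text \<open>In dimension two the skew operator \<open>R(\<partial>\<^sub>1, \<partial>\<^sub>2)\<close> is determined by its value on the unit field \<open>w\<close>,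
  which the Ricci identity expresses through \<open>f\<close> and \<open>df\<close>.\<close>

lemma curvature_anti_torqued:
  assumes w: "smooth_on S w" and f: "smooth_on S f"
    and unit: "\<And>x. x \<in> S \<Longrightarrow> met (G x) (w x) (w x) = 1"
    and nabw: "\<And>x a. x \<in> S \<Longrightarrow> cov G (\<lambda>y. y) w x a = f x *\<^sub>R (a - met (G x) a (w x) *\<^sub>R w x)"
    and x: "x \<in> S"
  shows "(\<Sum>l\<in>UNIV. curvature_tensor G l 1 2 2 x * G x $ l $ 1) /
     (G x $ 1 $ 1 * G x $ 2 $ 2 - (G x $ 1 $ 2)\<^sup>2) = - (fD f x (w x) + (f x)\<^sup>2)"
proof -
  note oS = mf_open[OF mf]
  let ?e = "\<lambda>i::2. axis i 1 :: real ^ 2"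
  define W where "W = (\<lambda>i y. met (G y) (?e i) (w y))"
  have sW: "smooth_on S (W i)" for i unfolding W_def
    by (rule smooth_on_met[OF mf oS smooth_on_id _ smooth_on_const w]) simp
  have dW: "W i differentiable (at x)" for i by (rule smooth_on_differentiable[OF sW x])
  have dw: "w differentiable (at x)" and df: "f differentiable (at x)"
    by (rule smooth_on_differentiable[OF w x], rule smooth_on_differentiable[OF f x])
  \<comment> \<open>Derivative of the 1-form dual to \<open>w\<close>, whose components are
    \<open>W 1\<close> and \<open>W 2\<close>.\<close>
  have fW: "fD (W j) x (?e i) = met (G x) (chr G x (?e i) (?e j)) (w x) + f x * (G x $ j $ i - W j x * W i x)" for i j
  proof -
    have "fD (W j) x (?e i) = met (G x) (nab i (\<lambda>y. ?e j) x) (w x) + met (G x) (?e j) (nab i w x)"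
      unfolding W_def by (rule fD_met_nab[OF x smooth_on_const w])
    moreover have "nab i (\<lambda>y. ?e j) x = chr G x (?e i) (?e j)" by (simp add: cov_def fD_linear)
    ultimately show ?thesis unfolding nabw[OF x] by (simp add: met_simps met_axis W_def)
  qed
  have nn: "nab i (nab j w) x = fD f x (?e i) *\<^sub>R (?e j - W j x *\<^sub>R w x) +
      f x *\<^sub>R (chr G x (?e i) (?e j) - W j x *\<^sub>R (f x *\<^sub>R (?e i - W i x *\<^sub>R w x)) - fD (W j) x (?e i) *\<^sub>R w x)" for i j
  proof -
    have d1: "(\<lambda>y. W j y *\<^sub>R w y) differentiable (at x)"
      by (rule fD_bilinear(2)[OF bounded_bilinear_scaleR dW dw])
    have d2: "(\<lambda>y. ?e j - W j y *\<^sub>R w y) differentiable (at x)" by (intro differentiable_diff d1) simp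
    have "fD (nab j w) x = fD (\<lambda>y. f y *\<^sub>R (?e j - W j y *\<^sub>R w y)) x"
      by (rule fD_cong_open[OF oS x]) (simp add: nabw W_def)
    then have A: "fD (nab j w) x (?e i) = f x *\<^sub>R (- (W j x *\<^sub>R fD w x (?e i) + fD (W j) x (?e i) *\<^sub>R w x)) +
        fD f x (?e i) *\<^sub>R (?e j - W j x *\<^sub>R w x)"
      by (simp add: fD_bilinear(1)[OF bounded_bilinear_scaleR df d2] fD_diff[OF _ d1] fD_bilinear(1)[OF bounded_bilinear_scaleR dW dw])
    have B: "nab j w x = f x *\<^sub>R (?e j - W j x *\<^sub>R w x)" by (simp add: nabw[OF x] W_def)
    have C: "chr G x (?e i) (w x) = f x *\<^sub>R (?e i - W i x *\<^sub>R w x) - fD w x (?e i)"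
      using nabw[OF x, of "?e i"] by (simp add: cov_def fD_linear W_def algebra_simps)
    have "nab i (nab j w) x = fD (nab j w) x (?e i) + chr G x (?e i) (nab j w x)"
      by (simp add: cov_def[of G "\<lambda>y. y" "nab j w"] fD_linear)
    also have "chr G x (?e i) (nab j w x) = f x *\<^sub>R (chr G x (?e i) (?e j) - W j x *\<^sub>R chr G x (?e i) (w x))"
      unfolding B by (simp only: linear_scale[OF linear_chr_right] linear_diff[OF linear_chr_right])
    finally show ?thesis unfolding A C by (simp add: algebra_simps)
  qed
  define r where "r = (\<lambda>a b. met (G x) (Rop x a) b)"
  have skew: "r a b = - r b a" for a b unfolding r_def by (rule Rop_skew[OF x])
  have sym: "G x $ 2 $ 1 = G x $ 1 $ 2" by (rule mf2_sym[OF x])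
  \<comment> \<open>In the commutator the terms of \<open>nn\<close> that are symmetric in the two
    directions cancel: the Christoffel terms, the derivatives \<open>fW\<close>, and the products of
    \<open>W 1\<close> and \<open>W 2\<close>.\<close>
  have Rw: "Rop x (w x) = fD f x (?e 1) *\<^sub>R (?e 2 - W 2 x *\<^sub>R w x) - fD f x (?e 2) *\<^sub>R (?e 1 - W 1 x *\<^sub>R w x)
      + (f x)\<^sup>2 *\<^sub>R (W 1 x *\<^sub>R ?e 2 - W 2 x *\<^sub>R ?e 1)"
    unfolding ricci_identity[OF x w, symmetric] nn fW chr_sym[OF mf x, of "?e 2" "?e 1"]
    by (simp add: sym vec_eq_iff power2_eq_square algebra_simps)
  define a b where "a = w x $ 1" and "b = w x $ 2"
  define E F H where "E = G x $ 1 $ 1" and "F = G x $ 1 $ 2" and "H = G x $ 2 $ 2"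
  define p q where "p = fD f x (?e 1)" and "q = fD f x (?e 2)"
  have we: "w x = a *\<^sub>R ?e 1 + b *\<^sub>R ?e 2" by (simp add: a_def b_def vec_eq_iff forall_2 axis_def)
  have W1: "W 1 x = E * a + F * b" and W2: "W 2 x = F * a + H * b"
    by (simp_all add: W_def met_2 axis_def sym a_def b_def E_def F_def H_def)
  have un: "(E * a + F * b) * a + (F * a + H * b) * b = 1"
    using unit[OF x] by (simp add: met_2 sym a_def b_def E_def F_def H_def algebra_simps)
  have r1: "r (w x) (?e 1) = p * (F - W 2 x * W 1 x) - q * (E - W 1 x * W 1 x) + (f x)\<^sup>2 * (W 1 x * F - W 2 x * E)"
    unfolding r_def Rw using met_sym[OF mf x, of "w x"]
    by (simp add: met_simps met_axis sym p_def q_def E_def F_def W_def)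
  have r2: "r (w x) (?e 2) = p * (H - W 2 x * W 2 x) - q * (F - W 1 x * W 2 x) + (f x)\<^sup>2 * (W 1 x * H - W 2 x * F)"
    unfolding r_def Rw using met_sym[OF mf x, of "w x"]
    by (simp add: met_simps met_axis sym p_def q_def H_def F_def W_def)
  \<comment> \<open>Skewness leaves one unknown, \<open>r (?e 2) (?e 1)\<close>. Pairing
    \<open>Rop x (w x)\<close> with the two basis vectors gives it the factors \<open>b\<close> and
    \<open>- a\<close>.\<close>
  have r0: "r c c = 0" for c using skew[of c c] by simp
  have rw1: "r (w x) (?e 1) = b * r (?e 2) (?e 1)"
    using r0[of "?e 1"] unfolding we unfolding r_def
    by (simp add: linear_add[OF linear_Rop] linear_scale[OF linear_Rop] met_simps)
  have rw2: "r (w x) (?e 2) = - a * r (?e 2) (?e 1)"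
    using r0[of "?e 2"] skew[of "?e 1" "?e 2"] unfolding we unfolding r_def
    by (simp add: linear_add[OF linear_Rop] linear_scale[OF linear_Rop] met_simps)
  define D where "D = E * H - F\<^sup>2"
  \<comment> \<open>Because \<open>w\<close> has length 1, the left sides of \<open>i1\<close>,
    \<open>i2\<close>, \<open>i3\<close> are Gram determinants of basis vectors against
    \<open>w\<close>, hence \<open>D\<close> times products of coordinates of
    \<open>w\<close>.\<close>
  have i1: "E - (E * a + F * b) * (E * a + F * b) = D * b * b"
    using un unfolding D_def by algebra
  have i2: "F - (F * a + H * b) * (E * a + F * b) = - D * a * b"
    using un unfolding D_def by algebra
  have i3: "H - (F * a + H * b) * (F * a + H * b) = D * a * a"
    using un unfolding D_def by algebra
  have i4: "(E * a + F * b) * F - (F * a + H * b) * E = - D * b" "(E * a + F * b) * H - (F * a + H * b) * F = D * a"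
    unfolding D_def by algebra+
  have k1: "b * r (?e 2) (?e 1) = - b * (D * (a * p + b * q + (f x)\<^sup>2))"
    using r1 unfolding rw1 W1 W2 i1 i2 i4 by (simp add: algebra_simps)
  have k2: "- a * r (?e 2) (?e 1) = a * (D * (a * p + b * q + (f x)\<^sup>2))"
  proof -
    have e: "F - (E * a + F * b) * (F * a + H * b) = - D * a * b" using i2 by (simp add: mult.commute)
    show ?thesis using r2 unfolding rw2 W1 W2 i3 i4 e by (simp add: algebra_simps)
  qed
  \<comment> \<open>\<open>a\<close> and \<open>b\<close> are not both zero, as \<open>w\<close> is
    a unit vector, so one of \<open>k1\<close> and \<open>k2\<close> can be divided by its
    factor.\<close>
  have k: "r (?e 2) (?e 1) = - (D * (a * p + b * q + (f x)\<^sup>2))"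
  proof (cases "b = 0")
    case True
    then have "a \<noteq> 0" using un by auto
    then show ?thesis using k2 by (metis minus_mult_commute mult_cancel_left neg_equal_iff_equal minus_minus)
  next
    case False
    then show ?thesis using k1 by (metis minus_mult_commute mult_cancel_left)
  qed
  have "(\<Sum>l\<in>UNIV. curvature_tensor G l 1 2 2 x * G x $ l $ 1) = r (?e 2) (?e 1)"
    unfolding r_def Rop_def met_2 by (simp add: sum_2 axis_def)
  moreover have "fD f x (w x) = a * p + b * q"
    using linear_real2[OF linear_fD[OF df], of "w x"] by (simp add: a_def b_def p_def q_def)
  moreover have "D > 0" using mf2_det[OF x] by (simp add: D_def E_def F_def H_def)
  ultimately show ?thesis using k by (simp add: D_def[symmetric] E_def[symmetric] F_def[symmetric] H_def[symmetric])
qed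

end

text \<open>With the field as first coordinate field, the condition gives \<nabla>_1 \<partial>_1 =
  0 and, by symmetry of the connection, \<nabla>_1 \<partial>_2 = f (\<partial>_2 - G_12
  \<partial>_1); metric compatibility turns these into the two derivatives.\<close>

lemma metric_in_flow_box:
  fixes f :: "real ^ 2 \<Rightarrow> real"
  assumes mf: "metric_field S G" and x: "x \<in> S" and unit: "\<And>x. x \<in> S \<Longrightarrow> G x $ 1 $ 1 = 1"
    and nabw: "\<And>a. cov G (\<lambda>y. y) (\<lambda>y. axis 1 1) x a = f x *\<^sub>R (a - met (G x) a (axis 1 1) *\<^sub>R axis 1 1)"
  shows "fD (\<lambda>y. G y $ 1 $ 2) x (axis 1 1) = 0"
    and "fD (\<lambda>y. G y $ 2 $ 2) x (axis 1 1) = 2 * f x * (G x $ 2 $ 2 - (G x $ 1 $ 2)\<^sup>2)"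
proof -
  have c: "chr G x a (axis 1 1) = f x *\<^sub>R (a - met (G x) a (axis 1 1) *\<^sub>R axis 1 1)" for a
    using nabw[of a] by (simp add: cov_def fD_linear)
  have c1: "chr G x (axis 1 1) (axis 1 1) = 0" using unit[OF x] by (simp add: c met_axis)
  have c2: "chr G x (axis 1 1) (axis 2 1) = f x *\<^sub>R (axis 2 1 - (G x $ 1 $ 2) *\<^sub>R axis 1 1)"
    using chr_sym[OF mf x, of "axis 1 1" "axis 2 1"] mf2_sym[OF mf x] by (simp add: c met_axis)
  have "fD (\<lambda>y. met (G y) (axis 1 1) (axis 2 1)) x (axis 1 1) = 0"
    unfolding chr_compat[OF mf x] c1 c2 using unit[OF x] by (simp add: met_simps met_axis)
  then show "fD (\<lambda>y. G y $ 1 $ 2) x (axis 1 1) = 0" by (simp add: met_axis)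
  have "fD (\<lambda>y. met (G y) (axis 2 1) (axis 2 1)) x (axis 1 1) = 2 * f x * (G x $ 2 $ 2 - (G x $ 1 $ 2)\<^sup>2)"
    unfolding chr_compat[OF mf x] c2 using mf2_sym[OF mf x]
    by (simp add: met_simps met_axis power2_eq_square algebra_simps)
  then show "fD (\<lambda>y. G y $ 2 $ 2) x (axis 1 1) = 2 * f x * (G x $ 2 $ 2 - (G x $ 1 $ 2)\<^sup>2)" by (simp add: met_axis)
qed

section \<open>Charts and tangent vectors\<close>

lemma chart_facts:
  assumes "is_chart c"
  shows chart_open: "open (chart_dom c)" and img_open: "open (chart_img c)"
    and inv_map: "p \<in> chart_dom c \<Longrightarrow> chart_inv c (chart_map c p) = p"
    and map_inv: "x \<in> chart_img c \<Longrightarrow> chart_map c (chart_inv c x) = x"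
    and inv_dom: "x \<in> chart_img c \<Longrightarrow> chart_inv c x \<in> chart_dom c"
    and map_img: "p \<in> chart_dom c \<Longrightarrow> chart_map c p \<in> chart_img c"
    and cont_map: "continuous_on (chart_dom c) (chart_map c)"
    and cont_inv: "continuous_on (chart_img c) (chart_inv c)"
  using assms by (auto simp: is_chart_def homeomorphism_def)

lemma in_chart_image:
  assumes "is_chart c"
  shows "x \<in> chart_map c ` (chart_dom c \<inter> W) \<longleftrightarrow> x \<in> chart_img c \<and> chart_inv c x \<in> W"
proof
  assume "x \<in> chart_map c ` (chart_dom c \<inter> W)"
  then show "x \<in> chart_img c \<and> chart_inv c x \<in> W"
    using inv_map[OF assms] by (auto simp: chart_img_def)
next
  assume "x \<in> chart_img c \<and> chart_inv c x \<in> W"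
  then show "x \<in> chart_map c ` (chart_dom c \<inter> W)"
    using map_inv[OF assms] inv_dom[OF assms] by (intro image_eqI[of _ _ "chart_inv c x"]) auto
qed

lemma open_chart_image:
  assumes "is_chart c" "open W"
  shows "open (chart_map c ` (chart_dom c \<inter> W))"
proof -
  have "chart_map c ` (chart_dom c \<inter> W) = chart_img c \<inter> chart_inv c -` W"
    using in_chart_image[OF assms(1)] by blast
  then show ?thesis
    using continuous_open_preimage[OF cont_inv[OF assms(1)] img_open[OF assms(1)] assms(2)] by simp
qed

text \<open>The tangent vector with components \<open>a\<close> in \<open>c\<close>, where
  \<open>c\<close> may be any member of the maximal atlas and need not lie in
  \<open>A\<close>.\<close>

definition tv :: "('a, 'n::finite) chart set \<Rightarrow> ('a, 'n) chart \<Rightarrow> 'a \<Rightarrow> real ^ 'n \<Rightarrow> ('a, 'n) tvec" where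
  "tv A c p a = (\<lambda>d. if d \<in> A \<and> p \<in> chart_dom d then fD (transition c d) (chart_map c p) a else 0)"

lemma tv_apply: "d \<in> A \<Longrightarrow> p \<in> chart_dom d \<Longrightarrow> tv A c p a d = fD (transition c d) (chart_map c p) a"
  by (simp add: tv_def)

lemma tv_off: "\<not> (d \<in> A \<and> p \<in> chart_dom d) \<Longrightarrow> tv A c p a d = 0"
  unfolding tv_def by (rule if_not_P)

lemma coord_vec_tv: "coord_vec A c i p = tv A c p (axis i 1)"
  by (simp add: coord_vec_def tv_def)

context
  fixes A :: "('a::topological_space, 'n::finite) chart set"
  assumes at: "smooth_atlas A"
begin

lemma atlas_chart: "c \<in> A \<Longrightarrow> is_chart c" and atlas_cs: "c \<in> A \<Longrightarrow> coordinate_system A c"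
  and atlas_cover: "\<exists>c\<in>A. p \<in> chart_dom c"
proof -
  show "c \<in> A \<Longrightarrow> is_chart c" "c \<in> A \<Longrightarrow> coordinate_system A c"
    using at by (auto simp: smooth_atlas_def coordinate_system_def)
  have "p \<in> (\<Union>c\<in>A. chart_dom c)" using at by (simp add: smooth_atlas_def)
  then show "\<exists>c\<in>A. p \<in> chart_dom c" by blast
qed

lemma chart_at: "chart_at A p \<in> A" "p \<in> chart_dom (chart_at A p)"
proof -
  have "chart_at A p \<in> A \<and> p \<in> chart_dom (chart_at A p)"
    unfolding chart_at_def by (rule someI_ex) (use atlas_cover[of p] in blast)
  then show "chart_at A p \<in> A" "p \<in> chart_dom (chart_at A p)" by auto
qed

lemma cs_chart: "coordinate_system A c \<Longrightarrow> is_chart c"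
  by (simp add: coordinate_system_def)

lemma transition_map: "is_chart c \<Longrightarrow> p \<in> chart_dom c \<Longrightarrow> transition c d (chart_map c p) = chart_map d p"
  by (simp add: transition_def inv_map)

text \<open>Compatibility is postulated against the charts of \<open>A\<close>; near each point the
  transition factors through one of them.\<close>

lemma smooth_transition:
  assumes c: "coordinate_system A c" and e: "coordinate_system A e"
  shows "smooth_on (chart_map c ` (chart_dom c \<inter> chart_dom e)) (transition c e)"
proof (rule smooth_on_open_cover)
  fix x assume "x \<in> chart_map c ` (chart_dom c \<inter> chart_dom e)"
  then have x: "x \<in> chart_img c" "chart_inv c x \<in> chart_dom e" using in_chart_image[OF cs_chart[OF c]] by auto
  obtain d where d: "d \<in> A" "chart_inv c x \<in> chart_dom d" using atlas_cover by blast
  have cc: "is_chart c" "is_chart e" "is_chart d" using cs_chart c e atlas_chart d by auto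
  let ?U = "chart_map c ` (chart_dom c \<inter> (chart_dom e \<inter> chart_dom d))"
  have U: "open ?U" by (intro open_chart_image cc open_Int chart_open)
  have xU: "x \<in> ?U" using in_chart_image[OF cc(1)] x d by auto
  have s1: "smooth_on (chart_map c ` (chart_dom c \<inter> chart_dom d)) (transition c d)"
    using c d by (simp add: coordinate_system_def smooth_compatible_def)
  have s2: "smooth_on (chart_map d ` (chart_dom e \<inter> chart_dom d)) (transition d e)"
    using e d by (simp add: coordinate_system_def smooth_compatible_def)
  have oD: "open (chart_map d ` (chart_dom e \<inter> chart_dom d))"
    using open_chart_image[OF cc(3) chart_open[OF cc(2)]] by (simp add: Int_commute)
  have sm: "smooth_on ?U (\<lambda>y. transition d e (transition c d y))"
  proof (rule smooth_on_compose[OF s2 smooth_on_subset[OF s1] U oD])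
    show "transition c d ` ?U \<subseteq> chart_map d ` (chart_dom e \<inter> chart_dom d)"
    proof (rule image_subsetI)
      fix y assume "y \<in> ?U"
      then obtain q where q: "y = chart_map c q" "q \<in> chart_dom c" "q \<in> chart_dom e \<inter> chart_dom d" by blast
      show "transition c d y \<in> chart_map d ` (chart_dom e \<inter> chart_dom d)"
        unfolding q(1) transition_map[OF cc(1) q(2)] by (rule imageI[OF q(3)])
    qed
  qed auto
  have "transition d e (transition c d y) = transition c e y" if y: "y \<in> ?U" for y
  proof -
    obtain q where q: "y = chart_map c q" "q \<in> chart_dom c" "q \<in> chart_dom d" using y by blast
    show ?thesis unfolding q(1) transition_map[OF cc(1) q(2)] transition_map[OF cc(3) q(3)] ..
  qed
  then have "smooth_on ?U (transition c e)" by (rule smooth_on_eq[OF sm U])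
  then show "\<exists>U. open U \<and> x \<in> U \<and> smooth_on U (transition c e)" using U xU by blast
qed

lemma transition_diff:
  assumes "coordinate_system A c" "coordinate_system A e" "p \<in> chart_dom c" "p \<in> chart_dom e"
  shows "transition c e differentiable (at (chart_map c p))"
  by (rule smooth_on_differentiable[OF smooth_transition[OF assms(1,2)]]) (use assms(3,4) in auto)

text \<open>Chain rule for transitions. This cocycle rule makes \<open>tv\<close> satisfy the
  compatibility required in \<open>tangent_space\<close>.\<close>

lemma fD_transition_trans:
  assumes c: "coordinate_system A c" and d: "coordinate_system A d" and e: "coordinate_system A e"
    and p: "p \<in> chart_dom c" "p \<in> chart_dom d" "p \<in> chart_dom e"
  shows "fD (transition c e) (chart_map c p) v = fD (transition d e) (chart_map d p) (fD (transition c d) (chart_map c p) v)"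
proof -
  have cc: "is_chart c" "is_chart d" "is_chart e" using cs_chart c d e by auto
  let ?U = "chart_map c ` (chart_dom c \<inter> (chart_dom e \<inter> chart_dom d))"
  have U: "open ?U" by (intro open_chart_image cc open_Int chart_open)
  have xU: "chart_map c p \<in> ?U" using p by auto
  have "transition c e y = transition d e (transition c d y)" if y: "y \<in> ?U" for y
  proof -
    obtain q where q: "y = chart_map c q" "q \<in> chart_dom c" "q \<in> chart_dom d" using y by blast
    show ?thesis unfolding q(1) transition_map[OF cc(1) q(2)] transition_map[OF cc(2) q(3)] ..
  qed
  then have 1: "fD (transition c e) (chart_map c p) = fD (\<lambda>y. transition d e (transition c d y)) (chart_map c p)"
    by (rule fD_cong_open[OF U xU])
  have "transition d e differentiable (at (transition c d (chart_map c p)))"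
    unfolding transition_map[OF cc(1) p(1)] by (rule transition_diff[OF d e p(2,3)])
  from fD_compose(1)[OF transition_diff[OF c d p(1,2)] this] show ?thesis
    unfolding 1 transition_map[OF cc(1) p(1)] .
qed

lemma fD_transition_refl:
  assumes c: "coordinate_system A c" and p: "p \<in> chart_dom c"
  shows "fD (transition c c) (chart_map c p) v = v"
proof -
  have "fD (transition c c) (chart_map c p) = fD (\<lambda>y. y) (chart_map c p)"
    by (rule fD_cong_open[OF img_open[OF cs_chart[OF c]] map_img[OF cs_chart[OF c] p]])
      (simp add: transition_def map_inv[OF cs_chart[OF c]])
  then show ?thesis by (simp add: fD_linear)
qed

lemma tv_in_tangent_space:
  assumes c: "coordinate_system A c" and p: "p \<in> chart_dom c"
  shows "tv A c p a \<in> tangent_space A p"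
  unfolding tangent_space_def
proof (intro CollectI conjI allI ballI impI)
  fix d assume "\<not> (d \<in> A \<and> p \<in> chart_dom d)"
  then show "tv A c p a d = 0" by (rule tv_off)
next
  fix d e assume d: "d \<in> A" "e \<in> A" "p \<in> chart_dom d" "p \<in> chart_dom e"
  show "tv A c p a e = fD (transition d e) (chart_map d p) (tv A c p a d)"
    unfolding tv_apply[OF d(1,3)] tv_apply[OF d(2,4)]
    by (rule fD_transition_trans[OF c atlas_cs[OF d(1)] atlas_cs[OF d(2)] p d(3,4)])
qed

text \<open>All other components follow from one by the Jacobians of the transitions, and at charts
  away from \<open>p\<close> they are zero by convention.\<close>

lemma tv_eqI:
  assumes X: "X \<in> tangent_space A p" "Y \<in> tangent_space A p" and c: "c \<in> A" "p \<in> chart_dom c" and e: "X c = Y c"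
  shows "X = Y"
proof
  fix d
  show "X d = Y d"
  proof (cases "d \<in> A \<and> p \<in> chart_dom d")
    case True
    have "Z d = fD (transition c d) (chart_map c p) (Z c)" if "Z \<in> tangent_space A p" for Z
      using that c True unfolding tangent_space_def by blast
    from this[OF X(1)] this[OF X(2)] show ?thesis using e by simp
  next
    case False
    have "Z d = 0" if "Z \<in> tangent_space A p" for Z
      using that False unfolding tangent_space_def by blast
    from this[OF X(1)] this[OF X(2)] show ?thesis by simp
  qed
qed

lemma tv_self: "c \<in> A \<Longrightarrow> p \<in> chart_dom c \<Longrightarrow> tv A c p a c = a"
  by (simp only: tv_apply fD_transition_refl[OF atlas_cs])

lemma tangent_tv:
  assumes "X \<in> tangent_space A p" "c \<in> A" "p \<in> chart_dom c"
  shows "X = tv A c p (X c)"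
  by (rule tv_eqI[OF assms(1) tv_in_tangent_space[OF atlas_cs[OF assms(2)] assms(3)] assms(2,3)])
    (simp add: tv_self assms)

lemma tv_change:
  assumes c: "coordinate_system A c" and d: "coordinate_system A d" and p: "p \<in> chart_dom c" "p \<in> chart_dom d"
  shows "tv A c p a = tv A d p (fD (transition c d) (chart_map c p) a)"
proof
  fix e
  show "tv A c p a e = tv A d p (fD (transition c d) (chart_map c p) a) e"
  proof (cases "e \<in> A \<and> p \<in> chart_dom e")
    case True
    then have e: "e \<in> A" "p \<in> chart_dom e" by auto
    show ?thesis unfolding tv_apply[OF e] by (rule fD_transition_trans[OF c d atlas_cs[OF e(1)] p e(2)])
  next
    case False
    show ?thesis unfolding tv_off[OF False] ..
  qed
qed

lemma tv_inject:
  assumes c: "coordinate_system A c" and p: "p \<in> chart_dom c" and e: "tv A c p a = tv A c p b"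
  shows "a = b"
proof -
  obtain d where d: "d \<in> A" "p \<in> chart_dom d" using atlas_cover by blast
  have e': "fD (transition c d) (chart_map c p) a = fD (transition c d) (chart_map c p) b"
    using fun_cong[OF e, of d] unfolding tv_apply[OF d] .
  have r: "v = fD (transition d c) (chart_map d p) (fD (transition c d) (chart_map c p) v)" for v
    using fD_transition_trans[OF c atlas_cs[OF d(1)] c p d(2) p, of v] fD_transition_refl[OF c p, of v]
    by (rule trans[OF sym, rotated])
  show ?thesis using r[of a] r[of b] unfolding e' by (rule trans[OF _ sym])
qed

lemma tangent_tv_cs:
  assumes X: "X \<in> tangent_space A p" and c: "coordinate_system A c" "p \<in> chart_dom c"
  obtains a where "X = tv A c p a"
proof -
  obtain d where d: "d \<in> A" "p \<in> chart_dom d" using atlas_cover by blast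
  have "X = tv A d p (X d)" by (rule tangent_tv[OF X d])
  also have "\<dots> = tv A c p (fD (transition d c) (chart_map d p) (X d))"
    by (rule tv_change[OF atlas_cs[OF d(1)] c(1) d(2) c(2)])
  finally show ?thesis by (rule that)
qed

lemma tv_linear:
  assumes c: "coordinate_system A c" and p: "p \<in> chart_dom c"
  shows "tv A c p (r *\<^sub>R a + s *\<^sub>R b) = (\<lambda>d. r *\<^sub>R tv A c p a d + s *\<^sub>R tv A c p b d)"
proof
  fix d
  show "tv A c p (r *\<^sub>R a + s *\<^sub>R b) d = r *\<^sub>R tv A c p a d + s *\<^sub>R tv A c p b d"
  proof (cases "d \<in> A \<and> p \<in> chart_dom d")
    case True
    then have d: "d \<in> A" "p \<in> chart_dom d" by auto
    have lin: "linear (fD (transition c d) (chart_map c p))"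
      by (rule linear_fD[OF transition_diff[OF c atlas_cs[OF d(1)] p d(2)]])
    show ?thesis unfolding tv_apply[OF d] by (simp add: linear_add[OF lin] linear_scale[OF lin])
  next
    case False
    show ?thesis unfolding tv_off[OF False] by simp
  qed
qed

end

section \<open>Riemannian metrics on manifolds\<close>

lemma metric_field_subset: "metric_field S G \<Longrightarrow> open U \<Longrightarrow> U \<subseteq> S \<Longrightarrow> metric_field U G"
  unfolding metric_field_def using smooth_on_subset by blast

lemma met_matrix_linear:
  assumes L: "linear L"
  shows "met (\<chi> i j. met M (L (axis i 1)) (L (axis j 1))) a b = met M (L a) (L b)"
proof -
  have e: "L a = (\<Sum>i\<in>UNIV. a $ i *\<^sub>R L (axis i 1))" for a
  proof -
    have "a = (\<Sum>i\<in>UNIV. a $ i *\<^sub>R axis i 1)"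
      using basis_expansion[of a] by (simp add: scalar_mult_eq_scaleR)
    then have "L a = L (\<Sum>i\<in>UNIV. a $ i *\<^sub>R axis i 1)" by simp
    then show ?thesis by (simp add: linear_sum[OF L] linear_scale[OF L])
  qed
  have "met M (L a) (L b) = (\<Sum>i\<in>UNIV. a $ i * met M (L (axis i 1)) (L b))"
    by (subst e) (simp add: linear_sum[OF met_linear_left] met_scale_left)
  also have "\<dots> = (\<Sum>i\<in>UNIV. a $ i * (\<Sum>j\<in>UNIV. b $ j * met M (L (axis i 1)) (L (axis j 1))))"
    by (subst e[of b]) (simp add: linear_sum[OF met_linear_right] met_scale_right)
  finally show ?thesis by (simp add: met_def[of "\<chi> i j. _ i j"] sum_distrib_left mult_ac)
qed

lemma metric_in_chart:
  fixes B :: "('b::topological_space, 'n::finite) chart set"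
  assumes rm: "riemannian_manifold B g" and d: "d \<in> B" "q \<in> chart_dom d"
    and X: "X \<in> tangent_space B q" "Y \<in> tangent_space B q"
  shows "g q X Y = met (metric_matrix B g d (chart_map d q)) (X d) (Y d)"
proof -
  have at: "smooth_atlas B" and g: "riemannian_metric B g" using rm by (auto simp: riemannian_manifold_def)
  note cs = atlas_cs[OF at d(1)]
  note tin = tv_in_tangent_space[OF at cs d(2)]
  have sym: "g q X Y = g q Y X" if "X \<in> tangent_space B q" "Y \<in> tangent_space B q" for X Y
    using g that by (auto simp: riemannian_metric_def)
  have add: "g q (\<lambda>c. a *\<^sub>R X c + b *\<^sub>R Y c) Z = a * g q X Z + b * g q Y Z"
    if "X \<in> tangent_space B q" "Y \<in> tangent_space B q" "Z \<in> tangent_space B q" for X Y Z a b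
    using g that by (auto simp: riemannian_metric_def)
  have lin: "linear (\<lambda>a. g q (tv B d q a) Z)" if "Z \<in> tangent_space B q" for Z
  proof (rule linearI)
    show "g q (tv B d q (a + b)) Z = g q (tv B d q a) Z + g q (tv B d q b) Z" for a b
      using tv_linear[OF at cs d(2), of 1 a 1 b] add[OF tin tin that, of 1 a 1 b] by simp
    show "g q (tv B d q (r *\<^sub>R a)) Z = r *\<^sub>R g q (tv B d q a) Z" for a r
      using tv_linear[OF at cs d(2), of r a 0 0] add[OF tin tin that, of r a 0 0] by simp
  qed
  have ex: "h a = (\<Sum>i\<in>UNIV. a $ i * h (axis i 1))" if "linear h" for h :: "real ^ 'n \<Rightarrow> real" and a
  proof -
    have "a = (\<Sum>i\<in>UNIV. a $ i *\<^sub>R axis i 1)"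
      using basis_expansion[of a] by (simp add: scalar_mult_eq_scaleR)
    then have "h a = h (\<Sum>i\<in>UNIV. a $ i *\<^sub>R axis i 1)" by simp
    then show ?thesis by (simp add: linear_sum[OF that] linear_scale[OF that])
  qed
  let ?M = "metric_matrix B g d (chart_map d q)"
  have M: "?M $ i $ j = g q (tv B d q (axis i 1)) (tv B d q (axis j 1))" for i j
    by (simp add: metric_matrix_def Let_def inv_map[OF cs_chart[OF at cs] d(2)] coord_vec_tv)
  have "g q (tv B d q a) (tv B d q b) = met ?M a b" for a b
  proof -
    have "g q (tv B d q a) (tv B d q b) = (\<Sum>i\<in>UNIV. a $ i * g q (tv B d q (axis i 1)) (tv B d q b))"
      by (rule ex[OF lin[OF tin]])
    also have "\<dots> = (\<Sum>i\<in>UNIV. a $ i * (\<Sum>j\<in>UNIV. b $ j * g q (tv B d q (axis i 1)) (tv B d q (axis j 1))))"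
    \<comment> \<open>\<open>lin\<close> gives linearity in the first argument; symmetry of
      \<open>g\<close> carries it over to the second.\<close>
    proof (rule sum.cong[OF refl])
      fix i
      have "g q (tv B d q (axis i 1)) (tv B d q b) = g q (tv B d q b) (tv B d q (axis i 1))" by (rule sym[OF tin tin])
      also have "\<dots> = (\<Sum>j\<in>UNIV. b $ j * g q (tv B d q (axis j 1)) (tv B d q (axis i 1)))" by (rule ex[OF lin[OF tin]])
      also have "\<dots> = (\<Sum>j\<in>UNIV. b $ j * g q (tv B d q (axis i 1)) (tv B d q (axis j 1)))"
        by (simp add: sym[OF tin tin])
      finally show "a $ i * g q (tv B d q (axis i 1)) (tv B d q b) =
          a $ i * (\<Sum>j\<in>UNIV. b $ j * g q (tv B d q (axis i 1)) (tv B d q (axis j 1)))" by simp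
    qed
    finally show ?thesis by (simp add: met_def M sum_distrib_left mult_ac)
  qed
  from this[of "X d" "Y d"] show ?thesis
    unfolding tangent_tv[OF at X(1) d, symmetric] tangent_tv[OF at X(2) d, symmetric] .
qed

lemma metric_field_chart:
  fixes B :: "('b::topological_space, 'n::finite) chart set"
  assumes rm: "riemannian_manifold B g" and d: "d \<in> B"
  shows "metric_field (chart_img d) (metric_matrix B g d)"
proof -
  have at: "smooth_atlas B" and g: "riemannian_metric B g" using rm by (auto simp: riemannian_manifold_def)
  note cs = atlas_cs[OF at d]
  have ch: "is_chart d" by (rule cs_chart[OF at cs])
  show ?thesis unfolding metric_field_def
  proof (intro conjI allI ballI impI)
    show "open (chart_img d)" by (rule img_open[OF ch])
    show "smooth_on (chart_img d) (\<lambda>x. metric_matrix B g d x $ i $ j)" for i j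
      using g d by (auto simp: riemannian_metric_def)
    fix x assume x: "x \<in> chart_img d"
    let ?q = "chart_inv d x"
    have q: "?q \<in> chart_dom d" by (rule inv_dom[OF ch x])
    have xq: "chart_map d ?q = x" by (rule map_inv[OF ch x])
    note tin = tv_in_tangent_space[OF at cs q]
    show "metric_matrix B g d x $ i $ j = metric_matrix B g d x $ j $ i" for i j
    proof -
      have "g ?q (tv B d ?q (axis i 1)) (tv B d ?q (axis j 1)) = g ?q (tv B d ?q (axis j 1)) (tv B d ?q (axis i 1))"
        using g tin by (auto simp: riemannian_metric_def)
      then show ?thesis by (simp add: metric_matrix_def Let_def coord_vec_tv)
    qed
    fix a :: "real ^ 'n" assume a: "a \<noteq> 0"
    have "tv B d ?q a \<noteq> (\<lambda>c. 0)"
    proof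
      assume "tv B d ?q a = (\<lambda>c. 0)"
      from fun_cong[OF this, of d] a show False unfolding tv_self[OF at d q] by blast
    qed
    then have "g ?q (tv B d ?q a) (tv B d ?q a) > 0" using g tin by (auto simp: riemannian_metric_def)
    then show "met (metric_matrix B g d x) a a > 0"
      unfolding metric_in_chart[OF rm d q tin tin] tv_self[OF at d q] xq .
  qed
qed

text \<open>Transition maps are isometries of the local metrics, as \<open>cov_transition\<close>
  requires.\<close>

lemma metric_transition:
  fixes B :: "('b::topological_space, 'n::finite) chart set"
  assumes rm: "riemannian_manifold B g" and d: "d \<in> B" "e \<in> B"
    and y: "y \<in> chart_map d ` (chart_dom d \<inter> chart_dom e)"
  shows "met (metric_matrix B g d y) a b =
    met (metric_matrix B g e (transition d e y)) (fD (transition d e) y a) (fD (transition d e) y b)"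
proof -
  have at: "smooth_atlas B" using rm by (auto simp: riemannian_manifold_def)
  obtain q where q: "q \<in> chart_dom d" "q \<in> chart_dom e" "y = chart_map d q" using y by auto
  note cs = atlas_cs[OF at d(1)]
  note tin = tv_in_tangent_space[OF at cs q(1)]
  have e: "tv B d q a e = fD (transition d e) y a" for a using tv_apply[OF d(2) q(2)] q(3) by simp
  have "met (metric_matrix B g d y) a b = g q (tv B d q a) (tv B d q b)"
    by (simp add: metric_in_chart[OF rm d(1) q(1) tin tin] tv_self[OF at d(1) q(1)] q(3))
  also have "\<dots> = met (metric_matrix B g e (chart_map e q)) (fD (transition d e) y a) (fD (transition d e) y b)"
    by (simp add: metric_in_chart[OF rm d(2) q(2) tin tin] e)
  also have "chart_map e q = transition d e y"
    using transition_map[OF at cs_chart[OF at cs] q(1)] q(3) by simp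
  finally show ?thesis .
qed

section \<open>Maps between manifolds\<close>

context
  fixes A :: "('a::topological_space, 'm::finite) chart set"
  assumes at: "smooth_atlas A"
begin

lemma chart_inv_transition:
  assumes "is_chart c" "is_chart e" "x \<in> chart_map c ` (chart_dom c \<inter> chart_dom e)"
  shows "chart_inv e (transition c e x) = chart_inv c x"
proof -
  obtain q where q: "x = chart_map c q" "q \<in> chart_dom c" "q \<in> chart_dom e" using assms(3) by blast
  show ?thesis unfolding q(1) transition_map[OF at assms(1) q(2)] inv_map[OF assms(1) q(2)] inv_map[OF assms(2) q(3)] ..
qed

text \<open>Makes quantities that are defined through the arbitrary \<open>chart_at\<close>
  computable in every coordinate system.\<close>

lemma fD_coord_change:
  fixes H :: "'a \<Rightarrow> 'x::real_normed_vector"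
  assumes c: "coordinate_system A c" and e: "coordinate_system A e"
    and p: "p \<in> chart_dom c" "p \<in> chart_dom e"
    and d: "(\<lambda>x. H (chart_inv e x)) differentiable (at (chart_map e p))"
  shows "fD (\<lambda>x. H (chart_inv c x)) (chart_map c p) v =
      fD (\<lambda>x. H (chart_inv e x)) (chart_map e p) (fD (transition c e) (chart_map c p) v)"
    and "(\<lambda>x. H (chart_inv c x)) differentiable (at (chart_map c p))"
proof -
  note cc = cs_chart[OF at c] cs_chart[OF at e]
  let ?U = "chart_map c ` (chart_dom c \<inter> chart_dom e)"
  have U: "open ?U" "chart_map c p \<in> ?U" using open_chart_image[OF cc(1) chart_open[OF cc(2)]] p by auto
  have t: "transition c e (chart_map c p) = chart_map e p" by (rule transition_map[OF at cc(1) p(1)])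
  have eq: "H (chart_inv c x) = H (chart_inv e (transition c e x))" if "x \<in> ?U" for x
    by (simp only: chart_inv_transition[OF cc that])
  have dt: "transition c e differentiable (at (chart_map c p))" by (rule transition_diff[OF at c e p])
  note comp = fD_compose[OF dt, of "\<lambda>x. H (chart_inv e x)", unfolded t, OF d]
  show "(\<lambda>x. H (chart_inv c x)) differentiable (at (chart_map c p))"
    by (rule differentiable_cong_open[OF U eq, THEN iffD2]) (assumption, rule comp(2))
  show "fD (\<lambda>x. H (chart_inv c x)) (chart_map c p) v =
      fD (\<lambda>x. H (chart_inv e x)) (chart_map e p) (fD (transition c e) (chart_map c p) v)"
  proof -
    have "fD (\<lambda>x. H (chart_inv c x)) (chart_map c p) = fD (\<lambda>x. H (chart_inv e (transition c e x))) (chart_map c p)"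
      by (rule fD_cong_open[OF U eq])
    then show ?thesis unfolding comp(1)[symmetric] by (rule fun_cong)
  qed
qed

text \<open>Smoothness on a manifold is defined by the charts of \<open>A\<close>, while flow boxes
  and adapted coordinates are only members of the maximal atlas; hence this transfer.\<close>

lemma smooth_coord_change:
  fixes H :: "'a \<Rightarrow> 'x::real_normed_vector"
  assumes c: "coordinate_system A c" and W: "open W"
    and H: "\<And>e. e \<in> A \<Longrightarrow> smooth_on (chart_map e ` (chart_dom e \<inter> W)) (\<lambda>x. H (chart_inv e x))"
  shows "smooth_on (chart_map c ` (chart_dom c \<inter> W)) (\<lambda>x. H (chart_inv c x))"
proof (rule smooth_on_open_cover)
  note cc = cs_chart[OF at c]
  fix x assume "x \<in> chart_map c ` (chart_dom c \<inter> W)"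
  then obtain p where p: "x = chart_map c p" "p \<in> chart_dom c" "p \<in> W" by blast
  obtain e where e: "e \<in> A" "p \<in> chart_dom e" using atlas_cover[OF at] by blast
  note ec = atlas_cs[OF at e(1)] and ee = cs_chart[OF at atlas_cs[OF at e(1)]]
  let ?U = "chart_map c ` (chart_dom c \<inter> (chart_dom e \<inter> W))"
  have U: "open ?U" by (rule open_chart_image[OF cc open_Int[OF chart_open[OF ee] W]])
  have xU: "x \<in> ?U" unfolding p(1) using p e(2) by blast
  have s: "smooth_on ?U (\<lambda>x. H (chart_inv e (transition c e x)))"
  proof (rule smooth_on_compose[OF H[OF e(1)] smooth_on_subset[OF smooth_transition[OF at c ec]] U open_chart_image[OF ee W]])
    show "transition c e ` ?U \<subseteq> chart_map e ` (chart_dom e \<inter> W)"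
    proof (rule image_subsetI)
      fix y assume "y \<in> ?U"
      then obtain q where q: "y = chart_map c q" "q \<in> chart_dom c" "q \<in> chart_dom e \<inter> W" by blast
      show "transition c e y \<in> chart_map e ` (chart_dom e \<inter> W)"
        unfolding q(1) transition_map[OF at cc q(2)] by (rule imageI[OF q(3)])
    qed
  qed blast
  have "H (chart_inv e (transition c e y)) = H (chart_inv c y)" if y: "y \<in> ?U" for y
  proof -
    have "y \<in> chart_map c ` (chart_dom c \<inter> chart_dom e)" using y by blast
    then show ?thesis by (simp only: chart_inv_transition[OF cc ee])
  qed
  then have "smooth_on ?U (\<lambda>x. H (chart_inv c x))" by (rule smooth_on_eq[OF s U])
  then show "\<exists>U. open U \<and> x \<in> U \<and> smooth_on U (\<lambda>x. H (chart_inv c x))" using U xU by blast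
qed

end

section \<open>Local expressions of a map, its differential and its covariant derivatives\<close>

abbreviation lf :: "('a \<Rightarrow> 'b) \<Rightarrow> ('a, 'm::finite) chart \<Rightarrow> ('b, 'n::finite) chart \<Rightarrow> real ^ 'm \<Rightarrow> real ^ 'n" where
  "lf F c d \<equiv> \<lambda>x. chart_map d (F (chart_inv c x))"

abbreviation ldom :: "('a \<Rightarrow> 'b) \<Rightarrow> ('a, 'm::finite) chart \<Rightarrow> ('b, 'n::finite) chart \<Rightarrow> (real ^ 'm) set" where
  "ldom F c d \<equiv> chart_map c ` (chart_dom c \<inter> F -` chart_dom d)"

lemma cov_cong_open:
  assumes "open U" "x \<in> U" "\<And>y. y \<in> U \<Longrightarrow> \<phi> y = \<phi>' y" "\<And>y. y \<in> U \<Longrightarrow> Y y = Y' y"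
  shows "cov G \<phi> Y x h = cov G \<phi>' Y' x h"
  unfolding cov_def using fD_cong_open[OF assms(1-3)] fD_cong_open[OF assms(1,2,4)] assms(3,4)[OF assms(2)] by simp

context
  fixes A :: "('a::topological_space, 'm::finite) chart set"
    and B :: "('b::topological_space, 'n::finite) chart set"
    and g :: "('b, 'n) metric" and F :: "'a \<Rightarrow> 'b"
  assumes at: "smooth_atlas A" and rm: "riemannian_manifold B g" and F: "smooth_map A B F"
begin

lemma atB: "smooth_atlas B" using rm by (simp add: riemannian_manifold_def)

lemma open_preimage_chart: "d \<in> B \<Longrightarrow> open (F -` chart_dom d)"
  using F chart_open[OF atlas_chart[OF atB]] open_vimage unfolding smooth_map_def by blast

lemma open_ldom: "coordinate_system A c \<Longrightarrow> d \<in> B \<Longrightarrow> open (ldom F c d)"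
  by (rule open_chart_image[OF cs_chart[OF at] open_preimage_chart])

lemma smooth_lf:
  assumes c: "coordinate_system A c" and d: "d \<in> B"
  shows "smooth_on (ldom F c d) (lf F c d)"
proof (rule smooth_coord_change[OF at c open_preimage_chart[OF d], of "\<lambda>p. chart_map d (F p)"])
  fix e assume e: "e \<in> A"
  have "smooth_on (ldom F e d) (chart_map d \<circ> F \<circ> chart_inv e)" using F e d by (simp add: smooth_map_def)
  then show "smooth_on (ldom F e d) (lf F e d)" by (simp only: o_def)
qed

lemma lf_diff:
  assumes c: "coordinate_system A c" and d: "d \<in> B" and p: "p \<in> chart_dom c" "F p \<in> chart_dom d"
  shows "lf F c d differentiable (at (chart_map c p))"
  by (rule smooth_on_differentiable[OF smooth_lf[OF c d]]) (use p in blast)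

text \<open>The arbitrary \<open>chart_at\<close> in the definition drops out by the chain
  rule.\<close>

lemma differential_apply:
  assumes c: "coordinate_system A c" and p: "p \<in> chart_dom c" and d: "d \<in> B" "F p \<in> chart_dom d"
  shows "differential A B F p (tv A c p a) d = fD (lf F c d) (chart_map c p) a"
proof -
  let ?c = "chart_at A p"
  note c0 = chart_at[OF at, of p]
  have "differential A B F p (tv A c p a) d = fD (chart_map d \<circ> F \<circ> chart_inv ?c) (chart_map ?c p) (tv A c p a ?c)"
    using d by (simp add: differential_def Let_def)
  also have "\<dots> = fD (lf F ?c d) (chart_map ?c p) (fD (transition c ?c) (chart_map c p) a)"
    unfolding tv_apply[OF c0] by (simp only: o_def)
  also have "\<dots> = fD (lf F c d) (chart_map c p) a"
    by (rule fD_coord_change(1)[OF at c atlas_cs[OF at c0(1)] p c0(2), of "\<lambda>p. chart_map d (F p)", symmetric])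
      (rule lf_diff[OF atlas_cs[OF at c0(1)] d(1) c0(2) d(2)])
  finally show ?thesis .
qed

lemma differential_off: "\<not> (d \<in> B \<and> F p \<in> chart_dom d) \<Longrightarrow> differential A B F p X d = 0"
  unfolding differential_def Let_def by (rule if_not_P)

lemma fD_lf_transition:
  assumes c: "coordinate_system A c" and p: "p \<in> chart_dom c"
    and d: "d \<in> B" "F p \<in> chart_dom d" and e: "e \<in> B" "F p \<in> chart_dom e"
  shows "fD (lf F c e) (chart_map c p) a = fD (transition d e) (chart_map d (F p)) (fD (lf F c d) (chart_map c p) a)"
proof -
  note cd = atlas_chart[OF atB d(1)]
  let ?U = "chart_map c ` (chart_dom c \<inter> (F -` chart_dom d \<inter> F -` chart_dom e))"
  have U: "open ?U" "chart_map c p \<in> ?U"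
    using open_chart_image[OF cs_chart[OF at c] open_Int[OF open_preimage_chart[OF d(1)] open_preimage_chart[OF e(1)]]] p d(2) e(2)
    by blast+
  have eq: "lf F c e x = transition d e (lf F c d x)" if x: "x \<in> ?U" for x
  proof -
    obtain q where q: "x = chart_map c q" "q \<in> chart_dom c" "F q \<in> chart_dom d" using x by blast
    show ?thesis unfolding q(1) inv_map[OF cs_chart[OF at c] q(2)] transition_map[OF atB cd q(3)] ..
  qed
  have i: "chart_inv c (chart_map c p) = p" by (rule inv_map[OF cs_chart[OF at c] p])
  have "transition d e differentiable (at (lf F c d (chart_map c p)))"
    unfolding i by (rule transition_diff[OF atB atlas_cs[OF atB d(1)] atlas_cs[OF atB e(1)] d(2) e(2)])
  note comp = fD_compose(1)[OF lf_diff[OF c d(1) p d(2)] this, of a]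
  have e: "fD (lf F c e) (chart_map c p) = fD (\<lambda>x. transition d e (lf F c d x)) (chart_map c p)"
    by (rule fD_cong_open[OF U eq])
  show ?thesis using comp unfolding e i .
qed

lemma differential_tv:
  assumes c: "coordinate_system A c" and p: "p \<in> chart_dom c" and d: "d \<in> B" "F p \<in> chart_dom d"
  shows "differential A B F p (tv A c p a) = tv B d (F p) (fD (lf F c d) (chart_map c p) a)"
proof
  fix e
  show "differential A B F p (tv A c p a) e = tv B d (F p) (fD (lf F c d) (chart_map c p) a) e"
  proof (cases "e \<in> B \<and> F p \<in> chart_dom e")
    case True
    then have e: "e \<in> B" "F p \<in> chart_dom e" by auto
    show ?thesis
      unfolding differential_apply[OF c p e] tv_apply[OF e] by (rule fD_lf_transition[OF c p d e])
  next
    case False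
    show ?thesis unfolding differential_off[OF False] tv_off[OF False] ..
  qed
qed

lemma differential_tangent:
  assumes c: "coordinate_system A c" and p: "p \<in> chart_dom c"
  shows "differential A B F p (tv A c p a) \<in> tangent_space B (F p)"
proof -
  obtain d where d: "d \<in> B" "F p \<in> chart_dom d" using atlas_cover[OF atB] by blast
  show ?thesis unfolding differential_tv[OF c p d] by (rule tv_in_tangent_space[OF atB atlas_cs[OF atB d(1)] d(2)])
qed

lemma smooth_field_along:
  assumes Y: "vector_field_along A B F Y" and c: "coordinate_system A c" and d: "d \<in> B"
  shows "smooth_on (ldom F c d) (\<lambda>x. Y (chart_inv c x) d)"
  by (rule smooth_coord_change[OF at c open_preimage_chart[OF d], of "\<lambda>p. Y p d"])
    (use Y d in \<open>simp add: vector_field_along_def\<close>)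

lemma field_along_diff:
  assumes Y: "vector_field_along A B F Y" and c: "coordinate_system A c" "p \<in> chart_dom c"
    and d: "d \<in> B" "F p \<in> chart_dom d"
  shows "(\<lambda>x. Y (chart_inv c x) d) differentiable (at (chart_map c p))"
  by (rule smooth_on_differentiable[OF smooth_field_along[OF Y c(1) d(1)]]) (use c d in blast)

lemma cov_deriv_apply:
  assumes Y: "vector_field_along A B F Y" and c: "coordinate_system A c" "p \<in> chart_dom c"
    and d: "d \<in> B" "F p \<in> chart_dom d"
  shows "cov_deriv A B g F p (tv A c p a) Y d =
    cov (metric_matrix B g d) (lf F c d) (\<lambda>x. Y (chart_inv c x) d) (chart_map c p) a"
proof -
  let ?c = "chart_at A p"
  note c0 = chart_at[OF at, of p]
  have i: "chart_inv c (chart_map c p) = p" by (rule inv_map[OF cs_chart[OF at c(1)] c(2)])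
  have "cov_deriv A B g F p (tv A c p a) Y d =
      fD (\<lambda>x. Y (chart_inv ?c x) d) (chart_map ?c p) (tv A c p a ?c) +
      chr (metric_matrix B g d) (chart_map d (F p)) (differential A B F p (tv A c p a) d) (Y p d)"
    using d by (simp add: cov_deriv_def Let_def chr_def)
  also have "fD (\<lambda>x. Y (chart_inv ?c x) d) (chart_map ?c p) (tv A c p a ?c) = fD (\<lambda>x. Y (chart_inv c x) d) (chart_map c p) a"
    unfolding tv_apply[OF c0]
    by (rule fD_coord_change(1)[OF at c(1) atlas_cs[OF at c0(1)] c(2) c0(2), of "\<lambda>p. Y p d", symmetric])
      (rule field_along_diff[OF Y atlas_cs[OF at c0(1)] c0(2) d])
  finally show ?thesis unfolding cov_def differential_apply[OF c d] i .
qed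

lemma cov_deriv_off: "\<not> (d \<in> B \<and> F p \<in> chart_dom d) \<Longrightarrow> cov_deriv A B g F p X Y d = 0"
  unfolding cov_deriv_def Let_def by (rule if_not_P)

text \<open>\<open>cov_deriv\<close> is computed in each ambient chart separately; that the
  components fit together is the transformation law of the Christoffel symbols.\<close>

lemma cov_deriv_tangent:
  assumes Y: "vector_field_along A B F Y" and c: "coordinate_system A c" "p \<in> chart_dom c"
  shows "cov_deriv A B g F p (tv A c p a) Y \<in> tangent_space B (F p)"
  unfolding tangent_space_def
proof (intro CollectI conjI allI ballI impI)
  fix d assume "\<not> (d \<in> B \<and> F p \<in> chart_dom d)"
  then show "cov_deriv A B g F p (tv A c p a) Y d = 0" by (rule cov_deriv_off)
next
  fix d e assume de: "d \<in> B" "e \<in> B" "F p \<in> chart_dom d" "F p \<in> chart_dom e"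
  let ?\<tau> = "transition d e" and ?\<psi> = "lf F c d" and ?x = "chart_map c p"
  note cd = atlas_chart[OF atB de(1)] and ce = atlas_chart[OF atB de(2)]
  let ?O = "chart_map d ` (chart_dom d \<inter> chart_dom e)"
  have O: "open ?O" by (rule open_chart_image[OF cd chart_open[OF ce]])
  have Od: "?O \<subseteq> chart_img d" by (auto simp: chart_img_def)
  have i: "chart_inv c ?x = p" by (rule inv_map[OF cs_chart[OF at c(1)] c(2)])
  let ?U = "chart_map c ` (chart_dom c \<inter> (F -` chart_dom d \<inter> F -` chart_dom e))"
  have U: "open ?U" "?x \<in> ?U"
    using open_chart_image[OF cs_chart[OF at c(1)] open_Int[OF open_preimage_chart[OF de(1)] open_preimage_chart[OF de(2)]]] c(2) de(3,4)
    by blast+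
  have q: "\<exists>q. x = chart_map c q \<and> q \<in> chart_dom c \<and> F q \<in> chart_dom d \<and> F q \<in> chart_dom e \<and> chart_inv c x = q"
    if "x \<in> ?U" for x
    using that inv_map[OF cs_chart[OF at c(1)]] by auto
  have e1: "lf F c e x = ?\<tau> (?\<psi> x)" if x: "x \<in> ?U" for x
    using q[OF x] transition_map[OF atB cd] by auto
  have e2: "Y (chart_inv c x) e = fD ?\<tau> (?\<psi> x) (Y (chart_inv c x) d)" if x: "x \<in> ?U" for x
  proof -
    obtain r where r: "F r \<in> chart_dom d" "F r \<in> chart_dom e" "chart_inv c x = r" using q[OF x] by blast
    have "Y r \<in> tangent_space B (F r)" using Y by (simp add: vector_field_along_def)
    then show ?thesis using r(1,2) de(1,2) unfolding tangent_space_def r(3) by blast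
  qed
  have e3: "?\<psi> x \<in> ?O" if x: "x \<in> ?U" for x using q[OF x] by auto
  have sub: "?\<tau> ` ?O \<subseteq> chart_img e"
  proof (rule image_subsetI)
    fix y assume "y \<in> ?O"
    then obtain r where r: "y = chart_map d r" "r \<in> chart_dom d" "r \<in> chart_dom e" by blast
    show "?\<tau> y \<in> chart_img e" unfolding r(1) transition_map[OF atB cd r(2)] by (rule map_img[OF ce r(3)])
  qed
  have "cov_deriv A B g F p (tv A c p a) Y e = cov (metric_matrix B g e) (lf F c e) (\<lambda>x. Y (chart_inv c x) e) ?x a"
    by (rule cov_deriv_apply[OF Y c de(2,4)])
  also have "\<dots> = cov (metric_matrix B g e) (\<lambda>x. ?\<tau> (?\<psi> x)) (\<lambda>x. fD ?\<tau> (?\<psi> x) (Y (chart_inv c x) d)) ?x a"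
    by (rule cov_cong_open[OF U e1 e2])
  also have "\<dots> = fD ?\<tau> (?\<psi> ?x) (cov (metric_matrix B g d) ?\<psi> (\<lambda>x. Y (chart_inv c x) d) ?x a)"
    by (rule cov_transition[OF metric_field_chart[OF rm de(2)] metric_field_subset[OF metric_field_chart[OF rm de(1)] O Od]
          smooth_transition[OF atB atlas_cs[OF atB de(1)] atlas_cs[OF atB de(2)]] sub
          metric_transition[OF rm de(1,2)] lf_diff[OF c(1) de(1) c(2) de(3)] field_along_diff[OF Y c de(1,3)] U e3])
  also have "cov (metric_matrix B g d) ?\<psi> (\<lambda>x. Y (chart_inv c x) d) ?x a = cov_deriv A B g F p (tv A c p a) Y d"
    by (rule cov_deriv_apply[OF Y c de(1,3), symmetric])
  finally show "cov_deriv A B g F p (tv A c p a) Y e =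
      fD ?\<tau> (chart_map d (F p)) (cov_deriv A B g F p (tv A c p a) Y d)" unfolding i .
qed

lemma induced_metric_tv:
  assumes c: "coordinate_system A c" "p \<in> chart_dom c" and d: "d \<in> B" "F p \<in> chart_dom d"
  shows "induced_metric A B g F p (tv A c p a) (tv A c p b) =
    met (metric_matrix B g d (chart_map d (F p))) (fD (lf F c d) (chart_map c p) a) (fD (lf F c d) (chart_map c p) b)"
  unfolding induced_metric_def
    metric_in_chart[OF rm d differential_tangent[OF c] differential_tangent[OF c]] differential_apply[OF c d] ..

lemma induced_matrix:
  assumes c: "coordinate_system A c" and d: "d \<in> B" and x: "x \<in> ldom F c d"
  shows "met (metric_matrix A (induced_metric A B g F) c x) a b =
    met (metric_matrix B g d (lf F c d x)) (fD (lf F c d) x a) (fD (lf F c d) x b)"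
proof -
  obtain p where p: "x = chart_map c p" "p \<in> chart_dom c" "F p \<in> chart_dom d" using x by blast
  have i: "chart_inv c x = p" unfolding p(1) by (rule inv_map[OF cs_chart[OF at c] p(2)])
  have lin: "linear (fD (lf F c d) x)" unfolding p(1) by (rule linear_fD[OF lf_diff[OF c d p(2,3)]])
  have "metric_matrix A (induced_metric A B g F) c x =
      (\<chi> k j. met (metric_matrix B g d (chart_map d (F p))) (fD (lf F c d) x (axis k 1)) (fD (lf F c d) x (axis j 1)))"
    unfolding metric_matrix_def[of A] Let_def i coord_vec_tv
    unfolding induced_metric_tv[OF c p(2) d p(3)] p(1) ..
  then show ?thesis unfolding i by (simp only: met_matrix_linear[OF lin])
qed

text \<open>Smoothness is local in the ambient charts; positivity holds because the differential of
  an immersion sends nonzero vectors to nonzero vectors.\<close>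

lemma metric_field_induced:
  assumes imm: "immersion A B F" and c: "coordinate_system A c"
  shows "metric_field (chart_img c) (metric_matrix A (induced_metric A B g F) c)"
proof -
  note ch = cs_chart[OF at c]
  let ?H = "metric_matrix A (induced_metric A B g F) c"
  have ex: "\<exists>d. d \<in> B \<and> F (chart_inv c x) \<in> chart_dom d \<and> x \<in> ldom F c d" if x: "x \<in> chart_img c" for x
  proof -
    obtain d where d: "d \<in> B" "F (chart_inv c x) \<in> chart_dom d" using atlas_cover[OF atB] by blast
    have "x \<in> ldom F c d" using in_chart_image[OF ch, of x "F -` chart_dom d"] x d by blast
    then show ?thesis using d by blast
  qed
  show ?thesis unfolding metric_field_def
  proof (intro conjI allI ballI impI)
    show "open (chart_img c)" by (rule img_open[OF ch])
    fix k j
    show "smooth_on (chart_img c) (\<lambda>x. ?H x $ k $ j)"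
    proof (rule smooth_on_open_cover)
      fix x assume "x \<in> chart_img c"
      then obtain d where d: "d \<in> B" "x \<in> ldom F c d" using ex by blast
      note o = open_ldom[OF c d(1)] and s = smooth_lf[OF c d(1)]
      have "lf F c d ` ldom F c d \<subseteq> chart_img d"
      proof (rule image_subsetI)
        fix y assume "y \<in> ldom F c d"
        then show "lf F c d y \<in> chart_img d"
          using in_chart_image[OF ch, of y "F -` chart_dom d"] map_img[OF atlas_chart[OF atB d(1)]] by blast
      qed
      then have sm: "smooth_on (ldom F c d) (\<lambda>x. met (metric_matrix B g d (lf F c d x)) (fD (lf F c d) x (axis k 1)) (fD (lf F c d) x (axis j 1)))"
        by (rule smooth_on_met[OF metric_field_chart[OF rm d(1)] o s _ smooth_on_fD[OF s] smooth_on_fD[OF s]])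
      have "smooth_on (ldom F c d) (\<lambda>x. ?H x $ k $ j)"
        by (rule smooth_on_eq[OF sm o]) (simp only: induced_matrix[OF c d(1), symmetric] met_axis)
      then show "\<exists>U. open U \<and> x \<in> U \<and> smooth_on U (\<lambda>x. ?H x $ k $ j)" using o d(2) by blast
    qed
  next
    fix x k j assume "x \<in> chart_img c"
    then obtain d where d: "d \<in> B" "x \<in> ldom F c d" "F (chart_inv c x) \<in> chart_dom d" using ex by blast
    have "lf F c d x \<in> chart_img d" by (rule map_img[OF atlas_chart[OF atB d(1)] d(3)])
    then have "met (?H x) (axis k 1) (axis j 1) = met (?H x) (axis j 1) (axis k 1)"
      unfolding induced_matrix[OF c d(1,2)] by (rule met_sym[OF metric_field_chart[OF rm d(1)]])
    then show "?H x $ k $ j = ?H x $ j $ k" unfolding met_axis .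
  next
    fix x and v :: "real ^ 'm" assume x: "x \<in> chart_img c" and v: "v \<noteq> 0"
    obtain d where d: "d \<in> B" "x \<in> ldom F c d" "F (chart_inv c x) \<in> chart_dom d" using ex[OF x] by blast
    let ?p = "chart_inv c x"
    have p: "?p \<in> chart_dom c" "chart_map c ?p = x" by (rule inv_dom[OF ch x], rule map_inv[OF ch x])
    have ne: "fD (lf F c d) x v \<noteq> 0"
    proof
      assume z: "fD (lf F c d) x v = 0"
      have "fD (lf F c d) x 0 = 0"
        by (rule linear_0[OF linear_fD[OF smooth_on_differentiable[OF smooth_lf[OF c d(1)] d(2)]]])
      then have "differential A B F ?p (tv A c ?p v) = differential A B F ?p (tv A c ?p 0)"
        unfolding differential_tv[OF c p(1) d(1,3)] p(2) z by simp
      moreover have "inj_on (differential A B F ?p) (tangent_space A ?p)" using imm by (simp add: immersion_def)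
      ultimately have "tv A c ?p v = tv A c ?p 0"
        using inj_onD[OF _ _ tv_in_tangent_space[OF at c p(1)] tv_in_tangent_space[OF at c p(1)]] by blast
      then show False using tv_inject[OF at c p(1)] v by blast
    qed
    have "lf F c d x \<in> chart_img d" by (rule map_img[OF atlas_chart[OF atB d(1)] d(3)])
    then show "met (?H x) v v > 0"
      unfolding induced_matrix[OF c d(1,2)] by (rule mf_pos[OF metric_field_chart[OF rm d(1)] _ ne])
  qed
qed

end

section \<open>Extension of tangent vectors to vector fields\<close>

text \<open>This family is closed under differentiation, up to linear combinations.\<close>

definition flat_exp :: "nat \<Rightarrow> real \<Rightarrow> real" where
  "flat_exp n x = (if x > 0 then (1 / x) ^ n * exp (- (1 / x)) else 0)"

text \<open>Substitute \<open>z = 1 / x\<close>: at infinity the exponential dominates every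
  power.\<close>

lemma flat_exp_tendsto: "((\<lambda>x. (1 / x) ^ n * exp (- (1 / x))) \<longlongrightarrow> (0::real)) (at_right 0)"
proof -
  have "((\<lambda>z::real. z ^ n / exp z) \<longlongrightarrow> 0) at_top" by (rule tendsto_power_div_exp_0)
  moreover have "filterlim (\<lambda>x::real. 1 / x) at_top (at_right 0)"
    using filterlim_inverse_at_top_right by (simp add: inverse_eq_divide)
  ultimately have "((\<lambda>x. (1 / x) ^ n / exp (1 / x)) \<longlongrightarrow> (0::real)) (at_right 0)"
    by (rule filterlim_compose)
  then show ?thesis by (simp add: exp_minus divide_inverse)
qed

lemma flat_exp_deriv:
  "(flat_exp n has_real_derivative flat_exp (n + 2) x - real n * flat_exp (n + 1) x) (at x)"
proof -
  consider "x > 0" | "x < 0" | "x = 0" by linarith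
  then show ?thesis
  proof cases
    case 1
    have "((\<lambda>x. (1 / x) ^ n * exp (- (1 / x))) has_real_derivative
        flat_exp (n + 2) x - real n * flat_exp (n + 1) x) (at x)"
      using 1 by (auto intro!: derivative_eq_intros simp: flat_exp_def)
        (cases n; simp add: field_simps power2_eq_square)
    then show ?thesis
      by (rule has_field_derivative_transform_within_open[where S="{0<..}"])
        (use 1 in \<open>auto simp: flat_exp_def\<close>)
  next
    case 2
    have "((\<lambda>x::real. 0) has_real_derivative 0) (at x)" by simp
    then have "(flat_exp n has_real_derivative 0) (at x)"
      by (rule has_field_derivative_transform_within_open[where S="{..<0}"])
        (use 2 in \<open>auto simp: flat_exp_def\<close>)
    then show ?thesis using 2 by (simp add: flat_exp_def)
  next
    case 3
    \<comment> \<open>The difference quotient at 0: division by \<open>y\<close> raises the exponent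
      by one and stays in the family.\<close>
    have "((\<lambda>y. flat_exp n y / y) \<longlongrightarrow> 0) (at 0)"
    proof (rule filterlim_split_at)
      show "((\<lambda>y. flat_exp n y / y) \<longlongrightarrow> 0) (at_left 0)"
        by (rule tendsto_eventually) (auto simp: eventually_at_filter flat_exp_def)
      have "eventually (\<lambda>y. (1 / y) ^ (n + 1) * exp (- (1 / y)) = flat_exp n y / y) (at_right 0)"
        by (auto simp: eventually_at_filter flat_exp_def)
      then show "((\<lambda>y. flat_exp n y / y) \<longlongrightarrow> 0) (at_right 0)"
        using flat_exp_tendsto[of "n + 1"] by (rule Lim_transform_eventually[rotated])
    qed
    then show ?thesis using 3 by (simp add: has_field_derivative_iff flat_exp_def)
  qed
qed

lemma smooth_on_flat_exp: "smooth_on UNIV (flat_exp n)"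
proof -
  have "Ck_on k UNIV (flat_exp n)" for k
  proof (induction k arbitrary: n)
    case 0
    have "continuous_on UNIV (flat_exp n)"
      using DERIV_isCont[OF flat_exp_deriv] continuous_at_imp_continuous_on by blast
    then show ?case by simp
  next
    case (Suc k)
    have "Ck_on k UNIV (\<lambda>x. flat_exp (n + 2) x + (- real n) * flat_exp (n + 1) x)"
      by (rule Ck_on_add[OF open_UNIV Suc Ck_on_bilinear[OF open_UNIV bounded_bilinear_mult Ck_on_const Suc]])
    then have "Ck_on k UNIV (\<lambda>x. flat_exp (n + 2) x - real n * flat_exp (n + 1) x)" by simp
    then show ?case by (rule Ck_on_real_SucI[OF open_UNIV flat_exp_deriv])
  qed
  then show ?thesis by (simp add: smooth_on_def)
qed

text \<open>Compose \<open>flat_exp 0\<close> with squared radius minus squared distance, and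
  normalise at the centre.\<close>

lemma bump_function:
  fixes x0 :: "real ^ 'n::finite"
  assumes r: "r > 0"
  obtains \<beta> :: "real ^ 'n \<Rightarrow> real" where "smooth_on UNIV \<beta>" "\<beta> x0 = 1" "\<And>x. x \<notin> cball x0 r \<Longrightarrow> \<beta> x = 0"
proof -
  define h where "h = (\<lambda>x. r\<^sup>2 - (x - x0) \<bullet> (x - x0))"
  have d: "smooth_on UNIV (\<lambda>x. x - x0)" by (rule smooth_on_diff[OF open_UNIV smooth_on_id smooth_on_const])
  have h: "smooth_on UNIV h" unfolding h_def
    by (rule smooth_on_diff[OF open_UNIV smooth_on_const smooth_on_inner[OF open_UNIV d d]])
  have s: "smooth_on UNIV (\<lambda>x. flat_exp 0 (h x))"
    by (rule smooth_on_compose[OF smooth_on_flat_exp h]) auto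
  have pos: "flat_exp 0 (h x0) > 0" using r by (simp add: flat_exp_def h_def)
  have s1: "smooth_on UNIV (\<lambda>x. flat_exp 0 (h x) * inverse (flat_exp 0 (h x0)))"
    by (rule smooth_on_mult[OF open_UNIV s smooth_on_const])
  have s2: "flat_exp 0 (h x) * inverse (flat_exp 0 (h x0)) = 0" if "x \<notin> cball x0 r" for x
  proof -
    have "r < norm (x - x0)" using that by (simp add: dist_norm norm_minus_commute)
    then have "r\<^sup>2 < (norm (x - x0))\<^sup>2" using r by (intro power_strict_mono) auto
    then have "h x < 0" by (simp add: h_def power2_norm_eq_inner)
    then show ?thesis by (simp add: flat_exp_def)
  qed
  have "flat_exp 0 (h x0) * inverse (flat_exp 0 (h x0)) = 1" using pos by simp
  from that[OF s1 this s2] show ?thesis .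
qed

section \<open>From bump functions to global vector fields\<close>

lemma zero_in_tangent_space:
  assumes at: "smooth_atlas A"
  shows "(\<lambda>d. 0) \<in> tangent_space A p"
proof -
  obtain c where c: "c \<in> A" "p \<in> chart_dom c" using atlas_cover[OF at] by blast
  have "tv A c p 0 d = 0" for d
  proof (cases "d \<in> A \<and> p \<in> chart_dom d")
    case True
    then have d: "d \<in> A" "p \<in> chart_dom d" by auto
    show ?thesis unfolding tv_apply[OF d]
      by (rule linear_0[OF linear_fD[OF transition_diff[OF at atlas_cs[OF at c(1)] atlas_cs[OF at d(1)] c(2) d(2)]]])
  next
    case False
    then show ?thesis by (rule tv_off)
  qed
  then have "(\<lambda>d. 0) = tv A c p 0" by (intro ext) simp
  then show ?thesis using tv_in_tangent_space[OF at atlas_cs[OF at c(1)] c(2)] by simp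
qed

text \<open>The anti-torqued condition quantifies over global vector fields; this makes it pointwise.\<close>

lemma vector_field_extension:
  fixes A :: "('a::t2_space, 'n::finite) chart set"
  assumes at: "smooth_atlas A" and c: "c \<in> A" "p \<in> chart_dom c"
  obtains X where "vector_field A X" "X p = tv A c p a"
proof -
  note cc = atlas_chart[OF at c(1)] and cs = atlas_cs[OF at c(1)]
  let ?x = "chart_map c p"
  obtain r where r: "r > 0" "cball ?x r \<subseteq> chart_img c"
    using img_open[OF cc] map_img[OF cc c(2)] open_contains_cball by blast
  obtain \<beta> :: "real ^ 'n \<Rightarrow> real" where \<beta>: "smooth_on UNIV \<beta>" "\<beta> ?x = 1" "\<And>x. x \<notin> cball ?x r \<Longrightarrow> \<beta> x = 0"
    by (rule bump_function[OF r(1), of ?x]) (rule that)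
  define K where "K = chart_inv c ` cball ?x r"
  \<comment> \<open>In a Hausdorff space the compact set \<open>K\<close> is closed. So the chart
    domain and \<open>- K\<close> are two open sets that cover the manifold; on the first
    \<open>X\<close> is a smooth multiple of a coordinate field, on the second it is zero.\<close>
  have "compact K" unfolding K_def
    by (rule compact_continuous_image[OF continuous_on_subset[OF cont_inv[OF cc] r(2)] compact_cball])
  then have K: "open (- K)" using compact_imp_closed by blast
  define X where "X = (\<lambda>q. if q \<in> chart_dom c then tv A c q (\<beta> (chart_map c q) *\<^sub>R a) else (\<lambda>d. 0))"
  have Xin: "X q = tv A c q (\<beta> (chart_map c q) *\<^sub>R a)" if "q \<in> chart_dom c" for q using that by (simp add: X_def)
  have X0: "X q d = 0" if q: "q \<in> - K" for q d
  proof (cases "q \<in> chart_dom c")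
    case True
    have "chart_map c q \<notin> cball ?x r"
    proof
      assume "chart_map c q \<in> cball ?x r"
      then have "chart_inv c (chart_map c q) \<in> K" unfolding K_def by (rule imageI)
      then show False using q inv_map[OF cc True] by simp
    qed
    then have z: "\<beta> (chart_map c q) *\<^sub>R a = 0" using \<beta>(3) by simp
    show ?thesis
    proof (cases "d \<in> A \<and> q \<in> chart_dom d")
      case d: True
      then have d: "d \<in> A" "q \<in> chart_dom d" by auto
      show ?thesis unfolding Xin[OF True] z tv_apply[OF d]
        by (rule linear_0[OF linear_fD[OF transition_diff[OF at cs atlas_cs[OF at d(1)] True d(2)]]])
    next
      case False
      then show ?thesis unfolding Xin[OF True] by (rule tv_off)
    qed
  qed (simp add: X_def)
  have "vector_field A X"
    unfolding vector_field_def vector_field_along_def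
  proof (intro conjI allI ballI)
    show "X q \<in> tangent_space A (id q)" for q
    proof (cases "q \<in> chart_dom c")
      case True
      show ?thesis unfolding Xin[OF True] id_apply by (rule tv_in_tangent_space[OF at cs True])
    next
      case False
      then show ?thesis using zero_in_tangent_space[OF at] by (simp add: X_def)
    qed
  next
    fix e d assume e: "e \<in> A" and d: "d \<in> A"
    note ee = atlas_chart[OF at e] and dd = atlas_chart[OF at d]
    show "smooth_on (chart_map e ` (chart_dom e \<inter> id -` chart_dom d)) (\<lambda>x. X (chart_inv e x) d)"
    proof (rule smooth_on_open_cover)
      fix x assume "x \<in> chart_map e ` (chart_dom e \<inter> id -` chart_dom d)"
      then obtain q where q: "x = chart_map e q" "q \<in> chart_dom e" "q \<in> chart_dom d" by auto
      show "\<exists>U. open U \<and> x \<in> U \<and> smooth_on U (\<lambda>x. X (chart_inv e x) d)"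
      proof (cases "q \<in> chart_dom c")
        case True
        let ?U = "chart_map e ` (chart_dom e \<inter> (chart_dom c \<inter> chart_dom d))"
        let ?W = "chart_map c ` (chart_dom c \<inter> chart_dom d)"
        have U: "open ?U" by (rule open_chart_image[OF ee open_Int[OF chart_open[OF cc] chart_open[OF dd]]])
        have W: "open ?W" by (rule open_chart_image[OF cc chart_open[OF dd]])
        have xU: "x \<in> ?U" unfolding q(1) using q True by blast
        have st: "smooth_on ?U (transition e c)"
          by (rule smooth_on_subset[OF smooth_transition[OF at atlas_cs[OF at e] cs]]) blast
        have tU: "transition e c ` ?U \<subseteq> ?W"
        proof (rule image_subsetI)
          fix y assume "y \<in> ?U"
          then obtain q where q: "y = chart_map e q" "q \<in> chart_dom e" "q \<in> chart_dom c \<inter> chart_dom d" by blast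
          show "transition e c y \<in> ?W" unfolding q(1) transition_map[OF at ee q(2)] by (rule imageI[OF q(3)])
        qed
        have s1: "smooth_on ?U (\<lambda>y. fD (transition c d) (transition e c y) a)"
          by (rule smooth_on_compose[OF smooth_on_fD[OF smooth_transition[OF at cs atlas_cs[OF at d]]] st U W tU])
        have s2: "smooth_on ?U (\<lambda>y. \<beta> (transition e c y))"
          by (rule smooth_on_compose[OF \<beta>(1) st U open_UNIV]) simp
        have "smooth_on ?U (\<lambda>y. X (chart_inv e y) d)"
        proof (rule smooth_on_eq[OF smooth_on_scaleR[OF U s2 s1] U])
          fix y assume "y \<in> ?U"
          then obtain q where q: "y = chart_map e q" "q \<in> chart_dom e" "q \<in> chart_dom c" "q \<in> chart_dom d" by blast
          show "\<beta> (transition e c y) *\<^sub>R fD (transition c d) (transition e c y) a = X (chart_inv e y) d"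
            unfolding q(1) inv_map[OF ee q(2)] transition_map[OF at ee q(2)] Xin[OF q(3)] tv_apply[OF d q(4)]
            by (rule linear_scale[OF linear_fD[OF transition_diff[OF at cs atlas_cs[OF at d] q(3,4)]], symmetric])
        qed
        then show ?thesis using U xU by blast
      next
        case False
        have "q \<in> - K" using False r(2) inv_dom[OF cc] by (auto simp: K_def)
        let ?U = "chart_map e ` (chart_dom e \<inter> - K)"
        have U: "open ?U" by (rule open_chart_image[OF ee K])
        have xU: "x \<in> ?U" unfolding q(1) using q \<open>q \<in> - K\<close> by blast
        have "smooth_on ?U (\<lambda>x. X (chart_inv e x) d)"
        proof (rule smooth_on_eq[OF smooth_on_const U])
          fix y assume "y \<in> ?U"
          then obtain q where q: "y = chart_map e q" "q \<in> chart_dom e" "q \<in> - K" by blast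
          show "0 = X (chart_inv e y) d" unfolding q(1) inv_map[OF ee q(2)] X0[OF q(3)] ..
        qed
        then show ?thesis using U xU by blast
      qed
    qed
  qed
  moreover have "X p = tv A c p a" unfolding Xin[OF c(2)] \<beta>(2) by simp
  ultimately show ?thesis by (rule that)
qed

section \<open>Anti-torqued fields tangent to a surface\<close>

text \<open>Dimension count: \<open>E\<close> and \<open>n\<close> together give an injective linear
  map from a space of dimension 3, hence a surjective one; pairing with \<open>n\<close> detects the
  coefficient of \<open>n\<close>.\<close>

lemma orthogonal_to_normal:
  fixes E :: "real ^ 2 \<Rightarrow> real ^ 3" and M :: "real ^ 3 ^ 3"
  assumes E: "linear E" "\<And>a. E a = 0 \<Longrightarrow> a = 0"
    and n: "\<And>a. met M (E a) n = 0" "met M n n = 1" and z: "met M z n = 0"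
  obtains a where "z = E a"
proof -
  define T where "T = (\<lambda>q :: (real ^ 2) \<times> real. E (fst q) + snd q *\<^sub>R n)"
  have T: "linear T"
    by (rule linearI) (simp_all add: T_def linear_add[OF E(1)] linear_scale[OF E(1)] algebra_simps)
  have nT: "met M (T q) n = snd q" for q by (simp add: T_def met_simps n)
  have "q = 0" if q: "T q = 0" for q
  proof -
    have "snd q = 0" using nT[of q] q by (simp add: met_simps)
    moreover have "fst q = 0" using q \<open>snd q = 0\<close> E(2) by (simp add: T_def)
    ultimately show ?thesis by (simp add: prod_eq_iff)
  qed
  then have "inj T" using linear_injective_0[OF T] by blast
  then have "dim (range T) = dim (UNIV :: ((real ^ 2) \<times> real) set)"
    by (intro dim_image_eq[OF T]) (simp add: inj_on_def)
  also have "\<dots> = DIM(real ^ 3)" by simp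
  finally have "span (range T) = UNIV" by (simp only: dim_eq_full)
  moreover have "span (range T) = range T"
    using linear_subspace_image[OF T subspace_UNIV] by simp
  ultimately obtain q where q: "z = T q" by (metis UNIV_I imageE)
  then have "snd q = 0" using nT z by simp
  then have "z = E (fst q)" using q by (simp add: T_def)
  then show ?thesis by (rule that)
qed

locale tangent_anti_torqued =
  fixes AM :: "('m::{t2_space, second_countable_topology}, 3) chart set"
    and g :: "('m, 3) metric"
    and AS :: "('s::{t2_space, second_countable_topology}, 2) chart set"
    and \<iota> :: "'s \<Rightarrow> 'm"
    and N V :: "'s \<Rightarrow> ('m, 3) tvec"
    and \<theta> f :: "'s \<Rightarrow> real"
  assumes rm: "riemannian_manifold AM g"
    and pa: "PA_surface AS AM g \<iota> N V \<theta>"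
    and atq: "anti_torqued AS AM g \<iota> V f"
    and f0: "f p \<noteq> 0"
    and th: "\<theta> p = pi / 2"
begin

abbreviation "H c \<equiv> metric_matrix AS (induced_metric AS AM g \<iota>) c"
abbreviation "G d \<equiv> metric_matrix AM g d"

lemma at: "smooth_atlas AS" and imm: "immersion AS AM \<iota>" and sm: "smooth_map AS AM \<iota>"
  and Nf: "vector_field_along AS AM \<iota> N" and NN: "g (\<iota> p) (N p) (N p) = 1"
  and Nn: "X \<in> tangent_space AS p \<Longrightarrow> g (\<iota> p) (differential AS AM \<iota> p X) (N p) = 0"
  and Vf: "vector_field_along AS AM \<iota> V" and VV: "g (\<iota> p) (V p) (V p) = 1"
  and VN: "g (\<iota> p) (V p) (N p) = 0"
  and sf: "smooth_function AS f"
  using pa atq th by (auto simp: PA_surface_def immersion_def unit_normal_field_def unit_field_along_def anti_torqued_def)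

lemma atM: "smooth_atlas AM" using rm by (simp add: riemannian_manifold_def)

lemma Nt: "N p \<in> tangent_space AM (\<iota> p)" and Vt: "V p \<in> tangent_space AM (\<iota> p)"
  using Nf Vf by (auto simp: vector_field_along_def)

lemma ambient_chart:
  obtains d where "d \<in> AM" "\<iota> p \<in> chart_dom d"
  using atlas_cover[OF atM] by blast

lemmas diff_apply = differential_apply[OF at rm sm]
  and diff_tangent = differential_tangent[OF at rm sm]
  and H_matrix = induced_matrix[OF at rm sm]
  and H_field = metric_field_induced[OF at rm sm imm]
  and G_field = metric_field_chart[OF rm]
  and lf_smooth = smooth_lf[OF at rm sm]
  and lf_differentiable = lf_diff[OF at rm sm]
  and g_chart = metric_in_chart[OF rm]
  and cov_apply = cov_deriv_apply[OF at rm sm]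
  and cov_tangent = cov_deriv_tangent[OF at rm sm]
  and ldom_open = open_ldom[OF at rm sm]

lemma lf_img: "coordinate_system AS c \<Longrightarrow> d \<in> AM \<Longrightarrow> lf \<iota> c d ` ldom \<iota> c d \<subseteq> chart_img d"
proof (rule image_subsetI)
  fix x assume c: "coordinate_system AS c" and d: "d \<in> AM" and "x \<in> ldom \<iota> c d"
  then obtain p where p: "x = chart_map c p" "p \<in> chart_dom c" "\<iota> p \<in> chart_dom d" by blast
  show "lf \<iota> c d x \<in> chart_img d"
    unfolding p(1) inv_map[OF cs_chart[OF at c] p(2)] by (rule map_img[OF atlas_chart[OF atM d] p(3)])
qed

lemma differential_inject:
  assumes c: "coordinate_system AS c" "p \<in> chart_dom c"
    and e: "differential AS AM \<iota> p (tv AS c p a) = differential AS AM \<iota> p (tv AS c p b)"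
  shows "a = b"
proof -
  have "inj_on (differential AS AM \<iota> p) (tangent_space AS p)" using imm by (simp add: immersion_def)
  from inj_onD[OF this e tv_in_tangent_space[OF at c] tv_in_tangent_space[OF at c]]
  show ?thesis by (rule tv_inject[OF at c])
qed

lemma normal_orthogonal_tangent:
  assumes c: "coordinate_system AS c" "p \<in> chart_dom c"
    and Z: "Z \<in> tangent_space AM (\<iota> p)" "g (\<iota> p) Z (N p) = 0"
  obtains a where "Z = differential AS AM \<iota> p (tv AS c p a)"
proof -
  obtain d where d: "d \<in> AM" "\<iota> p \<in> chart_dom d" by (rule ambient_chart)
  let ?E = "fD (lf \<iota> c d) (chart_map c p)" and ?M = "G d (chart_map d (\<iota> p))"
  have lin: "linear ?E" by (rule linear_fD[OF lf_differentiable[OF c(1) d(1) c(2) d(2)]])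
  have inj: "a = 0" if "?E a = 0" for a
  proof (rule differential_inject[OF c])
    show "differential AS AM \<iota> p (tv AS c p a) = differential AS AM \<iota> p (tv AS c p 0)"
      by (rule tv_eqI[OF atM diff_tangent[OF c] diff_tangent[OF c] d])
        (simp only: diff_apply[OF c d] that linear_0[OF lin])
  qed
  have 1: "met ?M (?E a) (N p d) = 0" for a
    using Nn[OF tv_in_tangent_space[OF at c], of a] unfolding g_chart[OF d diff_tangent[OF c] Nt] diff_apply[OF c d] .
  have 2: "met ?M (N p d) (N p d) = 1" using NN[of p] unfolding g_chart[OF d Nt Nt] .
  have 3: "met ?M (Z d) (N p d) = 0" using Z(2) unfolding g_chart[OF d Z(1) Nt] .
  obtain a where a: "Z d = ?E a" by (rule orthogonal_to_normal[OF lin inj 1 2 3])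
  have "Z = differential AS AM \<iota> p (tv AS c p a)"
    by (rule tv_eqI[OF atM Z(1) diff_tangent[OF c] d]) (simp only: diff_apply[OF c d] a)
  then show ?thesis by (rule that)
qed

text \<open>The coordinate expression of \<open>V\<close> as a field on the coordinate domain. It
  exists because \<open>V\<close> is orthogonal to \<open>N\<close>, and it is unique because
  \<iota> is an immersion.\<close>

definition w :: "('s, 2) chart \<Rightarrow> real ^ 2 \<Rightarrow> real ^ 2" where
  "w c x = (THE a. V (chart_inv c x) = differential AS AM \<iota> (chart_inv c x) (tv AS c (chart_inv c x) a))"

lemma w_eq:
  assumes c: "coordinate_system AS c" "p \<in> chart_dom c"
  shows "V p = differential AS AM \<iota> p (tv AS c p (w c (chart_map c p)))"
proof -
  have i: "chart_inv c (chart_map c p) = p" by (rule inv_map[OF cs_chart[OF at c(1)] c(2)])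
  obtain a where a: "V p = differential AS AM \<iota> p (tv AS c p a)" by (rule normal_orthogonal_tangent[OF c Vt[of p] VN[of p]])
  have "w c (chart_map c p) = a" unfolding w_def i
  proof (rule the_equality)
    fix b assume b: "V p = differential AS AM \<iota> p (tv AS c p b)"
    show "b = a" by (rule differential_inject[OF c trans[OF b[symmetric] a]])
  qed (rule a)
  then show ?thesis by (simp only: a[symmetric])
qed

lemma w_unique:
  assumes c: "coordinate_system AS c" "p \<in> chart_dom c" and a: "V p = differential AS AM \<iota> p (tv AS c p a)"
  shows "w c (chart_map c p) = a"
  by (rule differential_inject[OF c trans[OF w_eq[OF c, symmetric] a]])

lemma w_change:
  assumes c: "coordinate_system AS c" "p \<in> chart_dom c" and e: "coordinate_system AS e" "p \<in> chart_dom e"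
  shows "w e (chart_map e p) = fD (transition c e) (chart_map c p) (w c (chart_map c p))"
  by (rule w_unique[OF e]) (simp only: tv_change[OF at c(1) e(1) c(2) e(2), symmetric] w_eq[OF c, symmetric])

lemma V_apply:
  assumes c: "coordinate_system AS c" and d: "d \<in> AM" and x: "x \<in> ldom \<iota> c d"
  shows "V (chart_inv c x) d = fD (lf \<iota> c d) x (w c x)"
proof -
  obtain p where p: "x = chart_map c p" "p \<in> chart_dom c" "\<iota> p \<in> chart_dom d" using x by blast
  show ?thesis unfolding p(1) inv_map[OF cs_chart[OF at c] p(2)]
    by (subst w_eq[OF c p(2)]) (rule diff_apply[OF c p(2) d p(3)])
qed

lemma ldom_cover:
  assumes c: "coordinate_system AS c" and x: "x \<in> chart_img c"
  obtains d where "d \<in> AM" "x \<in> ldom \<iota> c d"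
proof -
  obtain d where d: "d \<in> AM" "\<iota> (chart_inv c x) \<in> chart_dom d" by (rule ambient_chart)
  have "x \<in> ldom \<iota> c d" using in_chart_image[OF cs_chart[OF at c], of x "\<iota> -` chart_dom d"] x d by blast
  then show ?thesis using d that by blast
qed

lemma ldom_img: "coordinate_system AS c \<Longrightarrow> ldom \<iota> c d \<subseteq> chart_img c"
  by (auto simp: chart_img_def)

lemma w_unit:
  assumes c: "coordinate_system AS c" and x: "x \<in> chart_img c"
  shows "met (H c x) (w c x) (w c x) = 1"
proof -
  obtain d where d: "d \<in> AM" "x \<in> ldom \<iota> c d" by (rule ldom_cover[OF c x])
  obtain p where p: "x = chart_map c p" "p \<in> chart_dom c" "\<iota> p \<in> chart_dom d" using d by blast
  have i: "chart_inv c x = p" unfolding p(1) by (rule inv_map[OF cs_chart[OF at c] p(2)])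
  show ?thesis
    unfolding H_matrix[OF c d] V_apply[OF c d, symmetric] i g_chart[OF d(1) p(3) Vt Vt, symmetric] by (rule VV)
qed

text \<open>The description that defines \<open>w\<close> gives no regularity. Smoothness comes from
  solving the linear system whose matrix is \<open>H c\<close> and whose right sides are the smooth
  functions \<langle>V, \<partial>_i\<rangle>.\<close>

lemma smooth_w:
  assumes c: "coordinate_system AS c"
  shows "smooth_on (chart_img c) (w c)"
proof (rule smooth_on_open_cover)
  fix x assume x: "x \<in> chart_img c"
  obtain d where d: "d \<in> AM" "x \<in> ldom \<iota> c d" by (rule ldom_cover[OF c x])
  let ?U = "ldom \<iota> c d"
  note U = ldom_open[OF c d(1)] and mH = metric_field_subset[OF H_field[OF c] ldom_open[OF c d(1)] ldom_img[OF c]]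
  note sl = lf_smooth[OF c d(1)]
  define b where "b = (\<lambda>i x. met (G d (lf \<iota> c d x)) (V (chart_inv c x) d) (fD (lf \<iota> c d) x (axis i 1)))"
  have sb: "smooth_on ?U (b i)" for i
    unfolding b_def
    by (rule smooth_on_met[OF G_field[OF d(1)] U sl lf_img[OF c d(1)] smooth_field_along[OF at rm sm Vf c d(1)] smooth_on_fD[OF sl]])
  have sH: "smooth_on ?U (\<lambda>x. H c x $ i $ j)" for i j by (rule mf_smooth[OF mH])
  define D where "D = (\<lambda>x. H c x $ 1 $ 1 * H c x $ 2 $ 2 - H c x $ 1 $ 2 * H c x $ 1 $ 2)"
  have sD: "smooth_on ?U D" unfolding D_def
    by (rule smooth_on_diff[OF U smooth_on_mult[OF U sH sH] smooth_on_mult[OF U sH sH]])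
  have D0: "D y \<noteq> 0" if "y \<in> ?U" for y using mf2_det[OF mH that] by (simp add: D_def power2_eq_square)
  \<comment> \<open>Cramer's rule for this system, with the symmetry of \<open>H c\<close> used to
    write both off-diagonal entries alike.\<close>
  define w' where "w' = (\<lambda>x. vector [(H c x $ 2 $ 2 * b 1 x - H c x $ 1 $ 2 * b 2 x) / D x,
      (H c x $ 1 $ 1 * b 2 x - H c x $ 1 $ 2 * b 1 x) / D x] :: real ^ 2)"
  have sw: "smooth_on ?U w'" unfolding w'_def
    by (rule smooth_on_vector2[OF U
          smooth_on_divide[OF U smooth_on_diff[OF U smooth_on_mult[OF U sH sb] smooth_on_mult[OF U sH sb]] sD D0]
          smooth_on_divide[OF U smooth_on_diff[OF U smooth_on_mult[OF U sH sb] smooth_on_mult[OF U sH sb]] sD D0]])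
  have "smooth_on ?U (w c)"
  proof (rule smooth_on_eq[OF sw U])
    fix y assume y: "y \<in> ?U"
    have bi: "b i y = met (H c y) (w c y) (axis i 1)" for i
      unfolding b_def V_apply[OF c d(1) y] by (rule H_matrix[OF c d(1) y, symmetric])
    have b1: "b 1 y = H c y $ 1 $ 1 * w c y $ 1 + H c y $ 1 $ 2 * w c y $ 2"
      and b2: "b 2 y = H c y $ 1 $ 2 * w c y $ 1 + H c y $ 2 $ 2 * w c y $ 2"
      by (simp_all add: bi met_2 axis_def mf2_sym[OF mH y])
    have n1: "H c y $ 2 $ 2 * b 1 y - H c y $ 1 $ 2 * b 2 y = w c y $ 1 * D y"
      and n2: "H c y $ 1 $ 1 * b 2 y - H c y $ 1 $ 2 * b 1 y = w c y $ 2 * D y"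
      unfolding b1 b2 D_def by (simp_all add: algebra_simps)
    show "w' y = w c y" unfolding w'_def n1 n2 using D0[OF y] by (simp add: vector_2_eta)
  qed
  then show "\<exists>U. open U \<and> x \<in> U \<and> smooth_on U (w c)" using U d(2) by blast
qed

text \<open>Both sides depend on the vector field only through its value at \<open>p\<close>, so the
  condition is instantiated with a global extension of the given vector.\<close>

lemma cov_V:
  assumes c: "coordinate_system AS c" "p \<in> chart_dom c"
  shows "cov_deriv AS AM g \<iota> p (tv AS c p a) V =
    (\<lambda>d. f p *\<^sub>R (differential AS AM \<iota> p (tv AS c p a) d -
      g (\<iota> p) (differential AS AM \<iota> p (tv AS c p a)) (V p) *\<^sub>R V p d))"
proof -
  obtain e where e: "e \<in> AS" "p \<in> chart_dom e" using atlas_cover[OF at] by blast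
  have t: "tv AS c p a = tv AS e p (tv AS c p a e)"
    by (rule tangent_tv[OF at tv_in_tangent_space[OF at c] e])
  obtain X where X: "vector_field AS X" "X p = tv AS e p (tv AS c p a e)"
    by (rule vector_field_extension[OF at e])
  have "X p = tv AS c p a" using X(2) t by simp
  moreover have "let dX = differential AS AM \<iota> p (X p) in
        cov_deriv AS AM g \<iota> p (X p) V = (\<lambda>d. f p *\<^sub>R (dX d - g (\<iota> p) dX (V p) *\<^sub>R V p d))"
    using atq X(1) unfolding anti_torqued_def by blast
  ultimately show ?thesis by (simp only: Let_def)
qed

lemma cov_V_chart:
  assumes c: "coordinate_system AS c" and d: "d \<in> AM" and x: "x \<in> ldom \<iota> c d"
  shows "cov (G d) (lf \<iota> c d) (\<lambda>x. V (chart_inv c x) d) x a = f (chart_inv c x) *\<^sub>R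
    (fD (lf \<iota> c d) x a - met (H c x) a (w c x) *\<^sub>R fD (lf \<iota> c d) x (w c x))"
proof -
  obtain p where p: "x = chart_map c p" "p \<in> chart_dom c" "\<iota> p \<in> chart_dom d" using x by blast
  have i: "chart_inv c x = p" unfolding p(1) by (rule inv_map[OF cs_chart[OF at c] p(2)])
  have "cov (G d) (lf \<iota> c d) (\<lambda>x. V (chart_inv c x) d) x a = cov_deriv AS AM g \<iota> p (tv AS c p a) V d"
    unfolding p(1) by (rule cov_apply[OF Vf c p(2) d p(3), symmetric])
  also have "\<dots> = f p *\<^sub>R (fD (lf \<iota> c d) x a - g (\<iota> p) (differential AS AM \<iota> p (tv AS c p a)) (V p) *\<^sub>R V p d)"
    unfolding cov_V[OF c p(2)] diff_apply[OF c p(2) d p(3)] p(1) ..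
  also have "g (\<iota> p) (differential AS AM \<iota> p (tv AS c p a)) (V p) = met (H c x) a (w c x)"
    unfolding g_chart[OF d p(3) diff_tangent[OF c p(2)] Vt] diff_apply[OF c p(2) d p(3)]
      H_matrix[OF c d x] V_apply[OF c d x, symmetric] i p(1)[symmetric] ..
  also have "V p d = fD (lf \<iota> c d) x (w c x)" using V_apply[OF c d x] i by simp
  finally show ?thesis unfolding i .
qed

text \<open>The right side of the ambient equation is already tangent, so pairing with tangent
  vectors and the Gauss formula turn it into the same equation for the connection of the induced
  metric.\<close>

lemma cov_w:
  assumes c: "coordinate_system AS c" and x: "x \<in> chart_img c"
  shows "cov (H c) (\<lambda>y. y) (w c) x a = f (chart_inv c x) *\<^sub>R (a - met (H c x) a (w c x) *\<^sub>R w c x)"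
proof (rule met_nondegenerate[OF H_field[OF c] x])
  fix b
  obtain d where d: "d \<in> AM" "x \<in> ldom \<iota> c d" by (rule ldom_cover[OF c x])
  let ?U = "ldom \<iota> c d" and ?\<phi> = "lf \<iota> c d"
  note U = ldom_open[OF c d(1)] and mH = metric_field_subset[OF H_field[OF c] ldom_open[OF c d(1)] ldom_img[OF c]]
  have lin: "linear (fD ?\<phi> x)" by (rule linear_fD[OF smooth_on_differentiable[OF lf_smooth[OF c d(1)] d(2)]])
  have "met (H c x) (cov (H c) (\<lambda>y. y) (w c) x a) b =
      met (G d (?\<phi> x)) (cov (G d) ?\<phi> (\<lambda>y. fD ?\<phi> y (w c y)) x a) (fD ?\<phi> x b)"
    by (rule met_cov_tangent[OF G_field[OF d(1)] mH lf_smooth[OF c d(1)] lf_img[OF c d(1)] H_matrix[OF c d(1)] d(2)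
          smooth_on_subset[OF smooth_w[OF c] ldom_img[OF c]], symmetric])
  also have "cov (G d) ?\<phi> (\<lambda>y. fD ?\<phi> y (w c y)) x a = cov (G d) ?\<phi> (\<lambda>y. V (chart_inv c y) d) x a"
    by (rule cov_cong_open[OF U d(2) refl]) (rule V_apply[OF c d(1), symmetric])
  also have "\<dots> = fD ?\<phi> x (f (chart_inv c x) *\<^sub>R (a - met (H c x) a (w c x) *\<^sub>R w c x))"
    unfolding cov_V_chart[OF c d] by (simp only: linear_scale[OF lin] linear_diff[OF lin])
  finally show "met (H c x) (cov (H c) (\<lambda>y. y) (w c) x a) b =
      met (H c x) (f (chart_inv c x) *\<^sub>R (a - met (H c x) a (w c x) *\<^sub>R w c x)) b"
    unfolding H_matrix[OF c d] .
qed

section \<open>Potential and curvatures of the surface\<close>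

lemma smooth_f:
  assumes c: "coordinate_system AS c"
  shows "smooth_on (chart_img c) (\<lambda>x. f (chart_inv c x))"
proof -
  have "smooth_on (chart_map e ` (chart_dom e \<inter> UNIV)) (\<lambda>x. f (chart_inv e x))" if "e \<in> AS" for e
    using sf that by (simp add: smooth_function_def chart_img_def o_def)
  from smooth_coord_change[OF at c open_UNIV this] show ?thesis by (simp add: chart_img_def)
qed

text \<open>The derivative of \<open>f\<close> along \<open>V\<close> does not depend on
  coordinates, so the formula passes from the chart hidden in \<open>gaussian_curvature\<close> to
  any other one.\<close>

lemma K_int_eq:
  assumes c: "coordinate_system AS c" "p \<in> chart_dom c"
  shows "K_int AS AM g \<iota> p = - (fD (\<lambda>x. f (chart_inv c x)) (chart_map c p) (w c (chart_map c p)) + (f p)\<^sup>2)"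
proof -
  let ?e = "chart_at AS p"
  note e = chart_at[OF at, of p]
  note ce = atlas_cs[OF at e(1)]
  have xe: "chart_map ?e p \<in> chart_img ?e" by (rule map_img[OF cs_chart[OF at ce] e(2)])
  have ie: "chart_inv ?e (chart_map ?e p) = p" by (rule inv_map[OF cs_chart[OF at ce] e(2)])
  have "K_int AS AM g \<iota> p = - (fD (\<lambda>x. f (chart_inv ?e x)) (chart_map ?e p) (w ?e (chart_map ?e p)) +
      (f (chart_inv ?e (chart_map ?e p)))\<^sup>2)"
    unfolding K_int_def gaussian_curvature_def Let_def
    by (rule curvature_anti_torqued[OF H_field[OF ce] smooth_w[OF ce] smooth_f[OF ce] w_unit[OF ce] cov_w[OF ce] xe])
  also have "fD (\<lambda>x. f (chart_inv ?e x)) (chart_map ?e p) (w ?e (chart_map ?e p)) =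
      fD (\<lambda>x. f (chart_inv c x)) (chart_map c p) (w c (chart_map c p))"
    unfolding w_change[OF c ce e(2)]
    by (rule fD_coord_change(1)[OF at c(1) ce c(2) e(2) smooth_on_differentiable[OF smooth_f[OF ce] xe], symmetric])
  finally show ?thesis unfolding ie .
qed

text \<open>Differentiating \<langle>N, N\<rangle> = 1 shows that the derivative of \<open>N\<close>
  is tangent, so the description in \<open>shape_operator\<close> has a value. Differentiating
  \<langle>N, V\<rangle> = 0 moves the derivative onto \<open>V\<close>, where it is tangent and
  hence orthogonal to \<open>N\<close>.\<close>

lemma shape_operator_eq:
  assumes c: "coordinate_system AS c" "p \<in> chart_dom c"
  obtains a where "shape_operator AS AM g \<iota> N p (tv AS c p b) = tv AS c p a"
    "met (H c (chart_map c p)) a (w c (chart_map c p)) = 0"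
proof -
  let ?x = "chart_map c p"
  obtain d where d: "d \<in> AM" "\<iota> p \<in> chart_dom d" by (rule ambient_chart)
  have x: "?x \<in> ldom \<iota> c d" using c d by blast
  have i: "chart_inv c ?x = p" by (rule inv_map[OF cs_chart[OF at c(1)] c(2)])
  note U = ldom_open[OF c(1) d(1)]
  let ?D = "cov_deriv AS AM g \<iota> p (tv AS c p b) N"
  define Z where "Z = (\<lambda>e. - ?D e)"
  have Z: "Z \<in> tangent_space AM (\<iota> p)"
  proof -
    have D: "?D e = tv AM d (\<iota> p) (?D d) e" for e
      by (rule fun_cong[OF tangent_tv[OF atM cov_tangent[OF Nf c] d]])
    have "Z = (\<lambda>e. (-1) *\<^sub>R tv AM d (\<iota> p) (?D d) e + 0 *\<^sub>R tv AM d (\<iota> p) 0 e)"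
      unfolding Z_def by (rule ext) (simp only: D[symmetric] scaleR_minus1_left scaleR_zero_left add.right_neutral)
    also have "\<dots> = tv AM d (\<iota> p) ((-1) *\<^sub>R ?D d + 0 *\<^sub>R 0)"
      by (rule tv_linear[OF atM atlas_cs[OF atM d(1)] d(2), symmetric])
    finally show ?thesis using tv_in_tangent_space[OF atM atlas_cs[OF atM d(1)] d(2)] by simp
  qed
  let ?M = "G d (chart_map d (\<iota> p))" and ?\<phi> = "lf \<iota> c d"
  have phx: "?\<phi> ?x \<in> chart_img d" using lf_img[OF c(1) d(1)] x by blast
  have NV: "met (G d (?\<phi> y)) (N (chart_inv c y) d) (N (chart_inv c y) d) = 1"
    "met (G d (?\<phi> y)) (N (chart_inv c y) d) (V (chart_inv c y) d) = 0" if y: "y \<in> ldom \<iota> c d" for y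
  proof -
    obtain q where q: "y = chart_map c q" "q \<in> chart_dom c" "\<iota> q \<in> chart_dom d" using y by blast
    have iq: "chart_inv c y = q" unfolding q(1) by (rule inv_map[OF cs_chart[OF at c(1)] q(2)])
    show "met (G d (?\<phi> y)) (N (chart_inv c y) d) (N (chart_inv c y) d) = 1"
      unfolding iq g_chart[OF d(1) q(3) Nt Nt, symmetric] by (rule NN)
    show "met (G d (?\<phi> y)) (N (chart_inv c y) d) (V (chart_inv c y) d) = 0"
      unfolding iq met_sym[OF G_field[OF d(1)] map_img[OF atlas_chart[OF atM d(1)] q(3)], of "N q d" "V q d"]
        g_chart[OF d(1) q(3) Vt Nt, symmetric] by (rule VN)
  qed
  note dN = field_along_diff[OF at rm sm Nf c d] and dV = field_along_diff[OF at rm sm Vf c d]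
    and dl = lf_differentiable[OF c(1) d(1) c(2) d(2)]
  have Dd: "?D d = cov (G d) ?\<phi> (\<lambda>x. N (chart_inv c x) d) ?x b" by (rule cov_apply[OF Nf c d])
  have "fD (\<lambda>y. met (G d (?\<phi> y)) (N (chart_inv c y) d) (N (chart_inv c y) d)) ?x = fD (\<lambda>y. 1) ?x"
    by (rule fD_cong_open[OF U x]) (rule NV(1))
  then have "met ?M (?D d) (N p d) + met ?M (N p d) (?D d) = 0"
    using cov_compat[OF G_field[OF d(1)] phx dl dN dN, of b] unfolding i Dd by simp
  then have DN: "met ?M (?D d) (N p d) = 0"
    using met_sym[OF G_field[OF d(1)] phx, of "N p d" "?D d"] unfolding i by simp
  \<comment> \<open>By the anti-torqued condition the derivative of \<open>V\<close> is a
    combination of tangent vectors.\<close>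
  have cV: "met ?M (N p d) (cov (G d) ?\<phi> (\<lambda>x. V (chart_inv c x) d) ?x b) = 0"
  proof -
    have "met ?M (fD ?\<phi> ?x a) (N p d) = 0" for a
      using Nn[OF tv_in_tangent_space[OF at c], of a] unfolding g_chart[OF d diff_tangent[OF c] Nt] diff_apply[OF c d] .
    then have "met ?M (N p d) (fD ?\<phi> ?x a) = 0" for a
      using met_sym[OF G_field[OF d(1)] phx, of "N p d"] unfolding i by simp
    then show ?thesis unfolding cov_V_chart[OF c(1) d(1) x] by (simp add: met_simps)
  qed
  have "fD (\<lambda>y. met (G d (?\<phi> y)) (N (chart_inv c y) d) (V (chart_inv c y) d)) ?x = fD (\<lambda>y. 0) ?x"
    by (rule fD_cong_open[OF U x]) (rule NV(2))
  then have DV: "met ?M (?D d) (V p d) = 0"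
    using cov_compat[OF G_field[OF d(1)] phx dl dN dV, of b] cV unfolding i Dd by simp
  have neg: "met ?M (Z d) b = - met ?M (?D d) b" for b
    unfolding Z_def by (rule linear_neg[OF met_linear_left])
  have "g (\<iota> p) Z (N p) = 0" unfolding g_chart[OF d Z Nt] neg DN by simp
  then obtain a where a: "Z = differential AS AM \<iota> p (tv AS c p a)" by (rule normal_orthogonal_tangent[OF c Z])
  have "shape_operator AS AM g \<iota> N p (tv AS c p b) = tv AS c p a"
    unfolding shape_operator_def
  proof (rule the_equality)
    show "tv AS c p a \<in> tangent_space AS p \<and> differential AS AM \<iota> p (tv AS c p a) = (\<lambda>d. - ?D d)"
      using a tv_in_tangent_space[OF at c] by (simp add: Z_def)
    fix Y assume Y: "Y \<in> tangent_space AS p \<and> differential AS AM \<iota> p Y = (\<lambda>d. - ?D d)"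
    then obtain a' where a': "Y = tv AS c p a'" using tangent_tv_cs[OF at _ c] by blast
    have "a' = a" by (rule differential_inject[OF c]) (use Y a a' in \<open>simp add: Z_def\<close>)
    then show "Y = tv AS c p a" using a' by simp
  qed
  moreover have "met (H c ?x) a (w c ?x) = 0"
  proof -
    have "met (H c ?x) a (w c ?x) = met ?M (Z d) (V p d)"
      unfolding H_matrix[OF c(1) d(1) x] V_apply[OF c(1) d(1) x, symmetric] i a diff_apply[OF c d] ..
    then show ?thesis unfolding neg DV by simp
  qed
  ultimately show ?thesis by (rule that)
qed

text \<open>Both columns of the shape operator are annihilated by the covector \<open>(u, v)\<close>
  dual to \<open>V\<close>. This covector is nonzero, since its value on \<open>V\<close> is 1, so
  the columns are linearly dependent.\<close>

lemma extrinsically_flat: "extrinsically_flat AS AM g \<iota> N"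
  unfolding extrinsically_flat_def
proof
  fix p
  let ?c = "chart_at AS p"
  note c = chart_at[OF at, of p]
  note cs = atlas_cs[OF at c(1)]
  let ?x = "chart_map ?c p"
  let ?M = "H ?c ?x" and ?w = "w ?c ?x"
  have xi: "?x \<in> chart_img ?c" by (rule map_img[OF cs_chart[OF at cs] c(2)])
  obtain a1 where a1: "shape_operator AS AM g \<iota> N p (tv AS ?c p (axis 1 1)) = tv AS ?c p a1" "met ?M a1 ?w = 0"
    by (rule shape_operator_eq[OF cs c(2)])
  obtain a2 where a2: "shape_operator AS AM g \<iota> N p (tv AS ?c p (axis 2 1)) = tv AS ?c p a2" "met ?M a2 ?w = 0"
    by (rule shape_operator_eq[OF cs c(2)])
  have K: "K_ext AS AM g \<iota> N p = a1 $ 1 * a2 $ 2 - a2 $ 1 * a1 $ 2"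
    unfolding K_ext_def Let_def det_2 coord_vec_tv
    by (simp add: a1(1) a2(1) tv_self[OF at c])
  define u v where "u = ?M $ 1 $ 1 * ?w $ 1 + ?M $ 1 $ 2 * ?w $ 2" and "v = ?M $ 2 $ 1 * ?w $ 1 + ?M $ 2 $ 2 * ?w $ 2"
  have e: "a $ 1 * u + a $ 2 * v = met ?M a ?w" for a by (simp add: u_def v_def met_2 algebra_simps)
  have e1: "a1 $ 1 * u + a1 $ 2 * v = 0" "a2 $ 1 * u + a2 $ 2 * v = 0" "?w $ 1 * u + ?w $ 2 * v = 1"
    unfolding e by (rule a1(2), rule a2(2), rule w_unit[OF cs xi])
  have "(a1 $ 1 * a2 $ 2 - a2 $ 1 * a1 $ 2) * (?w $ 1 * u + ?w $ 2 * v) = 0"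
    using e1(1,2) by algebra
  then show "K_ext AS AM g \<iota> N p = 0" unfolding e1(3) K by simp
qed

end

section \<open>The equation for the potential\<close>

lemma mem_box_2: "x \<in> box a b \<longleftrightarrow> x $ 1 \<in> {a $ 1<..<b $ 1} \<and> x $ 2 \<in> {a $ 2<..<b $ 2}"
  for x :: "real ^ 2"
  by (auto simp: mem_box_cart forall_2)

lemma vector_line: "vector [0, v] + t *\<^sub>R axis 1 1 = (vector [t, v] :: real ^ 2)"
  by (simp add: vec_eq_iff forall_2 axis_def)

lemma v_range_box:
  assumes "chart_img c = box a b" "x0 \<in> box a b"
  shows "v_range c = {a $ 2<..<b $ 2}"
proof
  show "v_range c \<subseteq> {a $ 2<..<b $ 2}" unfolding v_range_def assms(1) by (auto simp: mem_box_2)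
  show "{a $ 2<..<b $ 2} \<subseteq> v_range c"
  proof
    fix v assume "v \<in> {a $ 2<..<b $ 2}"
    then have "(vector [x0 $ 1, v] :: real ^ 2) \<in> chart_img c" using assms by (simp add: mem_box_2)
    then show "v \<in> v_range c" unfolding v_range_def by (rule image_eqI[rotated]) simp
  qed
qed

lemma has_real_derivative_u:
  fixes F :: "real ^ 2 \<Rightarrow> real"
  assumes "F differentiable (at (vector [t, v]))"
  shows "((\<lambda>t. F (vector [t, v])) has_real_derivative fD F (vector [t, v]) (axis 1 1)) (at t)"
  using has_real_derivative_line[of F "vector [0, v]" t "axis 1 1"] assms unfolding vector_line by blast

text \<open>Horizontal sections of a box are intervals, on which a vanishing derivative means
  constancy; this is why chart images are kept to be boxes.\<close>

lemma box_u_constant: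
  fixes F :: "real ^ 2 \<Rightarrow> real"
  assumes F: "\<And>x. x \<in> box a b \<Longrightarrow> F differentiable (at x)" "\<And>x. x \<in> box a b \<Longrightarrow> fD F x (axis 1 1) = 0"
    and x: "x \<in> box a b" "y \<in> box a b" "x $ 2 = y $ 2"
  shows "F x = F y"
proof -
  let ?v = "x $ 2"
  have in_box: "(vector [t, ?v] :: real ^ 2) \<in> box a b" if "t \<in> {a $ 1<..<b $ 1}" for t
    using that x by (simp add: mem_box_2)
  have "((\<lambda>t. F (vector [t, ?v])) has_field_derivative 0) (at t within {a $ 1<..<b $ 1})" if "t \<in> {a $ 1<..<b $ 1}" for t
    using has_real_derivative_u[OF F(1)[OF in_box[OF that]]] F(2)[OF in_box[OF that]]
    by (simp add: has_field_derivative_at_within)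
  from has_field_derivative_zero_constant[OF convex_real_interval(8) this]
  obtain c where c: "\<And>t. t \<in> {a $ 1<..<b $ 1} \<Longrightarrow> F (vector [t, ?v]) = c" by blast
  have 1: "F (vector [x $ 1, x $ 2]) = c" by (rule c) (use x in \<open>simp add: mem_box_2\<close>)
  have "F (vector [y $ 1, x $ 2]) = c" by (rule c) (use x in \<open>simp add: mem_box_2\<close>)
  then have 2: "F (vector [y $ 1, y $ 2]) = c" unfolding x(3) .
  show ?thesis using 1 2 unfolding vector_2_eta by (rule trans[OF _ sym])
qed

lemma smooth_on_slice:
  fixes F :: "real ^ 2 \<Rightarrow> 'a::real_normed_vector"
  assumes "smooth_on (box a b) F" "u0 \<in> {a $ 1<..<b $ 1}"
  shows "smooth_on {a $ 2<..<b $ 2} (\<lambda>v. F (vector [u0, v]))"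
  by (rule smooth_on_compose[OF assms(1) smooth_on_vector2[OF _ smooth_on_const smooth_on_id] _ open_box])
    (use assms(2) in \<open>auto simp: mem_box_2\<close>)

lemma smooth_on_slice_u:
  fixes F :: "real ^ 2 \<Rightarrow> 'a::real_normed_vector"
  assumes "smooth_on (box a b) F" "v \<in> {a $ 2<..<b $ 2}"
  shows "smooth_on {a $ 1<..<b $ 1} (\<lambda>u. F (vector [u, v]))"
  by (rule smooth_on_compose[OF assms(1) smooth_on_vector2[OF _ smooth_on_id smooth_on_const] _ open_box])
    (use assms(2) in \<open>auto simp: mem_box_2\<close>)

lemma smooth_on_of_real:
  assumes "open S" "smooth_on S f"
  shows "smooth_on S (\<lambda>x. complex_of_real (f x))"
  by (rule smooth_on_linear_compose[OF bounded_linear_of_real assms])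

text \<open>For each sign of \<open>K0\<close> a substitution trivialises the Riccati equation on
  the lines of constant \<open>v\<close>, and the integration constant is \<open>q\<close>. It is
  smooth in \<open>v\<close> because it is computed from the values on the slice
  \<open>u = u0\<close>.\<close>

lemma potential_formI:
  fixes c :: "('s, 2) chart" and f :: "'s \<Rightarrow> real"
  assumes img: "chart_img c = box a b" and x0: "x0 \<in> box a b"
    and sF: "smooth_on (box a b) (\<lambda>x. f (chart_inv c x))" and f0: "\<And>p. f p \<noteq> 0"
    and ode: "\<And>x. x \<in> box a b \<Longrightarrow> fD (\<lambda>x. f (chart_inv c x)) x (axis 1 1) = - K0 - (f (chart_inv c x))\<^sup>2"
  shows "potential_form c f K0"
proof -
  define F where "F = (\<lambda>x. f (chart_inv c x))"
  let ?B = "box a b" and ?J = "{a $ 2<..<b $ 2}" and ?I = "{a $ 1<..<b $ 1}"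
  note oB = open_box[of a b]
  have F: "smooth_on ?B F" using sF by (simp add: F_def)
  have F0: "F x \<noteq> 0" for x unfolding F_def by (rule f0)
  have Fd: "F differentiable (at x)" if "x \<in> ?B" for x by (rule smooth_on_differentiable[OF F that])
  have Fu: "fD F x (axis 1 1) = - K0 - (F x)\<^sup>2" if "x \<in> ?B" for x using ode[OF that] by (simp add: F_def)
  have vr: "v_range c = ?J" by (rule v_range_box[OF img x0])
  define u0 where "u0 = x0 $ 1"
  have u0: "u0 \<in> ?I" using x0 by (simp add: u0_def mem_box_2)
  have in_box: "(vector [u, v] :: real ^ 2) \<in> ?B" if "u \<in> ?I" "v \<in> ?J" for u v
    using that by (simp add: mem_box_2)
  have bx: "x $ 1 \<in> ?I" "x $ 2 \<in> ?J" if "x \<in> ?B" for x using that by (auto simp: mem_box_2)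
  have sx1: "smooth_on ?B (\<lambda>x::real ^ 2. x $ 1)" by (rule smooth_on_bounded_linear[OF bounded_linear_vec_nth])
  have d1: "fD (\<lambda>x::real ^ 2. x $ 1) x (axis 1 1) = 1" for x by (simp add: fD_linear[OF bounded_linear_vec_nth] axis_def)
  have der_u: "((\<lambda>t. F (vector [t, v])) has_real_derivative - K0 - (F (vector [t, v]))\<^sup>2) (at t)"
    if "t \<in> ?I" "v \<in> ?J" for t v
    using has_real_derivative_u[OF Fd[OF in_box[OF that]]] Fu[OF in_box[OF that]] by simp
  have const: "\<phi> x = \<phi> (vector [u0, x $ 2])"
    if s: "smooth_on ?B \<phi>" and x: "x \<in> ?B"
      and d: "\<And>t v. t \<in> ?I \<Longrightarrow> v \<in> ?J \<Longrightarrow> ((\<lambda>t. \<phi> (vector [t, v])) has_real_derivative 0) (at t)"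
    for \<phi> :: "real ^ 2 \<Rightarrow> real" and x
  proof (rule box_u_constant[OF _ _ x in_box[OF u0 bx(2)[OF x]]])
    show "\<phi> differentiable (at y)" if "y \<in> ?B" for y by (rule smooth_on_differentiable[OF s that])
    show "fD \<phi> y (axis 1 1) = 0" if y: "y \<in> ?B" for y
      using DERIV_unique[OF has_real_derivative_u[of \<phi> "y $ 1" "y $ 2"] d[OF bx[OF y]]]
        smooth_on_differentiable[OF s y] by (simp add: vector_2_eta)
  qed simp
  show ?thesis
    unfolding potential_form_def vr img
  proof (intro conjI impI)
    assume K: "K0 > 0"
    define k where "k = sqrt K0"
    have k: "k > 0" "k * k = K0" using K by (auto simp: k_def)
    \<comment> \<open>First integral: along a line \<open>arctan (F / k)\<close> decreases at the
      constant rate \<open>k\<close>.\<close>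
    define \<phi> where "\<phi> = (\<lambda>x. arctan (F x * inverse k) + k * x $ 1)"
    have s\<phi>: "smooth_on ?B \<phi>" unfolding \<phi>_def
      by (rule smooth_on_add[OF oB smooth_on_arctan[OF oB smooth_on_mult[OF oB F smooth_on_const]]
            smooth_on_mult[OF oB smooth_on_const sx1]])
    have c\<phi>: "\<phi> x = \<phi> (vector [u0, x $ 2])" if "x \<in> ?B" for x
    proof (rule const[OF s\<phi> that])
      fix t v assume tv: "t \<in> ?I" "v \<in> ?J"
      let ?F = "F (vector [t, v])"
      have pos: "K0 + ?F\<^sup>2 > 0" using K by (simp add: add_pos_nonneg)
      have "((\<lambda>t. \<phi> (vector [t, v])) has_real_derivative
          inverse (1 + (?F * inverse k)\<^sup>2) * ((- K0 - ?F\<^sup>2) * inverse k) + k) (at t)"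
        unfolding \<phi>_def vector_2
        by (rule derivative_eq_intros der_u[OF tv] refl | simp)+
      moreover have "inverse (1 + (?F * inverse k)\<^sup>2) * ((- K0 - ?F\<^sup>2) * inverse k) + k = 0"
      proof -
        define s where "s = K0 + ?F\<^sup>2"
        have s: "s > 0" using pos by (simp add: s_def)
        have e: "1 + (?F * inverse k)\<^sup>2 = s / K0"
          using K k by (simp add: s_def field_simps power2_eq_square)
        have n: "- K0 - ?F\<^sup>2 = - s" by (simp add: s_def)
        have "inverse (1 + (?F * inverse k)\<^sup>2) * ((- K0 - ?F\<^sup>2) * inverse k) = - (K0 / k)"
          unfolding e n using s k(1) K by (simp add: field_simps)
        also have "K0 / k = k" using k by (simp add: field_simps)
        finally show ?thesis by simp
      qed
      ultimately show "((\<lambda>t. \<phi> (vector [t, v])) has_real_derivative 0) (at t)" by simp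
    qed
    show "\<exists>q. smooth_on ?J q \<and> (\<forall>x\<in>?B. f (chart_inv c x) = sqrt K0 * tan (q (x $ 2) - sqrt K0 * x $ 1))"
    proof (intro exI conjI ballI)
      show "smooth_on ?J (\<lambda>v. \<phi> (vector [u0, v]))" by (rule smooth_on_slice[OF s\<phi> u0])
      fix x assume x: "x \<in> ?B"
      have "\<phi> (vector [u0, x $ 2]) - sqrt K0 * x $ 1 = arctan (F x * inverse k)"
        unfolding c\<phi>[OF x, symmetric] by (simp add: \<phi>_def k_def)
      then show "f (chart_inv c x) = sqrt K0 * tan (\<phi> (vector [u0, x $ 2]) - sqrt K0 * x $ 1)"
        using k(1) by (simp add: tan_arctan F_def flip: k_def)
    qed
  next
    assume K: "K0 = 0"
    \<comment> \<open>First integral: along a line \<open>1 / F\<close> increases at rate 1.\<close>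
    define \<phi> where "\<phi> = (\<lambda>x. inverse (F x) - x $ 1)"
    have s\<phi>: "smooth_on ?B \<phi>" unfolding \<phi>_def
      by (rule smooth_on_diff[OF oB smooth_on_inverse[OF oB F F0] sx1])
    have c\<phi>: "\<phi> x = \<phi> (vector [u0, x $ 2])" if "x \<in> ?B" for x
    proof (rule const[OF s\<phi> that])
      fix t v assume tv: "t \<in> ?I" "v \<in> ?J"
      have "((\<lambda>t. \<phi> (vector [t, v])) has_real_derivative
          - (inverse (F (vector [t, v])) * (- K0 - (F (vector [t, v]))\<^sup>2) * inverse (F (vector [t, v]))) - 1) (at t)"
        unfolding \<phi>_def vector_2
        by (rule DERIV_diff[OF DERIV_inverse'[OF der_u[OF tv] F0] DERIV_ident])
      moreover have "- (inverse (F (vector [t, v])) * (- K0 - (F (vector [t, v]))\<^sup>2) * inverse (F (vector [t, v]))) - 1 = 0"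
        using F0[of "vector [t, v]"] by (simp add: K power2_eq_square field_simps)
      ultimately show "((\<lambda>t. \<phi> (vector [t, v])) has_real_derivative 0) (at t)" by (simp only:)
    qed
    show "\<exists>q. smooth_on ?J q \<and> (\<forall>x\<in>?B. f (chart_inv c x) = 1 / (x $ 1 + q (x $ 2)))"
    proof (intro exI conjI ballI)
      show "smooth_on ?J (\<lambda>v. \<phi> (vector [u0, v]))" by (rule smooth_on_slice[OF s\<phi> u0])
      fix x assume x: "x \<in> ?B"
      show "f (chart_inv c x) = 1 / (x $ 1 + \<phi> (vector [u0, x $ 2]))"
        unfolding c\<phi>[OF x, symmetric] by (simp add: \<phi>_def F_def inverse_eq_divide)
    qed
  next
    assume K: "K0 < 0"
    define k where "k = sqrt (- K0)"
    have k: "k > 0" "k * k = - K0" using K by (auto simp: k_def)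
    \<comment> \<open>\<open>F\<close> has no zero and the box is connected, so the sign \<epsilon>
      of \<open>F\<close> is constant; the constant alternative therefore has the same sign on all
      lines.\<close>
    have "connected (F ` ?B)" by (rule connected_continuous_image[OF smooth_on_continuous[OF F] convex_connected[OF convex_box(2)]])
    then have ivl: "is_interval (F ` ?B)" by (simp add: is_interval_connected_1)
    define \<epsilon> where "\<epsilon> = sgn (F x0)"
    have eps: "\<epsilon> \<in> {1, -1}" using F0[of x0] by (auto simp: \<epsilon>_def sgn_if)
    have sgnF: "sgn (F x) = \<epsilon>" if x: "x \<in> ?B" for x
    proof (rule ccontr)
      assume ne: "sgn (F x) \<noteq> \<epsilon>"
      have "0 \<in> F ` ?B"
      proof (cases "F x > 0")
        case True
        then have "F x0 \<le> 0" using ne by (auto simp: \<epsilon>_def sgn_if split: if_splits)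
        then show ?thesis using mem_is_interval_1_I[OF ivl imageI[OF x0] imageI[OF x], of 0] True by simp
      next
        case False
        then have "F x0 \<ge> 0" using ne F0[of x] by (auto simp: \<epsilon>_def sgn_if split: if_splits)
        then show ?thesis using mem_is_interval_1_I[OF ivl imageI[OF x] imageI[OF x0], of 0] False by simp
      qed
      then show False using F0 by auto
    qed
    have sq: "F x = \<epsilon> * k" if "x \<in> ?B" "(F x)\<^sup>2 = k\<^sup>2" for x
    proof -
      have "\<bar>F x\<bar> = k" using that(2) k(1) by (metis abs_of_pos power2_eq_iff_nonneg abs_ge_zero power2_abs less_imp_le)
      then show ?thesis using sgnF[OF that(1)] by (metis mult_sgn_abs)
    qed
    have eps2: "\<epsilon> * \<epsilon> = 1" using eps by auto
    \<comment> \<open>The constant \<open>\<epsilon> * k\<close> solves the Riccati equation, and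
      the deviation of \<open>F\<close> from it solves a linear equation; so \<open>F\<close> takes
      this value on a whole line or nowhere on it.\<close>
    have line: "F (vector [t, v]) = \<epsilon> * k" if t1: "t1 \<in> ?I" "v \<in> ?J" "F (vector [t1, v]) = \<epsilon> * k" and t: "t \<in> ?I" for t t1 v
    proof -
      have "F (vector [t, v]) - \<epsilon> * k = (F (vector [t1, v]) - \<epsilon> * k) *
          exp (line_integral (\<lambda>s. - (F (vector [s, v]) + \<epsilon> * k)) t1 t)"
      proof (rule scalar_linear_ode[OF t1(1) t])
        show "continuous_on ?I (\<lambda>s. - (F (vector [s, v]) + \<epsilon> * k))"
          by (intro continuous_intros smooth_on_continuous[OF smooth_on_slice_u[OF F t1(2)]])
        fix s assume s: "s \<in> ?I"
        have "((\<lambda>t. F (vector [t, v]) - \<epsilon> * k) has_real_derivative (- K0 - (F (vector [s, v]))\<^sup>2) - 0) (at s)"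
          by (rule DERIV_diff[OF der_u[OF s t1(2)] DERIV_const])
        moreover have "(- K0 - (F (vector [s, v]))\<^sup>2) - 0 = - (F (vector [s, v]) + \<epsilon> * k) * (F (vector [s, v]) - \<epsilon> * k)"
        proof -
          have "\<epsilon> * k * (\<epsilon> * k) = - K0" using eps2 k(2) by (simp add: mult.left_commute mult.assoc[symmetric])
          then show ?thesis by (simp add: power2_eq_square algebra_simps)
        qed
        ultimately show "((\<lambda>t. F (vector [t, v]) - \<epsilon> * k) has_real_derivative
            - (F (vector [s, v]) + \<epsilon> * k) * (F (vector [s, v]) - \<epsilon> * k)) (at s)" by simp
      qed
      then show ?thesis using t1(3) by simp
    qed
    define F1 where "F1 = (\<lambda>v. F (vector [u0, v]))"
    have sF1: "smooth_on ?J F1" unfolding F1_def by (rule smooth_on_slice[OF F u0])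
    \<comment> \<open>The lines on which \<open>F\<close> differs from both constant solutions; by
      \<open>line\<close> it is enough to look at \<open>u = u0\<close>.\<close>
    define J where "J = ?J \<inter> (\<lambda>v. (F1 v)\<^sup>2 - k\<^sup>2) -` (- {0})"
    have J: "open J" unfolding J_def
      by (rule continuous_open_preimage) (auto intro!: continuous_intros smooth_on_continuous[OF sF1])
    have Jsub: "J \<subseteq> ?J" by (auto simp: J_def)
    have notJ: "F x = \<epsilon> * k" if x: "x \<in> ?B" and nJ: "x $ 2 \<notin> J" for x
    proof -
      have "(F (vector [u0, x $ 2]))\<^sup>2 = k\<^sup>2" using nJ bx(2)[OF x] by (simp add: J_def F1_def)
      then have "F (vector [u0, x $ 2]) = \<epsilon> * k" by (rule sq[OF in_box[OF u0 bx(2)[OF x]]])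
      from line[OF u0 bx(2)[OF x] this bx(1)[OF x]] show ?thesis by (simp add: vector_2_eta)
    qed
    have inJ: "F (vector [t, v]) \<noteq> k \<and> F (vector [t, v]) \<noteq> - k" if "t \<in> ?I" "v \<in> J" for t v
    proof -
      have v: "v \<in> ?J" using that Jsub by blast
      have "(F (vector [t, v]))\<^sup>2 \<noteq> k\<^sup>2"
      proof
        assume "(F (vector [t, v]))\<^sup>2 = k\<^sup>2"
        then have "F (vector [t, v]) = \<epsilon> * k" by (rule sq[OF in_box[OF that(1) v]])
        from line[OF that(1) v this u0] have "F1 v = \<epsilon> * k" by (simp add: F1_def)
        then have "(F1 v)\<^sup>2 = k\<^sup>2" using eps by auto
        then show False using that(2) by (simp add: J_def)
      qed
      then show ?thesis by auto
    qed
    \<comment> \<open>Moebius transform that sends the constant solutions \<open>- k\<close> and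
      \<open>k\<close> to 0 and infinity. With \<open>F = k * tanh z\<close> it equals
      \<open>exp (2 * z)\<close>, so along a line it solves the linear equation with coefficient
      \<open>2 * k\<close>.\<close>
    define R where "R = (\<lambda>x. (k + F x) / (k - F x))"
    have Rexp: "R (vector [t, v]) = R (vector [u0, v]) * exp (2 * k * (t - u0))" if t: "t \<in> ?I" and v: "v \<in> J" for t v
    proof -
      have v': "v \<in> ?J" using v Jsub by blast
      have "R (vector [t, v]) = R (vector [u0, v]) * exp (line_integral (\<lambda>s. 2 * k) u0 t)"
      proof (rule scalar_linear_ode[OF u0 t])
        fix s assume s: "s \<in> ?I"
        let ?F = "F (vector [s, v])"
        have ne: "k - ?F \<noteq> 0" using inJ[OF s v] by auto
        have "((\<lambda>t. k + F (vector [t, v])) has_real_derivative 0 + (- K0 - ?F\<^sup>2)) (at s)"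
          by (rule DERIV_add[OF DERIV_const der_u[OF s v']])
        moreover have "((\<lambda>t. k - F (vector [t, v])) has_real_derivative 0 - (- K0 - ?F\<^sup>2)) (at s)"
          by (rule DERIV_diff[OF DERIV_const der_u[OF s v']])
        ultimately have "((\<lambda>t. R (vector [t, v])) has_real_derivative
            ((0 + (- K0 - ?F\<^sup>2)) * (k - ?F) - (k + ?F) * (0 - (- K0 - ?F\<^sup>2))) / ((k - ?F) * (k - ?F))) (at s)"
          unfolding R_def by (rule DERIV_divide) (rule ne)
        moreover have "((0 + (- K0 - ?F\<^sup>2)) * (k - ?F) - (k + ?F) * (0 - (- K0 - ?F\<^sup>2))) / ((k - ?F) * (k - ?F)) =
            2 * k * R (vector [s, v])"
        proof -
          have "(0 + (- K0 - ?F\<^sup>2)) * (k - ?F) - (k + ?F) * (0 - (- K0 - ?F\<^sup>2)) = 2 * k * ((k + ?F) * (k - ?F))"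
            unfolding k(2)[symmetric] by (simp add: power2_eq_square algebra_simps)
          then show ?thesis using ne by (simp add: R_def)
        qed
        ultimately show "((\<lambda>t. R (vector [t, v])) has_real_derivative 2 * k * R (vector [s, v])) (at s)" by simp
      qed simp
      then show ?thesis by (simp add: line_integral_def mult.commute)
    qed
    define R0 where "R0 = (\<lambda>v. R (vector [u0, v]))"
    have R0: "R0 v \<noteq> 0" if "v \<in> J" for v using inJ[OF u0 that] by (auto simp: R0_def R_def)
    have sR0: "smooth_on J R0"
    proof -
      note s = smooth_on_subset[OF sF1 Jsub]
      have "smooth_on J (\<lambda>v. (k + F1 v) / (k - F1 v))"
        by (rule smooth_on_divide[OF J smooth_on_add[OF J smooth_on_const s] smooth_on_diff[OF J smooth_on_const s]])
          (use inJ[OF u0] in \<open>auto simp: F1_def\<close>)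
      then show ?thesis unfolding R0_def R_def F1_def .
    qed
    \<comment> \<open>Half a logarithm of \<open>R0\<close>, shifted from \<open>u0\<close> to the
      origin of \<open>u\<close>. The square inside \<open>ln\<close> yields the absolute value, and
      \<open>\<i> * (pi / 2)\<close> accounts for negative \<open>R0\<close>, i.e. for \<bar>F\<bar>
      > k, where tanh becomes coth.\<close>
    define q where "q = (\<lambda>v. complex_of_real ((1/4) * ln (R0 v * R0 v) - k * u0) + (if R0 v > 0 then 0 else \<i> * (pi / 2)))"
    have sq': "smooth_on J q"
    proof (rule smooth_on_open_cover)
      fix v assume v: "v \<in> J"
      have s1: "smooth_on J (\<lambda>v. complex_of_real ((1/4) * ln (R0 v * R0 v) - k * u0))"
        by (rule smooth_on_of_real[OF J smooth_on_diff[OF J smooth_on_mult[OF J smooth_on_const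
                smooth_on_ln[OF J smooth_on_mult[OF J sR0 sR0]]] smooth_on_const]])
          (use R0 in \<open>auto simp: zero_less_mult_iff linorder_neq_iff\<close>)
      \<comment> \<open>\<open>R0\<close> has no zero on \<open>J\<close> and keeps its sign near
        \<open>v\<close>, so the choice of branch is locally constant.\<close>
      define P where "P = (if R0 v > 0 then J \<inter> R0 -` {0<..} else J \<inter> R0 -` {..<0})"
      have oP: "open P" unfolding P_def
        by (auto intro!: continuous_open_preimage[OF smooth_on_continuous[OF sR0] J])
      have vP: "v \<in> P" using v R0[OF v] by (auto simp: P_def)
      have PJ: "P \<subseteq> J" by (auto simp: P_def)
      have s2: "smooth_on P (\<lambda>y. complex_of_real ((1/4) * ln (R0 y * R0 y) - k * u0) + (if R0 v > 0 then 0 else \<i> * (pi / 2)))"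
        by (rule smooth_on_add[OF oP smooth_on_subset[OF s1 PJ] smooth_on_const])
      have "smooth_on P q"
        by (rule smooth_on_eq[OF s2 oP]) (auto simp: q_def P_def split: if_splits)
      then show "\<exists>U. open U \<and> v \<in> U \<and> smooth_on U q" using oP vP by blast
    qed
    have expq: "exp (2 * (q v + of_real (k * t))) = complex_of_real (R (vector [t, v]))" if t: "t \<in> ?I" and v: "v \<in> J" for t v
    proof -
      have "2 * (q v + of_real (k * t)) = of_real ((1/2) * ln (R0 v * R0 v) + 2 * k * (t - u0)) + (if R0 v > 0 then 0 else \<i> * pi)"
        by (simp add: q_def algebra_simps)
      then have "exp (2 * (q v + of_real (k * t))) = of_real (exp ((1/2) * ln (R0 v * R0 v)) * exp (2 * k * (t - u0))) * (if R0 v > 0 then 1 else -1)"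
        by (simp add: exp_add exp_of_real[symmetric] del: exp_of_real)
      also have "exp ((1/2) * ln (R0 v * R0 v)) = \<bar>R0 v\<bar>"
      proof -
        have "ln (R0 v * R0 v) = 2 * ln \<bar>R0 v\<bar>"
          using R0[OF v] ln_mult[of "\<bar>R0 v\<bar>" "\<bar>R0 v\<bar>"] by simp
        then show ?thesis using R0[OF v] by simp
      qed
      finally show ?thesis unfolding Rexp[OF t v] R0_def[symmetric] using R0[OF v] by (auto simp: R0_def)
    qed
    have tanh: "complex_of_real (F x) = of_real k * tanh (q (x $ 2) + of_real (k * x $ 1))" if x: "x \<in> ?B" and v: "x $ 2 \<in> J" for x
    proof -
      let ?z = "q (x $ 2) + of_real (k * x $ 1)"
      have e: "exp (2 * ?z) = of_real (R x)" using expq[OF bx(1)[OF x] v] unfolding vector_2_eta .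
      have ne: "k - F x \<noteq> 0" using inJ[OF bx(1)[OF x] v] unfolding vector_2_eta by simp
      have ez: "exp ?z * exp ?z = of_real (R x)" using e unfolding mult_2 exp_add[of ?z ?z] .
      have R1: "R x + 1 = 2 * k / (k - F x)" using ne by (simp add: R_def field_simps)
      then have Rn: "R x + 1 \<noteq> 0" using ne k(1) by simp
      have "tanh ?z = (exp ?z - inverse (exp ?z)) / (exp ?z + inverse (exp ?z))"
        unfolding tanh_altdef exp_minus ..
      \<comment> \<open>Expanding the fraction by \<open>exp ?z\<close> writes tanh through
        \<open>exp (2 * z)\<close>, which is \<open>R\<close>.\<close>
      also have "\<dots> = (exp ?z * exp ?z - 1) / (exp ?z * exp ?z + 1)"
      proof -
        have n: "exp ?z \<noteq> 0" by simp
        have "(exp ?z - inverse (exp ?z)) / (exp ?z + inverse (exp ?z)) =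
            (exp ?z * (exp ?z - inverse (exp ?z))) / (exp ?z * (exp ?z + inverse (exp ?z)))"
          by (rule mult_divide_mult_cancel_left[OF n, symmetric])
        then show ?thesis using n by (simp add: right_diff_distrib distrib_left)
      qed
      also have "\<dots> = of_real ((R x - 1) / (R x + 1))" unfolding ez by simp
      also have "(R x - 1) / (R x + 1) = F x / k"
      proof -
        have "R x - 1 = 2 * F x / (k - F x)" using ne by (simp add: R_def field_simps)
        then show ?thesis unfolding R1 using ne k(1) by simp
      qed
      finally show ?thesis using k(1) by simp
    qed
    show "\<exists>J (q::real \<Rightarrow> complex) \<epsilon>. J \<subseteq> ?J \<and> open J \<and> smooth_on J q \<and> \<epsilon> \<in> {1, -1} \<and>
        (\<forall>x\<in>?B. if x $ 2 \<in> J
           then complex_of_real (f (chart_inv c x)) =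
             of_real (sqrt (- K0)) * tanh (q (x $ 2) + of_real (sqrt (- K0) * x $ 1))
           else f (chart_inv c x) = \<epsilon> * sqrt (- K0))"
    proof (rule exI[of _ J], rule exI[of _ q], rule exI[of _ \<epsilon>], intro conjI ballI)
      fix x assume x: "x \<in> ?B"
      show "if x $ 2 \<in> J
           then complex_of_real (f (chart_inv c x)) =
             of_real (sqrt (- K0)) * tanh (q (x $ 2) + of_real (sqrt (- K0) * x $ 1))
           else f (chart_inv c x) = \<epsilon> * sqrt (- K0)"
      proof (cases "x $ 2 \<in> J")
        case True
        show ?thesis using tanh[OF x True] unfolding if_P[OF True] F_def k_def .
      next
        case False
        show ?thesis using notJ[OF x False] unfolding if_not_P[OF False] F_def k_def .
      qed
    qed (fact Jsub J sq' eps)+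
  qed
qed

text \<open>The formula for \<open>f\<close> is differentiated along the horizontal line through
  \<open>x\<close> at time 0, so any open chart image will do. Nonvanishing of \<open>f\<close>
  excludes poles: there the quotients would have the value 0, by the convention on division by
  zero.\<close>

lemma potential_formD:
  fixes c :: "('s, 2) chart" and f :: "'s \<Rightarrow> real"
  assumes S: "open (chart_img c)" and x: "x \<in> chart_img c"
    and sF: "smooth_on (chart_img c) (\<lambda>x. f (chart_inv c x))" and f0: "\<And>p. f p \<noteq> 0"
    and pf: "potential_form c f K0"
  shows "fD (\<lambda>x. f (chart_inv c x)) x (axis 1 1) = - K0 - (f (chart_inv c x))\<^sup>2"
proof -
  define F where "F = (\<lambda>x. f (chart_inv c x))"
  define l where "l = (\<lambda>t. x + t *\<^sub>R axis 1 (1::real))"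
  have l: "l t $ 1 = x $ 1 + t" "l t $ 2 = x $ 2" "l 0 = x" for t by (simp_all add: l_def axis_def)
  have "continuous_on UNIV l" unfolding l_def by (intro continuous_intros)
  then have T: "open (l -` chart_img c)" by (rule open_vimage[OF S])
  have T0: "0 \<in> l -` chart_img c" using x by (simp add: l)
  have d: "((\<lambda>t. F (l t)) has_real_derivative fD F x (axis 1 1)) (at 0)"
    using has_real_derivative_line[of F x 0 "axis 1 1"] smooth_on_differentiable[OF sF x] by (simp add: l_def F_def)
  have F0: "F x \<noteq> 0" unfolding F_def by (rule f0)
  have main: "fD F x (axis 1 1) = D"
    if h: "(h has_real_derivative D) (at 0)" and e: "\<And>t. l t \<in> chart_img c \<Longrightarrow> h t = F (l t)" for h D
  proof -
    have "((\<lambda>t. F (l t)) has_real_derivative D) (at 0)"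
      by (rule has_field_derivative_transform_within_open[OF h T T0]) (simp add: e)
    then show ?thesis by (rule DERIV_unique[OF d])
  qed
  have "fD F x (axis 1 1) = - K0 - (F x)\<^sup>2"
  proof -
    consider "K0 > 0" | "K0 = 0" | "K0 < 0" by linarith
    then show ?thesis
    proof cases
      case 1
      then obtain q where q: "\<And>x. x \<in> chart_img c \<Longrightarrow> F x = sqrt K0 * tan (q (x $ 2) - sqrt K0 * x $ 1)"
        using pf unfolding potential_form_def F_def by blast
      define k where "k = sqrt K0"
      have k: "k * k = K0" using 1 by (simp add: k_def)
      let ?y = "q (x $ 2) - k * x $ 1"
      have Fx: "F x = k * tan ?y" using q[OF x] by (simp add: k_def)
      have c0: "cos ?y \<noteq> 0" using F0 Fx by (auto simp: tan_def)
      have "((\<lambda>t. k * tan (q (x $ 2) - k * (x $ 1 + t))) has_real_derivative k * (inverse ((cos ?y)\<^sup>2) * - k)) (at 0)"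
        using c0 by (auto intro!: derivative_eq_intros)
      then have "fD F x (axis 1 1) = k * (inverse ((cos ?y)\<^sup>2) * - k)"
        by (rule main) (simp add: q l k_def)
      also have "inverse ((cos ?y)\<^sup>2) = 1 + (tan ?y)\<^sup>2" using tan_sec[OF c0] by (simp add: power_inverse)
      finally show ?thesis unfolding Fx k[symmetric] by (simp add: power2_eq_square algebra_simps)
    next
      case 2
      then obtain q where q: "\<And>x. x \<in> chart_img c \<Longrightarrow> F x = 1 / (x $ 1 + q (x $ 2))"
        using pf unfolding potential_form_def F_def by blast
      let ?y = "x $ 1 + q (x $ 2)"
      have Fx: "F x = 1 / ?y" using q[OF x] .
      have c0: "?y \<noteq> 0" using F0 Fx by auto
      have "((\<lambda>t. 1 / (x $ 1 + t + q (x $ 2))) has_real_derivative - (1 / (?y * ?y))) (at 0)"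
        using c0 by (auto intro!: derivative_eq_intros)
      then have "fD F x (axis 1 1) = - (1 / (?y * ?y))"
        by (rule main) (simp add: q l)
      then show ?thesis unfolding Fx 2 by (simp add: power2_eq_square)
    next
      case 3
      then obtain J and q :: "real \<Rightarrow> complex" and \<epsilon> where q: "\<epsilon> \<in> {1, -1::real}"
        "\<And>x. x \<in> chart_img c \<Longrightarrow> if x $ 2 \<in> J
           then complex_of_real (F x) = of_real (sqrt (- K0)) * tanh (q (x $ 2) + of_real (sqrt (- K0) * x $ 1))
           else F x = \<epsilon> * sqrt (- K0)"
        using pf unfolding potential_form_def F_def by blast
      define k where "k = sqrt (- K0)"
      have k: "k * k = - K0" using 3 by (simp add: k_def)
      show ?thesis
      proof (cases "x $ 2 \<in> J")
        case False
        have e: "F (l t) = \<epsilon> * k" if "l t \<in> chart_img c" for t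
          using q(2)[OF that] False by (simp add: l k_def)
        have "fD F x (axis 1 1) = 0" by (rule main[OF DERIV_const]) (simp add: e)
        moreover have "F x * F x = k * k" using e[of 0] x q(1) by (auto simp: l)
        ultimately show ?thesis using k by (simp add: power2_eq_square)
      next
        case True
        have e: "complex_of_real (F (l t)) = of_real k * tanh (q (x $ 2) + of_real (k * (x $ 1 + t)))" if "l t \<in> chart_img c" for t
          using q(2)[OF that] True by (simp add: l k_def)
        let ?y = "q (x $ 2) + of_real (k * x $ 1)"
        have Fx: "complex_of_real (F x) = of_real k * tanh ?y" using e[of 0] x by (simp add: l)
        have c0: "cosh ?y \<noteq> 0" using F0 Fx by (auto simp: tanh_def)
        \<comment> \<open>As \<open>q\<close> is complex, the derivative is taken in a complex
          variable and then restricted to real \<open>t\<close>.\<close>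
        have ch: "((\<lambda>z. of_real k * tanh (q (x $ 2) + of_real k * (of_real (x $ 1) + z))) has_field_derivative
            of_real k * ((1 - (tanh ?y)\<^sup>2) * of_real k)) (at (of_real 0))"
          using c0 by (auto intro!: derivative_eq_intros)
        have "((\<lambda>t. of_real k * tanh (q (x $ 2) + of_real k * (of_real (x $ 1) + of_real t))) has_vector_derivative
            of_real k * ((1 - (tanh ?y)\<^sup>2) * of_real k)) (at 0)"
          using has_vector_derivative_real_field[OF ch] by simp
        then have "((\<lambda>t. complex_of_real (F (l t))) has_vector_derivative of_real k * ((1 - (tanh ?y)\<^sup>2) * of_real k)) (at 0)"
          by (rule has_vector_derivative_transform_within_open[OF _ T T0]) (simp add: e)
        moreover have "((\<lambda>t. complex_of_real (F (l t))) has_vector_derivative of_real (fD F x (axis 1 1))) (at 0)"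
          using d by (rule has_vector_derivative_of_real)
        ultimately have "complex_of_real (fD F x (axis 1 1)) = of_real k * ((1 - (tanh ?y)\<^sup>2) * of_real k)"
          by (metis vector_derivative_at)
        also have "\<dots> = of_real k * of_real k - (of_real k * tanh ?y)\<^sup>2"
          by (simp add: power2_eq_square algebra_simps)
        also have "\<dots> = complex_of_real (- K0 - (F x)\<^sup>2)" unfolding Fx[symmetric] k[symmetric] by simp
        finally show ?thesis by (simp only: of_real_eq_iff)
      qed
    qed
  qed
  then show ?thesis by (simp add: F_def)
qed

section \<open>Adapted coordinates and the ruling\<close>

text \<open>Changing a coordinate system by a diffeomorphism of part of its image stays in the
  maximal atlas. Flow boxes and shears, constructed in the plane, become coordinate systems of the
  surface in this way.\<close>

lemma chart_compose:
  fixes A :: "('a::topological_space, 'n::finite) chart set"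
  assumes at: "smooth_atlas A" and c: "coordinate_system A c"
    and U: "open U" "U \<subseteq> chart_img c" and W: "open W" and hom: "homeomorphism U W T h"
    and sT: "smooth_on U T" and sh: "smooth_on W h"
  obtains c' where "coordinate_system A c'" "chart_img c' = W"
    "\<And>p. p \<in> chart_dom c' \<longleftrightarrow> p \<in> chart_dom c \<and> chart_map c p \<in> U"
    "\<And>p. chart_map c' p = T (chart_map c p)"
    "\<And>p v. p \<in> chart_dom c' \<Longrightarrow> fD (transition c c') (chart_map c p) v = fD T (chart_map c p) v"
proof -
  note ch = cs_chart[OF at c]
  define c' :: "('a, 'n) chart" where "c' = (chart_dom c \<inter> chart_map c -` U, \<lambda>p. T (chart_map c p))"
  have dom: "p \<in> chart_dom c' \<longleftrightarrow> p \<in> chart_dom c \<and> chart_map c p \<in> U" for p by (simp add: c'_def)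
  have dom': "chart_dom c' = chart_dom c \<inter> chart_map c -` U" by (simp add: c'_def)
  have mp: "chart_map c' p = T (chart_map c p)" for p by (simp add: c'_def)
  have h1: "h (T x) = x" "T x \<in> W" if "x \<in> U" for x using hom that by (auto simp: homeomorphism_def)
  have h2: "T (h y) = y" "h y \<in> U" if "y \<in> W" for y using hom that by (auto simp: homeomorphism_def)
  have q: "chart_inv c (h y) \<in> chart_dom c'" "chart_map c (chart_inv c (h y)) = h y" if "y \<in> W" for y
  proof -
    have hi: "h y \<in> chart_img c" using h2(2)[OF that] U(2) by blast
    show "chart_map c (chart_inv c (h y)) = h y" by (rule map_inv[OF ch hi])
    then show "chart_inv c (h y) \<in> chart_dom c'" using h2(2)[OF that] inv_dom[OF ch hi] by (simp add: dom)
  qed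
  have img: "chart_img c' = W"
  proof
    show "chart_img c' \<subseteq> W" unfolding chart_img_def using h1(2) by (auto simp: dom mp)
    show "W \<subseteq> chart_img c'"
    proof
      fix y assume y: "y \<in> W"
      have "chart_map c' (chart_inv c (h y)) = y" unfolding mp q(2)[OF y] by (rule h2(1)[OF y])
      then show "y \<in> chart_img c'" unfolding chart_img_def using q(1)[OF y] by (metis imageI)
    qed
  qed
  have inj: "inj_on (chart_map c') (chart_dom c')"
  proof (rule inj_onI)
    fix p r assume p: "p \<in> chart_dom c'" and r: "r \<in> chart_dom c'" and e: "chart_map c' p = chart_map c' r"
    have "h (T (chart_map c p)) = h (T (chart_map c r))" using e by (simp add: mp)
    then have "chart_map c p = chart_map c r" using h1(1) p r by (simp add: dom)
    then have "chart_inv c (chart_map c p) = chart_inv c (chart_map c r)" by simp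
    then show "p = r" using inv_map[OF ch] p r by (simp add: dom)
  qed
  have inv: "chart_inv c' y = chart_inv c (h y)" if y: "y \<in> W" for y
    unfolding chart_inv_def[of c']
    by (rule inv_into_f_eq[OF inj q(1)[OF y]]) (simp only: mp q(2)[OF y] h2(1)[OF y])
  have inv': "chart_inv c' (chart_map c' p) = p" if "p \<in> chart_dom c'" for p
    unfolding chart_inv_def by (rule inv_into_f_f[OF inj that])
  have od: "open (chart_dom c')"
    unfolding dom' by (rule continuous_open_preimage[OF cont_map[OF ch] chart_open[OF ch] U(1)])
  have "homeomorphism (chart_dom c') W (chart_map c') (chart_inv c')"
    unfolding homeomorphism_def
  proof (intro conjI ballI)
    show "chart_map c' ` chart_dom c' = W" using img by (simp add: chart_img_def)
    have sub: "chart_map c ` (chart_dom c') \<subseteq> U" by (auto simp: dom)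
    have "continuous_on (chart_dom c') (\<lambda>p. T (chart_map c p))"
      by (rule continuous_on_compose2[OF _ continuous_on_subset[OF cont_map[OF ch]] sub])
        (use hom in \<open>auto simp: homeomorphism_def dom\<close>)
    then show "continuous_on (chart_dom c') (chart_map c')" by (simp add: c'_def)
    show "chart_inv c' ` W = chart_dom c'"
    proof
      show "chart_inv c' ` W \<subseteq> chart_dom c'" using q(1) inv by auto
      show "chart_dom c' \<subseteq> chart_inv c' ` W"
      proof
        fix p assume p: "p \<in> chart_dom c'"
        have "chart_map c' p \<in> W" using h1(2) p by (simp add: dom mp)
        then show "p \<in> chart_inv c' ` W" using inv'[OF p] by (metis imageI)
      qed
    qed
    have "continuous_on W (\<lambda>y. chart_inv c (h y))"
      by (rule continuous_on_compose2[OF cont_inv[OF ch]])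
        (use hom U(2) in \<open>auto simp: homeomorphism_def\<close>)
    then show "continuous_on W (chart_inv c')" by (rule continuous_on_eq) (simp add: inv)
    show "chart_map c' (chart_inv c' y) = y" if "y \<in> W" for y
      unfolding inv[OF that] mp q(2)[OF that] by (rule h2(1)[OF that])
  qed (rule inv')
  then have ch': "is_chart c'" unfolding is_chart_def img using od W by blast
  have "smooth_compatible c' d" if d: "d \<in> A" for d
    unfolding smooth_compatible_def
  proof
    note cd = atlas_chart[OF at d]
    let ?S = "chart_map c' ` (chart_dom c' \<inter> chart_dom d)"
    have S: "open ?S" by (rule open_chart_image[OF ch' chart_open[OF cd]])
    have SW: "?S \<subseteq> W" using img by (auto simp: chart_img_def)
    have pt: "\<exists>p. y = T (chart_map c p) \<and> p \<in> chart_dom c \<and> p \<in> chart_dom d \<and> h y = chart_map c p \<and> chart_inv c' y = p"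
      if y: "y \<in> ?S" for y
    proof -
      obtain p where p: "y = chart_map c' p" "p \<in> chart_dom c'" "p \<in> chart_dom d" using y by blast
      show ?thesis using p inv'[OF p(2)] h1(1) by (intro exI[of _ p]) (simp add: dom mp)
    qed
    have hS: "h ` ?S \<subseteq> chart_map c ` (chart_dom c \<inter> chart_dom d)"
      using pt by (intro image_subsetI) (metis IntI imageI)
    have s: "smooth_on ?S (\<lambda>y. transition c d (h y))"
      by (rule smooth_on_compose[OF smooth_transition[OF at c atlas_cs[OF at d]] smooth_on_subset[OF sh SW] S
            open_chart_image[OF ch chart_open[OF cd]] hS])
    show "smooth_on ?S (transition c' d)"
    proof (rule smooth_on_eq[OF s S])
      fix y assume y: "y \<in> ?S"
      obtain p where p: "p \<in> chart_dom c" "h y = chart_map c p" "chart_inv c' y = p" using pt[OF y] by blast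
      show "transition c d (h y) = transition c' d y"
        unfolding p(2) transition_map[OF at ch p(1)] by (simp add: transition_def p(3))
    qed
    let ?R = "chart_map d ` (chart_dom c' \<inter> chart_dom d)"
    have R: "open ?R" using open_chart_image[OF cd od] by (simp add: Int_commute)
    have ptd: "transition d c y \<in> U \<and> transition d c' y = T (transition d c y) \<and> y \<in> chart_map d ` (chart_dom d \<inter> chart_dom c)"
      if y: "y \<in> ?R" for y
    proof -
      obtain p where p: "y = chart_map d p" "p \<in> chart_dom c'" "p \<in> chart_dom d" using y by blast
      show ?thesis unfolding p(1) transition_map[OF at cd p(3)] using p(2,3) by (auto simp: dom mp)
    qed
    have "?R \<subseteq> chart_map d ` (chart_dom d \<inter> chart_dom c)" using ptd by blast
    note sR = smooth_on_subset[OF smooth_transition[OF at atlas_cs[OF at d] c] this]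
    have "transition d c ` ?R \<subseteq> U" using ptd by blast
    from smooth_on_eq[OF smooth_on_compose[OF sT sR R U(1) this] R]
    show "smooth_on ?R (transition d c')" using ptd by (metis (no_types, lifting))
  qed
  then have cs: "coordinate_system A c'" using ch' by (simp add: coordinate_system_def)
  have "fD (transition c c') (chart_map c p) v = fD T (chart_map c p) v" if p: "p \<in> chart_dom c'" for p v
  proof -
    have pU: "chart_map c p \<in> U" using p by (simp add: dom)
    have "fD (transition c c') (chart_map c p) = fD T (chart_map c p)"
    proof (rule fD_cong_open[OF U(1) pU])
      fix y assume "y \<in> U"
      then have "y \<in> chart_img c" using U(2) by blast
      then show "transition c c' y = T y" by (simp add: transition_def mp map_inv[OF ch])
    qed
    then show ?thesis by simp
  qed
  from that[OF cs img dom mp this] show ?thesis .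
qed

section \<open>Flow boxes of the field and the ruling\<close>

context tangent_anti_torqued
begin

text \<open>Coordinates in which \<open>V\<close> is the first coordinate field; a box as image is
  what \<open>foliation_by_curves\<close> demands.\<close>

definition flow_chart :: "('s, 2) chart \<Rightarrow> bool" where
  "flow_chart c \<longleftrightarrow> coordinate_system AS c \<and> (\<exists>a b. chart_img c = box a b) \<and>
     (\<forall>x\<in>chart_img c. w c x = axis 1 1)"

lemma flow_chart_exists:
  obtains c where "flow_chart c" "p \<in> chart_dom c"
proof -
  let ?c = "chart_at AS p"
  note c0 = chart_at[OF at, of p]
  note cs = atlas_cs[OF at c0(1)]
  note ch = cs_chart[OF at cs]
  let ?x = "chart_map ?c p"
  have x: "?x \<in> chart_img ?c" by (rule map_img[OF ch c0(2)])
  have w0: "w ?c ?x \<noteq> 0"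
  proof
    assume "w ?c ?x = 0"
    then show False using w_unit[OF cs x] by (simp add: met_zero_left)
  qed
  obtain U a b and T h :: "real ^ 2 \<Rightarrow> real ^ 2" where 1: "open U" "?x \<in> U" "U \<subseteq> chart_img ?c" "homeomorphism U (box a b) T h"
    "smooth_on U T" "smooth_on (box a b) h" "\<And>x. x \<in> U \<Longrightarrow> fD T x (w ?c x) = axis 1 1"
    by (rule flow_box[OF img_open[OF ch] smooth_w[OF cs] x w0]) (rule that)
  obtain c where c: "coordinate_system AS c" "chart_img c = box a b"
    "\<And>p. p \<in> chart_dom c \<longleftrightarrow> p \<in> chart_dom ?c \<and> chart_map ?c p \<in> U"
    "\<And>p. chart_map c p = T (chart_map ?c p)"
    "\<And>p v. p \<in> chart_dom c \<Longrightarrow> fD (transition ?c c) (chart_map ?c p) v = fD T (chart_map ?c p) v"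
    by (rule chart_compose[OF at cs 1(1,3) open_box 1(4-6)]) (rule that)
  have "w c x = axis 1 1" if x: "x \<in> chart_img c" for x
  proof -
    obtain q where q: "x = chart_map c q" "q \<in> chart_dom c" using x unfolding chart_img_def by blast
    have q': "q \<in> chart_dom ?c" "chart_map ?c q \<in> U" using q(2) c(3) by auto
    show ?thesis unfolding q(1) w_change[OF cs q'(1) c(1) q(2)] c(5)[OF q(2)] by (rule 1(7)[OF q'(2)])
  qed
  then have "flow_chart c" unfolding flow_chart_def using c(1,2) by blast
  moreover have "p \<in> chart_dom c" using c(3) c0(2) 1(2) by simp
  ultimately show ?thesis by (rule that)
qed

text \<open>A transition between two such charts preserves \<partial>_u, so the derivative of its
  second component in \<open>u\<close> vanishes.\<close>

lemma flow_chart_transition: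
  assumes c: "flow_chart c" and d: "flow_chart d" and p: "p \<in> chart_dom c" "p \<in> chart_dom d"
  shows "\<exists>W h. open W \<and> p \<in> W \<and> W \<subseteq> chart_dom c \<inter> chart_dom d \<and>
    (\<forall>x\<in>W. chart_map d x $ 2 = h (chart_map c x $ 2))"
proof -
  have cs: "coordinate_system AS c" "coordinate_system AS d"
    and wc: "\<And>x. x \<in> chart_img c \<Longrightarrow> w c x = axis 1 1" and wd: "\<And>x. x \<in> chart_img d \<Longrightarrow> w d x = axis 1 1"
    using c d by (auto simp: flow_chart_def)
  note cc = cs_chart[OF at cs(1)] and cd = cs_chart[OF at cs(2)]
  let ?O = "chart_map c ` (chart_dom c \<inter> chart_dom d)"
  have O: "open ?O" by (rule open_chart_image[OF cc chart_open[OF cd]])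
  have pO: "chart_map c p \<in> ?O" using p by blast
  \<comment> \<open>Horizontal sections of the overlap may be disconnected; those of a box around
    the point are not.\<close>
  obtain a b where ab: "chart_map c p \<in> box a b" "box a b \<subseteq> ?O" by (rule open_contains_box[OF O pO])
  define \<tau> where "\<tau> = (\<lambda>x. transition c d x $ 2)"
  have st: "smooth_on ?O (transition c d)" by (rule smooth_transition[OF at cs])
  have dt: "transition c d differentiable (at x)" if "x \<in> box a b" for x
    by (rule smooth_on_differentiable[OF st]) (use that ab in blast)
  have d1: "\<tau> differentiable (at x)" if "x \<in> box a b" for x
    unfolding \<tau>_def by (rule smooth_on_differentiable[OF smooth_on_vec_nth[OF O st]]) (use that ab in blast)
  have d2: "fD \<tau> x (axis 1 1) = 0" if x: "x \<in> box a b" for x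
  proof -
    obtain q where q: "x = chart_map c q" "q \<in> chart_dom c" "q \<in> chart_dom d" using x ab by blast
    have "fD (transition c d) x (axis 1 1) = axis 1 1"
      using w_change[OF cs(1) q(2) cs(2) q(3)] wc[OF map_img[OF cc q(2)]] wd[OF map_img[OF cd q(3)]] q(1) by simp
    then show ?thesis unfolding \<tau>_def fD_vec_nth[OF dt[OF x]] by (simp add: axis_def)
  qed
  let ?W = "chart_dom c \<inter> chart_map c -` box a b"
  define h where "h = (\<lambda>s. \<tau> (vector [chart_map c p $ 1, s]))"
  have "open ?W" by (rule continuous_open_preimage[OF cont_map[OF cc] chart_open[OF cc] open_box])
  moreover have "p \<in> ?W" using p ab by blast
  moreover have "?W \<subseteq> chart_dom c \<inter> chart_dom d"
  proof
    fix x assume x: "x \<in> ?W"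
    then have "chart_map c x \<in> ?O" using ab by blast
    then show "x \<in> chart_dom c \<inter> chart_dom d"
      using x in_chart_image[OF cc, of "chart_map c x" "chart_dom d"] inv_map[OF cc] by auto
  qed
  moreover have "chart_map d x $ 2 = h (chart_map c x $ 2)" if x: "x \<in> ?W" for x
  proof -
    have "\<tau> (chart_map c x) = \<tau> (vector [chart_map c p $ 1, chart_map c x $ 2])"
      by (rule box_u_constant[OF d1 d2]) (use x ab(1) in \<open>auto simp: mem_box_2\<close>)
    then show ?thesis using transition_map[OF at cc, of x d] x by (simp add: \<tau>_def h_def)
  qed
  ultimately show ?thesis by blast
qed

text \<open>The velocity of a horizontal line is \<open>V\<close>, so its acceleration is the
  derivative of \<open>V\<close> along itself. The anti-torqued condition makes this zero, because a
  unit vector minus its projection to itself vanishes.\<close>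

lemma flow_line_geodesic:
  assumes c: "flow_chart c" and p: "p \<in> chart_dom c"
  shows "\<exists>I \<gamma>. continuous_on I \<gamma> \<and> \<gamma> ` I = plaque c p \<and> geodesic_on AM g I (\<iota> \<circ> \<gamma>)"
proof -
  obtain a b where cs: "coordinate_system AS c" and img: "chart_img c = box a b"
    and wc: "\<And>x. x \<in> chart_img c \<Longrightarrow> w c x = axis 1 1"
    using c by (auto simp: flow_chart_def)
  note cc = cs_chart[OF at cs]
  define s where "s = chart_map c p $ 2"
  have "chart_map c p \<in> box a b" using map_img[OF cc p] img by simp
  then have s: "s \<in> {a $ 2<..<b $ 2}" by (simp add: s_def mem_box_2)
  let ?I = "{a $ 1<..<b $ 1}"
  define l where "l = (\<lambda>t. vector [0, s] + t *\<^sub>R axis 1 (1::real) :: real ^ 2)"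
  define \<gamma> where "\<gamma> = (\<lambda>t. chart_inv c (l t))"
  have lv: "l t = vector [t, s]" for t unfolding l_def by (rule vector_line)
  have l_img: "l t \<in> chart_img c \<longleftrightarrow> t \<in> ?I" for t unfolding img lv mem_box_2 using s by simp
  have lc: "continuous_on X l" for X unfolding l_def by (intro continuous_intros)
  have sl: "smooth_on X l" if "open X" for X unfolding l_def
    by (rule smooth_on_add[OF that smooth_on_const smooth_on_scaleR[OF that smooth_on_id smooth_on_const]])
  have \<gamma>c: "continuous_on ?I \<gamma>" unfolding \<gamma>_def
    by (rule continuous_on_compose2[OF cont_inv[OF cc] lc]) (rule image_subsetI, rule l_img[THEN iffD2])
  have plq: "\<gamma> ` ?I = plaque c p"
  proof
    show "\<gamma> ` ?I \<subseteq> plaque c p"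
    proof (rule image_subsetI)
      fix t assume "t \<in> ?I"
      then have t: "l t \<in> chart_img c" using l_img by simp
      show "\<gamma> t \<in> plaque c p"
        unfolding plaque_def \<gamma>_def using inv_dom[OF cc t] map_inv[OF cc t] by (simp add: lv s_def)
    qed
    show "plaque c p \<subseteq> \<gamma> ` ?I"
    proof
      fix x assume "x \<in> plaque c p"
      then have x: "x \<in> chart_dom c" "chart_map c x $ 2 = s" by (auto simp: plaque_def s_def)
      have lx: "l (chart_map c x $ 1) = chart_map c x" unfolding lv x(2)[symmetric] vector_2_eta ..
      then have "chart_map c x $ 1 \<in> ?I" using l_img map_img[OF cc x(1)] by metis
      moreover have "\<gamma> (chart_map c x $ 1) = x" unfolding \<gamma>_def lx by (rule inv_map[OF cc x(1)])
      ultimately show "x \<in> \<gamma> ` ?I" by (metis imageI)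
    qed
  qed
  have "geodesic_on AM g ?I (\<iota> \<circ> \<gamma>)"
    unfolding geodesic_on_def
  proof (intro conjI ballI)
    show "open ?I" "is_interval ?I" by (auto simp: is_interval_oo)
    have "continuous_on UNIV \<iota>" using sm by (simp add: smooth_map_def)
    then show "continuous_on ?I (\<iota> \<circ> \<gamma>)" using continuous_on_compose[OF \<gamma>c] continuous_on_subset by blast
    fix d assume d: "d \<in> AM"
    let ?J = "?I \<inter> (\<iota> \<circ> \<gamma>) -` chart_dom d"
    have J: "?J = l -` ldom \<iota> c d"
    proof (rule set_eqI)
      fix t
      show "t \<in> ?J \<longleftrightarrow> t \<in> l -` ldom \<iota> c d"
        using in_chart_image[OF cc, of "l t" "\<iota> -` chart_dom d"] l_img[of t] by (simp add: \<gamma>_def)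
    qed
    have oJ: "open ?J" unfolding J by (rule open_vimage[OF ldom_open[OF cs d] lc])
    have lJ: "l t \<in> ldom \<iota> c d" if "t \<in> ?J" for t using that unfolding J by simp
    have e: "chart_map d \<circ> (\<iota> \<circ> \<gamma>) = (\<lambda>t. lf \<iota> c d (l t))" by (simp add: \<gamma>_def o_def)
    show "smooth_on ?J (chart_map d \<circ> (\<iota> \<circ> \<gamma>))" unfolding e
      by (rule smooth_on_compose[OF lf_smooth[OF cs d] sl[OF oJ] oJ ldom_open[OF cs d]]) (use lJ in blast)
    fix t assume t: "t \<in> ?J"
    note lt = lJ[OF t]
    have wl: "w c (l r) = axis 1 1" if "r \<in> ?J" for r using wc ldom_img[OF cs] lJ[OF that] by blast
    have v1: "vector_derivative (\<lambda>t. lf \<iota> c d (l t)) (at r) = V (\<gamma> r) d" if r: "r \<in> ?J" for r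
    proof (rule vector_derivative_at)
      have "lf \<iota> c d differentiable (at (l r))"
        by (rule smooth_on_differentiable[OF lf_smooth[OF cs d] lJ[OF r]])
      from has_vector_derivative_line[OF this[unfolded l_def]]
      show "((\<lambda>t. lf \<iota> c d (l t)) has_vector_derivative V (\<gamma> r) d) (at r)"
        unfolding \<gamma>_def V_apply[OF cs d lJ[OF r]] wl[OF r] unfolding l_def .
    qed
    have v2: "vector_derivative (\<lambda>r. vector_derivative (\<lambda>t. lf \<iota> c d (l t)) (at r)) (at t) =
        fD (\<lambda>x. V (chart_inv c x) d) (l t) (axis 1 1)"
    proof (rule vector_derivative_at)
      have "(\<lambda>x. V (chart_inv c x) d) differentiable (at (l t))"
        by (rule smooth_on_differentiable[OF smooth_field_along[OF at rm sm Vf cs d] lt])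
      from has_vector_derivative_line[OF this[unfolded l_def]]
      have "((\<lambda>r. V (\<gamma> r) d) has_vector_derivative fD (\<lambda>x. V (chart_inv c x) d) (l t) (axis 1 1)) (at t)"
        unfolding \<gamma>_def l_def .
      then show "((\<lambda>r. vector_derivative (\<lambda>t. lf \<iota> c d (l t)) (at r)) has_vector_derivative
          fD (\<lambda>x. V (chart_inv c x) d) (l t) (axis 1 1)) (at t)"
        by (rule has_vector_derivative_transform_within_open[OF _ oJ t]) (rule v1[symmetric])
    qed
    have Vd: "V (\<gamma> t) d = fD (lf \<iota> c d) (l t) (axis 1 1)"
      unfolding \<gamma>_def V_apply[OF cs d lt] wl[OF t] ..
    have unit: "met (H c (l t)) (axis 1 1) (axis 1 1) = 1"
      using w_unit[OF cs subsetD[OF ldom_img[OF cs] lt]] unfolding wl[OF t] .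
    have geo: "fD (\<lambda>x. V (chart_inv c x) d) (l t) (axis 1 1) + chr (G d) (lf \<iota> c d (l t)) (V (\<gamma> t) d) (V (\<gamma> t) d) = 0"
      using cov_V_chart[OF cs d lt, of "axis 1 1"]
      unfolding cov_def wl[OF t] unit Vd[symmetric] \<gamma>_def[symmetric]
      by (simp add: \<gamma>_def)
    have ne: "V (\<gamma> t) d \<noteq> 0"
    proof
      assume z: "V (\<gamma> t) d = 0"
      have "met (H c (l t)) (axis 1 1) (axis 1 1) = 0"
        unfolding H_matrix[OF cs d lt] Vd[symmetric] z by (simp add: met_zero_left)
      then show False using unit by simp
    qed
    show "let \<gamma>' = (\<lambda>s. vector_derivative (chart_map d \<circ> (\<iota> \<circ> \<gamma>)) (at s)) in
           \<gamma>' t \<noteq> 0 \<and>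
           vector_derivative \<gamma>' (at t) +
             (\<chi> k. \<Sum>i\<in>UNIV. \<Sum>j\<in>UNIV.
                christoffel (metric_matrix AM g d) k i j (chart_map d ((\<iota> \<circ> \<gamma>) t)) *
                \<gamma>' t $ i * \<gamma>' t $ j) = 0"
      unfolding Let_def e v2 v1[OF t]
      using ne geo by (simp add: chr_def \<gamma>_def)
  qed
  then show ?thesis using \<gamma>c plq by blast
qed

lemma flow_foliation: "foliation_by_curves AS (Collect flow_chart)"
proof -
  have "(\<Union>c\<in>Collect flow_chart. chart_dom c) = UNIV"
  proof (intro set_eqI iffI UNIV_I)
    fix p
    obtain c where "flow_chart c" "p \<in> chart_dom c" by (rule flow_chart_exists)
    then show "p \<in> (\<Union>c\<in>Collect flow_chart. chart_dom c)" by blast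
  qed
  moreover have "\<forall>c\<in>Collect flow_chart. coordinate_system AS c \<and> (\<exists>a b. chart_img c = box a b)"
    by (simp add: flow_chart_def)
  moreover have "\<forall>c\<in>Collect flow_chart. \<forall>d\<in>Collect flow_chart. \<forall>p\<in>chart_dom c \<inter> chart_dom d.
      \<exists>W h. open W \<and> p \<in> W \<and> W \<subseteq> chart_dom c \<inter> chart_dom d \<and>
        (\<forall>x\<in>W. chart_map d x $ 2 = h (chart_map c x $ 2))"
  proof (intro ballI)
    fix c d p assume "c \<in> Collect flow_chart" "d \<in> Collect flow_chart" "p \<in> chart_dom c \<inter> chart_dom d"
    then show "\<exists>W h. open W \<and> p \<in> W \<and> W \<subseteq> chart_dom c \<inter> chart_dom d \<and>
        (\<forall>x\<in>W. chart_map d x $ 2 = h (chart_map c x $ 2))"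
      by (intro flow_chart_transition) simp_all
  qed
  ultimately show ?thesis unfolding foliation_by_curves_def by (intro conjI)
qed

lemma ruled: "ruled AS AM g \<iota>"
  unfolding ruled_def
proof (rule exI[of _ "Collect flow_chart"], rule conjI[OF flow_foliation], intro ballI)
  fix c p assume "c \<in> Collect flow_chart" "p \<in> chart_dom c"
  then show "\<exists>I \<gamma>. continuous_on I \<gamma> \<and> \<gamma> ` I = plaque c p \<and> geodesic_on AM g I (\<iota> \<circ> \<gamma>)"
    by (intro flow_line_geodesic) simp_all
qed

section \<open>The metric in flow boxes and adapted coordinates\<close>

lemma H_change:
  assumes c: "coordinate_system AS c" "p \<in> chart_dom c" and e: "coordinate_system AS e" "p \<in> chart_dom e"
  shows "met (H e (chart_map e p)) (fD (transition c e) (chart_map c p) a) (fD (transition c e) (chart_map c p) b) =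
    met (H c (chart_map c p)) a b"
proof -
  obtain d where d: "d \<in> AM" "\<iota> p \<in> chart_dom d" by (rule ambient_chart)
  have *: "met (H c (chart_map c p)) a b = induced_metric AS AM g \<iota> p (tv AS c p a) (tv AS c p b)"
    if c: "coordinate_system AS c" "p \<in> chart_dom c" for c a b
  proof -
    have x: "chart_map c p \<in> ldom \<iota> c d" using c d by blast
    show ?thesis
      unfolding H_matrix[OF c(1) d(1) x] induced_metric_tv[OF at rm sm c d] inv_map[OF cs_chart[OF at c(1)] c(2)] ..
  qed
  show ?thesis unfolding *[OF c] *[OF e] tv_change[OF at c(1) e(1) c(2) e(2)] ..
qed

lemma flow_chart_metric:
  assumes c: "flow_chart c" and x: "x \<in> chart_img c"
  shows "H c x $ 1 $ 1 = 1" "fD (\<lambda>y. H c y $ 1 $ 2) x (axis 1 1) = 0"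
    "fD (\<lambda>y. H c y $ 2 $ 2) x (axis 1 1) = 2 * f (chart_inv c x) * (H c x $ 2 $ 2 - (H c x $ 1 $ 2)\<^sup>2)"
proof -
  have cs: "coordinate_system AS c" and wc: "\<And>x. x \<in> chart_img c \<Longrightarrow> w c x = axis 1 1"
    using c by (auto simp: flow_chart_def)
  have u: "H c y $ 1 $ 1 = 1" if "y \<in> chart_img c" for y
    using w_unit[OF cs that] unfolding wc[OF that] met_axis .
  then show "H c x $ 1 $ 1 = 1" using x .
  have "cov (H c) (\<lambda>y. y) (\<lambda>y. axis 1 1) x a = f (chart_inv c x) *\<^sub>R (a - met (H c x) a (axis 1 1) *\<^sub>R axis 1 1)" for a
  proof -
    have "cov (H c) (\<lambda>y. y) (\<lambda>y. axis 1 1) x a = cov (H c) (\<lambda>y. y) (w c) x a"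
      by (rule cov_cong_open[OF img_open[OF cs_chart[OF at cs]] x refl]) (rule wc[symmetric])
    then show ?thesis unfolding cov_w[OF cs x] wc[OF x] .
  qed
  from metric_in_flow_box[OF H_field[OF cs] x u, of "\<lambda>y. f (chart_inv c y)", OF _ this]
  show "fD (\<lambda>y. H c y $ 1 $ 2) x (axis 1 1) = 0"
    "fD (\<lambda>y. H c y $ 2 $ 2) x (axis 1 1) = 2 * f (chart_inv c x) * (H c x $ 2 $ 2 - (H c x $ 1 $ 2)\<^sup>2)"
    by blast+
qed

end

text \<open>Shears along \<open>u\<close> preserve the first coordinate field and hence flow charts,
  while they change the second one by a multiple of the first.\<close>

lemma shear_flow_box:
  fixes \<eta> \<beta> :: "real \<Rightarrow> real"
  assumes J: "open J" and \<eta>: "smooth_on J \<eta>" "\<And>s. s \<in> J \<Longrightarrow> (\<eta> has_real_derivative \<beta> s) (at s)"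
  defines "Q \<equiv> \<lambda>x::real ^ 2. vector [x $ 1 + \<eta> (x $ 2), x $ 2] :: real ^ 2"
    and "R \<equiv> \<lambda>x::real ^ 2. vector [x $ 1 - \<eta> (x $ 2), x $ 2] :: real ^ 2"
  shows "open {x::real ^ 2. x $ 2 \<in> J}" "smooth_on {x. x $ 2 \<in> J} Q" "smooth_on {x. x $ 2 \<in> J} R"
    "x $ 2 \<in> J \<Longrightarrow> fD Q x v = vector [v $ 1 + \<beta> (x $ 2) * v $ 2, v $ 2]"
proof -
  let ?S = "{x::real ^ 2. x $ 2 \<in> J}"
  have bl: "bounded_linear (\<lambda>x::real ^ 2. x $ i)" for i by (rule bounded_linear_vec_nth)
  have "?S = (\<lambda>x. x $ 2) -` J" by auto
  then show S: "open ?S" using open_vimage[OF J linear_continuous_on[OF bl]] by simp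
  have s: "smooth_on ?S (\<lambda>x::real ^ 2. x $ i)" for i by (rule smooth_on_bounded_linear[OF bl])
  have e: "smooth_on ?S (\<lambda>x. \<eta> (x $ 2))" by (rule smooth_on_compose[OF \<eta>(1) s S J]) auto
  show "smooth_on ?S Q" unfolding Q_def by (rule smooth_on_vector2[OF S smooth_on_add[OF S s e] s])
  show "smooth_on ?S R" unfolding R_def by (rule smooth_on_vector2[OF S smooth_on_diff[OF S s e] s])
  show "fD Q x v = vector [v $ 1 + \<beta> (x $ 2) * v $ 2, v $ 2]" if x: "x $ 2 \<in> J"
  proof -
    have d1: "(\<lambda>x::real ^ 2. x $ i) differentiable (at x)" for i by (rule bounded_linear_imp_differentiable[OF bl])
    have d2: "(\<lambda>x. \<eta> (x $ 2)) differentiable (at x)" by (rule smooth_on_differentiable[OF e]) (use x in simp)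
    have "\<eta> differentiable (at (x $ 2))" by (rule smooth_on_differentiable[OF \<eta>(1) x])
    from fD_compose(1)[OF d1[of 2] this, of v]
    have "fD (\<lambda>x. \<eta> (x $ 2)) x v = fD \<eta> (x $ 2) (v $ 2)" by (simp add: fD_linear[OF bl])
    also have "fD \<eta> (x $ 2) = (*) (\<beta> (x $ 2))"
      by (rule fD_eqI) (use \<eta>(2)[OF x] in \<open>simp add: has_field_derivative_def\<close>)
    finally show ?thesis
      unfolding Q_def fD_vector2[OF differentiable_add[OF d1 d2] d1] fD_add[OF d1 d2] by (simp add: fD_linear[OF bl])
  qed
qed

context tangent_anti_torqued
begin

text \<open>In a flow box the coefficient \<open>\<beta> = \<langle>\<partial>\<^sub>u, \<partial>\<^sub>v\<rangle>\<close> depends on \<open>v\<close> only,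
  and the shear \<open>u + \<integral> \<beta> dv\<close> removes it.\<close>

lemma orthogonal_flow_chart:
  obtains c where "flow_chart c" "p \<in> chart_dom c" "\<And>x. x \<in> chart_img c \<Longrightarrow> H c x $ 1 $ 2 = 0"
proof -
  obtain c0 where fc0: "flow_chart c0" and p: "p \<in> chart_dom c0" by (rule flow_chart_exists)
  then obtain a b where cs: "coordinate_system AS c0" and img: "chart_img c0 = box a b"
    and w0: "\<And>x. x \<in> chart_img c0 \<Longrightarrow> w c0 x = axis 1 1" by (auto simp: flow_chart_def)
  note ch = cs_chart[OF at cs]
  define x0 where "x0 = chart_map c0 p"
  have x0: "x0 \<in> box a b" using map_img[OF ch p] img by (simp add: x0_def)
  let ?J = "{a $ 2<..<b $ 2}"
  have u0: "x0 $ 1 \<in> {a $ 1<..<b $ 1}" and v0: "x0 $ 2 \<in> ?J" using x0 by (auto simp: mem_box_2)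
  define \<alpha> where "\<alpha> = (\<lambda>x. H c0 x $ 1 $ 2)"
  have s\<alpha>: "smooth_on (box a b) \<alpha>" using mf_smooth[OF H_field[OF cs]] by (simp add: \<alpha>_def img)
  define \<beta> where "\<beta> = (\<lambda>s. \<alpha> (vector [x0 $ 1, s]))"
  have s\<beta>: "smooth_on ?J \<beta>" unfolding \<beta>_def by (rule smooth_on_slice[OF s\<alpha> u0])
  have \<alpha>\<beta>: "\<alpha> x = \<beta> (x $ 2)" if x: "x \<in> box a b" for x unfolding \<beta>_def
  proof (rule box_u_constant[OF smooth_on_differentiable[OF s\<alpha>] _ x])
    show "fD \<alpha> y (axis 1 1) = 0" if "y \<in> box a b" for y
      unfolding \<alpha>_def by (rule flow_chart_metric(2)[OF fc0]) (simp add: img that)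
    show "vector [x0 $ 1, x $ 2] \<in> box a b" using x u0 by (simp add: mem_box_2)
  qed simp_all
  define \<eta> where "\<eta> = line_integral \<beta> (x0 $ 2)"
  have d\<eta>: "(\<eta> has_real_derivative \<beta> s) (at s)" if "s \<in> ?J" for s
    unfolding \<eta>_def by (rule line_integral_deriv_open[OF smooth_on_continuous[OF s\<beta>] v0 that])
  have s\<eta>: "smooth_on ?J \<eta>" by (rule smooth_on_realI[OF open_greaterThanLessThan d\<eta> s\<beta>])
  define Q where "Q = (\<lambda>x::real ^ 2. vector [x $ 1 + \<eta> (x $ 2), x $ 2] :: real ^ 2)"
  define R where "R = (\<lambda>x::real ^ 2. vector [x $ 1 - \<eta> (x $ 2), x $ 2] :: real ^ 2)"
  note QR = shear_flow_box[OF open_greaterThanLessThan s\<eta> d\<eta>, folded Q_def R_def]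
  have RQ: "R (Q x) = x" and QR': "Q (R x) = x" for x by (simp_all add: Q_def R_def vec_eq_iff forall_2)
  let ?S = "{x::real ^ 2. x $ 2 \<in> ?J}"
  have bS: "box a b \<subseteq> ?S" by (auto simp: mem_box_2)
  define W where "W = ?S \<inter> R -` box a b"
  have W: "open W" unfolding W_def by (rule continuous_open_preimage[OF smooth_on_continuous[OF QR(3)] QR(1) open_box])
  have Q2: "Q x $ 2 = x $ 2" and R2: "R x $ 2 = x $ 2" for x by (simp_all add: Q_def R_def)
  have QW: "Q x \<in> W" if "x \<in> box a b" for x using that bS by (auto simp: W_def RQ Q2)
  have hom: "homeomorphism (box a b) W Q R"
    unfolding homeomorphism_def
  proof (intro conjI ballI)
    show "Q ` box a b = W"
    proof
      show "Q ` box a b \<subseteq> W" using QW by blast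
      show "W \<subseteq> Q ` box a b"
      proof
        fix y assume "y \<in> W"
        then have "R y \<in> box a b" by (simp add: W_def)
        then show "y \<in> Q ` box a b" using QR'[of y] by (metis imageI)
      qed
    qed
    show "R ` W = box a b"
    proof
      show "R ` W \<subseteq> box a b" by (auto simp: W_def)
      show "box a b \<subseteq> R ` W"
      proof
        fix y assume "y \<in> box a b"
        then have "Q y \<in> W" by (rule QW)
        then show "y \<in> R ` W" using RQ[of y] by (metis imageI)
      qed
    qed
    show "continuous_on (box a b) Q" by (rule continuous_on_subset[OF smooth_on_continuous[OF QR(2)] bS])
    show "continuous_on W R" by (rule continuous_on_subset[OF smooth_on_continuous[OF QR(3)]]) (auto simp: W_def)
  qed (rule RQ, rule QR')
  \<comment> \<open>The sheared box is in general not a box, so the image is shrunk to one around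
    the given point.\<close>
  obtain a' b' where ab: "Q x0 \<in> box a' b'" "box a' b' \<subseteq> W" by (rule open_contains_box[OF W QW[OF x0]])
  let ?U = "box a b \<inter> Q -` box a' b'"
  note hom' = homeomorphism_shrink[OF hom open_box ab(2) open_box]
  have US: "?U \<subseteq> ?S" using bS by blast
  have BS: "box a' b' \<subseteq> ?S" using ab(2) by (auto simp: W_def)
  have Uimg: "?U \<subseteq> chart_img c0" unfolding img by blast
  have sQ: "smooth_on ?U Q" by (rule smooth_on_subset[OF QR(2) US])
  have sR: "smooth_on (box a' b') R" by (rule smooth_on_subset[OF QR(3) BS])
  obtain c where c: "coordinate_system AS c" "chart_img c = box a' b'"
    "\<And>p. p \<in> chart_dom c \<longleftrightarrow> p \<in> chart_dom c0 \<and> chart_map c0 p \<in> ?U"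
    "\<And>p. chart_map c p = Q (chart_map c0 p)"
    "\<And>p v. p \<in> chart_dom c \<Longrightarrow> fD (transition c0 c) (chart_map c0 p) v = fD Q (chart_map c0 p) v"
    by (rule chart_compose[OF at cs hom'(2) Uimg open_box hom'(1) sQ sR]) (rule that)
  have tr: "fD (transition c0 c) (chart_map c0 q) v = vector [v $ 1 + \<beta> (chart_map c0 q $ 2) * v $ 2, v $ 2]"
    if q: "q \<in> chart_dom c" for q v
  proof -
    have j: "chart_map c0 q $ 2 \<in> ?J" using q US by (auto simp: c(3) mem_box_2)
    show ?thesis unfolding c(5)[OF q] by (rule QR(4)) (assumption, rule j)
  qed
  have wc: "w c x = axis 1 1" and Hc: "H c x $ 1 $ 2 = 0" if x: "x \<in> chart_img c" for x
  proof -
    obtain q where q: "x = chart_map c q" "q \<in> chart_dom c" using x unfolding chart_img_def by blast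
    have q0: "q \<in> chart_dom c0" and xi: "chart_map c0 q \<in> chart_img c0" using q(2) Uimg by (auto simp: c(3))
    let ?x = "chart_map c0 q"
    have "w c x = fD (transition c0 c) ?x (axis 1 1)"
      unfolding q(1) w_change[OF cs q0 c(1) q(2)] w0[OF xi] ..
    then show "w c x = axis 1 1" unfolding tr[OF q(2)] by (simp add: vec_eq_iff forall_2 axis_def)
    \<comment> \<open>The vector that the differential of the shear sends to the second basis
      vector; subtracting \<beta> times the unit field makes it orthogonal to that field.\<close>
    let ?b = "axis 2 1 - \<beta> (?x $ 2) *\<^sub>R axis 1 1 :: real ^ 2"
    have t1: "fD (transition c0 c) ?x (axis 1 1) = axis 1 1"
      and t2: "fD (transition c0 c) ?x ?b = axis 2 1"
      unfolding tr[OF q(2)] by (simp_all add: vec_eq_iff forall_2 axis_def)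
    have "H c x $ 1 $ 2 = met (H c x) (axis 1 1) (axis 2 1)" by (rule met_axis[symmetric])
    also have "\<dots> = met (H c0 ?x) (axis 1 1) ?b"
      using H_change[OF cs q0 c(1) q(2), of "axis 1 1" ?b] unfolding t1 t2 q(1) .
    also have "\<dots> = \<alpha> ?x - \<beta> (?x $ 2)"
      using flow_chart_metric(1)[OF fc0 xi] by (simp add: met_simps met_axis \<alpha>_def)
    also have "\<dots> = 0" using \<alpha>\<beta>[of ?x] xi img by simp
    finally show "H c x $ 1 $ 2 = 0" .
  qed
  have "flow_chart c" unfolding flow_chart_def using c(1,2) wc by blast
  moreover have "p \<in> chart_dom c" using p x0 ab(1) by (simp add: c(3) x0_def)
  ultimately show ?thesis using Hc by (rule that)
qed

text \<open>In orthogonal flow coordinates the coefficient \<open>h\<close> of dv^2 has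
  \<open>u\<close>-derivative \<open>2 * f * h\<close>, so it is its value on the slice
  \<open>u = u0\<close> times \<open>exp (2 * \<Phi>)\<close>. The factor \<open>p\<close> of the
  adapted metric is the square root of that initial value.\<close>

lemma adapted_flow_chart:
  obtains c where "flow_chart c" "p \<in> chart_dom c" "adapted_coordinates AS AM g \<iota> V f c"
proof -
  obtain c where fc: "flow_chart c" and p: "p \<in> chart_dom c" and H12: "\<And>x. x \<in> chart_img c \<Longrightarrow> H c x $ 1 $ 2 = 0"
    by (rule orthogonal_flow_chart) (rule that)
  obtain a b where cs: "coordinate_system AS c" and img: "chart_img c = box a b"
    and wc: "\<And>x. x \<in> chart_img c \<Longrightarrow> w c x = axis 1 1" using fc by (auto simp: flow_chart_def)
  note ch = cs_chart[OF at cs] and mH = H_field[OF cs]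
  define x0 where "x0 = chart_map c p"
  have x0: "x0 \<in> box a b" using map_img[OF ch p] img by (simp add: x0_def)
  let ?I = "{a $ 1<..<b $ 1}" and ?J = "{a $ 2<..<b $ 2}"
  define u0 where "u0 = x0 $ 1"
  have u0: "u0 \<in> ?I" using x0 by (simp add: u0_def mem_box_2)
  have vr: "v_range c = ?J" by (rule v_range_box[OF img x0])
  define F where "F = (\<lambda>x. f (chart_inv c x))"
  have sF: "smooth_on (box a b) F" using smooth_f[OF cs] by (simp add: F_def img)
  define h where "h = (\<lambda>x. H c x $ 2 $ 2)"
  have sh: "smooth_on (box a b) h" using mf_smooth[OF mH] by (simp add: h_def img)
  have hpos: "h x > 0" if "x \<in> box a b" for x
    using mf_pos[OF mH, of x "axis 2 1"] that by (simp add: img met_axis h_def axis_eq_0_iff)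
  have hu: "fD h x (axis 1 1) = 2 * F x * h x" if "x \<in> box a b" for x
    using flow_chart_metric(3)[OF fc, of x] H12[of x] that by (simp add: img h_def F_def)
  define \<Phi> :: "real ^ 2 \<Rightarrow> real" where "\<Phi> = (\<lambda>x. line_integral (\<lambda>s. F (vector [s, x $ 2])) u0 (x $ 1))"
  define pp where "pp = (\<lambda>v. sqrt (h (vector [u0, v])))"
  have in_box: "(vector [u, v] :: real ^ 2) \<in> box a b" if "u \<in> ?I" "v \<in> ?J" for u v using that by (simp add: mem_box_2)
  have spp: "smooth_on ?J pp" unfolding pp_def
    by (rule smooth_on_sqrt[OF open_greaterThanLessThan smooth_on_slice[OF sh u0] hpos[OF in_box[OF u0]]])
  have pos: "pp v > 0" if "v \<in> ?J" for v unfolding pp_def using hpos[OF in_box[OF u0 that]] by simp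
  have \<Phi>d: "((\<lambda>u. \<Phi> (vector [u, x $ 2])) has_real_derivative f (chart_inv c x)) (at (x $ 1))" if x: "x \<in> chart_img c" for x
  proof -
    have x12: "x $ 1 \<in> ?I" "x $ 2 \<in> ?J" using x by (auto simp: img mem_box_2)
    have "(line_integral (\<lambda>s. F (vector [s, x $ 2])) u0 has_real_derivative F (vector [x $ 1, x $ 2])) (at (x $ 1))"
      by (rule line_integral_deriv_open[OF smooth_on_continuous[OF smooth_on_slice_u[OF sF x12(2)]] u0 x12(1)])
    then show ?thesis unfolding vector_2_eta \<Phi>_def F_def vector_2 .
  qed
  have h_eq: "h x = (pp (x $ 2) * exp (\<Phi> x))\<^sup>2" if x: "x \<in> chart_img c" for x
  proof -
    have x12: "x $ 1 \<in> ?I" "x $ 2 \<in> ?J" using x by (auto simp: img mem_box_2)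
    have "h (vector [x $ 1, x $ 2]) = h (vector [u0, x $ 2]) *
        exp (line_integral (\<lambda>s. 2 * F (vector [s, x $ 2])) u0 (x $ 1))"
    proof (rule scalar_linear_ode[OF u0 x12(1)])
      show "continuous_on ?I (\<lambda>s. 2 * F (vector [s, x $ 2]))"
        by (intro continuous_intros smooth_on_continuous[OF smooth_on_slice_u[OF sF x12(2)]])
      fix s assume s: "s \<in> ?I"
      note sb = in_box[OF s x12(2)]
      show "((\<lambda>t. h (vector [t, x $ 2])) has_real_derivative 2 * F (vector [s, x $ 2]) * h (vector [s, x $ 2])) (at s)"
        using has_real_derivative_u[OF smooth_on_differentiable[OF sh sb]] unfolding hu[OF sb] .
    qed
    also have "line_integral (\<lambda>s. 2 * F (vector [s, x $ 2])) u0 (x $ 1) = 2 * \<Phi> x"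
      by (simp add: line_integral_def \<Phi>_def)
    also have "h (vector [u0, x $ 2]) = (pp (x $ 2))\<^sup>2"
      unfolding pp_def using hpos[OF in_box[OF u0 x12(2)]] by simp
    finally show ?thesis unfolding vector_2_eta by (simp add: power_mult_distrib exp_double)
  qed
  have "V q = differential AS AM \<iota> q (coord_vec AS c 1 q)" if q: "q \<in> chart_dom c" for q
    using w_eq[OF cs q] unfolding wc[OF map_img[OF ch q]] coord_vec_tv .
  moreover have "let M = H c x in M $ 1 $ 1 = 1 \<and> M $ 1 $ 2 = 0 \<and> M $ 2 $ 1 = 0 \<and> M $ 2 $ 2 = (pp (x $ 2) * exp (\<Phi> x))\<^sup>2"
    if x: "x \<in> chart_img c" for x
    using flow_chart_metric(1)[OF fc x] H12[OF x] mf2_sym[OF mH x] h_eq[OF x] by (simp add: h_def)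
  ultimately have "adapted_coordinates AS AM g \<iota> V f c"
    unfolding adapted_coordinates_def vr using cs spp pos \<Phi>d by blast
  with fc p show ?thesis by (rule that)
qed

text \<open>Where \<open>V\<close> is \<partial>_u, the formula for the curvature reads
  \<open>f_u = - K0 - f^2\<close> on the coordinate lines; one direction solves this equation in a
  box, the other checks it in the given coordinates around each point.\<close>

lemma constant_curvature_iff:
  "(\<forall>p. K_int AS AM g \<iota> p = K0) \<longleftrightarrow>
    (\<forall>p. \<exists>c. p \<in> chart_dom c \<and> adapted_coordinates AS AM g \<iota> V f c \<and> potential_form c f K0)"
proof
  assume K: "\<forall>p. K_int AS AM g \<iota> p = K0"
  show "\<forall>p. \<exists>c. p \<in> chart_dom c \<and> adapted_coordinates AS AM g \<iota> V f c \<and> potential_form c f K0"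
  proof
    fix p
    obtain c where fc: "flow_chart c" and p: "p \<in> chart_dom c" and ac: "adapted_coordinates AS AM g \<iota> V f c"
      by (rule adapted_flow_chart)
    obtain a b where cs: "coordinate_system AS c" and img: "chart_img c = box a b"
      and wc: "\<And>x. x \<in> chart_img c \<Longrightarrow> w c x = axis 1 1" using fc by (auto simp: flow_chart_def)
    note ch = cs_chart[OF at cs]
    have "potential_form c f K0"
    proof (rule potential_formI[OF img _ smooth_f[OF cs, unfolded img] f0])
      show "chart_map c p \<in> box a b" using map_img[OF ch p] img by simp
      fix x assume "x \<in> box a b"
      then have x: "x \<in> chart_img c" by (simp add: img)
      have "K0 = - (fD (\<lambda>x. f (chart_inv c x)) x (axis 1 1) + (f (chart_inv c x))\<^sup>2)"
        using K K_int_eq[OF cs inv_dom[OF ch x]] unfolding map_inv[OF ch x] wc[OF x] by simp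
      then show "fD (\<lambda>x. f (chart_inv c x)) x (axis 1 1) = - K0 - (f (chart_inv c x))\<^sup>2" by simp
    qed
    then show "\<exists>c. p \<in> chart_dom c \<and> adapted_coordinates AS AM g \<iota> V f c \<and> potential_form c f K0"
      using p ac by blast
  qed
next
  assume P: "\<forall>p. \<exists>c. p \<in> chart_dom c \<and> adapted_coordinates AS AM g \<iota> V f c \<and> potential_form c f K0"
  show "\<forall>p. K_int AS AM g \<iota> p = K0"
  proof
    fix p
    obtain c where p: "p \<in> chart_dom c" and ac: "adapted_coordinates AS AM g \<iota> V f c" and pf: "potential_form c f K0"
      using P by blast
    have cs: "coordinate_system AS c" and Vp: "V p = differential AS AM \<iota> p (tv AS c p (axis 1 1))"
      using ac p unfolding adapted_coordinates_def coord_vec_tv by blast+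
    note ch = cs_chart[OF at cs]
    have "fD (\<lambda>x. f (chart_inv c x)) (chart_map c p) (axis 1 1) = - K0 - (f (chart_inv c (chart_map c p)))\<^sup>2"
      by (rule potential_formD[OF img_open[OF ch] map_img[OF ch p] smooth_f[OF cs] f0 pf])
    then show "K_int AS AM g \<iota> p = K0"
      unfolding K_int_eq[OF cs p] w_unique[OF cs p Vp] inv_map[OF ch p] by simp
  qed
qed

end

theorem theorem4p5:
  fixes AM :: "('m::{t2_space, second_countable_topology}, 3) chart set"
    and g :: "('m, 3) metric"
    and AS :: "('s::{t2_space, second_countable_topology}, 2) chart set"
    and \<iota> :: "'s \<Rightarrow> 'm"
    and N V :: "'s \<Rightarrow> ('m, 3) tvec"
    and \<theta> f :: "'s \<Rightarrow> real"
  assumes "riemannian_manifold AM g"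
    and "PA_surface AS AM g \<iota> N V \<theta>"
    and "anti_torqued AS AM g \<iota> V f"
    and "\<forall>p. f p \<noteq> 0"
    and "\<forall>p. \<theta> p = pi / 2"
  shows "extrinsically_flat AS AM g \<iota> N \<and> ruled AS AM g \<iota> \<and>
    (\<forall>K0::real. (\<forall>p. K_int AS AM g \<iota> p = K0) \<longleftrightarrow>
      (\<forall>p. \<exists>c. p \<in> chart_dom c \<and> adapted_coordinates AS AM g \<iota> V f c \<and> potential_form c f K0))"
proof -
  interpret tangent_anti_torqued AM g AS \<iota> N V \<theta> f
    by unfold_locales (use assms in auto)
  show ?thesis using extrinsically_flat ruled constant_curvature_iff by blast
qed

end
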